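(* Let $\beta\in(1,2)$ and $p>2$. Then there exists a nontrivial radial solution (i.e. one with $u\ne0$ radially symmetric) of the system $$-\Delta u+|u|^{\beta-2}u-\phi u+|u|^{p-2}u=0\ \text{ in }\mathbb{R}^2,\qquad \Delta\phi=u^2\ \text{ in }\mathbb{R}^2.$$
   Context: Solutions are finite energy solutions, understood as follows. Let $\mathcal H$ be the closure of $C_0^\infty(\mathbb{R}^2)$ with respect to the norm $\|u\|=\|\nabla u\|_2+\|u\|_\beta$ (where $\|\cdot\|_q$ is the $L^q(\mathbb{R}^2)$ norm), and let $\mathcal H_r$ be its subspace of radial functions. For $u\in\mathcal H_r$ set $\phi_u(x)=\frac1{2\pi}\int_{\mathbb{R}^2}\log|x-y|\,u^2(y)\,dy$ and $V_0(u)=\frac1{2\pi}\int_{\mathbb{R}^2}\int_{\mathbb{R}^2}\log(|x-y|)u^2(x)u^2(y)\,dx\,dy$. The functional $$I_\beta(u)=\frac12\int_{\mathbb{R}^2}|\nabla u|^2\,dx-\frac14V_0(u)+\int_{\mathbb{R}^2}\left(\frac1\beta|u|^\beta+\frac1p|u|^p\right)dx$$ is well defined and $C^1$ on $\mathcal H_r$. A radial solution of the system is a pair $(u,\phi)$ with $u\in\mathcal H_r$, $\phi=\phi_u$ and $u$ a critical point of $I_\beta$ on $\mathcal H_r$; any such critical point yields a solution of the system. *)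

theory Defs
  imports "HOL-Analysis.Analysis"
begin

type_synonym plane = "real ^ 2"

text \<open>Elements of Lebesgue and Sobolev spaces are represented by Borel functions; two functions
  that agree almost everywhere represent the same element.\<close>

definition grad :: "(plane \<Rightarrow> real) \<Rightarrow> plane \<Rightarrow> plane" where
  "grad f x = (\<chi> i. frechet_derivative f (at x) (axis i 1))"

primrec C_k :: "nat \<Rightarrow> (plane \<Rightarrow> real) \<Rightarrow> bool" where
  "C_k 0 f \<longleftrightarrow> continuous_on UNIV f"
| "C_k (Suc k) f \<longleftrightarrow> (\<forall>x. f differentiable (at x)) \<and> (\<forall>i. C_k k (\<lambda>x. grad f x $ i))"

definition test_functions :: "(plane \<Rightarrow> real) set" where
  "test_functions = {f. (\<forall>k. C_k k f) \<and> compact (closure {x. f x \<noteq> 0})}"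

definition Lq_space :: "real \<Rightarrow> (plane \<Rightarrow> 'b::euclidean_space) set" where
  "Lq_space q = {f \<in> borel_measurable borel. integrable lborel (\<lambda>x. norm (f x) powr q)}"

definition Lq_norm :: "real \<Rightarrow> (plane \<Rightarrow> 'b::euclidean_space) \<Rightarrow> real" where
  "Lq_norm q f = (LINT x|lborel. norm (f x) powr q) powr (1 / q)"

definition locally_integrable :: "(plane \<Rightarrow> 'b::euclidean_space) \<Rightarrow> bool" where
  "locally_integrable f \<longleftrightarrow>
     f \<in> borel_measurable borel \<and> (\<forall>K. compact K \<longrightarrow> set_integrable lborel K f)"

definition has_weak_gradient :: "(plane \<Rightarrow> real) \<Rightarrow> (plane \<Rightarrow> plane) \<Rightarrow> bool" where
  "has_weak_gradient u g \<longleftrightarrow> locally_integrable u \<and> locally_integrable g \<and>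
     (\<forall>\<psi>\<in>test_functions.
        (LINT x|lborel. u x *\<^sub>R grad \<psi> x) = - (LINT x|lborel. \<psi> x *\<^sub>R g x))"

text \<open>A weak gradient is unique almost everywhere, so the choice made here affects none of the
  integrals below.\<close>

definition weak_grad :: "(plane \<Rightarrow> real) \<Rightarrow> plane \<Rightarrow> plane" where
  "weak_grad u = (SOME g. has_weak_gradient u g)"

definition H_norm :: "real \<Rightarrow> (plane \<Rightarrow> real) \<Rightarrow> real" where
  "H_norm \<beta> u = Lq_norm 2 (weak_grad u) + Lq_norm \<beta> u"

text \<open>The closure of the test functions, realised inside the functions \<open>u \<in> L\<^sup>\<beta>\<close> having a weak
  gradient in \<open>L\<^sup>2\<close>. The latter are complete for \<open>H_norm \<beta>\<close>, so this is the completion.\<close>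

definition H_space :: "real \<Rightarrow> (plane \<Rightarrow> real) set" where
  "H_space \<beta> = {u \<in> Lq_space \<beta>. (\<exists>g. has_weak_gradient u g) \<and> weak_grad u \<in> Lq_space 2 \<and>
     (\<exists>\<psi>. (\<forall>n::nat. \<psi> n \<in> test_functions) \<and>
          (\<lambda>n. H_norm \<beta> (\<lambda>x. \<psi> n x - u x)) \<longlonglongrightarrow> 0)}"

definition radial :: "(plane \<Rightarrow> real) \<Rightarrow> bool" where
  "radial u \<longleftrightarrow> (\<exists>f :: real \<Rightarrow> real. AE x in lborel. u x = f (norm x))"

definition Hr_space :: "real \<Rightarrow> (plane \<Rightarrow> real) set" where
  "Hr_space \<beta> = {u \<in> H_space \<beta>. radial u}"

definition log_potential :: "(plane \<Rightarrow> real) \<Rightarrow> plane \<Rightarrow> real" where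
  "log_potential u x = 1 / (2 * pi) * (LINT y|lborel. ln (norm (x - y)) * (u y)\<^sup>2)"

definition V0 :: "(plane \<Rightarrow> real) \<Rightarrow> real" where
  "V0 u = 1 / (2 * pi) *
     (LINT x|lborel. (LINT y|lborel. ln (norm (x - y)) * (u x)\<^sup>2 * (u y)\<^sup>2))"

definition energy :: "real \<Rightarrow> real \<Rightarrow> (plane \<Rightarrow> real) \<Rightarrow> real" where
  "energy \<beta> p u =
     1 / 2 * (LINT x|lborel. (norm (weak_grad u x))\<^sup>2) - 1 / 4 * V0 u
     + (LINT x|lborel. 1 / \<beta> * \<bar>u x\<bar> powr \<beta> + 1 / p * \<bar>u x\<bar> powr p)"

text \<open>The Frechet derivative of \<open>energy \<beta> p\<close> at \<open>u\<close>, as a functional on the normed space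
  \<open>Hr_space \<beta>\<close>, exists and is zero.\<close>

definition critical_point :: "real \<Rightarrow> real \<Rightarrow> (plane \<Rightarrow> real) \<Rightarrow> bool" where
  "critical_point \<beta> p u \<longleftrightarrow> u \<in> Hr_space \<beta> \<and>
     (\<forall>\<epsilon>>0. \<exists>\<delta>>0. \<forall>h\<in>Hr_space \<beta>. H_norm \<beta> h < \<delta> \<longrightarrow>
        \<bar>energy \<beta> p (\<lambda>x. u x + h x) - energy \<beta> p u\<bar> \<le> \<epsilon> * H_norm \<beta> h)"

text \<open>Finite energy radial solutions \<open>(u, \<phi>)\<close> of the system
  \<open>- \<Delta> u + |u|^(\<beta>-2) u - \<phi> u + |u|^(p-2) u = 0\<close>, \<open>\<Delta> \<phi> = u^2\<close> in the plane.\<close>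

definition radial_solution ::
    "real \<Rightarrow> real \<Rightarrow> (plane \<Rightarrow> real) \<Rightarrow> (plane \<Rightarrow> real) \<Rightarrow> bool" where
  "radial_solution \<beta> p u \<phi> \<longleftrightarrow>
     u \<in> Hr_space \<beta> \<and> \<phi> = log_potential u \<and> critical_point \<beta> p u"

end

theory Submission
  imports Defs "HOL-Complex_Analysis.Great_Picard"
begin

text \<open>The energy is minimised on a natural constraint. Replacing \<open>u\<close> by the
  dilation \<open>u(x / sqrt \<tau>)\<close> leaves the Dirichlet integral \<open>A\<close>
  unchanged, multiplies the local potential term \<open>P\<close> by \<open>\<tau>\<close> and
  turns \<open>V0 u\<close> into \<open>\<tau>\<^sup>2 (V0 u + 4 K ln \<tau>)\<close>, where
  \<open>K\<close> is a multiple of the squared \<open>L\<^sup>2\<close> mass. Along such a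
  fibre the energy has a maximum, attained where the function satisfies the Pohozaev identity
  \<open>P = V0/2 + K\<close>. On the set of nonzero radial functions with this identity the
  energy is \<open>(A + P + K)/2\<close>, so minimising sequences are bounded.

  Compactness comes from radial symmetry. A radial function of finite energy is \<open>u(x) =
  F(|x|\<^sup>2)\<close> with \<open>F\<close> square-root Hoelder continuous in the logarithm
  of its argument (\<open>radial_profile\<close>). Together with the
  \<open>L\<^sup>\<beta>\<close> bound this gives power decay at infinity
  (\<open>radial_decay\<close>), and as \<open>\<beta> < 2\<close> the function is square
  integrable against a logarithmic weight, with uniformly small tails
  (\<open>weighted_square_bound\<close>). Hence profiles converge along a subsequence
  (\<open>profile_subsequence\<close>), the logarithmic energy and the mass converge with them
  (\<open>V0_mass_tendsto\<close>), and the limit lies in the energy space with a Dirichlet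
  integral that has not grown (\<open>weak_limit_R_pair\<close>, by convex combinations). The
  decay estimate also keeps \<open>P\<close> away from zero, so that the limit is not zero; a
  dilation returns it to the constraint, and a minimiser results
  (\<open>pohozaev_minimiser\<close>).

  That the minimiser \<open>w\<close> is a free critical point follows from two one-sided
  estimates. A small perturbation \<open>w + s k\<close> is brought back to the constraint by a
  dilation with \<open>\<tau>\<close> close to 1. As \<open>w\<close> is the maximum of its own
  fibre and \<open>P\<close>, \<open>V0\<close>, \<open>K\<close> are Lipschitz, minimality
  gives \<open>energy (w + s k) \<ge> energy w - o(s)\<close>
  (\<open>minimiser_lower_bound\<close>). The second difference of the energy is at most of
  order \<open>s\<^sup>\<beta>\<close>, and \<open>\<beta> > 1\<close>, so the lower bound at
  \<open>w - s k\<close> is an upper bound at \<open>w + s k\<close>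
  (\<open>minimiser_two_sided_bound\<close>).\<close>

section \<open>Smooth functions on the line and in the plane\<close>

text \<open>The one-dimensional counterpart of \<open>C_k\<close>. Test functions are built as
  \<open>Z(|x|\<^sup>2)\<close> and as products of functions of one coordinate, so that
  smoothness in the plane reduces to smoothness on the line.\<close>

primrec smooth1 :: "nat \<Rightarrow> (real \<Rightarrow> real) \<Rightarrow> bool" where
  "smooth1 0 f \<longleftrightarrow> continuous_on UNIV f"
| "smooth1 (Suc k) f \<longleftrightarrow> (\<exists>f'. (\<forall>x. (f has_real_derivative f' x) (at x)) \<and> smooth1 k f')"

lemma smooth1_SucD: "smooth1 (Suc k) f \<Longrightarrow> smooth1 k f"
proof (induction k arbitrary: f)
  case 0
  then show ?case
    by (metis DERIV_isCont continuous_at_imp_continuous_on smooth1.simps)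
next
  case (Suc k)
  then show ?case by (metis smooth1.simps(2))
qed

lemma smooth1_const: "smooth1 k (\<lambda>x. c)"
proof (induction k arbitrary: c)
  case (Suc k)
  have "\<forall>x. ((\<lambda>x. c) has_real_derivative 0) (at x)" by simp
  then show ?case using Suc[of 0] unfolding smooth1.simps by (intro exI[of _ "\<lambda>_. 0"]) auto
qed auto

lemma smooth1_add: "smooth1 k f \<Longrightarrow> smooth1 k g \<Longrightarrow> smooth1 k (\<lambda>x. f x + g x)"
proof (induction k arbitrary: f g)
  case 0
  then show ?case by (auto intro: continuous_on_add)
next
  case (Suc k)
  obtain f' g' where "\<forall>x. (f has_real_derivative f' x) (at x)" "smooth1 k f'"
    "\<forall>x. (g has_real_derivative g' x) (at x)" "smooth1 k g'" using Suc.prems by auto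
  then show ?case using Suc.IH[of f' g'] by (auto intro!: exI[of _ "\<lambda>x. f' x + g' x"] DERIV_add)
qed

lemma smooth1_mult: "smooth1 k f \<Longrightarrow> smooth1 k g \<Longrightarrow> smooth1 k (\<lambda>x. f x * g x)"
proof (induction k arbitrary: f g)
  case 0
  then show ?case by (auto intro: continuous_on_mult)
next
  case (Suc k)
  obtain f' g' where d: "\<forall>x. (f has_real_derivative f' x) (at x)" "smooth1 k f'"
    "\<forall>x. (g has_real_derivative g' x) (at x)" "smooth1 k g'" using Suc.prems by auto
  have "smooth1 k (\<lambda>x. f' x * g x)" "smooth1 k (\<lambda>x. g' x * f x)"
    using Suc.IH[of f' g] Suc.IH[of g' f] d Suc.prems smooth1_SucD by auto
  then have "smooth1 k (\<lambda>x. f' x * g x + g' x * f x)" by (rule smooth1_add)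
  moreover have "\<forall>x. ((\<lambda>x. f x * g x) has_real_derivative f' x * g x + g' x * f x) (at x)"
    using d by (auto intro: DERIV_mult)
  ultimately show ?case by (auto intro!: exI[of _ "\<lambda>x. f' x * g x + g' x * f x"])
qed

lemma smooth1_affine: "smooth1 k f \<Longrightarrow> smooth1 k (\<lambda>x. f (c * x + d))"
proof (induction k arbitrary: f)
  case 0
  then show ?case
    by (auto intro!: continuous_on_compose2[of UNIV f] continuous_intros)
next
  case (Suc k)
  then obtain f' where d: "\<forall>x. (f has_real_derivative f' x) (at x)" "smooth1 k f'" by auto
  have "\<forall>x. ((\<lambda>x. f (c * x + d)) has_real_derivative f' (c * x + d) * c) (at x)"
  proof
    fix x
    have "((\<lambda>x. c * x + d) has_real_derivative c) (at x)" by (auto intro!: derivative_eq_intros)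
    then show "((\<lambda>x. f (c * x + d)) has_real_derivative f' (c * x + d) * c) (at x)"
      using d(1) DERIV_chain2 by blast
  qed
  moreover have "smooth1 k (\<lambda>x. f' (c * x + d) * c)"
    using Suc.IH[OF d(2)] smooth1_const[of k c] by (rule smooth1_mult)
  ultimately show ?case unfolding smooth1.simps
    by (intro exI[of _ "\<lambda>x. f' (c * x + d) * c"] conjI)
qed

lemma has_real_derivative_div_power:
  assumes Z: "\<And>x. (Z has_real_derivative Z' x) (at x)" and a: "a > 0" "\<And>q. q \<le> a \<Longrightarrow> Z q = 0"
  shows "((\<lambda>q. Z q / q ^ m) has_real_derivative (Z' x / x ^ m - real m * (Z x / x ^ Suc m))) (at x)"
    and "x < a \<Longrightarrow> Z' x = 0"
proof -
  have loc0: "((\<lambda>q. Z q / q ^ m) has_real_derivative 0) (at x)" if "x < a" for m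
  proof -
    have "eventually (\<lambda>q. q \<in> {..<a}) (nhds x)" using that by (intro eventually_nhds_in_open) auto
    then have "eventually (\<lambda>q. Z q / q ^ m = 0) (nhds x)" by eventually_elim (use a in auto)
    then show ?thesis by (subst DERIV_cong_ev[OF refl _ refl, of _ "\<lambda>_. 0"]) auto
  qed
  show Z'0: "Z' x = 0" if "x < a" using loc0[OF that, of 0] DERIV_unique[OF Z] by simp
  show "((\<lambda>q. Z q / q ^ m) has_real_derivative (Z' x / x ^ m - real m * (Z x / x ^ Suc m))) (at x)"
  proof (cases "x < a")
    case True
    then show ?thesis using loc0[of m] Z'0 a by auto
  next
    case False
    then have "x > 0" using a by auto
    then have "((\<lambda>q. Z q / q ^ m) has_real_derivative
       (Z' x * x ^ m - Z x * (real m * x ^ (m - 1))) / (x ^ m * x ^ m)) (at x)"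
      by (intro DERIV_divide Z) (auto intro!: derivative_eq_intros)
    moreover have "(Z' x * x ^ m - Z x * (real m * x ^ (m - 1))) / (x ^ m * x ^ m) =
       Z' x / x ^ m - real m * (Z x / x ^ Suc m)"
      using \<open>x > 0\<close> by (cases m) (auto simp: field_simps)
    ultimately show ?thesis by simp
  qed
qed

text \<open>Division by a power of \<open>q\<close> is harmless for a function that vanishes near the origin and on
  the negative axis.\<close>

lemma smooth1_div_power:
  assumes "smooth1 k Z" "a > 0" "\<And>q. q \<le> a \<Longrightarrow> Z q = 0"
  shows "smooth1 k (\<lambda>q. Z q / q ^ m)"
  using assms
proof (induction k arbitrary: Z a m)
  case 0
  have "isCont (\<lambda>q. Z q / q ^ m) x" for x
  proof (cases "x = 0")
    case True
    have "eventually (\<lambda>q. q \<in> {..<a}) (nhds x)" using 0 True by (intro eventually_nhds_in_open) auto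
    then have "eventually (\<lambda>q. Z q / q ^ m = 0) (nhds x)" by eventually_elim (use 0 in auto)
    then show ?thesis using isCont_cong[of "\<lambda>q. Z q / q ^ m" "\<lambda>_. 0" x] by auto
  next
    case False
    then show ?thesis using 0 by (auto intro!: continuous_intros simp: continuous_on_eq_continuous_at)
  qed
  then show ?case by (simp add: continuous_at_imp_continuous_on)
next
  case (Suc k)
  then obtain Z' where d: "\<forall>x. (Z has_real_derivative Z' x) (at x)" "smooth1 k Z'" by auto
  note D = has_real_derivative_div_power[OF d(1)[rule_format] Suc.prems(2,3)]
  have Z'0: "Z' q = 0" if "q \<le> a/2" for q using D(2)[of q] that Suc.prems(2) by auto
  have "smooth1 k (\<lambda>q. Z' q / q ^ m)" using Suc.IH[OF d(2), of "a/2" m] Z'0 Suc.prems by auto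
  moreover have "smooth1 k (\<lambda>q. Z q / q ^ Suc m)"
    using Suc.IH[of Z a "Suc m"] Suc.prems smooth1_SucD by blast
  ultimately have "smooth1 k (\<lambda>x. Z' x / x ^ m + (- real m) * (Z x / x ^ Suc m))"
    by (intro smooth1_add smooth1_mult smooth1_const) auto
  then show ?case using D(1)[of m] unfolding smooth1.simps
    by (intro exI[of _ "\<lambda>x. Z' x / x ^ m - real m * (Z x / x ^ Suc m)"]) auto
qed

text \<open>The class \<open>P(1/t) exp(-1/t)\<close>, extended by \<open>0\<close> to \<open>t \<le> 0\<close>, is closed under differentiation;
  this is why \<open>exp(-1/t)\<close> is smooth.\<close>

definition flat :: "real poly \<Rightarrow> real \<Rightarrow> real" where
  "flat P t = (if t > 0 then poly P (1/t) * exp (-1/t) else 0)"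

lemma poly_times_exp_minus_tendsto_0:
  "((\<lambda>y. y ^ k * poly P y * exp (- y :: real)) \<longlongrightarrow> 0) at_top"
proof (induction P arbitrary: k)
  case 0
  then show ?case by simp
next
  case (pCons a P)
  have "((\<lambda>y. a * (y ^ k / exp y) + y ^ Suc k * poly P y * exp (- y :: real)) \<longlongrightarrow> a * 0 + 0) at_top"
    by (intro tendsto_intros tendsto_power_div_exp_0 pCons)
  then show ?case by (simp add: algebra_simps exp_minus divide_inverse)
qed

lemma flat_has_derivative:
  "(flat P has_real_derivative flat ([:0,0,1:] * (P - pderiv P)) t) (at t)"
proof -
  consider "t > 0" | "t < 0" | "t = 0" by linarith
  then show ?thesis
  proof cases
    case 1
    have "eventually (\<lambda>s. s \<in> {0<..}) (nhds t)" using 1 by (intro eventually_nhds_in_open) auto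
    then have ev: "eventually (\<lambda>s. flat P s = poly P (1/s) * exp (-1/s)) (nhds t)"
      by eventually_elim (auto simp: flat_def)
    have d: "((\<lambda>s. 1/s) has_real_derivative - (1/t^2)) (at t)"
      using 1 by (auto intro!: derivative_eq_intros simp: power2_eq_square)
    have "((\<lambda>s. poly P (1/s)) has_real_derivative poly (pderiv P) (1/t) * (- (1/t^2))) (at t)"
      by (rule DERIV_chain2[OF poly_DERIV d])
    moreover have "((\<lambda>s. exp (-1/s)) has_real_derivative exp (-1/t) * (1/t^2)) (at t)"
      using 1 by (auto intro!: derivative_eq_intros simp: power2_eq_square)
    ultimately have "((\<lambda>s. poly P (1/s) * exp (-1/s)) has_real_derivative
       poly (pderiv P) (1/t) * (- (1/t^2)) * exp (-1/t) + exp (-1/t) * (1/t^2) * poly P (1/t)) (at t)"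
      by (rule DERIV_mult)
    then show ?thesis using ev 1
      by (subst DERIV_cong_ev[OF refl ev refl]) (simp add: flat_def algebra_simps power2_eq_square)
  next
    case 2
    have "eventually (\<lambda>s. s \<in> {..<0}) (nhds t)" using 2 by (intro eventually_nhds_in_open) auto
    then have ev: "eventually (\<lambda>s. flat P s = 0) (nhds t)"
      by eventually_elim (auto simp: flat_def)
    show ?thesis using 2 by (subst DERIV_cong_ev[OF refl ev refl]) (simp add: flat_def)
  next
    case 3
    have "((\<lambda>s. flat P s / s) \<longlongrightarrow> 0) (at_left 0)"
      by (rule tendsto_eventually) (auto simp: eventually_at_filter flat_def)
    moreover have "((\<lambda>s. flat P s / s) \<longlongrightarrow> 0) (at_right 0)"
    proof -
      have "((\<lambda>s. (1/s) ^ 1 * poly P (1/s) * exp (- (1/s))) \<longlongrightarrow> 0) (at_right 0)"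
        by (rule filterlim_compose[OF poly_times_exp_minus_tendsto_0])
          (use filterlim_inverse_at_top_right in \<open>simp add: inverse_eq_divide\<close>)
      then show ?thesis
        by (rule Lim_transform_eventually)
          (auto simp: flat_def eventually_at_filter)
    qed
    ultimately have "((\<lambda>s. flat P s / s) \<longlongrightarrow> 0) (at 0)" by (simp add: filterlim_at_split)
    then show ?thesis using 3 by (simp add: DERIV_def flat_def)
  qed
qed

lemma smooth1_flat: "smooth1 k (flat P)"
proof (induction k arbitrary: P)
  case 0
  have "isCont (flat P) x" for x by (rule DERIV_isCont[OF flat_has_derivative])
  then show ?case by (simp add: continuous_at_imp_continuous_on)
next
  case (Suc k)
  then show ?case using flat_has_derivative[of P] unfolding smooth1.simps by blast
qed

text \<open>Smooth functions with values in \<open>[0,1]\<close>, positive exactly on \<open>(a,b)\<close>, that increase to the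
  indicator of \<open>(a,b)\<close> as \<open>n\<close> grows.\<close>

definition bump :: "real \<Rightarrow> real \<Rightarrow> nat \<Rightarrow> real \<Rightarrow> real" where
  "bump a b n q = flat 1 (real (Suc n) * (q - a)) * flat 1 (real (Suc n) * (b - q))"

lemma smooth1_bump: "smooth1 k (bump a b n)"
proof -
  have 1: "smooth1 k (\<lambda>q. flat 1 (real (Suc n) * q + (- real (Suc n) * a)))"
    by (rule smooth1_affine[OF smooth1_flat])
  have 2: "smooth1 k (\<lambda>q. flat 1 ((- real (Suc n)) * q + real (Suc n) * b))"
    by (rule smooth1_affine[OF smooth1_flat])
  have "bump a b n = (\<lambda>q. flat 1 (real (Suc n) * q + (- real (Suc n) * a)) * flat 1 ((- real (Suc n)) * q + real (Suc n) * b))"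
    by (auto simp: bump_def algebra_simps)
  then show ?thesis using smooth1_mult[OF 1 2] by simp
qed

lemma flat_1_bounds: "0 \<le> flat 1 t" "flat 1 t \<le> 1" by (auto simp: flat_def)

lemma bump_bounds: "0 \<le> bump a b n q" "bump a b n q \<le> 1"
  by (auto simp: bump_def flat_1_bounds mult_le_one)

lemma bump_eq_0: "q \<notin> {a<..<b} \<Longrightarrow> bump a b n q = 0"
  by (auto simp: bump_def flat_def zero_less_mult_iff)

lemma bump_pos: "q \<in> {a<..<b} \<Longrightarrow> bump a b n q > 0"
  by (auto simp: bump_def flat_def zero_less_mult_iff)

lemma bump_tendsto: "(\<lambda>n. bump a b n q) \<longlonglongrightarrow> indicator {a<..<b} q"
proof (cases "q \<in> {a<..<b}")
  case True
  have *: "(\<lambda>n. flat 1 (real (Suc n) * t)) \<longlonglongrightarrow> 1" if "t > 0" for t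
  proof -
    have "(\<lambda>n. exp (- (1/t) * (1 / real (Suc n)))) \<longlonglongrightarrow> exp (- (1/t) * 0)"
      by (intro tendsto_exp tendsto_mult tendsto_const lim_1_over_n[THEN LIMSEQ_Suc])
    moreover have "flat 1 (real (Suc n) * t) = exp (- (1/t) * (1 / real (Suc n)))" for n
      using that by (simp add: flat_def zero_less_mult_iff mult.commute)
    ultimately show ?thesis by simp
  qed
  have "(\<lambda>n. bump a b n q) \<longlonglongrightarrow> 1 * 1" unfolding bump_def
    using True by (intro tendsto_mult *) auto
  then show ?thesis using True by simp
next
  case False
  then show ?thesis by (simp add: bump_eq_0)
qed

lemma grad_eqI: "(f has_derivative (\<lambda>h. h \<bullet> G)) (at x) \<Longrightarrow> grad f x = G"
  unfolding grad_def by (subst frechet_derivative_at[symmetric]) (auto simp: inner_axis' vec_eq_iff)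

lemma has_derivative_grad:
  assumes "f differentiable (at x)"
  shows "(f has_derivative (\<lambda>h. h \<bullet> grad f x)) (at x)"
proof -
  have d: "(f has_derivative frechet_derivative f (at x)) (at x)"
    using assms frechet_derivative_works by blast
  then have lin: "linear (frechet_derivative f (at x))" by (rule has_derivative_linear)
  have "frechet_derivative f (at x) = (\<lambda>h. h \<bullet> grad f x)"
  proof
    fix h :: plane
    have "frechet_derivative f (at x) h = frechet_derivative f (at x) (\<Sum>i\<in>UNIV. (h $ i) *\<^sub>R axis i 1)"
      by (simp add: basis_expansion scalar_mult_eq_scaleR[symmetric])
    also have "\<dots> = (\<Sum>i\<in>UNIV. (h $ i) * grad f x $ i)"
      using lin by (simp add: linear_sum linear_cmul grad_def)
    finally show "frechet_derivative f (at x) h = h \<bullet> grad f x" by (simp add: inner_vec_def)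
  qed
  then show ?thesis using d by simp
qed

lemma C_k_SucI:
  assumes "\<And>x. (f has_derivative (\<lambda>h. h \<bullet> G x)) (at x)" "\<And>i. C_k k (\<lambda>x. G x $ i)"
  shows "C_k (Suc k) f"
  using assms grad_eqI[OF assms(1)] by (auto simp: differentiable_def)

lemma C_k_SucD: "C_k (Suc k) f \<Longrightarrow> C_k k f"
proof (induction k arbitrary: f)
  case 0
  then show ?case
    by (auto intro!: continuous_at_imp_continuous_on differentiable_imp_continuous_within)
next
  case (Suc k)
  then show ?case by (metis C_k.simps(2))
qed

lemma C_k_has_derivative: "C_k (Suc k) f \<Longrightarrow> (f has_derivative (\<lambda>h. h \<bullet> grad f x)) (at x)"
  by (auto intro: has_derivative_grad)

lemma C_k_const: "C_k k (\<lambda>x. c)"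
proof (induction k arbitrary: c)
  case (Suc k)
  show ?case by (rule C_k_SucI[where G="\<lambda>_. 0"]) (auto simp: Suc)
qed auto

lemma C_k_coord: "C_k k (\<lambda>x. x $ i)"
proof (cases k)
  case 0
  then show ?thesis by (auto intro: continuous_intros)
next
  case (Suc l)
  have "((\<lambda>x. x $ i) has_derivative (\<lambda>h. h \<bullet> axis i 1)) (at x)" for x :: plane
    by (simp add: inner_axis bounded_linear_imp_has_derivative bounded_linear_vec_nth)
  then show ?thesis unfolding Suc by (rule C_k_SucI) (simp add: C_k_const)
qed

lemma C_k_add: "C_k k f \<Longrightarrow> C_k k g \<Longrightarrow> C_k k (\<lambda>x. f x + g x)"
proof (induction k arbitrary: f g)
  case 0
  then show ?case by (auto intro: continuous_on_add)
next
  case (Suc k)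
  have "((\<lambda>x. f x + g x) has_derivative (\<lambda>h. h \<bullet> (grad f x + grad g x))) (at x)" for x
    unfolding inner_add_right
    by (intro has_derivative_add C_k_has_derivative[OF Suc.prems(1)] C_k_has_derivative[OF Suc.prems(2)])
  then show ?case by (rule C_k_SucI) (use Suc in auto)
qed

lemma C_k_mult: "C_k k f \<Longrightarrow> C_k k g \<Longrightarrow> C_k k (\<lambda>x. f x * g x)"
proof (induction k arbitrary: f g)
  case 0
  then show ?case by (auto intro: continuous_on_mult)
next
  case (Suc k)
  have "((\<lambda>x. f x * g x) has_derivative (\<lambda>h. h \<bullet> (f x *\<^sub>R grad g x + g x *\<^sub>R grad f x))) (at x)" for x
    using has_derivative_mult[OF C_k_has_derivative[OF Suc.prems(1), of x] C_k_has_derivative[OF Suc.prems(2), of x]]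
    by (simp add: inner_add_right mult.commute add.commute)
  then show ?case
    by (rule C_k_SucI) (use Suc C_k_SucD in \<open>auto intro!: C_k_add\<close>)
qed

lemma C_k_sum: "finite I \<Longrightarrow> (\<And>i. i \<in> I \<Longrightarrow> C_k k (f i)) \<Longrightarrow> C_k k (\<lambda>x. \<Sum>i\<in>I. f i x)"
  by (induction I rule: finite_induct) (auto intro: C_k_const C_k_add)

lemma C_k_compose: "smooth1 k Z \<Longrightarrow> C_k k q \<Longrightarrow> C_k k (\<lambda>x. Z (q x))"
proof (induction k arbitrary: Z)
  case 0
  then show ?case by (auto intro: continuous_on_compose2[of UNIV Z])
next
  case (Suc k)
  then obtain Z' where d: "\<forall>x. (Z has_real_derivative Z' x) (at x)" "smooth1 k Z'" by auto
  have "((\<lambda>x. Z (q x)) has_derivative (\<lambda>h. h \<bullet> (Z' (q x) *\<^sub>R grad q x))) (at x)" for x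
    using has_derivative_compose[OF C_k_has_derivative[OF Suc.prems(2), of x] d(1)[rule_format, of "q x", unfolded has_field_derivative_def]]
    by simp
  then show ?case
    using Suc.IH[OF d(2) C_k_SucD[OF Suc.prems(2)]] Suc.prems(2)
    by (intro C_k_SucI[where G="\<lambda>x. Z' (q x) *\<^sub>R grad q x"]) (auto intro!: C_k_mult)
qed

lemma C_k_norm2: "C_k k (\<lambda>x. (norm x)\<^sup>2)"
proof -
  have "(\<lambda>x::plane. (norm x)\<^sup>2) = (\<lambda>x. \<Sum>i\<in>UNIV. x $ i * x $ i)"
    by (simp add: power2_norm_eq_inner inner_vec_def)
  then show ?thesis by (simp only:) (intro C_k_sum C_k_mult C_k_coord, auto)
qed

lemma grad_scale:
  assumes "f differentiable (at (c *\<^sub>R x))"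
  shows "((\<lambda>x. f (c *\<^sub>R x)) has_derivative (\<lambda>h. h \<bullet> (c *\<^sub>R grad f (c *\<^sub>R x)))) (at x)"
  using has_derivative_compose[of "\<lambda>x. c *\<^sub>R x" "\<lambda>x. c *\<^sub>R x" x UNIV f, OF _ has_derivative_grad[OF assms]]
  by (simp add: has_derivative_scaleR_right[OF has_derivative_ident])

lemma C_k_scale: "C_k k f \<Longrightarrow> C_k k (\<lambda>x. f (c *\<^sub>R x))"
proof (induction k arbitrary: f)
  case 0
  then show ?case by (auto intro!: continuous_on_compose2[of UNIV f] continuous_intros)
next
  case (Suc k)
  then show ?case
    by (intro C_k_SucI[where G="\<lambda>x. c *\<^sub>R grad f (c *\<^sub>R x)"] grad_scale)
      (auto intro!: C_k_mult C_k_const)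
qed

lemma test_functionsI:
  assumes "\<And>k. C_k k f" "\<And>x. f x \<noteq> 0 \<Longrightarrow> norm x \<le> R"
  shows "f \<in> test_functions"
proof -
  have "bounded {x. f x \<noteq> 0}" using assms(2) by (auto simp: bounded_iff)
  then show ?thesis using assms(1) by (auto simp: test_functions_def)
qed

lemma test_functionsD:
  assumes "f \<in> test_functions"
  shows "C_k k f" "f differentiable (at x)" "continuous_on UNIV f" "continuous_on UNIV (grad f)"
    "\<exists>R. \<forall>x. f x \<noteq> 0 \<longrightarrow> norm x \<le> R"
proof -
  show 1: "C_k k f" for k using assms by (auto simp: test_functions_def)
  show "f differentiable (at x)" using 1[of 1] by auto
  show "continuous_on UNIV f" using 1[of 0] by auto
  have "continuous_on UNIV (\<lambda>x. grad f x $ i)" for i using 1[of 1] by auto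
  then have "continuous_on UNIV (\<lambda>x. \<chi> i. grad f x $ i)" by (intro continuous_on_vec_lambda)
  then show "continuous_on UNIV (grad f)" by simp
  have "bounded (closure {x. f x \<noteq> 0})" using assms by (auto simp: test_functions_def compact_imp_bounded)
  then have "bounded {x. f x \<noteq> 0}" using bounded_subset closure_subset by blast
  then show "\<exists>R. \<forall>x. f x \<noteq> 0 \<longrightarrow> norm x \<le> R" by (auto simp: bounded_iff)
qed

section \<open>Integrals over the plane\<close>

lemma integrable_dominated:
  fixes f :: "'a \<Rightarrow> 'b::{banach, second_countable_topology}" and g :: "'a \<Rightarrow> real"
  assumes "integrable M g" "f \<in> borel_measurable M" "\<And>x. norm (f x) \<le> g x"
  shows "integrable M f"
  by (rule Bochner_Integration.integrable_bound[OF assms(1,2)])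
    (use assms(3) in \<open>auto intro!: AE_I2 intro: order_trans[OF _ abs_ge_self]\<close>)

lemma borel_measurable_nth [measurable]:
  fixes f :: "'a \<Rightarrow> plane"
  shows "f \<in> borel_measurable M \<Longrightarrow> (\<lambda>x. f x $ i) \<in> borel_measurable M"
  using borel_measurable_inner[of f M "\<lambda>_. axis i 1"] by (simp add: inner_axis)

lemma lborel_scale:
  fixes f :: "plane \<Rightarrow> 'b::{banach, second_countable_topology}"
  assumes c: "c \<noteq> 0" and f: "f \<in> borel_measurable borel"
  shows "integrable lborel (\<lambda>x. f (c *\<^sub>R x)) \<longleftrightarrow> integrable lborel f" (is ?A)
    and "(LINT x|lborel. f (c *\<^sub>R x)) = (1 / c\<^sup>2) *\<^sub>R (LINT x|lborel. f x)" (is ?B)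
proof -
  let ?D = "distr lborel borel (\<lambda>x::plane. c *\<^sub>R x)"
  have f': "f \<in> borel_measurable ?D" using f by simp
  have L: "lborel = density ?D (\<lambda>_. ennreal (c\<^sup>2))"
    using lborel_affine[OF c, of "0::plane"] by (simp add: ennreal_power)
  have i: "integrable lborel f \<longleftrightarrow> integrable ?D f"
  proof -
    have "integrable lborel f \<longleftrightarrow> integrable (density ?D (\<lambda>_. ennreal (c\<^sup>2))) f" by (subst L) simp
    also have "\<dots> \<longleftrightarrow> integrable ?D (\<lambda>x. c\<^sup>2 *\<^sub>R f x)" using f' by (subst integrable_density) auto
    also have "\<dots> \<longleftrightarrow> integrable ?D f"
      using c integrable_scaleR_right[of "1 / c\<^sup>2" ?D "\<lambda>x. c\<^sup>2 *\<^sub>R f x"] by auto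
    finally show ?thesis .
  qed
  then show ?A using f by (simp add: integrable_distr_eq)
  have "(LINT x|lborel. f x) = (LINT x|density ?D (\<lambda>_. ennreal (c\<^sup>2)). f x)" by (subst L) simp
  also have "\<dots> = (LINT x|?D. c\<^sup>2 *\<^sub>R f x)" using f' by (subst integral_density) auto
  also have "\<dots> = c\<^sup>2 *\<^sub>R (LINT x|?D. f x)" using c by (subst integral_scaleR_right) auto
  also have "(LINT x|?D. f x) = (LINT x|lborel. f (c *\<^sub>R x))" using f by (simp add: integral_distr)
  finally show ?B using c by simp
qed

lemma lborel_translate:
  fixes f :: "plane \<Rightarrow> 'b::{banach, second_countable_topology}"
  assumes f: "f \<in> borel_measurable borel"
  shows "integrable lborel (\<lambda>x. f (c + x)) \<longleftrightarrow> integrable lborel f" (is ?A)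
    and "(LINT x|lborel. f (c + x)) = (LINT x|lborel. f x)" (is ?B)
proof -
  show ?A by (subst (2) lborel_distr_plus[symmetric, of c]) (use f in \<open>simp add: integrable_distr_eq\<close>)
  show ?B by (subst (2) lborel_distr_plus[symmetric, of c]) (use f in \<open>simp add: integral_distr\<close>)
qed

lemma integrable_indicator_ball: "integrable lborel (\<lambda>x::plane. C * indicator (cball 0 R) x :: real)"
  using emeasure_bounded_finite[of "cball (0::plane) R"]
  by (intro integrable_mult_right integrable_real_indicator) auto

text \<open>A Dynkin class argument for the signed density \<open>f\<close>: the vanishing total
  integral makes the class of admissible sets closed under complements. It serves both for boxes
  in the plane (\<open>\<rho>\<close> the identity) and for intervals of radii (\<open>\<rho> x
  = |x|\<^sup>2\<close>).\<close>

lemma preimage_integrals_zero_induct: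
  fixes f :: "'a \<Rightarrow> real" and \<rho> :: "'a \<Rightarrow> 'b"
  assumes f: "integrable M f" and \<rho> [measurable]: "\<rho> \<in> M \<rightarrow>\<^sub>M N"
    and E: "Int_stable E" "E \<subseteq> Pow (space N)" "sets N = sigma_sets (space N) E"
    and tot: "(LINT x|M. f x) = 0" and 0: "\<And>X. X \<in> E \<Longrightarrow> (LINT x|M. indicator X (\<rho> x) * f x) = 0"
    and X: "X \<in> sets N"
  shows "(LINT x|M. indicator X (\<rho> x) * f x) = 0"
proof -
  have si: "integrable M (\<lambda>x. indicator Y (\<rho> x) * f x)" if [measurable]: "Y \<in> sets N" for Y
  proof (rule Bochner_Integration.integrable_bound[OF f])
    show "(\<lambda>x. indicator Y (\<rho> x) * f x) \<in> borel_measurable M"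
      using f by measurable
  qed (auto simp: indicator_def)
  have sums: "(LINT x|M. indicator (\<Union>i. A i) (\<rho> x) * f x) = (\<Sum>i. LINT x|M. indicator (A i) (\<rho> x) * f x)"
    if A: "range A \<subseteq> sets N" "disjoint_family A" for A :: "nat \<Rightarrow> 'b set"
  proof -
    have vi: "(LINT x|M. indicator Y (\<rho> x) * f x) = (LINT x:(\<rho> -` Y \<inter> space M)|M. f x)" for Y
      unfolding set_lebesgue_integral_def by (intro Bochner_Integration.integral_cong) (auto simp: indicator_def)
    have "(LINT x:(\<Union>i. \<rho> -` A i \<inter> space M)|M. f x) = (\<Sum>i. (LINT x:(\<rho> -` A i \<inter> space M)|M. f x))"
    proof (rule lebesgue_integral_countable_add)
      show "\<rho> -` A i \<inter> space M \<in> sets M" for i using A by (auto intro: measurable_sets[OF \<rho>])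
      show "(\<rho> -` A i \<inter> space M) \<inter> (\<rho> -` A j \<inter> space M) = {}" if "i \<noteq> j" for i j
        using A(2) that by (auto simp: disjoint_family_on_def)
      show "set_integrable M (\<Union>i. \<rho> -` A i \<inter> space M) f"
        unfolding set_integrable_def
        by (rule integrable_mult_indicator[OF _ f]) (use A in \<open>auto intro: measurable_sets[OF \<rho>]\<close>)
    qed
    moreover have "(\<Union>i. \<rho> -` A i \<inter> space M) = \<rho> -` (\<Union>i. A i) \<inter> space M" by auto
    ultimately show ?thesis unfolding vi by simp
  qed
  have "X \<in> sigma_sets (space N) E" using X E by simp
  then show ?thesis
  proof (induction rule: sigma_sets_induct_disjoint[OF E(1,2), consumes 1, case_names basic empty compl union])
    case (basic A)
    then show ?case by (rule 0)
  next
    case empty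
    then show ?case by simp
  next
    case (compl A)
    then have A [measurable]: "A \<in> sets N" using E(3) by auto
    have "(LINT x|M. indicator (space N - A) (\<rho> x) * f x) = (LINT x|M. f x - indicator A (\<rho> x) * f x)"
      using measurable_space[OF \<rho>] by (intro Bochner_Integration.integral_cong) (auto simp: indicator_def)
    also have "\<dots> = 0" using compl tot f si[OF A] by simp
    finally show ?case .
  next
    case (union A)
    then show ?case using sums[of A] E(3) by simp
  qed
qed

lemma AE_zero_if_set_integrals_zero:
  fixes f :: "'a \<Rightarrow> real"
  assumes f: "integrable M f" and 0: "\<And>X. X \<in> sets M \<Longrightarrow> (LINT x:X|M. f x) = 0"
  shows "AE x in M. f x = 0"
  using density_unique_real[OF f integrable_zero] 0 by simp

section \<open>Test functions and weak gradients\<close>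

lemma test_functions_bounds:
  assumes f: "f \<in> test_functions"
  obtains C R where "C > 0" "R > 0" "\<And>x. norm x > R \<Longrightarrow> f x = 0" "\<And>x. norm x > R \<Longrightarrow> grad f x = 0"
    "\<And>x. \<bar>f x\<bar> \<le> C * indicator (cball 0 R) x" "\<And>x. norm (grad f x) \<le> C * indicator (cball 0 R) x"
proof -
  obtain R0 where R0: "\<And>x. f x \<noteq> 0 \<Longrightarrow> norm x \<le> R0" using test_functionsD(5)[OF f] by blast
  define R where "R = max R0 1"
  have 1: "f x = 0" if "norm x > R" for x using R0[of x] that by (auto simp: R_def)
  have 2: "grad f x = 0" if "norm x > R" for x
  proof (rule grad_eqI)
    have "((\<lambda>y. 0 :: real) has_derivative (\<lambda>h. 0)) (at x)" by simp
    then have "(f has_derivative (\<lambda>h. 0)) (at x)"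
      by (rule has_derivative_transform_within_open[of _ _ _ _ "- cball 0 R"]) (use that 1 in auto)
    then show "(f has_derivative (\<lambda>h. h \<bullet> 0)) (at x)" by simp
  qed
  have "bounded (f ` cball 0 R)" "bounded (grad f ` cball 0 R)"
    using test_functionsD(3,4)[OF f] compact_cball
    by (auto intro!: compact_imp_bounded compact_continuous_image intro: continuous_on_subset)
  then obtain C1 C2 where C: "\<And>x. x \<in> cball 0 R \<Longrightarrow> \<bar>f x\<bar> \<le> C1" "\<And>x. x \<in> cball 0 R \<Longrightarrow> norm (grad f x) \<le> C2"
    unfolding bounded_iff by (metis imageI real_norm_def)
  define C where "C = max 1 (max C1 C2)"
  have "\<bar>f x\<bar> \<le> C * indicator (cball 0 R) x" "norm (grad f x) \<le> C * indicator (cball 0 R) x" for x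
    using 1[of x] 2[of x] C[of x] by (cases "x \<in> cball 0 R"; force simp: C_def)+
  then show ?thesis using that[of C R] 1 2 by (auto simp: C_def R_def)
qed

lemma test_functions_measurable [measurable]:
  assumes f: "f \<in> test_functions"
  shows "f \<in> borel_measurable borel" "grad f \<in> borel_measurable borel"
  using test_functionsD(3,4)[OF f] by (auto intro: borel_measurable_continuous_onI)

lemma test_functions_mult:
  assumes "f \<in> test_functions" "g \<in> test_functions"
  shows "(\<lambda>x. f x * g x) \<in> test_functions"
proof -
  obtain R where "\<And>x. f x \<noteq> 0 \<Longrightarrow> norm x \<le> R" using test_functionsD(5)[OF assms(1)] by blast
  then show ?thesis
    by (intro test_functionsI[where R=R] C_k_mult test_functionsD(1)[OF assms(1)] test_functionsD(1)[OF assms(2)]) auto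
qed

lemma test_functions_add:
  assumes "f \<in> test_functions" "g \<in> test_functions"
  shows "(\<lambda>x. f x + g x) \<in> test_functions"
proof -
  obtain R R' where R: "\<And>x. f x \<noteq> 0 \<Longrightarrow> norm x \<le> R" "\<And>x. g x \<noteq> 0 \<Longrightarrow> norm x \<le> R'"
    using test_functionsD(5)[OF assms(1)] test_functionsD(5)[OF assms(2)] by metis
  show ?thesis
  proof (rule test_functionsI[where R="max R R'"])
    show "C_k k (\<lambda>x. f x + g x)" for k
      by (intro C_k_add test_functionsD(1)[OF assms(1)] test_functionsD(1)[OF assms(2)])
    show "norm x \<le> max R R'" if "f x + g x \<noteq> 0" for x
      using R[of x] that by (cases "f x = 0") auto
  qed
qed

lemma test_functions_cmult:
  assumes "f \<in> test_functions" shows "(\<lambda>x. c * f x) \<in> test_functions"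
proof -
  obtain R where "\<And>x. f x \<noteq> 0 \<Longrightarrow> norm x \<le> R" using test_functionsD(5)[OF assms(1)] by blast
  then show ?thesis
    by (intro test_functionsI[where R=R] C_k_mult C_k_const test_functionsD(1)[OF assms(1)]) auto
qed

lemma test_functions_scale:
  assumes "f \<in> test_functions" "c > 0" shows "(\<lambda>x. f (c *\<^sub>R x)) \<in> test_functions"
proof -
  obtain R where R: "\<And>x. f x \<noteq> 0 \<Longrightarrow> norm x \<le> R" using test_functionsD(5)[OF assms(1)] by blast
  show ?thesis
  proof (rule test_functionsI[where R="R / c"])
    show "C_k k (\<lambda>x. f (c *\<^sub>R x))" for k by (intro C_k_scale test_functionsD(1)[OF assms(1)])
    show "norm x \<le> R / c" if "f (c *\<^sub>R x) \<noteq> 0" for x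
      using R[OF that] assms(2) by (simp add: pos_le_divide_eq mult.commute)
  qed
qed

text \<open>The integral of \<open>f\<close> is translation invariant; differentiating under the integral sign shows
  that the gradient of a test function integrates to zero.\<close>

lemma integral_grad_test_function:
  assumes f: "f \<in> test_functions"
  shows "(LINT x|lborel. grad f x) = 0"
proof -
  obtain C R where CR: "C > 0" "R > 0" "\<And>x. norm x > R \<Longrightarrow> f x = 0" "\<And>x. norm x > R \<Longrightarrow> grad f x = 0"
    "\<And>x. \<bar>f x\<bar> \<le> C * indicator (cball 0 R) x" "\<And>x. norm (grad f x) \<le> C * indicator (cball 0 R) x"
    using test_functions_bounds[OF f] by blast
  note [measurable] = test_functions_measurable[OF f]
  have intf: "integrable lborel f"
    by (rule Bochner_Integration.integrable_bound[OF integrable_indicator_ball[of C R]]) (use CR in auto)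
  have intg: "integrable lborel (grad f)"
    by (rule Bochner_Integration.integrable_bound[OF integrable_indicator_ball[of C R]])
      (use CR in \<open>auto intro: order_trans\<close>)
  have der: "(f has_derivative (\<lambda>h. h \<bullet> grad f x)) (at x)" for x
    by (rule has_derivative_grad[OF test_functionsD(2)[OF f]])
  have lip: "\<bar>f x - f y\<bar> \<le> C * norm (x - y)" for x y
  proof -
    have "norm (f x - f y) \<le> C * norm (x - y)"
    proof (rule differentiable_bound[where S=UNIV])
      show "onorm (\<lambda>h. h \<bullet> grad f x) \<le> C" for x
      proof (rule onorm_bound)
        show "norm (h \<bullet> grad f x) \<le> C * norm h" for h
        proof -
          have "norm (grad f x) \<le> C" using CR(1) CR(6)[of x] by (cases "norm x \<le> R") auto
          then have "norm h * norm (grad f x) \<le> norm h * C" by (intro mult_left_mono) auto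
          then show ?thesis using Cauchy_Schwarz_ineq2[of h "grad f x"] by (simp add: mult.commute)
        qed
      qed (use CR in auto)
    qed (use der in auto)
    then show ?thesis by simp
  qed
  have "(LINT x|lborel. grad f x \<bullet> e) = 0" if e: "norm e = 1" for e
  proof -
    define D where "D n x = (f ((1 / real (Suc n)) *\<^sub>R e + x) - f x) * real (Suc n)" for n x
    have "(LINT x|lborel. D n x) = 0" for n
      unfolding D_def using intf lborel_translate[of f] by simp
    moreover have "(\<lambda>n. LINT x|lborel. D n x) \<longlonglongrightarrow> (LINT x|lborel. grad f x \<bullet> e)"
    proof (rule integral_dominated_convergence)
      show "integrable lborel (\<lambda>x::plane. C * indicator (cball 0 (R + 1)) x :: real)"
        by (rule integrable_indicator_ball)
      show "AE x in lborel. (\<lambda>n. D n x) \<longlonglongrightarrow> grad f x \<bullet> e"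
      proof (rule AE_I2)
        fix x
        have "((\<lambda>t. x + t *\<^sub>R e) has_derivative (\<lambda>t. t *\<^sub>R e)) (at 0)"
          by (auto intro!: derivative_eq_intros)
        from has_derivative_compose[OF this, of f "\<lambda>h. h \<bullet> grad f x"] der[of x]
        have "((\<lambda>t. f (x + t *\<^sub>R e)) has_derivative (\<lambda>t. (t *\<^sub>R e) \<bullet> grad f x)) (at 0)" by simp
        then have "((\<lambda>t. f (x + t *\<^sub>R e)) has_real_derivative (grad f x \<bullet> e)) (at 0)"
          by (simp add: has_field_derivative_def inner_commute mult.commute[of _ "_ \<bullet> _"])
        then have lim: "((\<lambda>t. (f (x + t *\<^sub>R e) - f x) / t) \<longlongrightarrow> grad f x \<bullet> e) (at 0)"
          by (simp add: DERIV_def)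
        have "filterlim (\<lambda>n. 1 / real (Suc n)) (at 0) sequentially"
          unfolding filterlim_at using lim_1_over_n[THEN LIMSEQ_Suc] by auto
        from filterlim_compose[OF lim this] show "(\<lambda>n. D n x) \<longlonglongrightarrow> grad f x \<bullet> e"
          by (simp add: D_def add.commute)
      qed
      show "AE x in lborel. norm (D n x) \<le> C * indicator (cball 0 (R + 1)) x" for n
      proof (rule AE_I2)
        fix x :: plane
        have n1: "norm ((1 / real (Suc n)) *\<^sub>R e) = 1 / real (Suc n)" using e by simp
        show "norm (D n x) \<le> C * indicator (cball 0 (R + 1)) x"
        proof (cases "norm x \<le> R + 1")
          case True
          have "\<bar>D n x\<bar> \<le> (C * (1 / real (Suc n))) * real (Suc n)"
            unfolding D_def abs_mult using lip[of "(1 / real (Suc n)) *\<^sub>R e + x" x] n1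
            by (intro mult_mono) auto
          then show ?thesis using True by simp
        next
          case False
          have "norm x - norm ((1 / real (Suc n)) *\<^sub>R e) \<le> norm ((1 / real (Suc n)) *\<^sub>R e + x)"
            using norm_diff_ineq[of x "(1 / real (Suc n)) *\<^sub>R e"] by (simp add: add.commute)
          moreover have "1 / real (Suc n) \<le> 1" by simp
          ultimately have "norm ((1 / real (Suc n)) *\<^sub>R e + x) > R" "norm x > R" using False n1 by linarith+
          then show ?thesis using CR by (simp add: D_def)
        qed
      qed
    qed (auto simp: D_def)
    ultimately show ?thesis by (simp add: LIMSEQ_const_iff)
  qed
  then have "(LINT x|lborel. grad f x) \<bullet> e = 0" if "norm e = 1" for e
    using that intg by (subst integral_inner_left[symmetric]) auto
  then show ?thesis by (metis (no_types, lifting) euclidean_eqI inner_zero_left norm_Basis)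
qed

lemma locally_integrableD:
  assumes "locally_integrable f"
  shows "f \<in> borel_measurable borel" "integrable lborel (\<lambda>x. indicator (cball 0 R) x *\<^sub>R f x)"
    "integrable lborel (\<lambda>x. indicator (cball 0 R) x * norm (f x))"
proof -
  show "f \<in> borel_measurable borel" using assms by (simp add: locally_integrable_def)
  show 1: "integrable lborel (\<lambda>x. indicator (cball 0 R) x *\<^sub>R f x)"
    using assms by (simp add: locally_integrable_def set_integrable_def)
  show "integrable lborel (\<lambda>x. indicator (cball 0 R) x * norm (f x))"
    using integrable_norm[OF 1] by (simp)
qed

lemma locally_integrableI:
  assumes m [measurable]: "f \<in> borel_measurable borel" and i: "\<And>R. integrable lborel (\<lambda>x. indicator (cball 0 R) x * norm (f x))"
  shows "locally_integrable f"
  unfolding locally_integrable_def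
proof (intro conjI allI impI m)
  fix K :: "plane set" assume K: "compact K"
  then obtain R where "\<forall>x\<in>K. norm x \<le> R" using compact_imp_bounded[OF K] by (auto simp: bounded_iff)
  then have R: "K \<subseteq> cball 0 R" by auto
  have [measurable]: "K \<in> sets borel" using K by (simp add: borel_compact)
  show "set_integrable lborel K f" unfolding set_integrable_def
    by (rule integrable_dominated[OF i[of R]]) (use R in \<open>auto simp: indicator_def\<close>)
qed

lemma locally_integrable_mult_bounded:
  fixes f :: "plane \<Rightarrow> 'b::euclidean_space" and b :: "plane \<Rightarrow> real"
  assumes f: "locally_integrable f" and b [measurable]: "b \<in> borel_measurable borel"
    and bd: "\<And>x. \<bar>b x\<bar> \<le> C * indicator (cball 0 R) x"
  shows "integrable lborel (\<lambda>x. b x *\<^sub>R f x)"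
proof -
  note [measurable] = locally_integrableD(1)[OF f]
  show ?thesis
  proof (rule integrable_dominated)
    show "integrable lborel (\<lambda>x. C * (indicator (cball 0 R) x * norm (f x)))"
      by (intro integrable_mult_right locally_integrableD f)
    show "norm (b x *\<^sub>R f x) \<le> C * (indicator (cball 0 R) x * norm (f x))" for x
      using mult_right_mono[OF bd[of x], of "norm (f x)"] by (simp add: algebra_simps)
  qed auto
qed

lemma test_function_integrable:
  fixes g :: "plane \<Rightarrow> 'b::euclidean_space"
  assumes f: "f \<in> test_functions" and g: "locally_integrable g"
  shows "integrable lborel (\<lambda>x. f x *\<^sub>R g x)"
proof -
  obtain C R where "\<And>x. \<bar>f x\<bar> \<le> C * indicator (cball 0 R) x"
    using test_functions_bounds[OF f] by metis
  then show ?thesis using locally_integrable_mult_bounded[OF g] test_functions_measurable[OF f] by blast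
qed

lemma test_grad_integrable:
  fixes u :: "plane \<Rightarrow> real"
  assumes f: "f \<in> test_functions" and u: "locally_integrable u"
  shows "integrable lborel (\<lambda>x. u x *\<^sub>R grad f x)"
proof -
  note [measurable] = locally_integrableD(1)[OF u] test_functions_measurable[OF f]
  obtain C R where C: "\<And>x. norm (grad f x) \<le> C * indicator (cball 0 R) x"
    using test_functions_bounds[OF f] by metis
  have "integrable lborel (\<lambda>x. norm (grad f x) *\<^sub>R u x)"
    by (rule locally_integrable_mult_bounded[OF u]) (use C in auto)
  then show ?thesis
    by (rule Bochner_Integration.integrable_bound) (auto simp: mult.commute)
qed

lemma locally_integrable_add:
  assumes f: "locally_integrable f" and g: "locally_integrable g"
  shows "locally_integrable (\<lambda>x. f x + g x)"
proof (rule locally_integrableI)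
  note [measurable] = locally_integrableD(1)[OF f] locally_integrableD(1)[OF g]
  show "(\<lambda>x. f x + g x) \<in> borel_measurable borel" by measurable
  show "integrable lborel (\<lambda>x. indicator (cball 0 R) x * norm (f x + g x))" for R
    by (rule Bochner_Integration.integrable_bound[OF Bochner_Integration.integrable_add[OF locally_integrableD(3)[OF f] locally_integrableD(3)[OF g], of R R]])
      (auto simp: indicator_def intro: norm_triangle_ineq)
qed

lemma locally_integrable_scaleR:
  assumes f: "locally_integrable f"
  shows "locally_integrable (\<lambda>x. c *\<^sub>R f x)"
proof (rule locally_integrableI)
  note [measurable] = locally_integrableD(1)[OF f]
  show "(\<lambda>x. c *\<^sub>R f x) \<in> borel_measurable borel" by measurable
  show "integrable lborel (\<lambda>x. indicator (cball 0 R) x * norm (c *\<^sub>R f x))" for R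
    using integrable_mult_right[OF locally_integrableD(3)[OF f, of R], of "\<bar>c\<bar>"]
    by (simp add: algebra_simps)
qed

lemma locally_integrable_test:
  assumes f: "f \<in> test_functions"
  shows "locally_integrable f" "locally_integrable (grad f)"
proof -
  obtain C R where C: "\<And>x. norm (grad f x) \<le> C * indicator (cball 0 R) x" "\<And>x. norm (f x) \<le> C * indicator (cball 0 R) x"
    using test_functions_bounds[OF f] by (metis real_norm_def)
  note [measurable] = test_functions_measurable[OF f]
  have *: "integrable lborel (\<lambda>x. indicator (cball 0 S) x * norm (h x))"
    if "\<And>x. norm (h x) \<le> C * indicator (cball 0 R) x" "h \<in> borel_measurable borel" for S and h :: "plane \<Rightarrow> 'b::euclidean_space"
  proof (rule integrable_dominated[OF integrable_indicator_ball[of C R]])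
    show "norm (indicator (cball 0 S) x * norm (h x)) \<le> C * indicator (cball 0 R) x" for x
      using that(1)[of x] norm_ge_zero[of "h x"] by (cases "x \<in> cball 0 S") (auto intro: order_trans simp del: norm_ge_zero)
  next
    note [measurable] = that(2)
    show "(\<lambda>x. indicator (cball 0 S) x * norm (h x)) \<in> borel_measurable lborel"
      by (intro borel_measurable_times borel_measurable_indicator borel_measurable_norm) (auto simp: that)
  qed
  show "locally_integrable f"
    by (rule locally_integrableI[OF _ *]) (use C in auto)
  show "locally_integrable (grad f)"
    by (rule locally_integrableI[OF _ *]) (use C in auto)
qed

text \<open>The product rule, since the gradient of \<open>f \<psi>\<close> integrates to
  zero.\<close>

lemma has_weak_gradient_test:
  assumes f: "f \<in> test_functions"
  shows "has_weak_gradient f (grad f)"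
  unfolding has_weak_gradient_def
proof (intro conjI ballI locally_integrable_test f)
  fix g assume g: "g \<in> test_functions"
  have "grad (\<lambda>x. f x * g x) x = f x *\<^sub>R grad g x + g x *\<^sub>R grad f x" for x
    by (rule grad_eqI)
      (use has_derivative_mult[OF has_derivative_grad[OF test_functionsD(2)[OF f]] has_derivative_grad[OF test_functionsD(2)[OF g]], of x]
       in \<open>simp add: inner_add_right mult.commute add.commute\<close>)
  then have "(LINT x|lborel. f x *\<^sub>R grad g x + g x *\<^sub>R grad f x) = 0"
    using integral_grad_test_function[OF test_functions_mult[OF f g]] by simp
  then show "(LINT x|lborel. f x *\<^sub>R grad g x) = - (LINT x|lborel. g x *\<^sub>R grad f x)"
    using test_grad_integrable[OF g locally_integrable_test(1)[OF f]]
      test_function_integrable[OF g locally_integrable_test(2)[OF f]]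
    by (simp add: eq_neg_iff_add_eq_0)
qed

lemma has_weak_gradient_add:
  assumes "has_weak_gradient u g" "has_weak_gradient v h"
  shows "has_weak_gradient (\<lambda>x. u x + v x) (\<lambda>x. g x + h x)"
  using assms unfolding has_weak_gradient_def
  by (auto intro!: locally_integrable_add
      simp: scaleR_add_left scaleR_add_right test_grad_integrable test_function_integrable)

lemma has_weak_gradient_cmult:
  assumes "has_weak_gradient u g"
  shows "has_weak_gradient (\<lambda>x. c * u x) (\<lambda>x. c *\<^sub>R g x)"
  using assms locally_integrable_scaleR[of u c] unfolding has_weak_gradient_def
  by (auto intro!: locally_integrable_scaleR simp: scaleR_scaleR[symmetric] scaleR_left_commute[of _ c]
      simp del: scaleR_scaleR)

lemma box_bump_test:
  "(\<lambda>x::plane. \<Prod>i\<in>UNIV. bump (a$i) (b$i) n (x$i)) \<in> test_functions"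
proof -
  have p: "C_k k (\<lambda>x. \<Prod>i\<in>I. bump (a$i) (b$i) n (x$i))" if "finite I" for I k
    using that
  proof induction
    case (insert i I)
    have "C_k k (\<lambda>x. bump (a$i) (b$i) n (x$i))" by (rule C_k_compose[OF smooth1_bump C_k_coord])
    from C_k_mult[OF this insert.IH] show ?case using insert.hyps by simp
  qed (simp add: C_k_const)
  obtain R where R: "box a b \<subseteq> cball 0 R" using bounded_box[of a b] by (auto simp: bounded_iff subset_iff)
  show ?thesis
  proof (rule test_functionsI[where R=R])
    show "C_k k (\<lambda>x. \<Prod>i\<in>UNIV. bump (a$i) (b$i) n (x$i))" for k by (rule p) auto
    fix x :: plane assume "(\<Prod>i\<in>UNIV. bump (a$i) (b$i) n (x$i)) \<noteq> 0"
    then have "bump (a$i) (b$i) n (x$i) \<noteq> 0" for i by auto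
    then have "x$i \<in> {a$i<..<b$i}" for i using bump_eq_0[of "x$i" "a$i" "b$i" n] by auto
    then have "x \<in> box a b" by (auto simp: mem_box_cart)
    then show "norm x \<le> R" using R by auto
  qed
qed

text \<open>Products of one-dimensional bumps increase to indicators of boxes, and boxes
  generate the Borel sets.\<close>

lemma AE_zero_if_test_integrals_zero:
  fixes g :: "plane \<Rightarrow> real"
  assumes g: "locally_integrable g" and 0: "\<And>\<psi>. \<psi> \<in> test_functions \<Longrightarrow> (LINT x|lborel. \<psi> x * g x) = 0"
  shows "AE x in lborel. g x = 0"
proof -
  note [measurable] = locally_integrableD(1)[OF g]
  have ib: "integrable lborel (\<lambda>x. indicator (box a b) x * norm (g x))" for a b
  proof -
    obtain R where "box a b \<subseteq> cball 0 R" using bounded_box[of a b] by (auto simp: bounded_iff subset_iff)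
    then show ?thesis
      by (intro integrable_dominated[OF locally_integrableD(3)[OF g, of R]])
        (auto simp: indicator_def)
  qed
  have box0: "(LINT x|lborel. indicator (box a b) x * g x) = 0" for a b
  proof -
    let ?\<psi> = "\<lambda>n x. \<Prod>i\<in>UNIV. bump (a$i) (b$i) n (x$i)"
    have ind: "(\<Prod>i\<in>UNIV. indicator {a$i<..<b$i} (x$i)) = (indicator (box a b) x :: real)" for x :: plane
      by (auto simp: indicator_def mem_box_cart)
    note [measurable] = test_functions_measurable(1)[OF box_bump_test]
    have "(\<lambda>n. LINT x|lborel. ?\<psi> n x * g x) \<longlonglongrightarrow> (LINT x|lborel. indicator (box a b) x * g x)"
    proof (rule integral_dominated_convergence[OF _ _ ib[of a b]])
      show "AE x in lborel. (\<lambda>n. ?\<psi> n x * g x) \<longlonglongrightarrow> indicator (box a b) x * g x"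
        unfolding ind[symmetric] by (intro AE_I2 tendsto_mult tendsto_prod bump_tendsto tendsto_const)
      have "?\<psi> n x \<le> indicator (box a b) x" "0 \<le> ?\<psi> n x" for n x
      proof -
        show "0 \<le> ?\<psi> n x" by (intro prod_nonneg) (auto simp: bump_bounds)
        have "?\<psi> n x \<le> (\<Prod>i\<in>UNIV. indicator {a$i<..<b$i} (x$i))"
          by (intro prod_mono) (auto simp: bump_bounds indicator_def bump_eq_0)
        then show "?\<psi> n x \<le> indicator (box a b) x" using ind by simp
      qed
      then show "AE x in lborel. norm (?\<psi> n x * g x) \<le> indicator (box a b) x * norm (g x)" for n
        by (auto simp: abs_mult intro!: mult_right_mono)
    qed auto
    then show ?thesis using 0[OF box_bump_test[of a b]] by (simp add: LIMSEQ_const_iff)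
  qed
  have "AE x in lborel. indicator (box (\<chi> i. - real n) (\<chi> i. real n)) x * g x = 0" for n :: nat
  proof (rule AE_zero_if_set_integrals_zero)
    let ?B = "box (\<chi> i. - real n) (\<chi> i. real n) :: plane set"
    show int: "integrable lborel (\<lambda>x. indicator ?B x * g x)"
      by (rule integrable_dominated[OF ib]) (auto simp: abs_mult)
    show "(LINT x:X|lborel. indicator ?B x * g x) = 0" if "X \<in> sets lborel" for X
      unfolding set_lebesgue_integral_def real_scaleR_def
    proof (rule preimage_integrals_zero_induct[OF int, where N=borel and \<rho>="\<lambda>x. x" and E="range (\<lambda>(a, b). box a b)"])
      show "Int_stable (range (\<lambda>(a, b). box a b) :: plane set set)"
      proof (rule Int_stableI)
        fix X Y :: "plane set" assume "X \<in> range (\<lambda>(a, b). box a b)" "Y \<in> range (\<lambda>(a, b). box a b)"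
        then obtain a b c d where "X = box a b" "Y = box c d" by auto
        then obtain e f where "X \<inter> Y = box e f" using box_Int_box by blast
        then show "X \<inter> Y \<in> range (\<lambda>(a, b). box a b)" by (auto intro!: range_eqI[of _ _ "(e, f)"])
      qed
      show "sets borel = sigma_sets (space borel) (range (\<lambda>(a, b). box a b :: plane set))"
        by (simp add: borel_eq_box)
      show "(LINT x|lborel. indicator ?B x * g x) = 0" by (rule box0)
      show "(LINT x|lborel. indicator Y x * (indicator ?B x * g x)) = 0" if Y: "Y \<in> range (\<lambda>(a, b). box a b)" for Y
      proof -
        obtain a b where Y: "Y = box a b" using Y by auto
        obtain a' b' where "Y \<inter> ?B = box a' b'" unfolding Y box_Int_box by blast
        then have "indicator Y x * (indicator ?B x * g x) = indicator (box a' b') x * g x" for x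
          by (simp add: indicator_inter_arith[symmetric] mult.assoc[symmetric] del: mult_cancel_right)
        then show ?thesis using box0[of a' b'] by (simp only:)
      qed
    qed (use that in auto)
  qed
  then have "AE x in lborel. \<forall>n::nat. indicator (box (\<chi> i. - real n) (\<chi> i. real n)) x * g x = 0"
    by (subst AE_all_countable) blast
  then show ?thesis
  proof eventually_elim
    case (elim x)
    obtain n :: nat where "norm x < real n" using reals_Archimedean2 by blast
    then have "\<bar>x $ i\<bar> < real n" for i using component_le_norm_cart[of x i] by linarith
    then have "x \<in> box (\<chi> i. - real n) (\<chi> i. real n)" by (auto simp: mem_box_cart abs_less_iff minus_less_iff)
    then show ?case using elim[rule_format, of n] by simp
  qed
qed

lemma weak_gradient_unique:
  assumes "has_weak_gradient u g" "has_weak_gradient u h"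
  shows "AE x in lborel. g x = h x"
proof -
  have li: "locally_integrable g" "locally_integrable h"
    using assms by (auto simp: has_weak_gradient_def)
  have d: "has_weak_gradient (\<lambda>x. u x + (- 1) * u x) (\<lambda>x. g x + (- 1) *\<^sub>R h x)"
    by (intro has_weak_gradient_add has_weak_gradient_cmult assms)
  then have ld: "locally_integrable (\<lambda>x. g x - h x)" by (simp add: has_weak_gradient_def)
  have c: "AE x in lborel. (g x - h x) $ i = 0" for i
  proof (rule AE_zero_if_test_integrals_zero)
    note [measurable] = locally_integrableD(1)[OF ld]
    show "locally_integrable (\<lambda>x. (g x - h x) $ i)"
    proof (rule locally_integrableI)
      show "integrable lborel (\<lambda>x. indicator (cball 0 R) x * norm ((g x - h x) $ i))" for R
      proof (rule integrable_dominated[OF locally_integrableD(3)[OF ld, of R]])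
        show "(\<lambda>x. indicator (cball 0 R) x * norm ((g x - h x) $ i)) \<in> borel_measurable lborel"
          using locally_integrableD(1)[OF ld]
          by (intro borel_measurable_times borel_measurable_indicator borel_measurable_norm borel_measurable_nth)
            (auto simp del: vector_minus_component)
        show "norm (indicator (cball 0 R) x * norm ((g x - h x) $ i)) \<le> indicator (cball 0 R) x * norm (g x - h x)" for x
          using component_le_norm_cart[of "g x - h x" i] by (auto simp: indicator_def)
      qed
    qed measurable
    fix \<psi> assume \<psi>: "\<psi> \<in> test_functions"
    have "(LINT x|lborel. \<psi> x *\<^sub>R (g x - h x)) = 0"
      using d \<psi> by (simp add: has_weak_gradient_def)
    moreover have "(LINT x|lborel. (\<psi> x *\<^sub>R (g x - h x)) \<bullet> axis i 1) = (LINT x|lborel. \<psi> x *\<^sub>R (g x - h x)) \<bullet> axis i 1"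
      by (rule integral_inner_left) (use test_function_integrable[OF \<psi> ld] in auto)
    ultimately show "(LINT x|lborel. \<psi> x * (g x - h x) $ i) = 0"
      by (simp add: inner_axis)
  qed
  have "AE x in lborel. \<forall>i. (g x - h x) $ i = 0" using c by (subst AE_all_countable) auto
  then show ?thesis by eventually_elim (auto simp: vec_eq_iff)
qed

lemma weak_grad_AE:
  assumes "has_weak_gradient u g"
  shows "has_weak_gradient u (weak_grad u)" "AE x in lborel. weak_grad u x = g x"
proof -
  show 1: "has_weak_gradient u (weak_grad u)"
    using assms someI[of "has_weak_gradient u"] by (simp add: weak_grad_def)
  show "AE x in lborel. weak_grad u x = g x" by (rule weak_gradient_unique[OF 1 assms])
qed

section \<open>The finite energy space\<close>

text \<open>The \<open>q\<close>-th power of the \<open>L\<^sup>q\<close> norm. It is additive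
  over sets, scales exactly and is lower semicontinuous under almost everywhere convergence,
  hence is handled instead of the norm throughout.\<close>

definition pint :: "real \<Rightarrow> (plane \<Rightarrow> 'b::euclidean_space) \<Rightarrow> real" where
  "pint q f = (LINT x|lborel. norm (f x) powr q)"

lemma pint_nonneg: "0 \<le> pint q f"
  unfolding pint_def by (rule integral_nonneg_AE) auto

lemma powr_2_norm: "norm a powr 2 = (norm a)\<^sup>2"
  by (cases "norm a = 0") (auto simp: powr_numeral)

lemma norm_add_powr_le:
  assumes "q \<ge> 0"
  shows "norm (a + b) powr q \<le> 2 powr q * (norm a powr q + norm b powr q)"
proof -
  have "norm (a + b) \<le> 2 * max (norm a) (norm b)" using norm_triangle_ineq[of a b] by linarith
  then have "norm (a + b) powr q \<le> (2 * max (norm a) (norm b)) powr q" using assms by (intro powr_mono2) auto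
  also have "\<dots> = 2 powr q * max (norm a) (norm b) powr q" by (rule powr_mult; simp add: le_max_iff_disj)
  also have "max (norm a) (norm b) powr q \<le> norm a powr q + norm b powr q" by (auto simp: max_def)
  finally show ?thesis by simp
qed

lemma Lq_spaceD:
  assumes "f \<in> Lq_space q"
  shows "f \<in> borel_measurable borel" "integrable lborel (\<lambda>x. norm (f x) powr q)"
  using assms by (auto simp: Lq_space_def)

lemma Lq_space_add:
  assumes f: "f \<in> Lq_space q" and g: "g \<in> Lq_space q" and q: "q \<ge> 0"
  shows "(\<lambda>x. f x + g x) \<in> Lq_space q" "pint q (\<lambda>x. f x + g x) \<le> 2 powr q * (pint q f + pint q g)"
proof -
  note [measurable] = Lq_spaceD(1)[OF f] Lq_spaceD(1)[OF g]
  have i: "integrable lborel (\<lambda>x. 2 powr q * (norm (f x) powr q + norm (g x) powr q))"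
    using Lq_spaceD(2)[OF f] Lq_spaceD(2)[OF g] by auto
  have j: "integrable lborel (\<lambda>x. norm (f x + g x) powr q)"
    by (rule integrable_dominated[OF i]) (use norm_add_powr_le[OF q] in auto)
  then show "(\<lambda>x. f x + g x) \<in> Lq_space q" by (auto simp: Lq_space_def)
  have "pint q (\<lambda>x. f x + g x) \<le> (LINT x|lborel. 2 powr q * (norm (f x) powr q + norm (g x) powr q))"
    unfolding pint_def by (rule integral_mono[OF j i]) (rule norm_add_powr_le[OF q])
  then show "pint q (\<lambda>x. f x + g x) \<le> 2 powr q * (pint q f + pint q g)"
    using Lq_spaceD(2)[OF f] Lq_spaceD(2)[OF g] by (simp add: pint_def)
qed

lemma Lq_space_cmult:
  assumes f: "f \<in> Lq_space q"
  shows "(\<lambda>x. c *\<^sub>R f x) \<in> Lq_space q" "pint q (\<lambda>x. c *\<^sub>R f x) = \<bar>c\<bar> powr q * pint q f"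
  using Lq_spaceD[OF f] by (auto simp: Lq_space_def pint_def powr_mult)

lemma Lq_space_diff:
  assumes f: "f \<in> Lq_space q" and g: "g \<in> Lq_space q" and q: "q \<ge> 0"
  shows "(\<lambda>x. f x - g x) \<in> Lq_space q" "pint q (\<lambda>x. f x - g x) \<le> 2 powr q * (pint q f + pint q g)"
  using Lq_space_add[OF f Lq_space_cmult(1)[OF g, of "-1"] q] Lq_space_cmult(2)[OF g, of "-1"] by auto

lemma pint_cong_AE: "AE x in lborel. f x = g x \<Longrightarrow> f \<in> borel_measurable borel \<Longrightarrow> g \<in> borel_measurable borel \<Longrightarrow> pint q f = pint q g"
  unfolding pint_def by (intro integral_cong_AE) auto

lemma Lq_space_cong_AE:
  assumes "AE x in lborel. f x = g x" "f \<in> Lq_space q" "g \<in> borel_measurable borel"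
  shows "g \<in> Lq_space q"
  using assms(1) assms(3) Lq_spaceD[OF assms(2)]
  by (auto simp: Lq_space_def elim!: eventually_mono intro!: Bochner_Integration.integrable_cong_AE[THEN iffD1, rotated -1, OF Lq_spaceD(2)[OF assms(2)]])

lemma Lq_space_scale:
  assumes f: "f \<in> Lq_space q" and c: "c > 0"
  shows "(\<lambda>x. f (c *\<^sub>R x)) \<in> Lq_space q" "pint q (\<lambda>x. f (c *\<^sub>R x)) = pint q f / c\<^sup>2"
proof -
  note [measurable] = Lq_spaceD(1)[OF f]
  show "(\<lambda>x. f (c *\<^sub>R x)) \<in> Lq_space q" "pint q (\<lambda>x. f (c *\<^sub>R x)) = pint q f / c\<^sup>2"
    using Lq_spaceD[OF f] lborel_scale[of c "\<lambda>x. norm (f x) powr q"] c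
    by (auto simp: Lq_space_def pint_def)
qed

lemma Lq_space_test:
  assumes f: "f \<in> test_functions" and q: "q > 0"
  shows "f \<in> Lq_space q" "grad f \<in> Lq_space q"
proof -
  obtain C R where C: "C > 0" "\<And>x. norm (grad f x) \<le> C * indicator (cball 0 R) x" "\<And>x. norm (f x) \<le> C * indicator (cball 0 R) x"
    using test_functions_bounds[OF f] by (metis real_norm_def)
  note [measurable] = test_functions_measurable[OF f]
  have *: "h \<in> Lq_space q" if b: "\<And>x. norm (h x) \<le> C * indicator (cball 0 R) x" and m: "h \<in> borel_measurable borel" for h :: "plane \<Rightarrow> 'b::euclidean_space"
  proof -
    have "integrable lborel (\<lambda>x. norm (h x) powr q)"
    proof (rule integrable_dominated[OF integrable_indicator_ball[of "C powr q" R]])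
      show "(\<lambda>x. norm (h x) powr q) \<in> borel_measurable lborel" using m by auto
      show "norm (norm (h x) powr q) \<le> C powr q * indicator (cball 0 R) x" for x
        using b[of x] q by (cases "x \<in> cball 0 R") (auto intro: powr_mono2)
    qed
    then show ?thesis using m by (simp add: Lq_space_def)
  qed
  show "f \<in> Lq_space q" "grad f \<in> Lq_space q" by (rule *; use C in auto)+
qed

text \<open>Young's inequality in its crudest form: \<open>L\<^sup>q\<close> convergence, \<open>q \<ge> 1\<close>, controls local
  \<open>L\<^sup>1\<close> convergence.\<close>

lemma le_delta_plus_powr:
  fixes a :: real
  assumes "a \<ge> 0" "\<delta> > 0" "q \<ge> 1"
  shows "a \<le> \<delta> + \<delta> powr (1 - q) * a powr q"
proof (cases "a \<le> \<delta>")
  case True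
  then show ?thesis using assms by (smt (verit) mult_nonneg_nonneg powr_ge_zero)
next
  case False
  then have "1 \<le> a / \<delta>" using assms by simp
  then have "(a / \<delta>) powr 1 \<le> (a / \<delta>) powr q" using assms by (intro powr_mono) auto
  then have "a \<le> \<delta> * (a / \<delta>) powr q" using assms False by (simp add: field_simps)
  also have "\<dots> = \<delta> powr (1 - q) * a powr q"
    using assms False by (simp add: powr_divide powr_diff)
  finally show ?thesis using assms by linarith
qed

lemma local_L1_le:
  fixes f :: "plane \<Rightarrow> 'b::euclidean_space"
  assumes f: "f \<in> Lq_space q" and q: "q \<ge> 1" and \<delta>: "\<delta> > 0"
  shows "integrable lborel (\<lambda>x. indicator (cball 0 R) x * norm (f x))"
    "(LINT x|lborel. indicator (cball 0 R) x * norm (f x))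
       \<le> \<delta> * (LINT x|lborel. indicator (cball (0::plane) R) x) + \<delta> powr (1 - q) * pint q f"
proof -
  note [measurable] = Lq_spaceD(1)[OF f]
  have i: "integrable lborel (\<lambda>x. \<delta> * indicator (cball 0 R) x + \<delta> powr (1 - q) * norm (f x) powr q)"
    using Lq_spaceD(2)[OF f] integrable_indicator_ball by auto
  have le: "indicator (cball 0 R) x * norm (f x) \<le> \<delta> * indicator (cball 0 R) x + \<delta> powr (1 - q) * norm (f x) powr q" for x
    using le_delta_plus_powr[OF norm_ge_zero \<delta> q, of "f x"] by (auto simp: indicator_def)
  show j: "integrable lborel (\<lambda>x. indicator (cball 0 R) x * norm (f x))"
  proof (rule integrable_dominated[OF i])
    show "(\<lambda>x. indicator (cball 0 R) x * norm (f x)) \<in> borel_measurable lborel"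
      using Lq_spaceD(1)[OF f]
      by (intro borel_measurable_times borel_measurable_indicator borel_measurable_norm) auto
  qed (use le in auto)
  have "(LINT x|lborel. indicator (cball 0 R) x * norm (f x)) \<le> (LINT x|lborel. \<delta> * indicator (cball 0 R) x + \<delta> powr (1 - q) * norm (f x) powr q)"
    by (rule integral_mono[OF j i le])
  then show "(LINT x|lborel. indicator (cball 0 R) x * norm (f x))
       \<le> \<delta> * (LINT x|lborel. indicator (cball (0::plane) R) x) + \<delta> powr (1 - q) * pint q f"
    using Lq_spaceD(2)[OF f] integrable_indicator_ball[of \<delta> R] by (simp add: pint_def)
qed

lemma Lq_space_locally_integrable: "f \<in> Lq_space q \<Longrightarrow> q \<ge> 1 \<Longrightarrow> locally_integrable f"
  by (intro locally_integrableI local_L1_le(1)[where \<delta>=1] Lq_spaceD(1)) auto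

text \<open>Membership in the finite energy space, expressed by the integrals that make up the norm
  instead of their roots, together with the weak gradient as a separate datum.\<close>

definition H_pair :: "real \<Rightarrow> (plane \<Rightarrow> real) \<Rightarrow> (plane \<Rightarrow> plane) \<Rightarrow> bool" where
  "H_pair \<beta> u g \<longleftrightarrow> u \<in> Lq_space \<beta> \<and> g \<in> Lq_space 2 \<and>
     (\<forall>e>0. \<exists>\<psi>\<in>test_functions. pint 2 (\<lambda>x. grad \<psi> x - g x) < e \<and> pint \<beta> (\<lambda>x. \<psi> x - u x) < e)"

lemma H_pairD:
  assumes "H_pair \<beta> u g"
  shows "u \<in> Lq_space \<beta>" "g \<in> Lq_space 2"
  using assms by (auto simp: H_pair_def)

text \<open>First \<open>e\<close> tends to zero for fixed \<open>\<delta>\<close>, then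
  \<open>\<delta>\<close> does.\<close>

lemma le_zero_if_le_all_positive:
  fixes X K :: real and B :: "real \<Rightarrow> real"
  assumes "\<And>\<delta> e. \<delta> > 0 \<Longrightarrow> e > 0 \<Longrightarrow> X \<le> K * \<delta> + B \<delta> * e"
  shows "X \<le> 0"
proof (rule field_le_epsilon)
  fix \<epsilon> :: real assume \<epsilon>: "\<epsilon> > 0"
  define \<delta> where "\<delta> = \<epsilon> / (2 * (\<bar>K\<bar> + 1))"
  define e where "e = \<epsilon> / (2 * (\<bar>B \<delta>\<bar> + 1))"
  have p: "\<delta> > 0" "e > 0" using \<epsilon> by (auto simp: \<delta>_def e_def)
  have "K * \<delta> \<le> (\<bar>K\<bar> + 1) * \<delta>" "B \<delta> * e \<le> (\<bar>B \<delta>\<bar> + 1) * e" using p by (auto intro!: mult_right_mono)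
  moreover have "(\<bar>K\<bar> + 1) * \<delta> = \<epsilon> / 2" "(\<bar>B \<delta>\<bar> + 1) * e = \<epsilon> / 2"
    by (auto simp: \<delta>_def e_def field_simps)
  ultimately show "X \<le> 0 + \<epsilon>" using assms[OF p] by linarith
qed

text \<open>Integration by parts for the approximating test functions passes to the limit: on
  the support of \<open>\<phi>\<close> the errors in \<open>L\<^sup>\<beta>\<close> and
  \<open>L\<^sup>2\<close> control the errors in \<open>L\<^sup>1\<close>.\<close>

lemma H_pair_weak_gradient:
  assumes H: "H_pair \<beta> u g" and \<beta>: "\<beta> > 1"
  shows "has_weak_gradient u g"
  unfolding has_weak_gradient_def
proof (intro conjI ballI)
  have uL: "u \<in> Lq_space \<beta>" and gL: "g \<in> Lq_space 2" using H by (auto simp: H_pair_def)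
  show lu: "locally_integrable u" and lg: "locally_integrable g"
    using Lq_space_locally_integrable[OF uL] Lq_space_locally_integrable[OF gL] \<beta> by auto
  fix \<phi> assume \<phi>: "\<phi> \<in> test_functions"
  obtain C R where C: "C > 0" "\<And>x. \<bar>\<phi> x\<bar> \<le> C * indicator (cball 0 R) x" "\<And>x. norm (grad \<phi> x) \<le> C * indicator (cball 0 R) x"
    using test_functions_bounds[OF \<phi>] by metis
  define b where "b = (LINT x|lborel. indicator (cball (0::plane) R) x :: real)"
  let ?X = "(LINT x|lborel. u x *\<^sub>R grad \<phi> x) + (LINT x|lborel. \<phi> x *\<^sub>R g x)"
  have "norm ?X \<le> 0"
  proof (rule le_zero_if_le_all_positive[where K="2 * C * b" and B="\<lambda>\<delta>. C * (\<delta> powr (1 - \<beta>) + \<delta> powr (1 - 2))"])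
    fix \<delta> e :: real assume \<delta>: "\<delta> > 0" and e: "e > 0"
    obtain \<psi> where \<psi>: "\<psi> \<in> test_functions" "pint 2 (\<lambda>x. grad \<psi> x - g x) < e" "pint \<beta> (\<lambda>x. \<psi> x - u x) < e"
      using H e by (auto simp: H_pair_def)
    note [measurable] = Lq_spaceD(1)[OF uL] Lq_spaceD(1)[OF gL] test_functions_measurable[OF \<psi>(1)] test_functions_measurable[OF \<phi>]
    have dL: "(\<lambda>x. \<psi> x - u x) \<in> Lq_space \<beta>" "(\<lambda>x. grad \<psi> x - g x) \<in> Lq_space 2"
      using Lq_space_diff(1)[OF Lq_space_test(1)[OF \<psi>(1)] uL] Lq_space_diff(1)[OF Lq_space_test(2)[OF \<psi>(1)] gL] \<beta> by auto
    note l1 = local_L1_le[OF dL(1) less_imp_le[OF \<beta>] \<delta>, of R] and l2 = local_L1_le[OF dL(2) _ \<delta>, of R, simplified]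
    have ibp: "(LINT x|lborel. \<psi> x *\<^sub>R grad \<phi> x) = - (LINT x|lborel. \<phi> x *\<^sub>R grad \<psi> x)"
      using has_weak_gradient_test[OF \<psi>(1)] \<phi> by (simp add: has_weak_gradient_def)
    have i1: "integrable lborel (\<lambda>x. u x *\<^sub>R grad \<phi> x)" "integrable lborel (\<lambda>x. \<psi> x *\<^sub>R grad \<phi> x)"
      "integrable lborel (\<lambda>x. \<phi> x *\<^sub>R g x)" "integrable lborel (\<lambda>x. \<phi> x *\<^sub>R grad \<psi> x)"
      using test_grad_integrable[OF \<phi>] test_function_integrable[OF \<phi>] lu lg locally_integrable_test[OF \<psi>(1)] by auto
    have "?X = - ((LINT x|lborel. (\<psi> x - u x) *\<^sub>R grad \<phi> x) + (LINT x|lborel. \<phi> x *\<^sub>R (grad \<psi> x - g x)))"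
      using i1 ibp by (simp add: scaleR_diff_left scaleR_diff_right)
    then have "norm ?X \<le> norm (LINT x|lborel. (\<psi> x - u x) *\<^sub>R grad \<phi> x) + norm (LINT x|lborel. \<phi> x *\<^sub>R (grad \<psi> x - g x))"
      using norm_triangle_ineq by (simp only: norm_minus_cancel)
    also have "norm (LINT x|lborel. (\<psi> x - u x) *\<^sub>R grad \<phi> x) \<le> (LINT x|lborel. C * (indicator (cball 0 R) x * norm (\<psi> x - u x)))"
    proof (rule Bochner_Integration.integral_norm_bound_integral)
      show "norm ((\<psi> x - u x) *\<^sub>R grad \<phi> x) \<le> C * (indicator (cball 0 R) x * norm (\<psi> x - u x))" for x
        using mult_left_mono[OF C(3)[of x], of "\<bar>\<psi> x - u x\<bar>"] by (simp add: mult.assoc mult.left_commute mult.commute)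
    qed (use i1 l1(1) in \<open>auto simp: scaleR_diff_left\<close>)
    also have "norm (LINT x|lborel. \<phi> x *\<^sub>R (grad \<psi> x - g x)) \<le> (LINT x|lborel. C * (indicator (cball 0 R) x * norm (grad \<psi> x - g x)))"
    proof (rule Bochner_Integration.integral_norm_bound_integral)
      show "norm (\<phi> x *\<^sub>R (grad \<psi> x - g x)) \<le> C * (indicator (cball 0 R) x * norm (grad \<psi> x - g x))" for x
        using mult_right_mono[OF C(2)[of x], of "norm (grad \<psi> x - g x)"] by (simp add: mult.assoc)
    qed (use i1 l2(1) in \<open>auto simp: scaleR_diff_right\<close>)
    also have "(LINT x|lborel. C * (indicator (cball 0 R) x * norm (\<psi> x - u x))) \<le> C * (\<delta> * b + \<delta> powr (1 - \<beta>) * e)"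
      unfolding integral_mult_right_zero b_def
      using l1(2) mult_left_mono[OF less_imp_le[OF \<psi>(3)], of "\<delta> powr (1 - \<beta>)"] C(1)
      by (intro mult_left_mono) auto
    also have "(LINT x|lborel. C * (indicator (cball 0 R) x * norm (grad \<psi> x - g x))) \<le> C * (\<delta> * b + \<delta> powr (1 - 2) * e)"
      unfolding integral_mult_right_zero b_def
      using l2(2) mult_left_mono[OF less_imp_le[OF \<psi>(2)], of "\<delta> powr (1 - 2)"] C(1)
      by (intro mult_left_mono) auto
    finally show "norm ?X \<le> 2 * C * b * \<delta> + C * (\<delta> powr (1 - \<beta>) + \<delta> powr (1 - 2)) * e"
      by (simp add: algebra_simps)
  qed
  then show "(LINT x|lborel. u x *\<^sub>R grad \<phi> x) = - (LINT x|lborel. \<phi> x *\<^sub>R g x)"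
    by (simp add: eq_neg_iff_add_eq_0)
qed

lemma Lq_norm_pint: "Lq_norm q f = pint q f powr (1 / q)"
  by (simp add: Lq_norm_def pint_def)

text \<open>By uniqueness of weak gradients, the distance of \<open>u\<close> to a test function
  in the energy norm is made up of the two integrals in \<open>H_pair\<close>; a sum of roots is
  small exactly if both integrals are.\<close>

lemma H_space_iff:
  assumes \<beta>: "\<beta> > 1"
  shows "u \<in> H_space \<beta> \<longleftrightarrow> (\<exists>g. H_pair \<beta> u g)" (is "?L \<longleftrightarrow> ?R")
    and "u \<in> H_space \<beta> \<Longrightarrow> H_pair \<beta> u (weak_grad u)"
proof -
  \<comment> \<open>The difference of \<open>u\<close> and a test function has the difference of gradients as weak gradient.\<close>
  have diff: "pint 2 (weak_grad (\<lambda>x. \<psi> x - u x)) = pint 2 (\<lambda>x. grad \<psi> x - g x)"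
    if u: "has_weak_gradient u g" and \<psi>: "\<psi> \<in> test_functions" for \<psi> g
  proof -
    have w: "has_weak_gradient (\<lambda>x. \<psi> x - u x) (\<lambda>x. grad \<psi> x - g x)"
      using has_weak_gradient_add[OF has_weak_gradient_test[OF \<psi>] has_weak_gradient_cmult[OF u, of "-1"]] by simp
    show ?thesis
      by (rule pint_cong_AE[OF weak_grad_AE(2)[OF w]])
        (use weak_grad_AE(1)[OF w] w in \<open>auto simp: has_weak_gradient_def locally_integrable_def\<close>)
  qed
  show wg: "H_pair \<beta> u (weak_grad u)" if u: "u \<in> H_space \<beta>"
  proof -
    obtain \<psi> g where \<psi>: "\<And>n::nat. \<psi> n \<in> test_functions" "(\<lambda>n. H_norm \<beta> (\<lambda>x. \<psi> n x - u x)) \<longlonglongrightarrow> 0"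
      and g: "has_weak_gradient u g" and L: "u \<in> Lq_space \<beta>" "weak_grad u \<in> Lq_space 2"
      using u by (auto simp: H_space_def)
    note wu = weak_grad_AE(1)[OF g]
    show "H_pair \<beta> u (weak_grad u)" unfolding H_pair_def
    proof (intro conjI L allI impI)
      fix e :: real assume e: "e > 0"
      define \<eta> where "\<eta> = min (e powr (1/2)) (e powr (1/\<beta>))"
      have "\<eta> > 0" using e by (simp add: \<eta>_def)
      then have "eventually (\<lambda>n. H_norm \<beta> (\<lambda>x. \<psi> n x - u x) < \<eta>) sequentially"
        using order_tendstoD(2)[OF \<psi>(2)] by auto
      then obtain n where n: "H_norm \<beta> (\<lambda>x. \<psi> n x - u x) < \<eta>" by (auto simp: eventually_sequentially)
      then have "pint 2 (\<lambda>x. grad (\<psi> n) x - weak_grad u x) powr (1/2) + pint \<beta> (\<lambda>x. \<psi> n x - u x) powr (1/\<beta>) < \<eta>"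
        unfolding H_norm_def Lq_norm_pint diff[OF wu \<psi>(1)] .
      then have "pint 2 (\<lambda>x. grad (\<psi> n) x - weak_grad u x) powr (1/2) < e powr (1/2)"
        "pint \<beta> (\<lambda>x. \<psi> n x - u x) powr (1/\<beta>) < e powr (1/\<beta>)"
        unfolding \<eta>_def by (smt (verit) powr_ge_zero)+
      then have "pint 2 (\<lambda>x. grad (\<psi> n) x - weak_grad u x) < e" "pint \<beta> (\<lambda>x. \<psi> n x - u x) < e"
        using e \<beta> by (smt (verit) powr_mono2 zero_le_divide_1_iff)+
      then show "\<exists>\<psi>\<in>test_functions. pint 2 (\<lambda>x. grad \<psi> x - weak_grad u x) < e \<and> pint \<beta> (\<lambda>x. \<psi> x - u x) < e"
        using \<psi>(1) by blast
    qed
  qed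
  show "?L \<longleftrightarrow> ?R"
  proof
    assume ?R
    then obtain g where H: "H_pair \<beta> u g" by blast
    have w: "has_weak_gradient u g" by (rule H_pair_weak_gradient[OF H \<beta>])
    have L: "u \<in> Lq_space \<beta>" "g \<in> Lq_space 2" using H by (auto simp: H_pair_def)
    have wL: "weak_grad u \<in> Lq_space 2"
    proof (rule Lq_space_cong_AE[OF _ L(2)])
      show "AE x in lborel. g x = weak_grad u x" using weak_grad_AE(2)[OF w] by eventually_elim auto
      show "weak_grad u \<in> borel_measurable borel" using weak_grad_AE(1)[OF w] by (auto simp: has_weak_gradient_def locally_integrable_def)
    qed
    have "\<forall>n. \<exists>\<psi>. \<psi> \<in> test_functions \<and> pint 2 (\<lambda>x. grad \<psi> x - g x) < 1 / real (Suc n) \<and> pint \<beta> (\<lambda>x. \<psi> x - u x) < 1 / real (Suc n)"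
    proof
      fix n :: nat
      have "1 / real (Suc n) > 0" by simp
      then show "\<exists>\<psi>. \<psi> \<in> test_functions \<and> pint 2 (\<lambda>x. grad \<psi> x - g x) < 1 / real (Suc n) \<and> pint \<beta> (\<lambda>x. \<psi> x - u x) < 1 / real (Suc n)"
        using H unfolding H_pair_def Bex_def by blast
    qed
    from choice[OF this] obtain \<psi> where \<psi>': "\<forall>n. \<psi> n \<in> test_functions \<and> pint 2 (\<lambda>x. grad (\<psi> n) x - g x) < 1 / real (Suc n) \<and> pint \<beta> (\<lambda>x. \<psi> n x - u x) < 1 / real (Suc n)"
      by blast
    then have \<psi>: "\<psi> n \<in> test_functions" "pint 2 (\<lambda>x. grad (\<psi> n) x - g x) < 1 / real (Suc n)"
      "pint \<beta> (\<lambda>x. \<psi> n x - u x) < 1 / real (Suc n)" for n by blast+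
    have "(\<lambda>n. H_norm \<beta> (\<lambda>x. \<psi> n x - u x)) \<longlonglongrightarrow> 0"
    proof -
      have l: "(\<lambda>n. pint 2 (\<lambda>x. grad (\<psi> n) x - g x)) \<longlonglongrightarrow> 0" "(\<lambda>n. pint \<beta> (\<lambda>x. \<psi> n x - u x)) \<longlonglongrightarrow> 0"
        using \<psi>(2,3)
        by (intro tendsto_sandwich[OF _ _ tendsto_const lim_1_over_n[THEN LIMSEQ_Suc]] always_eventually
            allI pint_nonneg less_imp_le; blast)+
      have "(\<lambda>n. pint 2 (\<lambda>x. grad (\<psi> n) x - g x) powr (1/2) + pint \<beta> (\<lambda>x. \<psi> n x - u x) powr (1/\<beta>)) \<longlonglongrightarrow> 0 + 0"
        by (intro tendsto_add tendsto_zero_powrI[OF l(1), of "\<lambda>_. 1/2" "1/2"] tendsto_zero_powrI[OF l(2), of "\<lambda>_. 1/\<beta>" "1/\<beta>"])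
          (use \<beta> in \<open>auto intro!: always_eventually pint_nonneg\<close>)
      then show ?thesis unfolding H_norm_def Lq_norm_pint diff[OF w \<psi>(1)] by simp
    qed
    then show ?L using L w wL \<psi>(1) unfolding H_space_def by blast
  qed (use wg in blast)
qed

lemma H_pair_weak_grad:
  assumes H: "H_pair \<beta> u g" and \<beta>: "\<beta> > 1"
  shows "u \<in> H_space \<beta>" "AE x in lborel. weak_grad u x = g x" "pint 2 (weak_grad u) = pint 2 g"
proof -
  show 1: "u \<in> H_space \<beta>" using H H_space_iff(1)[OF \<beta>] by blast
  show 2: "AE x in lborel. weak_grad u x = g x" by (rule weak_grad_AE(2)[OF H_pair_weak_gradient[OF H \<beta>]])
  have "H_pair \<beta> u (weak_grad u)" by (rule H_space_iff(2)[OF \<beta> 1])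
  then show "pint 2 (weak_grad u) = pint 2 g" using H
    by (intro pint_cong_AE[OF 2]) (auto simp: H_pair_def Lq_space_def)
qed

lemma H_pair_test:
  assumes f: "f \<in> test_functions" and \<beta>: "\<beta> > 1" shows "H_pair \<beta> f (grad f)"
  unfolding H_pair_def using Lq_space_test[OF f] \<beta> f by (auto intro!: bexI[of _ f] simp: pint_def)

lemma halving:
  fixes e :: real
  assumes e: "e > 0"
  obtains \<eta> where "\<eta> > 0" "2 powr \<beta> * (\<eta> + \<eta>) < e" "2 powr 2 * (\<eta> + \<eta>) < e"
proof -
  define B :: real where "B = 2 powr \<beta> + 2 powr 2"
  have B: "B > 0" "2 powr \<beta> \<le> B" "2 powr 2 \<le> B" by (auto simp: B_def add_pos_pos)
  define \<eta> where "\<eta> = e / (4 * B)"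
  have \<eta>: "\<eta> > 0" "B * (\<eta> + \<eta>) = e / 2" using B e by (auto simp: \<eta>_def field_simps)
  have "2 powr \<beta> * (\<eta> + \<eta>) \<le> B * (\<eta> + \<eta>)" "2 powr 2 * (\<eta> + \<eta>) \<le> B * (\<eta> + \<eta>)"
    using B \<eta> by (intro mult_right_mono; simp)+
  then show thesis using that[of \<eta>] \<eta> e by linarith
qed

lemma H_pair_limit:
  assumes u: "u \<in> Lq_space \<beta>" and g: "g \<in> Lq_space 2" and \<beta>: "\<beta> > 1"
    and ap: "\<And>e. e > 0 \<Longrightarrow> \<exists>v h. H_pair \<beta> v h \<and> pint 2 (\<lambda>x. h x - g x) < e \<and> pint \<beta> (\<lambda>x. v x - u x) < e"
  shows "H_pair \<beta> u g"
  unfolding H_pair_def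
proof (intro conjI u g allI impI)
  fix e :: real assume e: "e > 0"
  obtain \<eta> :: real where \<eta>: "\<eta> > 0" "2 powr \<beta> * (\<eta> + \<eta>) < e" "2 powr 2 * (\<eta> + \<eta>) < e"
    by (rule halving[OF e])
  obtain v h where vh: "H_pair \<beta> v h" "pint 2 (\<lambda>x. h x - g x) < \<eta>" "pint \<beta> (\<lambda>x. v x - u x) < \<eta>"
    using ap[OF \<eta>(1)] by blast
  then obtain \<psi> where \<psi>: "\<psi> \<in> test_functions" "pint 2 (\<lambda>x. grad \<psi> x - h x) < \<eta>" "pint \<beta> (\<lambda>x. \<psi> x - v x) < \<eta>"
    using \<eta>(1) by (auto simp: H_pair_def)
  have L: "v \<in> Lq_space \<beta>" "h \<in> Lq_space 2" using vh(1) by (auto simp: H_pair_def)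
  have "pint \<beta> (\<lambda>x. \<psi> x - u x) \<le> 2 powr \<beta> * (pint \<beta> (\<lambda>x. \<psi> x - v x) + pint \<beta> (\<lambda>x. v x - u x))"
    using Lq_space_add(2)[OF Lq_space_diff(1)[OF Lq_space_test(1)[OF \<psi>(1)] L(1)] Lq_space_diff(1)[OF L(1) u]] \<beta> by simp
  also have "\<dots> \<le> 2 powr \<beta> * (\<eta> + \<eta>)" using \<psi> vh by (intro mult_left_mono) auto
  finally have 1: "pint \<beta> (\<lambda>x. \<psi> x - u x) < e" using \<eta> by simp
  have "pint 2 (\<lambda>x. grad \<psi> x - g x) \<le> 2 powr 2 * (pint 2 (\<lambda>x. grad \<psi> x - h x) + pint 2 (\<lambda>x. h x - g x))"
    using Lq_space_add(2)[OF Lq_space_diff(1)[OF Lq_space_test(2)[OF \<psi>(1)] L(2)] Lq_space_diff(1)[OF L(2) g]] by simp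
  also have "\<dots> \<le> 2 powr 2 * (\<eta> + \<eta>)" using \<psi> vh by (intro mult_left_mono) auto
  finally have 2: "pint 2 (\<lambda>x. grad \<psi> x - g x) < e" using \<eta> by simp
  show "\<exists>\<psi>\<in>test_functions. pint 2 (\<lambda>x. grad \<psi> x - g x) < e \<and> pint \<beta> (\<lambda>x. \<psi> x - u x) < e"
    using \<psi>(1) 1 2 by blast
qed

lemma H_pair_add:
  assumes u: "H_pair \<beta> u g" and v: "H_pair \<beta> v h" and \<beta>: "\<beta> > 1"
  shows "H_pair \<beta> (\<lambda>x. u x + v x) (\<lambda>x. g x + h x)"
proof (rule H_pair_limit)
  note L = H_pairD[OF u] H_pairD[OF v]
  show "(\<lambda>x. u x + v x) \<in> Lq_space \<beta>" "(\<lambda>x. g x + h x) \<in> Lq_space 2"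
    using Lq_space_add(1)[OF L(1,3)] Lq_space_add(1)[OF L(2,4)] \<beta> by auto
  fix e :: real assume e: "e > 0"
  obtain \<eta> :: real where \<eta>: "\<eta> > 0" "2 powr \<beta> * (\<eta> + \<eta>) < e" "2 powr 2 * (\<eta> + \<eta>) < e"
    by (rule halving[OF e])
  obtain \<psi> where \<psi>: "\<psi> \<in> test_functions" "pint 2 (\<lambda>x. grad \<psi> x - g x) < \<eta>" "pint \<beta> (\<lambda>x. \<psi> x - u x) < \<eta>"
    using u \<eta>(1) unfolding H_pair_def by blast
  obtain \<phi> where \<phi>: "\<phi> \<in> test_functions" "pint 2 (\<lambda>x. grad \<phi> x - h x) < \<eta>" "pint \<beta> (\<lambda>x. \<phi> x - v x) < \<eta>"
    using v \<eta>(1) unfolding H_pair_def by blast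
  have gr: "grad (\<lambda>x. \<psi> x + \<phi> x) x = grad \<psi> x + grad \<phi> x" for x
    by (rule grad_eqI)
      (use has_derivative_add[OF has_derivative_grad[OF test_functionsD(2)[OF \<psi>(1)]] has_derivative_grad[OF test_functionsD(2)[OF \<phi>(1)]]]
       in \<open>simp add: inner_add_right\<close>)
  have "pint \<beta> (\<lambda>x. (\<psi> x - u x) + (\<phi> x - v x)) \<le> 2 powr \<beta> * (pint \<beta> (\<lambda>x. \<psi> x - u x) + pint \<beta> (\<lambda>x. \<phi> x - v x))"
    using Lq_space_add(2)[OF Lq_space_diff(1)[OF Lq_space_test(1)[OF \<psi>(1)] L(1)] Lq_space_diff(1)[OF Lq_space_test(1)[OF \<phi>(1)] L(3)]] \<beta> by simp
  also have "\<dots> \<le> 2 powr \<beta> * (\<eta> + \<eta>)" using \<psi> \<phi> by (intro mult_left_mono) auto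
  finally have 1: "pint \<beta> (\<lambda>x. (\<psi> x + \<phi> x) - (u x + v x)) < e" using \<eta> by (simp add: algebra_simps)
  have "pint 2 (\<lambda>x. (grad \<psi> x - g x) + (grad \<phi> x - h x)) \<le> 2 powr 2 * (pint 2 (\<lambda>x. grad \<psi> x - g x) + pint 2 (\<lambda>x. grad \<phi> x - h x))"
    using Lq_space_add(2)[OF Lq_space_diff(1)[OF Lq_space_test(2)[OF \<psi>(1)] L(2)] Lq_space_diff(1)[OF Lq_space_test(2)[OF \<phi>(1)] L(4)]] by simp
  also have "\<dots> \<le> 2 powr 2 * (\<eta> + \<eta>)" using \<psi> \<phi> by (intro mult_left_mono) auto
  finally have 2: "pint 2 (\<lambda>x. grad (\<lambda>x. \<psi> x + \<phi> x) x - (g x + h x)) < e" using \<eta> by (simp add: add_diff_add gr)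
  show "\<exists>v' h'. H_pair \<beta> v' h' \<and> pint 2 (\<lambda>x. h' x - (g x + h x)) < e \<and> pint \<beta> (\<lambda>x. v' x - (u x + v x)) < e"
    using H_pair_test[OF test_functions_add[OF \<psi>(1) \<phi>(1)] \<beta>] 1 2 by blast
qed (rule \<beta>)

lemma H_pair_cmult:
  assumes u: "H_pair \<beta> u g" and \<beta>: "\<beta> > 1"
  shows "H_pair \<beta> (\<lambda>x. c * u x) (\<lambda>x. c *\<^sub>R g x)"
proof (rule H_pair_limit)
  note L = H_pairD[OF u]
  show "(\<lambda>x. c * u x) \<in> Lq_space \<beta>" "(\<lambda>x. c *\<^sub>R g x) \<in> Lq_space 2"
    using Lq_space_cmult(1)[OF L(1), of c] Lq_space_cmult(1)[OF L(2)] by auto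
  fix e :: real assume e: "e > 0"
  define \<eta> where "\<eta> = min (e / (\<bar>c\<bar> powr 2 + 1)) (e / (\<bar>c\<bar> powr \<beta> + 1))"
  have p: "0 \<le> \<bar>c\<bar> powr 2" "0 \<le> \<bar>c\<bar> powr \<beta>" by auto
  then have "\<eta> > 0" using e by (simp add: \<eta>_def add_nonneg_pos)
  then obtain \<psi> where \<psi>: "\<psi> \<in> test_functions" "pint 2 (\<lambda>x. grad \<psi> x - g x) < \<eta>" "pint \<beta> (\<lambda>x. \<psi> x - u x) < \<eta>"
    using u unfolding H_pair_def by blast
  have gr: "grad (\<lambda>x. c * \<psi> x) x = c *\<^sub>R grad \<psi> x" for x
    by (rule grad_eqI)
      (use has_derivative_mult_right[OF has_derivative_grad[OF test_functionsD(2)[OF \<psi>(1)]], of c x] in simp)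
  have sm: "k * X < e" if "0 \<le> k" "0 \<le> X" "X < \<eta>" "\<eta> \<le> e / (k + 1)" for k X
  proof -
    have "X < e / (k + 1)" using that by linarith
    then have "X * (k + 1) < e" using that by (simp add: pos_less_divide_eq)
    then show ?thesis using that by (simp add: algebra_simps)
  qed
  have "\<bar>c\<bar> powr \<beta> * pint \<beta> (\<lambda>x. \<psi> x - u x) < e"
    by (rule sm) (use \<psi> pint_nonneg in \<open>auto simp: \<eta>_def\<close>)
  then have 1: "pint \<beta> (\<lambda>x. c * \<psi> x - c * u x) < e"
    using Lq_space_cmult(2)[OF Lq_space_diff(1)[OF Lq_space_test(1)[OF \<psi>(1)] L(1)], of c] \<beta> by (simp add: algebra_simps)
  have "\<bar>c\<bar> powr 2 * pint 2 (\<lambda>x. grad \<psi> x - g x) < e"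
    by (rule sm) (use \<psi> pint_nonneg in \<open>auto simp: \<eta>_def simp del: powr_numeral\<close>)
  then have 2: "pint 2 (\<lambda>x. grad (\<lambda>x. c * \<psi> x) x - c *\<^sub>R g x) < e"
    using Lq_space_cmult(2)[OF Lq_space_diff(1)[OF Lq_space_test(2)[OF \<psi>(1)] L(2)], of c] by (simp add: algebra_simps gr)
  show "\<exists>v' h'. H_pair \<beta> v' h' \<and> pint 2 (\<lambda>x. h' x - c *\<^sub>R g x) < e \<and> pint \<beta> (\<lambda>x. v' x - c * u x) < e"
    using H_pair_test[OF test_functions_cmult[OF \<psi>(1)] \<beta>] 1 2 by blast
qed (rule \<beta>)

lemma H_pair_scale:
  assumes u: "H_pair \<beta> u g" and \<beta>: "\<beta> > 1" and c: "c > 0"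
  shows "H_pair \<beta> (\<lambda>x. u (c *\<^sub>R x)) (\<lambda>x. c *\<^sub>R g (c *\<^sub>R x))"
proof (rule H_pair_limit)
  note L = H_pairD[OF u]
  show "(\<lambda>x. u (c *\<^sub>R x)) \<in> Lq_space \<beta>" "(\<lambda>x. c *\<^sub>R g (c *\<^sub>R x)) \<in> Lq_space 2"
    using Lq_space_scale(1)[OF L(1) c] Lq_space_cmult(1)[OF Lq_space_scale(1)[OF L(2) c]] by auto
  fix e :: real assume e: "e > 0"
  define \<eta> where "\<eta> = min e (e * c\<^sup>2)"
  have \<eta>: "\<eta> > 0" using e c by (simp add: \<eta>_def)
  then obtain \<psi> where \<psi>: "\<psi> \<in> test_functions" "pint 2 (\<lambda>x. grad \<psi> x - g x) < \<eta>" "pint \<beta> (\<lambda>x. \<psi> x - u x) < \<eta>"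
    using u unfolding H_pair_def by blast
  have gr: "grad (\<lambda>x. \<psi> (c *\<^sub>R x)) x = c *\<^sub>R grad \<psi> (c *\<^sub>R x)" for x
    by (rule grad_eqI[OF grad_scale[OF test_functionsD(2)[OF \<psi>(1)]]])
  have 1: "pint \<beta> (\<lambda>x. \<psi> (c *\<^sub>R x) - u (c *\<^sub>R x)) < e"
    using Lq_space_scale(2)[OF Lq_space_diff(1)[OF Lq_space_test(1)[OF \<psi>(1)] L(1)] c] \<psi>(3) \<beta> c
    by (simp add: \<eta>_def pos_divide_less_eq)
  have "pint 2 (\<lambda>x. c *\<^sub>R (grad \<psi> (c *\<^sub>R x) - g (c *\<^sub>R x))) = pint 2 (\<lambda>x. grad \<psi> x - g x)"
    using Lq_space_cmult(2)[OF Lq_space_scale(1)[OF Lq_space_diff(1)[OF Lq_space_test(2)[OF \<psi>(1)] L(2)] c], of c]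
      Lq_space_scale(2)[OF Lq_space_diff(1)[OF Lq_space_test(2)[OF \<psi>(1)] L(2)] c] c by (simp add: powr_numeral)
  then have 2: "pint 2 (\<lambda>x. grad (\<lambda>x. \<psi> (c *\<^sub>R x)) x - c *\<^sub>R g (c *\<^sub>R x)) < e"
    using \<psi>(2) by (simp add: algebra_simps gr \<eta>_def)
  show "\<exists>v' h'. H_pair \<beta> v' h' \<and> pint 2 (\<lambda>x. h' x - c *\<^sub>R g (c *\<^sub>R x)) < e \<and> pint \<beta> (\<lambda>x. v' x - u (c *\<^sub>R x)) < e"
    using H_pair_test[OF test_functions_scale[OF \<psi>(1) c] \<beta>] 1 2 by blast
qed (rule \<beta>)

lemma pint_grad_scale:
  assumes "g \<in> Lq_space 2" "c > 0"
  shows "pint 2 (\<lambda>x. c *\<^sub>R g (c *\<^sub>R x)) = pint 2 g"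
  using Lq_space_cmult(2)[OF Lq_space_scale(1)[OF assms], of c] Lq_space_scale(2)[OF assms] assms(2)
  by (simp add: powr_numeral)

lemma AE_scale:
  assumes P: "AE x in lborel. P (x :: plane)" and c: "c \<noteq> 0"
  shows "AE x in lborel. P (c *\<^sub>R x)"
proof -
  let ?D = "distr lborel borel (\<lambda>x::plane. c *\<^sub>R x)"
  have L: "lborel = density ?D (\<lambda>_. ennreal (c\<^sup>2))"
    using lborel_affine[OF c, of "0::plane"] by (simp add: ennreal_power)
  have "AE x in density ?D (\<lambda>_. ennreal (c\<^sup>2)). P x" using P by (subst (asm) L)
  then have "AE x in ?D. P x" using c by (subst (asm) AE_density) auto
  then show ?thesis by (rule AE_distrD[rotated]) auto
qed

lemma radial_add: "radial u \<Longrightarrow> radial v \<Longrightarrow> radial (\<lambda>x. u x + v x)"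
proof -
  assume "radial u" "radial v"
  then obtain f f' where "AE x in lborel. u x = f (norm x)" "AE x in lborel. v x = f' (norm x)"
    by (auto simp: radial_def)
  then have "AE x in lborel. u x + v x = f (norm x) + f' (norm x)" by eventually_elim auto
  then show ?thesis by (auto simp: radial_def intro!: exI[of _ "\<lambda>r. f r + f' r"])
qed

lemma radial_cmult: "radial u \<Longrightarrow> radial (\<lambda>x. c * u x)"
proof -
  assume "radial u"
  then obtain f where "AE x in lborel. u x = f (norm x)" by (auto simp: radial_def)
  then have "AE x in lborel. c * u x = c * f (norm x)" by eventually_elim auto
  then show ?thesis by (auto simp: radial_def intro!: exI[of _ "\<lambda>r. c * f r"])
qed

lemma radial_scale: "radial u \<Longrightarrow> c > 0 \<Longrightarrow> radial (\<lambda>x. u (c *\<^sub>R x))"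
proof -
  assume "radial u" and c: "c > 0"
  then obtain f where "AE x in lborel. u x = f (norm x)" by (auto simp: radial_def)
  from AE_scale[OF this, of c] c have "AE x in lborel. u (c *\<^sub>R x) = f (c * norm x)" by simp
  then show ?thesis by (auto simp: radial_def intro!: exI[of _ "\<lambda>r. f (c * r)"])
qed

definition R_pair :: "real \<Rightarrow> (plane \<Rightarrow> real) \<Rightarrow> (plane \<Rightarrow> plane) \<Rightarrow> bool" where
  "R_pair \<beta> u g \<longleftrightarrow> H_pair \<beta> u g \<and> radial u"

lemma Hr_space_R_pair:
  assumes \<beta>: "\<beta> > 1"
  shows "u \<in> Hr_space \<beta> \<Longrightarrow> R_pair \<beta> u (weak_grad u)" "R_pair \<beta> u g \<Longrightarrow> u \<in> Hr_space \<beta>"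
  using H_space_iff[OF \<beta>] by (auto simp: Hr_space_def R_pair_def)

lemma R_pair_add: "R_pair \<beta> u g \<Longrightarrow> R_pair \<beta> v h \<Longrightarrow> \<beta> > 1 \<Longrightarrow> R_pair \<beta> (\<lambda>x. u x + v x) (\<lambda>x. g x + h x)"
  by (auto simp: R_pair_def H_pair_add radial_add)

lemma R_pair_cmult: "R_pair \<beta> u g \<Longrightarrow> \<beta> > 1 \<Longrightarrow> R_pair \<beta> (\<lambda>x. c * u x) (\<lambda>x. c *\<^sub>R g x)"
  by (auto simp: R_pair_def H_pair_cmult radial_cmult)

lemma R_pair_scale: "R_pair \<beta> u g \<Longrightarrow> \<beta> > 1 \<Longrightarrow> c > 0 \<Longrightarrow> R_pair \<beta> (\<lambda>x. u (c *\<^sub>R x)) (\<lambda>x. c *\<^sub>R g (c *\<^sub>R x))"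
  by (auto simp: R_pair_def H_pair_scale radial_scale)

lemma R_pairD:
  assumes "R_pair \<beta> u g"
  shows "u \<in> Lq_space \<beta>" "g \<in> Lq_space 2" "radial u" "u \<in> borel_measurable borel"
  using assms by (auto simp: R_pair_def H_pair_def Lq_space_def)

lemma H_norm_bounds:
  assumes "\<beta> > 1" "H_norm \<beta> h \<le> s"
  shows "pint 2 (weak_grad h) \<le> s\<^sup>2" "pint \<beta> h \<le> s powr \<beta>"
proof -
  have n: "pint 2 (weak_grad h) powr (1/2) + pint \<beta> h powr (1/\<beta>) \<le> s"
    using assms by (simp add: H_norm_def Lq_norm_pint)
  have 1: "pint 2 (weak_grad h) powr (1/2) \<le> s" "pint \<beta> h powr (1/\<beta>) \<le> s"
    using n by (smt (verit) powr_ge_zero)+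
  have s: "s \<ge> 0" using 1(1) powr_ge_zero[of "pint 2 (weak_grad h)" "1/2"] by linarith
  have "(pint 2 (weak_grad h) powr (1/2)) powr 2 \<le> s powr 2" by (rule powr_mono2) (use 1 in auto)
  then show "pint 2 (weak_grad h) \<le> s\<^sup>2" using s pint_nonneg[of 2 "weak_grad h"]
    by (cases "s = 0") (auto simp: powr_powr powr_numeral)
  have "(pint \<beta> h powr (1/\<beta>)) powr \<beta> \<le> s powr \<beta>" by (rule powr_mono2) (use 1 assms in auto)
  then show "pint \<beta> h \<le> s powr \<beta>" using assms pint_nonneg[of \<beta> h] by (auto simp: powr_powr)
qed

lemma fatou_bound:
  fixes f :: "nat \<Rightarrow> 'a \<Rightarrow> real"
    and M :: "'a measure" and g :: "'a \<Rightarrow> real"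
  assumes i: "\<And>n. integrable M (f n)" and 0: "\<And>n x. 0 \<le> f n x" and g [measurable]: "g \<in> borel_measurable M"
    and lim: "AE x in M. (\<lambda>n. f n x) \<longlonglongrightarrow> g x"
    and c: "\<And>n. n \<ge> N \<Longrightarrow> (LINT x|M. f n x) \<le> c"
  shows "integrable M g" "(LINT x|M. g x) \<le> c"
proof -
  note [measurable] = borel_measurable_integrable[OF i]
  have c0: "c \<ge> 0" using c[of N] Bochner_Integration.integral_nonneg[of M "f N"] 0 by (meson dual_order.trans order_refl)
  have g0: "AE x in M. 0 \<le> g x" using lim by eventually_elim (rule LIMSEQ_le_const, auto simp: 0)
  have "(\<integral>\<^sup>+x. ennreal (g x) \<partial>M) = (\<integral>\<^sup>+x. liminf (\<lambda>n. ennreal (f n x)) \<partial>M)"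
  proof (rule nn_integral_cong_AE)
    show "AE x in M. ennreal (g x) = liminf (\<lambda>n. ennreal (f n x))"
      using lim by eventually_elim (auto intro!: lim_imp_Liminf[symmetric] tendsto_ennrealI)
  qed
  also have "\<dots> \<le> liminf (\<lambda>n. \<integral>\<^sup>+x. ennreal (f n x) \<partial>M)" by (rule nn_integral_liminf) auto
  also have "\<dots> \<le> ennreal c"
  proof (rule Liminf_le)
    have "(\<integral>\<^sup>+x. ennreal (f n x) \<partial>M) \<le> ennreal c" if "n \<ge> N" for n
      using nn_integral_eq_integral[OF i[of n]] c[OF that] 0 by (simp add: ennreal_leI)
    then show "\<forall>\<^sub>F n in sequentially. (\<integral>\<^sup>+x. ennreal (f n x) \<partial>M) \<le> ennreal c"
      by (auto simp: eventually_sequentially)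
  qed simp
  finally have le: "(\<integral>\<^sup>+x. ennreal (g x) \<partial>M) \<le> ennreal c" .
  then show ig: "integrable M g"
    using g0 by (intro integrableI_nonneg) (auto simp: less_top[symmetric] top_unique)
  show "(LINT x|M. g x) \<le> c"
    using nn_integral_eq_integral[OF ig g0] le c0 by simp
qed

text \<open>Riesz--Fischer: a subsequence with geometrically small increments converges almost everywhere,
  and Fatou's lemma turns this into convergence in \<open>L\<^sup>2\<close>.\<close>

lemma L2_complete:
  fixes g :: "nat \<Rightarrow> plane \<Rightarrow> 'b::euclidean_space"
  assumes L: "\<And>n. g n \<in> Lq_space 2"
    and C: "\<And>e. e > 0 \<Longrightarrow> \<exists>N. \<forall>m\<ge>N. \<forall>n\<ge>N. pint 2 (\<lambda>x. g m x - g n x) < e"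
  shows "\<exists>G\<in>Lq_space 2. (\<lambda>n. pint 2 (\<lambda>x. g n x - G x)) \<longlonglongrightarrow> 0"
proof -
  note [measurable] = Lq_spaceD(1)[OF L]
  have "\<exists>N. \<forall>k. (\<forall>m\<ge>N k. \<forall>n\<ge>N k. pint 2 (\<lambda>x. g m x - g n x) < (1/8)^k)"
    using C[of "(1/8)^_"] by (intro choice) auto
  then obtain N where N: "\<And>k m n. m \<ge> N k \<Longrightarrow> n \<ge> N k \<Longrightarrow> pint 2 (\<lambda>x. g m x - g n x) < (1/8)^k" by metis
  define r where "r k = (\<Sum>i\<le>k. N i) + k" for k
  have r: "strict_mono r" "\<And>k. r k \<ge> N k"
    by (auto simp: r_def strict_mono_Suc_iff intro: trans_le_add1 member_le_sum)
  \<comment> \<open>The increments are below \<open>8\<^sup>-\<^sup>k\<close>, so the weighted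
    increments are still summable, while the factor \<open>4\<^sup>k\<close> forces the
    pointwise increments to be of order \<open>2\<^sup>-\<^sup>k\<close>.\<close>
  define D where "D k x = 4^k * norm (g (r (Suc k)) x - g (r k) x) powr 2" for k x
  have D0: "0 \<le> D k x" for k x by (simp add: D_def)
  have dL: "(\<lambda>x. g m x - g n x) \<in> Lq_space 2" for m n by (rule Lq_space_diff(1)[OF L L]) auto
  have iD: "integrable lborel (D k)" for k unfolding D_def using Lq_spaceD(2)[OF dL] by auto
  have bD: "(LINT x|lborel. D k x) \<le> (1/2)^k" for k
  proof -
    have "r (Suc k) \<ge> N k" using r(2)[of k] strict_mono_less_eq[OF r(1), of k "Suc k"] by simp
    then have "4^k * pint 2 (\<lambda>x. g (r (Suc k)) x - g (r k) x) \<le> 4^k * (1/8)^k"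
      using N[of k "r (Suc k)" "r k"] r(2)[of k] by (intro mult_left_mono) auto
    then show ?thesis by (simp add: D_def pint_def power_mult_distrib[symmetric])
  qed
  have "(\<integral>\<^sup>+x. (\<Sum>k. ennreal (D k x)) \<partial>lborel) = (\<Sum>k. \<integral>\<^sup>+x. ennreal (D k x) \<partial>lborel)"
    using iD by (intro nn_integral_suminf) auto
  also have "\<dots> = (\<Sum>k. ennreal (LINT x|lborel. D k x))"
    using nn_integral_eq_integral[OF iD] D0 by auto
  also have "\<dots> \<le> (\<Sum>k. ennreal ((1/2)^k))" by (intro suminf_le ennreal_leI bD) auto
  also have "\<dots> < top" by (subst suminf_ennreal2) (auto simp: summable_geometric)
  finally have fin: "(\<integral>\<^sup>+x. (\<Sum>k. ennreal (D k x)) \<partial>lborel) \<noteq> \<infinity>" by simp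
  have "AE x in lborel. (\<Sum>k. ennreal (D k x)) \<noteq> \<infinity>"
    by (rule nn_integral_PInf_AE[OF _ fin]) (use iD in measurable)
  then have conv: "AE x in lborel. convergent (\<lambda>k. g (r k) x)"
  proof eventually_elim
    case (elim x)
    have "summable (\<lambda>k. D k x)" by (rule summable_suminf_not_top) (use elim D0 in auto)
    then have "(\<lambda>k. D k x) \<longlonglongrightarrow> 0" by (rule summable_LIMSEQ_zero)
    then have "eventually (\<lambda>k. D k x < 1) sequentially" by (rule order_tendstoD) auto
    then have ev: "eventually (\<lambda>k. norm (g (r (Suc k)) x - g (r k) x) \<le> (1/2)^k) sequentially"
    proof eventually_elim
      case (elim k)
      then have "(2^k * norm (g (r (Suc k)) x - g (r k) x))\<^sup>2 < 1\<^sup>2"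
        by (simp add: D_def powr_2_norm power_mult_distrib power_mult[symmetric] mult.commute[of k] power_mult)
      then have "2^k * norm (g (r (Suc k)) x - g (r k) x) < 1" by (rule power2_less_imp_less) auto
      then show ?case by (simp add: field_simps power_one_over)
    qed
    have "summable (\<lambda>k. g (r (Suc k)) x - g (r k) x)"
      by (rule summable_comparison_test_ev[OF ev]) (simp add: summable_geometric)
    then have "convergent (\<lambda>n. \<Sum>k<n. g (r (Suc k)) x - g (r k) x)" by (simp add: summable_iff_convergent)
    then have "convergent (\<lambda>n. g (r n) x - g (r 0) x)"
      using sum_lessThan_telescope[of "\<lambda>k. g (r k) x"] by simp
    from convergent_add[OF this convergent_const[of "g (r 0) x"]] show ?case by simp
  qed
  define G where "G x = lim (\<lambda>k. g (r k) x)" for x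
  have G [measurable]: "G \<in> borel_measurable borel" unfolding G_def by measurable
  have lim: "AE x in lborel. (\<lambda>k. g (r k) x) \<longlonglongrightarrow> G x"
    using conv by eventually_elim (simp add: G_def convergent_LIMSEQ_iff)
  have F: "integrable lborel (\<lambda>x. norm (g n x - G x) powr 2)" "pint 2 (\<lambda>x. g n x - G x) \<le> (1/8)^k" if n: "n \<ge> N k" for n k
  proof -
    have *: "AE x in lborel. (\<lambda>j. norm (g n x - g (r j) x) powr 2) \<longlonglongrightarrow> norm (g n x - G x) powr 2"
      using lim unfolding powr_2_norm by eventually_elim (intro tendsto_intros)
    have b: "(LINT x|lborel. norm (g n x - g (r j) x) powr 2) \<le> (1/8)^k" if "j \<ge> k" for j
    proof -
      have "r j \<ge> N k" using r(2)[of k] strict_mono_less_eq[OF r(1), of k j] that by simp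
      then show ?thesis using N[OF n] by (auto simp: pint_def intro: less_imp_le)
    qed
    show "integrable lborel (\<lambda>x. norm (g n x - G x) powr 2)"
      by (rule fatou_bound(1)[OF _ _ _ * b]) (use Lq_spaceD(2)[OF dL] in auto)
    show "pint 2 (\<lambda>x. g n x - G x) \<le> (1/8)^k" unfolding pint_def
      by (rule fatou_bound(2)[OF _ _ _ * b]) (use Lq_spaceD(2)[OF dL] in auto)
  qed
  have "(\<lambda>x. g (N 0) x - G x) \<in> Lq_space 2" using F(1)[of 0 "N 0"] by (simp add: Lq_space_def)
  from Lq_space_diff(1)[OF L[of "N 0"] this] have GL: "G \<in> Lq_space 2" by simp
  have "(\<lambda>n. pint 2 (\<lambda>x. g n x - G x)) \<longlonglongrightarrow> 0"
  proof (rule LIMSEQ_I)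
    fix e :: real assume "e > 0"
    then obtain k where k: "(1/8)^k < e" using real_arch_pow_inv[of e "1/8"] by auto
    have "norm (pint 2 (\<lambda>x. g n x - G x) - 0) < e" if "n \<ge> N k" for n
      using F(2)[OF that] k pint_nonneg[of 2 "\<lambda>x. g n x - G x"] by simp
    then show "\<exists>n0. \<forall>n\<ge>n0. norm (pint 2 (\<lambda>x. g n x - G x) - 0) < e" by blast
  qed
  then show ?thesis using GL by blast
qed

section \<open>Radial integration\<close>

text \<open>The disc of squared radius \<open>a\<close> has area \<open>\<pi> a\<close>. In the
  variable \<open>q = |x|\<^sup>2\<close> the measure of the plane is thus a constant multiple
  of \<open>dq\<close>; for this reason radial functions are described below by profiles in
  \<open>q\<close> instead of \<open>|x|\<close>.\<close>

lemma distr_norm_square: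
  "distr lborel borel (\<lambda>x::plane. (norm x)\<^sup>2) = density lborel (\<lambda>q. ennreal (pi * indicator {0<..} q))"
proof (rule measure_eqI_generator_eq[where E="range (\<lambda>a. {..a::real})" and \<Omega>=UNIV and A="\<lambda>n. {..real n}"])
  show "Int_stable (range (\<lambda>a. {..a::real}))"
    by (auto simp: Int_stable_def min_def intro: range_eqI)
  show "sets (distr lborel borel (\<lambda>x::plane. (norm x)\<^sup>2)) = sigma_sets UNIV (range (\<lambda>a. {..a::real}))"
    "sets (density lborel (\<lambda>q. ennreal (pi * indicator {0<..} q))) = sigma_sets UNIV (range (\<lambda>a. {..a::real}))"
    by (simp_all add: borel_eq_atMost)
  have e1: "emeasure (distr lborel borel (\<lambda>x::plane. (norm x)\<^sup>2)) {..a} = ennreal (pi * max a 0)" for a :: real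
  proof (cases "a \<ge> 0")
    case True
    have "(\<lambda>x::plane. (norm x)\<^sup>2) -` {..a} = cball 0 (sqrt a)"
      using True by (auto simp: real_le_rsqrt real_le_lsqrt sqrt_ge_absD abs_le_square_iff
          intro: real_le_rsqrt dest: sqrt_ge_absD)
    then show ?thesis using True
      by (simp add: emeasure_distr emeasure_cball unit_ball_vol_2)
  next
    case False
    then have "(\<lambda>x::plane. (norm x)\<^sup>2) -` {..a} = {}"
      by (auto simp: not_le) (smt (verit) zero_le_power2)
    then show ?thesis using False by (simp add: emeasure_distr)
  qed
  have e2: "emeasure (density lborel (\<lambda>q. ennreal (pi * indicator {0<..} q))) {..a} = ennreal (pi * max a 0)" for a :: real
  proof -
    have "emeasure (density lborel (\<lambda>q. ennreal (pi * indicator {0<..} q))) {..a}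
        = (\<integral>\<^sup>+q. ennreal pi * indicator {0<..max a 0} q \<partial>lborel)"
      by (subst emeasure_density) (auto intro!: nn_integral_cong simp: indicator_def)
    also have "\<dots> = ennreal pi * emeasure lborel {0<..max a 0}"
      by (rule nn_integral_cmult_indicator) auto
    also have "\<dots> = ennreal (pi * max a 0)" by (simp add: ennreal_mult)
    finally show ?thesis .
  qed
  show "emeasure (distr lborel borel (\<lambda>x::plane. (norm x)\<^sup>2)) X = emeasure (density lborel (\<lambda>q. ennreal (pi * indicator {0<..} q))) X"
    if "X \<in> range (\<lambda>a. {..a::real})" for X
    using that e1 e2 by auto
  show "emeasure (distr lborel borel (\<lambda>x::plane. (norm x)\<^sup>2)) {..real n} \<noteq> \<infinity>" for n
    using e1[of "real n"] by simp
  show "(\<Union>n. {..real n}) = UNIV" 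
  proof -
    have "x \<in> (\<Union>n. {..real n})" for x using real_arch_simple[of x] by auto
    then show ?thesis by blast
  qed
qed auto

lemma radial_integral:
  fixes h :: "real \<Rightarrow> real"
  assumes [measurable]: "h \<in> borel_measurable borel"
  shows "integrable lborel (\<lambda>x::plane. h ((norm x)\<^sup>2)) \<longleftrightarrow> integrable lborel (\<lambda>q. indicator {0<..} q * h q)"
    and "(LINT x|lborel. h ((norm (x::plane))\<^sup>2)) = pi * (LINT q|lborel. indicator {0<..} q * h q)"
proof -
  have "integrable lborel (\<lambda>x::plane. h ((norm x)\<^sup>2)) \<longleftrightarrow> integrable (distr lborel borel (\<lambda>x::plane. (norm x)\<^sup>2)) h"
    by (subst integrable_distr_eq) auto
  also have "\<dots> \<longleftrightarrow> integrable lborel (\<lambda>q. (pi * indicator {0<..} q) *\<^sub>R h q)"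
    unfolding distr_norm_square by (subst integrable_density) auto
  finally show "integrable lborel (\<lambda>x::plane. h ((norm x)\<^sup>2)) \<longleftrightarrow> integrable lborel (\<lambda>q. indicator {0<..} q * h q)"
    by (simp add: mult.assoc)
  have "(LINT x|lborel. h ((norm (x::plane))\<^sup>2)) = integral\<^sup>L (distr lborel borel (\<lambda>x::plane. (norm x)\<^sup>2)) h"
    by (subst integral_distr) auto
  also have "\<dots> = (LINT q|lborel. (pi * indicator {0<..} q) *\<^sub>R h q)"
    unfolding distr_norm_square by (subst integral_density) auto
  finally show "(LINT x|lborel. h ((norm (x::plane))\<^sup>2)) = pi * (LINT q|lborel. indicator {0<..} q * h q)"
    by (simp add: mult.assoc)
qed

lemma annulus_inverse_square:
  assumes ab: "0 < a" "a \<le> b"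
  shows "integrable lborel (\<lambda>x::plane. indicator {a<..b} ((norm x)\<^sup>2) / (norm x)\<^sup>2)"
    and "(LINT x|lborel. indicator {a<..b} ((norm (x::plane))\<^sup>2) / (norm x)\<^sup>2) = pi * ln (b / a)"
proof -
  have hb: "has_bochner_integral lborel (\<lambda>q. (1 / q) * indicator {a..b} q) (ln b - ln a)"
    by (rule has_bochner_integral_FTC_Icc_real)
      (use ab in \<open>auto intro!: derivative_eq_intros continuous_intros\<close>)
  have ae: "AE q in lborel. (1 / q) * indicator {a..b} q = indicator {0<..} q * (indicator {a<..b} q / q)"
    using AE_lborel_singleton[of a] by eventually_elim (use ab in \<open>auto simp: indicator_def\<close>)
  have hb': "has_bochner_integral lborel (\<lambda>q. indicator {0<..} q * (indicator {a<..b} q / q)) (ln b - ln a)"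
    using hb by (subst has_bochner_integral_cong_AE[symmetric, OF _ _ ae]) auto
  show "integrable lborel (\<lambda>x::plane. indicator {a<..b} ((norm x)\<^sup>2) / (norm x)\<^sup>2)"
    using radial_integral(1)[of "\<lambda>q. indicator {a<..b} q / q"] has_bochner_integral_integrable[of lborel] hb'
    by (auto simp: has_bochner_integral_iff)
  show "(LINT x|lborel. indicator {a<..b} ((norm (x::plane))\<^sup>2) / (norm x)\<^sup>2) = pi * ln (b / a)"
    using radial_integral(2)[of "\<lambda>q. indicator {a<..b} q / q"] hb' ab
    by (auto simp: has_bochner_integral_iff ln_div)
qed

lemma Cauchy_Schwarz_integral:
  fixes f g :: "'a \<Rightarrow> real"
  assumes f: "integrable M (\<lambda>x. (f x)\<^sup>2)" and g: "integrable M (\<lambda>x. (g x)\<^sup>2)"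
    and fg: "integrable M (\<lambda>x. f x * g x)"
  shows "(LINT x|M. f x * g x)\<^sup>2 \<le> (LINT x|M. (f x)\<^sup>2) * (LINT x|M. (g x)\<^sup>2)"
proof -
  define a where "a = (LINT x|M. (f x)\<^sup>2)"
  define b where "b = (LINT x|M. f x * g x)"
  define c where "c = (LINT x|M. (g x)\<^sup>2)"
  have q: "0 \<le> a + 2 * t * b + t\<^sup>2 * c" for t
  proof -
    have "0 \<le> (LINT x|M. (f x + t * g x)\<^sup>2)" by (rule integral_nonneg_AE) auto
    also have "\<dots> = (LINT x|M. (f x)\<^sup>2 + (2 * t) * (f x * g x) + t\<^sup>2 * (g x)\<^sup>2)"
      by (simp add: power2_eq_square algebra_simps)
    also have "\<dots> = a + (2 * t) * b + t\<^sup>2 * c" using f g fg by (simp add: a_def b_def c_def)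
    finally show ?thesis .
  qed
  have c0: "c \<ge> 0" unfolding c_def by (rule integral_nonneg_AE) auto
  show ?thesis
  proof (cases "c = 0")
    case True
    have "b = 0"
    proof (rule ccontr)
      assume "b \<noteq> 0"
      then show False using q[of "- (a + 1) / (2 * b)"] True by (simp add: field_simps)
    qed
    then show ?thesis using True unfolding a_def b_def c_def by simp
  next
    case False
    have "0 \<le> a - b\<^sup>2 / c" using q[of "- b / c"] False by (simp add: power2_eq_square)
    then have "b\<^sup>2 \<le> a * c" using False c0 by (simp add: pos_divide_le_eq)
    then show ?thesis unfolding a_def b_def c_def .
  qed
qed

section \<open>The profile of a radial function\<close>

text \<open>The profile
  \<open>\<phi>\<close> need not be measurable; this is circumvented by choosing a compact set \<open>T\<close> on which
  the function is positive. It is still positive on the radial compact set generated by \<open>T\<close>, on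
  which its integral vanishes; so \<open>T\<close> is a null set.\<close>

lemma radial_le_zero:
  fixes h :: "plane \<Rightarrow> real"
  assumes h: "integrable lborel h" and rad: "AE x in lborel. h x = \<phi> (norm x)" and R: "\<And>x. norm x > R \<Longrightarrow> h x = 0"
    and 0: "\<And>X. X \<in> sets borel \<Longrightarrow> (LINT x|lborel. indicator X ((norm x)\<^sup>2) * h x) = 0"
  shows "AE x in lborel. h x \<le> 0"
proof -
  have [measurable]: "h \<in> borel_measurable borel" using h by auto
  obtain N where N: "N \<in> null_sets lborel" "\<And>x. x \<notin> N \<Longrightarrow> h x = \<phi> (norm x)"
    using rad by (auto simp: eventually_ae_filter)
  have [measurable]: "N \<in> sets borel" using N by auto
  define Z where "Z = {x. h x > 0} - N"
  have [measurable]: "Z \<in> sets borel" unfolding Z_def by measurable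
  have ZR: "Z \<subseteq> cball 0 R" using R by (force simp: Z_def not_less[symmetric])
  have "emeasure lborel Z = 0"
  proof (rule ccontr)
    assume ne: "emeasure lborel Z \<noteq> 0"
    have Zf: "emeasure lborel Z < \<infinity>" using ZR emeasure_bounded_finite[of Z] bounded_cball bounded_subset by blast
    define e where "e = measure lborel Z"
    have e: "e > 0" "emeasure lborel Z = ennreal e"
      using ne Zf by (auto simp: e_def measure_def enn2real_positive_iff less_top zero_less_iff_neq_zero)
    have "Z \<in> sets lebesgue" by (simp add: sets_completionI_sets)
    then obtain T where T: "closed T" "T \<subseteq> Z" "Z - T \<in> lmeasurable" "emeasure lebesgue (Z - T) < ennreal e"
      using sets_lebesgue_inner_closed[OF _ e(1)] by metis
    have cT: "compact T" using T(1) bounded_subset[OF bounded_cball order_trans[OF T(2) ZR]] by (auto simp: compact_eq_bounded_closed)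
    have [measurable]: "T \<in> sets borel" using T(1) by simp
    have Tpos: "emeasure lborel T \<noteq> 0"
    proof
      assume T0: "emeasure lborel T = 0"
      have "emeasure lborel Z \<le> emeasure lborel (Z - T) + emeasure lborel T"
        using emeasure_subadditive[of "Z - T" lborel T] T(2) by (simp add: Un_absorb2)
      also have "\<dots> < ennreal e" using T0 T(4) by (simp add: emeasure_completion)
      finally show False using e by simp
    qed
    define L where "L = (\<lambda>x. (norm x)\<^sup>2) ` T"
    have "compact L" unfolding L_def by (intro compact_continuous_image cT continuous_intros)
    then have L [measurable]: "L \<in> sets borel" by (simp add: borel_compact)
    have i: "integrable lborel (\<lambda>x. indicator L ((norm x)\<^sup>2) * h x)"
      by (rule Bochner_Integration.integrable_bound[OF h]) (auto simp: indicator_def)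
    have pos: "indicator L ((norm x)\<^sup>2) * h x \<ge> 0" if "x \<notin> N" for x
    proof (cases "(norm x)\<^sup>2 \<in> L")
      case True
      then obtain y where y: "y \<in> T" "(norm y)\<^sup>2 = (norm x)\<^sup>2" by (auto simp: L_def)
      then have "norm y = norm x" by simp
      moreover have "h y > 0" "y \<notin> N" using y T(2) by (auto simp: Z_def)
      ultimately show ?thesis using N(2)[of y] N(2)[OF that] by simp
    qed simp
    have "AE x in lborel. indicator L ((norm x)\<^sup>2) * h x \<ge> 0"
      using AE_not_in[OF N(1)] by eventually_elim (rule pos)
    then have "AE x in lborel. indicator L ((norm x)\<^sup>2) * h x = 0"
      using integral_nonneg_eq_0_iff_AE[OF i] 0[OF L] by simp
    then have "AE x in lborel. x \<notin> T"
    proof eventually_elim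
      case (elim x)
      show ?case
      proof
        assume x: "x \<in> T"
        then have "(norm x)\<^sup>2 \<in> L" "h x > 0" using T(2) by (auto simp: L_def Z_def)
        then show False using elim by simp
      qed
    qed
    then have "T \<in> null_sets lborel" by (subst (asm) AE_iff_null_sets[symmetric]) auto
    then show False using Tpos by auto
  qed
  then have "Z \<in> null_sets lborel" by auto
  from AE_not_in[OF this] AE_not_in[OF N(1)] show ?thesis
    by eventually_elim (auto simp: Z_def)
qed

lemma radial_eq_zero:
  fixes h :: "plane \<Rightarrow> real"
  assumes h: "integrable lborel h" and rad: "radial h" and R: "\<And>x. norm x > R \<Longrightarrow> h x = 0"
    and 0: "\<And>X. X \<in> sets borel \<Longrightarrow> (LINT x|lborel. indicator X ((norm x)\<^sup>2) * h x) = 0"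
  shows "AE x in lborel. h x = 0"
proof -
  obtain \<phi> where \<phi>: "AE x in lborel. h x = \<phi> (norm x)" using rad by (auto simp: radial_def)
  have "AE x in lborel. h x \<le> 0" by (rule radial_le_zero[OF h \<phi> R 0])
  moreover have "AE x in lborel. - h x \<le> 0"
  proof (rule radial_le_zero[where \<phi>="\<lambda>r. - \<phi> r" and R=R])
    show "AE x in lborel. - h x = - \<phi> (norm x)" using \<phi> by eventually_elim simp
  qed (use h R 0 in auto)
  ultimately show ?thesis by eventually_elim auto
qed

definition radial_deriv :: "(plane \<Rightarrow> plane) \<Rightarrow> plane \<Rightarrow> real" where
  "radial_deriv g x = (g x \<bullet> x) / (norm x)\<^sup>2"

text \<open>Smooth functions of \<open>q > 0\<close> with compact support and vanishing integral are derivatives of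
  such functions \<open>Z\<close>. Testing with the radial vector field \<open>Z(|x|\<^sup>2) x / |x|\<^sup>2\<close>, whose
  divergence is \<open>2 Z'(|x|\<^sup>2)\<close>, gives the radial form of the definition of the weak gradient.\<close>

lemma weak_gradient_radial_test:
  assumes ug: "has_weak_gradient u g"
    and Z: "\<And>k. smooth1 k Z" "\<And>q. (Z has_real_derivative \<theta> q) (at q)"
    and supp: "0 < a" "\<And>q. q \<le> a \<Longrightarrow> Z q = 0" "\<And>q. q \<ge> b \<Longrightarrow> Z q = 0"
  shows "2 * (LINT x|lborel. u x * \<theta> ((norm x)\<^sup>2)) = - (LINT x|lborel. Z ((norm x)\<^sup>2) * radial_deriv g x)"
proof -
  have u: "locally_integrable u" and g: "locally_integrable g" using ug by (auto simp: has_weak_gradient_def)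
  define Y where "Y q = Z q / q" for q
  define Y' where "Y' q = \<theta> q / q - Z q / q\<^sup>2" for q
  have Ys: "smooth1 k Y" for k using smooth1_div_power[OF Z(1) supp(1,2), of k 1] by (simp add: Y_def[abs_def])
  have Yd: "(Y has_real_derivative Y' q) (at q)" for q
    using has_real_derivative_div_power(1)[OF Z(2) supp(1,2), of 1 q]
    by (simp add: Y_def[abs_def] Y'_def power2_eq_square)
  have \<theta>0: "\<theta> q = 0" if "q < a" for q using has_real_derivative_div_power(2)[OF Z(2) supp(1,2)] that by blast
  define \<psi> where "\<psi> i x = x $ i * Y ((norm x)\<^sup>2)" for i and x :: plane
  have \<psi>: "\<psi> i \<in> test_functions" for i
  proof (rule test_functionsI[where R="sqrt (max b 0)"])
    show "C_k k (\<psi> i)" for k unfolding \<psi>_def[abs_def]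
      by (intro C_k_mult C_k_coord C_k_compose[OF Ys] C_k_norm2)
    show "norm x \<le> sqrt (max b 0)" if "\<psi> i x \<noteq> 0" for x
    proof -
      have "Z ((norm x)\<^sup>2) \<noteq> 0" using that by (auto simp: \<psi>_def Y_def)
      then have "(norm x)\<^sup>2 < b" using supp(3) by (meson not_le)
      then show ?thesis by (intro real_le_rsqrt) auto
    qed
  qed
  have gr: "grad (\<psi> i) x = Y ((norm x)\<^sup>2) *\<^sub>R axis i 1 + (x $ i * Y' ((norm x)\<^sup>2) * 2) *\<^sub>R x" for i x
  proof (rule grad_eqI)
    have "((\<lambda>x. (norm x)\<^sup>2) has_derivative (\<lambda>h. h \<bullet> (2 *\<^sub>R x))) (at x)"
      unfolding power2_norm_eq_inner by (auto intro!: derivative_eq_intros simp: inner_commute)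
    from has_derivative_compose[OF this Yd[of "(norm x)\<^sup>2", unfolded has_field_derivative_def]]
    have 1: "((\<lambda>x. Y ((norm x)\<^sup>2)) has_derivative (\<lambda>h. Y' ((norm x)\<^sup>2) * (h \<bullet> (2 *\<^sub>R x)))) (at x)" .
    have "((\<lambda>x. x $ i) has_derivative (\<lambda>h. h $ i)) (at x)"
      by (simp add: bounded_linear_imp_has_derivative bounded_linear_vec_nth)
    from has_derivative_mult[OF this 1]
    show "(\<psi> i has_derivative (\<lambda>h. h \<bullet> (Y ((norm x)\<^sup>2) *\<^sub>R axis i 1 + (x $ i * Y' ((norm x)\<^sup>2) * 2) *\<^sub>R x))) (at x)"
      unfolding \<psi>_def[abs_def] by (simp add: inner_add_right inner_axis algebra_simps)
  qed
  have div: "(\<Sum>i\<in>UNIV. grad (\<psi> i) x $ i) = 2 * \<theta> ((norm x)\<^sup>2)" for x :: plane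
  proof -
    have "(\<Sum>i\<in>UNIV. grad (\<psi> i) x $ i) = (\<Sum>i\<in>(UNIV::2 set). Y ((norm x)\<^sup>2) + 2 * Y' ((norm x)\<^sup>2) * (x $ i * x $ i))"
      unfolding gr by (intro sum.cong) (auto simp: axis_def algebra_simps)
    also have "\<dots> = 2 * Y ((norm x)\<^sup>2) + 2 * Y' ((norm x)\<^sup>2) * (\<Sum>i\<in>UNIV. x $ i * x $ i)"
      by (simp add: sum.distrib sum_distrib_left)
    also have "(\<Sum>i\<in>UNIV. x $ i * x $ i) = (norm x)\<^sup>2" by (simp add: power2_norm_eq_inner inner_vec_def)
    also have "2 * Y ((norm x)\<^sup>2) + 2 * Y' ((norm x)\<^sup>2) * (norm x)\<^sup>2 = 2 * \<theta> ((norm x)\<^sup>2)"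
    proof (cases "x = 0")
      case True
      then show ?thesis using supp \<theta>0[of 0] by (simp add: Y_def)
    next
      case False
      then show ?thesis by (simp add: Y_def Y'_def field_simps power2_eq_square)
    qed
    finally show ?thesis .
  qed
  have "(LINT x|lborel. u x * (2 * \<theta> ((norm x)\<^sup>2))) = (LINT x|lborel. (\<Sum>i\<in>UNIV. (u x *\<^sub>R grad (\<psi> i) x) \<bullet> axis i 1))"
    by (simp add: div[symmetric] sum_distrib_left inner_axis)
  also have "\<dots> = (\<Sum>i\<in>UNIV. (LINT x|lborel. u x *\<^sub>R grad (\<psi> i) x) \<bullet> axis i 1)"
    using test_grad_integrable[OF \<psi> u]
    by (subst Bochner_Integration.integral_sum) (auto intro!: integrable_inner_left sum.cong integral_inner_left simp del: inner_scaleR_left)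
  also have "\<dots> = (\<Sum>i\<in>UNIV. - (LINT x|lborel. \<psi> i x *\<^sub>R g x) \<bullet> axis i 1)"
    using ug \<psi> by (intro sum.cong) (auto simp: has_weak_gradient_def)
  also have "\<dots> = - (\<Sum>i\<in>UNIV. (LINT x|lborel. (\<psi> i x *\<^sub>R g x) \<bullet> axis i 1))"
    using test_function_integrable[OF \<psi> g]
    by (subst sum_negf[symmetric]) (auto intro!: sum.cong integral_inner_left[symmetric] simp del: inner_scaleR_left)
  also have "(\<Sum>i\<in>UNIV. (LINT x|lborel. (\<psi> i x *\<^sub>R g x) \<bullet> axis i 1)) = (LINT x|lborel. (\<Sum>i\<in>UNIV. (\<psi> i x *\<^sub>R g x) \<bullet> axis i 1))"
    using test_function_integrable[OF \<psi> g]
    by (subst Bochner_Integration.integral_sum) (auto intro!: integrable_inner_left simp del: inner_scaleR_left)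
  also have "(\<lambda>x. \<Sum>i\<in>UNIV. (\<psi> i x *\<^sub>R g x) \<bullet> axis i 1) = (\<lambda>x. Z ((norm x)\<^sup>2) * radial_deriv g x)"
  proof
    fix x
    have "(\<Sum>i\<in>UNIV. (\<psi> i x *\<^sub>R g x) \<bullet> axis i 1) = (\<Sum>i\<in>UNIV. \<psi> i x * g x $ i)"
      by (intro sum.cong) (auto simp: inner_axis)
    also have "\<dots> = Y ((norm x)\<^sup>2) * (g x \<bullet> x)"
      by (simp add: \<psi>_def inner_vec_def sum_distrib_left mult_ac)
    finally have "(\<Sum>i\<in>UNIV. (\<psi> i x *\<^sub>R g x) \<bullet> axis i 1) = Y ((norm x)\<^sup>2) * (g x \<bullet> x)" .
    then show "(\<Sum>i\<in>UNIV. (\<psi> i x *\<^sub>R g x) \<bullet> axis i 1) = Z ((norm x)\<^sup>2) * radial_deriv g x"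
      by (simp add: Y_def radial_deriv_def)
  qed
  finally show ?thesis by (simp add: mult.left_commute[of _ 2])
qed

text \<open>Cauchy-Schwarz against \<open>1/|x|\<close>, whose square has the integral
  \<open>\<pi> ln(b/a)\<close> over the annulus.\<close>

lemma radial_deriv_annulus:
  assumes g: "g \<in> Lq_space 2" and ab: "0 < a" "a \<le> b"
  shows "integrable lborel (\<lambda>x. indicator {a<..b} ((norm x)\<^sup>2) * radial_deriv g x)"
    and "(LINT x|lborel. indicator {a<..b} ((norm x)\<^sup>2) * radial_deriv g x)\<^sup>2 \<le> pi * ln (b / a) * pint 2 g"
    and "integrable lborel (\<lambda>x. indicator {a<..b} ((norm x)\<^sup>2) * \<bar>radial_deriv g x\<bar>)"
proof -
  note [measurable] = Lq_spaceD(1)[OF g]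
  have [measurable]: "radial_deriv g \<in> borel_measurable borel" unfolding radial_deriv_def[abs_def] by measurable
  let ?f = "\<lambda>x::plane. indicator {a<..b} ((norm x)\<^sup>2) / norm x :: real"
  have f2: "(?f x)\<^sup>2 = indicator {a<..b} ((norm x)\<^sup>2) / (norm x)\<^sup>2" for x
    by (auto simp: indicator_def power_divide)
  have g2: "integrable lborel (\<lambda>x. (norm (g x))\<^sup>2)" using Lq_spaceD(2)[OF g] by (simp add: powr_2_norm)
  have le: "\<bar>indicator {a<..b} ((norm x)\<^sup>2) * radial_deriv g x\<bar> \<le> ?f x * norm (g x)" for x
  proof -
    have "\<bar>radial_deriv g x\<bar> \<le> norm (g x) * norm x / (norm x)\<^sup>2"
      unfolding radial_deriv_def using Cauchy_Schwarz_ineq2[of "g x" x] by (simp add: abs_div divide_right_mono)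
    then show ?thesis using ab by (cases "x = 0") (auto simp: indicator_def power2_eq_square)
  qed
  have fg: "integrable lborel (\<lambda>x. ?f x * norm (g x))"
  proof (rule integrable_dominated)
    show "integrable lborel (\<lambda>x. indicator {a<..b} ((norm x)\<^sup>2) / (norm x)\<^sup>2 + (norm (g x))\<^sup>2)"
      using annulus_inverse_square(1)[OF ab] g2 by simp
    show "norm (?f x * norm (g x)) \<le> indicator {a<..b} ((norm x)\<^sup>2) / (norm x)\<^sup>2 + (norm (g x))\<^sup>2" for x
    proof -
      have "0 \<le> ?f x * norm (g x)" by auto
      then have "norm (?f x * norm (g x)) = ?f x * norm (g x)" by (simp only: real_norm_def abs_of_nonneg)
      then show ?thesis
        using sum_squares_bound[of "?f x" "norm (g x)"] \<open>0 \<le> ?f x * norm (g x)\<close> unfolding f2[of x] by linarith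
    qed
  qed measurable
  show i: "integrable lborel (\<lambda>x. indicator {a<..b} ((norm x)\<^sup>2) * radial_deriv g x)"
    by (rule integrable_dominated[OF fg]) (use le in auto)
  then show "integrable lborel (\<lambda>x. indicator {a<..b} ((norm x)\<^sup>2) * \<bar>radial_deriv g x\<bar>)"
    using integrable_abs[OF i] by (simp add: abs_mult)
  have "\<bar>LINT x|lborel. indicator {a<..b} ((norm x)\<^sup>2) * radial_deriv g x\<bar> \<le> (LINT x|lborel. ?f x * norm (g x))"
    using Bochner_Integration.integral_norm_bound_integral[OF i fg] le by simp
  then have "(LINT x|lborel. indicator {a<..b} ((norm x)\<^sup>2) * radial_deriv g x)\<^sup>2 \<le> (LINT x|lborel. ?f x * norm (g x))\<^sup>2"
    by (simp add: abs_le_square_iff[symmetric])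
  also have "\<dots> \<le> (LINT x|lborel. (?f x)\<^sup>2) * (LINT x|lborel. (norm (g x))\<^sup>2)"
    by (rule Cauchy_Schwarz_integral[OF _ g2 fg]) (unfold f2, rule annulus_inverse_square(1)[OF ab])
  also have "(LINT x|lborel. (?f x)\<^sup>2) = pi * ln (b / a)" unfolding f2 by (rule annulus_inverse_square(2)[OF ab])
  finally show "(LINT x|lborel. indicator {a<..b} ((norm x)\<^sup>2) * radial_deriv g x)\<^sup>2 \<le> pi * ln (b / a) * pint 2 g"
    by (simp add: pint_def powr_2_norm)
qed

lemma integrable_product:
  fixes a :: "'a::euclidean_space \<Rightarrow> real" and b :: "'b::euclidean_space \<Rightarrow> real"
  assumes a: "integrable lborel a" and b: "integrable lborel b"
  shows "integrable (lborel \<Otimes>\<^sub>M lborel) (\<lambda>z. a (fst z) * b (snd z))"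
    and "(LINT z|(lborel \<Otimes>\<^sub>M lborel). a (fst z) * b (snd z)) = (LINT x|lborel. a x) * (LINT y|lborel. b y)"
proof -
  have [measurable]: "a \<in> borel_measurable borel" "b \<in> borel_measurable borel" using a b by auto
  show i: "integrable (lborel \<Otimes>\<^sub>M lborel) (\<lambda>z. a (fst z) * b (snd z))"
  proof (rule lborel_pair.Fubini_integrable)
    have "(\<lambda>x. LINT y|lborel. norm (a (fst (x, y)) * b (snd (x, y)))) = (\<lambda>x. \<bar>a x\<bar> * (LINT y|lborel. \<bar>b y\<bar>))"
      by (simp add: abs_mult)
    then show "integrable lborel (\<lambda>x. LINT y|lborel. norm (a (fst (x, y)) * b (snd (x, y))))" using a by simp
  qed (use b in auto)
  show "(LINT z|(lborel \<Otimes>\<^sub>M lborel). a (fst z) * b (snd z)) = (LINT x|lborel. a x) * (LINT y|lborel. b y)"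
    using lborel_pair.integral_fst'[OF i] by simp
qed

text \<open>Approximations of the indicator of \<open>(a,b)\<close>, balanced by a multiple of
  an approximate indicator of the reference interval \<open>(1,2)\<close> so that a compactly
  supported primitive exists.\<close>

definition mean_zero_bump :: "real \<Rightarrow> real \<Rightarrow> nat \<Rightarrow> real \<Rightarrow> real" where
  "mean_zero_bump a b n q =
     (LINT s|lborel. bump 1 2 n s) * bump a b n q - (LINT s|lborel. bump a b n s) * bump 1 2 n q"

lemma bump_integrable:
  "integrable lborel (bump a b n)" "bump a b n \<in> borel_measurable borel" "continuous_on UNIV (bump a b n)"
proof -
  show c: "continuous_on UNIV (bump a b n)" using smooth1_bump[of 0] by simp
  then show [measurable]: "bump a b n \<in> borel_measurable borel" by (rule borel_measurable_continuous_onI)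
  have "integrable lborel (\<lambda>q. indicator {a<..<b} q :: real)"
    by (cases "a \<le> b") auto
  then show "integrable lborel (bump a b n)"
    by (rule integrable_dominated) (auto simp: bump_bounds bump_eq_0 indicator_def)
qed

lemma bump_integral_bounds:
  assumes "a \<le> b"
  shows "0 \<le> (LINT q|lborel. bump a b n q)" "(LINT q|lborel. bump a b n q) \<le> b - a"
    "(\<lambda>n. LINT q|lborel. bump a b n q) \<longlonglongrightarrow> b - a"
proof -
  have i: "integrable lborel (\<lambda>q. indicator {a<..<b} q :: real)" using assms by auto
  have le: "bump a b n q \<le> indicator {a<..<b} q" for n q by (auto simp: bump_bounds bump_eq_0 indicator_def)
  have I: "(LINT q|lborel. indicator {a<..<b} q :: real) = b - a" using assms by simp
  show "0 \<le> (LINT q|lborel. bump a b n q)" by (rule integral_nonneg_AE) (auto simp: bump_bounds)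
  show "(LINT q|lborel. bump a b n q) \<le> b - a" unfolding I[symmetric]
    by (rule integral_mono[OF bump_integrable(1) i le])
  show "(\<lambda>n. LINT q|lborel. bump a b n q) \<longlonglongrightarrow> b - a" unfolding I[symmetric]
  proof (rule integral_dominated_convergence[OF _ _ i])
    show "AE x in lborel. (\<lambda>n. bump a b n x) \<longlonglongrightarrow> indicator {a<..<b} x"
      by (rule AE_I2) (rule bump_tendsto)
    show "AE x in lborel. norm (bump a b n x) \<le> indicator {a<..<b} x" for n
      by (rule AE_I2) (simp add: bump_bounds le)
  qed (auto simp: bump_integrable(2))
qed

lemma smooth_bounded_primitive:
  assumes \<theta>: "continuous_on UNIV \<theta>" "integrable lborel \<theta>" and supp: "\<And>q. q < a \<Longrightarrow> \<theta> q = 0" "\<And>q. q > b \<Longrightarrow> \<theta> q = 0"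
    and tot: "(LINT q|lborel. \<theta> q) = (0 :: real)"
  defines "Z \<equiv> \<lambda>q. LINT s|lborel. indicator {..q} s * \<theta> s"
  shows "(Z has_real_derivative \<theta> q) (at q)" "q \<le> a \<Longrightarrow> Z q = 0" "q \<ge> b \<Longrightarrow> Z q = 0"
proof -
  have [measurable]: "\<theta> \<in> borel_measurable borel" using \<theta>(1) by (rule borel_measurable_continuous_onI)
  have si: "integrable lborel (\<lambda>s. indicator X s * \<theta> s)" if "X \<in> sets borel" for X
    using integrable_mult_indicator[of X lborel \<theta>] that \<theta>(2) by simp
  show "q \<le> a \<Longrightarrow> Z q = 0" unfolding Z_def
  proof -
    assume q: "q \<le> a"
    have "AE s in lborel. indicator {..q} s * \<theta> s = 0"
      using AE_lborel_singleton[of a] by eventually_elim (use supp(1) q in \<open>auto simp: indicator_def\<close>)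
    then show "(LINT s|lborel. indicator {..q} s * \<theta> s) = 0" by (rule integral_eq_zero_AE)
  qed
  show "q \<ge> b \<Longrightarrow> Z q = 0" unfolding Z_def
  proof -
    assume q: "q \<ge> b"
    have "(LINT s|lborel. indicator {..q} s * \<theta> s) = (LINT s|lborel. \<theta> s)"
      using supp(2) q by (intro Bochner_Integration.integral_cong) (auto simp: indicator_def)
    then show "(LINT s|lborel. indicator {..q} s * \<theta> s) = 0" using tot by simp
  qed
  define m where "m = q - 1"
  have Zeq: "Z s = Z m + integral {m..s} \<theta>" if s: "m \<le> s" for s
  proof -
    have ii: "set_integrable lborel {m..s} \<theta>" using si[of "{m..s}"] by (simp add: set_integrable_def)
    have "(LINT t|lborel. indicator {..s} t * \<theta> t) = (LINT t|lborel. indicator {..m} t * \<theta> t + indicator {m<..s} t * \<theta> t)"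
      using s by (intro Bochner_Integration.integral_cong) (auto simp: indicator_def)
    also have "\<dots> = Z m + (LINT t|lborel. indicator {m<..s} t * \<theta> t)"
      unfolding Z_def using si by (intro Bochner_Integration.integral_add) auto
    also have "(LINT t|lborel. indicator {m<..s} t * \<theta> t) = (LINT t|lborel. indicator {m..s} t * \<theta> t)"
    proof (rule integral_cong_AE)
      show "AE t in lborel. indicator {m<..s} t * \<theta> t = indicator {m..s} t * \<theta> t"
        using AE_lborel_singleton[of m] by eventually_elim (auto simp: indicator_def)
    qed auto
    also have "\<dots> = integral {m..s} \<theta>"
      using set_borel_integral_eq_integral(2)[OF ii] by (simp add: set_lebesgue_integral_def)
    finally show ?thesis by (simp add: Z_def)
  qed
  have "((\<lambda>s. integral {m..s} \<theta>) has_real_derivative \<theta> q) (at q within {m..q+1})"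
    by (rule integral_has_real_derivative) (use \<theta>(1) in \<open>auto simp: m_def intro: continuous_on_subset\<close>)
  from DERIV_add[OF DERIV_const[of "Z m"] this]
  have "((\<lambda>s. Z m + integral {m..s} \<theta>) has_real_derivative \<theta> q) (at q within {m..q+1})" by simp
  then have "(Z has_real_derivative \<theta> q) (at q within {m..q+1})"
  proof (rule has_field_derivative_transform_within[OF _ zero_less_one])
    show "q \<in> {m..q+1}" by (simp add: m_def)
    show "Z m + integral {m..s} \<theta> = Z s" if "s \<in> {m..q+1}" for s
      by (rule Zeq[symmetric]) (use that in auto)
  qed
  moreover have "at q within {m..q+1} = at q" by (rule at_within_Icc_at) (auto simp: m_def)
  ultimately show "(Z has_real_derivative \<theta> q) (at q)" by (simp only:)
qed

text \<open>The integral of the radial derivative from the unit circle outwards (inwards for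
  \<open>q < 1\<close>, whence the difference of indicators). Writing it as an integral over the
  plane gives meaning to it for a weak gradient and makes Fubini's theorem applicable.\<close>

definition profile :: "(plane \<Rightarrow> plane) \<Rightarrow> real \<Rightarrow> real" where
  "profile g q = 1 / (2 * pi) *
     (LINT x|lborel. (indicator {..q} ((norm x)\<^sup>2) - indicator {..1} ((norm x)\<^sup>2)) * radial_deriv g x)"

lemma profile_kernel:
  "indicator {..q} s - indicator {..1} s
     = (if 1 \<le> q then indicator {1<..q} s else - indicator {q<..1} s :: real)"
  for q s :: real
  by (auto simp: indicator_def)

lemma profile_Holder:
  assumes g: "g \<in> Lq_space 2" and ab: "0 < a" "a \<le> b"
  shows "(profile g b - profile g a)\<^sup>2 \<le> pint 2 g / (4 * pi) * ln (b / a)"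
proof -
  have int: "integrable lborel (\<lambda>x. (indicator {..q} ((norm x)\<^sup>2) - indicator {..1} ((norm x)\<^sup>2)) * radial_deriv g x)"
    if "q > 0" for q
    unfolding profile_kernel
    using radial_deriv_annulus(1)[OF g, of 1 q] radial_deriv_annulus(1)[OF g, of q 1] that
    by (cases "1 \<le> q") auto
  have "profile g b - profile g a = 1 / (2 * pi) * (LINT x|lborel. indicator {a<..b} ((norm x)\<^sup>2) * radial_deriv g x)"
  proof -
    have "profile g b - profile g a = 1 / (2 * pi) * (LINT x|lborel.
       (indicator {..b} ((norm x)\<^sup>2) - indicator {..1} ((norm x)\<^sup>2)) * radial_deriv g x
      - (indicator {..a} ((norm x)\<^sup>2) - indicator {..1} ((norm x)\<^sup>2)) * radial_deriv g x)"
      unfolding profile_def using int[of a] int[of b] ab by (subst Bochner_Integration.integral_diff) (auto simp: algebra_simps)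
    also have "\<dots> = 1 / (2 * pi) * (LINT x|lborel. indicator {a<..b} ((norm x)\<^sup>2) * radial_deriv g x)"
      using ab by (intro arg_cong2[where f="(*)"] Bochner_Integration.integral_cong refl) (auto simp: indicator_def)
    finally show ?thesis .
  qed
  then have "(profile g b - profile g a)\<^sup>2 = 1 / (4 * pi\<^sup>2) * (LINT x|lborel. indicator {a<..b} ((norm x)\<^sup>2) * radial_deriv g x)\<^sup>2"
    by (simp add: power_mult_distrib power_divide)
  also have "\<dots> \<le> 1 / (4 * pi\<^sup>2) * (pi * ln (b / a) * pint 2 g)"
    by (intro mult_left_mono radial_deriv_annulus(2)[OF g ab]) auto
  also have "\<dots> = pint 2 g / (4 * pi) * ln (b / a)" by (simp add: power2_eq_square field_simps)
  finally show ?thesis .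
qed

text \<open>Square-root Hoelder continuity in the logarithmic variable, with constant \<open>K\<close>.\<close>

definition log_Holder :: "real \<Rightarrow> (real \<Rightarrow> real) \<Rightarrow> bool" where
  "log_Holder K F \<longleftrightarrow> (\<forall>a b. 0 < a \<longrightarrow> a \<le> b \<longrightarrow> (F b - F a)\<^sup>2 \<le> K * ln (b / a))"

lemma log_Holder_continuous:
  assumes F: "log_Holder K F"
  shows "continuous_on {0<..} F"
proof (rule continuous_at_imp_continuous_on, rule ballI)
  fix a :: real assume "a \<in> {0<..}"
  then have a: "a > 0" by simp
  have "((\<lambda>b. sqrt (\<bar>K\<bar> * \<bar>ln (b / a)\<bar>)) \<longlongrightarrow> sqrt (\<bar>K\<bar> * \<bar>ln (a / a)\<bar>)) (at a)"
    using a by (intro tendsto_intros) auto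
  then have l: "((\<lambda>b. sqrt (\<bar>K\<bar> * \<bar>ln (b / a)\<bar>)) \<longlongrightarrow> 0) (at a)" using a by simp
  have "eventually (\<lambda>b. b > 0) (at a)" using a by (auto simp: eventually_at_filter eventually_nhds intro!: exI[of _ "{0<..}"])
  then have "eventually (\<lambda>b. norm (F b - F a) \<le> sqrt (\<bar>K\<bar> * \<bar>ln (b / a)\<bar>)) (at a)"
  proof eventually_elim
    case (elim b)
    have "(F b - F a)\<^sup>2 \<le> \<bar>K\<bar> * \<bar>ln (b / a)\<bar>"
    proof (cases "a \<le> b")
      case True
      then have "(F b - F a)\<^sup>2 \<le> K * ln (b / a)" using F a unfolding log_Holder_def by auto
      also have "\<dots> \<le> \<bar>K * ln (b / a)\<bar>" by simp
      finally show ?thesis by (simp add: abs_mult)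
    next
      case False
      then have "(F a - F b)\<^sup>2 \<le> K * ln (a / b)" using F elim unfolding log_Holder_def by auto
      also have "\<dots> \<le> \<bar>K * ln (a / b)\<bar>" by simp
      finally show ?thesis using a elim by (simp add: power2_commute ln_div abs_mult abs_minus_commute)
    qed
    then show ?case by (simp add: real_le_rsqrt abs_le_square_iff)
  qed
  from Lim_null_comparison[OF this l] have "((\<lambda>b. F b - F a) \<longlongrightarrow> 0) (at a)" .
  then show "isCont F a" by (simp add: isCont_def LIM_zero_iff)
qed

lemma log_Holder_measurable:
  assumes F: "log_Holder K F"
  shows "(\<lambda>q. indicator {0<..} q * F q) \<in> borel_measurable borel"
    "(\<lambda>x::plane. F ((norm x)\<^sup>2)) \<in> borel_measurable borel"
proof -
  show 1: "(\<lambda>q. indicator {0<..} q * F q) \<in> borel_measurable borel"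
    using borel_measurable_continuous_on_indicator[OF _ log_Holder_continuous[OF F]] by simp
  have "(\<lambda>x::plane. F ((norm x)\<^sup>2)) = (\<lambda>x. if x = 0 then F 0 else indicator {0<..} ((norm x)\<^sup>2) * F ((norm x)\<^sup>2))"
    by auto
  moreover have "(\<lambda>x::plane. indicator {0<..} ((norm x)\<^sup>2) * F ((norm x)\<^sup>2)) \<in> borel_measurable borel"
    by (rule measurable_compose[OF _ 1]) measurable
  ultimately show "(\<lambda>x::plane. F ((norm x)\<^sup>2)) \<in> borel_measurable borel" by simp
qed

lemma profile_log_Holder: "g \<in> Lq_space 2 \<Longrightarrow> log_Holder (pint 2 g / (4 * pi)) (profile g)"
  unfolding log_Holder_def using profile_Holder by blast

text \<open>Fubini's theorem: pairing the profile with \<open>\<theta>\<close> amounts to pairing the radial derivative with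
  the primitive of \<open>\<theta>\<close>.\<close>

lemma profile_pairing:
  assumes g: "g \<in> Lq_space 2"
    and \<theta>: "continuous_on UNIV \<theta>" "\<And>q. \<bar>\<theta> q\<bar> \<le> C" and supp: "0 < a" "a \<le> 1" "1 \<le> b" "\<And>q. q < a \<Longrightarrow> \<theta> q = 0" "\<And>q. q > b \<Longrightarrow> \<theta> q = 0"
    and tot: "(LINT q|lborel. \<theta> q) = 0"
  shows "2 * (LINT x|lborel. profile g ((norm (x::plane))\<^sup>2) * \<theta> ((norm x)\<^sup>2))
     = - (LINT x|lborel. (LINT s|lborel. indicator {..(norm x)\<^sup>2} s * \<theta> s) * radial_deriv g x)"
proof -
  note [measurable] = Lq_spaceD(1)[OF g]
  have [measurable]: "radial_deriv g \<in> borel_measurable borel" unfolding radial_deriv_def[abs_def] by measurable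
  have [measurable]: "\<theta> \<in> borel_measurable borel" using \<theta>(1) by (rule borel_measurable_continuous_onI)
  have \<theta>le: "\<bar>\<theta> q\<bar> \<le> C * indicator {a..b} q" for q using \<theta>(2)[of q] supp(4,5)[of q] by (auto simp: indicator_def)
  have C: "C \<ge> 0" using \<theta>(2)[of 0] by linarith
  have i\<theta>: "integrable lborel \<theta>"
  proof (rule integrable_dominated)
    show "integrable lborel (\<lambda>q. C * indicator {a..b} q)" using supp by auto
    show "norm (\<theta> q) \<le> C * indicator {a..b} q" for q using \<theta>le by simp
  qed simp
  define k where "k = (\<lambda>(q, x::plane). \<theta> q * ((indicator {..q} ((norm x)\<^sup>2) - indicator {..1} ((norm x)\<^sup>2)) * radial_deriv g x))"
  have [measurable]: "k \<in> borel_measurable (lborel \<Otimes>\<^sub>M lborel)"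
  proof -
    have "(\<lambda>z::real \<times> plane. indicator {..fst z} ((norm (snd z))\<^sup>2) :: real) = (\<lambda>z. if (norm (snd z))\<^sup>2 \<le> fst z then 1 else 0)"
      by (auto simp: indicator_def)
    then have [measurable]: "(\<lambda>z::real \<times> plane. indicator {..fst z} ((norm (snd z))\<^sup>2) :: real) \<in> borel_measurable (lborel \<Otimes>\<^sub>M lborel)"
      by simp
    show ?thesis unfolding k_def case_prod_beta by measurable
  qed
  have ik: "integrable (lborel \<Otimes>\<^sub>M lborel) k"
  proof (rule integrable_dominated)
    have "integrable (lborel \<Otimes>\<^sub>M lborel) (\<lambda>(q, x). (C * indicator {a..b} q) * (indicator {a<..b} ((norm x)\<^sup>2) * \<bar>radial_deriv g x\<bar>))"
      unfolding case_prod_beta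
      by (rule integrable_product) (use supp radial_deriv_annulus(3)[OF g, of a b] in auto)
    then show "integrable (lborel \<Otimes>\<^sub>M lborel) (\<lambda>z. (C * indicator {a..b} (fst z)) * (indicator {a<..b} ((norm (snd z))\<^sup>2) * \<bar>radial_deriv g (snd z)\<bar>))"
      by (simp add: case_prod_beta')
    show "norm (k z) \<le> (C * indicator {a..b} (fst z)) * (indicator {a<..b} ((norm (snd z))\<^sup>2) * \<bar>radial_deriv g (snd z)\<bar>)" for z
    proof -
      obtain q x where z: "z = (q, x)" by (cases z)
      have "norm (k z) = \<bar>\<theta> q\<bar> * (\<bar>indicator {..q} ((norm x)\<^sup>2) - indicator {..1} ((norm x)\<^sup>2)\<bar> * \<bar>radial_deriv g x\<bar>)"
        by (simp add: k_def z abs_mult)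
      also have "\<dots> \<le> (C * indicator {a..b} q) * (indicator {a<..b} ((norm x)\<^sup>2) * \<bar>radial_deriv g x\<bar>)"
      proof (cases "q \<in> {a..b}")
        case True
        then show ?thesis using supp \<theta>le[of q] C
          by (intro mult_mono mult_right_mono) (auto simp: indicator_def)
      qed (use \<theta>le[of q] in auto)
      finally show ?thesis by (simp add: z)
    qed
  qed measurable
  have inner: "(LINT q|lborel. k (q, x)) = - (LINT s|lborel. indicator {..(norm x)\<^sup>2} s * \<theta> s) * radial_deriv g x" for x
  proof -
    let ?s = "(norm x)\<^sup>2"
    have si: "integrable lborel (\<lambda>s. indicator X s * \<theta> s)" if "X \<in> sets borel" for X
      using integrable_mult_indicator[of X lborel \<theta>] that i\<theta> by simp
    have "(LINT q|lborel. k (q, x)) = (LINT q|lborel. (\<theta> q - indicator {..<?s} q * \<theta> q - indicator {..1} ?s * \<theta> q) * radial_deriv g x)"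
      by (intro Bochner_Integration.integral_cong) (auto simp: k_def indicator_def algebra_simps)
    also have "\<dots> = (LINT q|lborel. (\<theta> q - indicator {..<?s} q * \<theta> q - indicator {..1} ?s * \<theta> q)) * radial_deriv g x"
      by simp
    also have "(LINT q|lborel. (\<theta> q - indicator {..<?s} q * \<theta> q - indicator {..1} ?s * \<theta> q)) = - (LINT q|lborel. indicator {..<?s} q * \<theta> q)"
      using i\<theta> si[of "{..<?s}"] tot by simp
    also have "(LINT q|lborel. indicator {..<?s} q * \<theta> q) = (LINT q|lborel. indicator {..?s} q * \<theta> q)"
    proof (rule integral_cong_AE)
      show "AE q in lborel. indicator {..<?s} q * \<theta> q = indicator {..?s} q * \<theta> q"
        using AE_lborel_singleton[of ?s] by eventually_elim (auto simp: indicator_def)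
    qed auto
    finally show ?thesis .
  qed
  have h0: "\<theta> q = 0" if "q \<le> 0" for q using supp(4)[of q] that supp(1) by auto
  have "(LINT x|lborel. profile g ((norm (x::plane))\<^sup>2) * \<theta> ((norm x)\<^sup>2)) = (LINT x|lborel. (\<lambda>q. (indicator {0<..} q * profile g q) * \<theta> q) ((norm (x::plane))\<^sup>2))"
    using h0 by (intro Bochner_Integration.integral_cong) (auto simp: indicator_def)
  also have "\<dots> = pi * (LINT q|lborel. indicator {0<..} q * ((indicator {0<..} q * profile g q) * \<theta> q))"
    by (rule radial_integral(2)) (use log_Holder_measurable(1)[OF profile_log_Holder[OF g]] in measurable)
  also have "(LINT q|lborel. indicator {0<..} q * ((indicator {0<..} q * profile g q) * \<theta> q)) = (LINT q|lborel. 1 / (2 * pi) * (LINT x|lborel. k (q, x)))"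
  proof (intro Bochner_Integration.integral_cong refl)
    fix q
    have "(LINT x|lborel. k (q, x)) = \<theta> q * (2 * pi * profile g q)" by (simp add: k_def profile_def)
    then show "indicator {0<..} q * ((indicator {0<..} q * profile g q) * \<theta> q) = 1 / (2 * pi) * (LINT x|lborel. k (q, x))"
      using h0[of q] by (auto simp: indicator_def)
  qed
  also have "\<dots> = 1 / (2 * pi) * (LINT q|lborel. (LINT x|lborel. k (q, x)))" by simp
  also have "(LINT q|lborel. (LINT x|lborel. k (q, x))) = (LINT x|lborel. (LINT q|lborel. k (q, x)))"
    using lborel_pair.integral_fst'[OF ik] lborel_pair.integral_snd[of "\<lambda>q x. k (q, x)"] ik by simp
  also have "\<dots> = - (LINT x|lborel. (LINT s|lborel. indicator {..(norm x)\<^sup>2} s * \<theta> s) * radial_deriv g x)"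
    unfolding inner by simp
  finally show ?thesis by simp
qed

lemma annulus_area:
  assumes "0 < a" "a \<le> b"
  shows "integrable lborel (\<lambda>x::plane. indicator {a..b} ((norm x)\<^sup>2) :: real)"
    "(LINT x|lborel. indicator {a..b} ((norm (x::plane))\<^sup>2)) = pi * (b - a)"
    "integrable lborel (\<lambda>x::plane. indicator {a<..<b} ((norm x)\<^sup>2) :: real)"
    "(LINT x|lborel. indicator {a<..<b} ((norm (x::plane))\<^sup>2)) = pi * (b - a)"
proof -
  have e: "(\<lambda>q::real. indicator {0<..} q * indicator {a..b} q :: real) = indicator {a..b}"
    "(\<lambda>q::real. indicator {0<..} q * indicator {a<..<b} q :: real) = indicator {a<..<b}"
    using assms by (auto simp: indicator_def)
  show "integrable lborel (\<lambda>x::plane. indicator {a..b} ((norm x)\<^sup>2) :: real)"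
    "(LINT x|lborel. indicator {a..b} ((norm (x::plane))\<^sup>2)) = pi * (b - a)"
    using radial_integral[of "indicator {a..b}"] assms unfolding e by auto
  show "integrable lborel (\<lambda>x::plane. indicator {a<..<b} ((norm x)\<^sup>2) :: real)"
    "(LINT x|lborel. indicator {a<..<b} ((norm (x::plane))\<^sup>2)) = pi * (b - a)"
    using radial_integral[of "indicator {a<..<b}"] assms unfolding e by auto
qed

lemma log_Holder_bounded_annulus:
  assumes F: "log_Holder K F" and ab: "0 < a" "a \<le> b"
  obtains C where "C \<ge> 0" "\<And>q. q \<in> {a..b} \<Longrightarrow> \<bar>F q\<bar> \<le> C"
proof -
  have "continuous_on {a..b} F" using log_Holder_continuous[OF F] by (rule continuous_on_subset) (use ab in auto)
  then have "bounded (F ` {a..b})" by (intro compact_imp_bounded compact_continuous_image) auto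
  then obtain C where C: "\<forall>y\<in>F ` {a..b}. norm y \<le> C" by (auto simp: bounded_iff)
  then have "\<bar>F q\<bar> \<le> max C 0" if "q \<in> {a..b}" for q using that by force
  then show thesis using that[of "max C 0"] by auto
qed

lemma annulus_integrable:
  assumes u: "locally_integrable u" and F: "log_Holder K F" and ab: "0 < a" "a \<le> b"
  shows "integrable lborel (\<lambda>x. indicator {a..b} ((norm x)\<^sup>2) * (u x :: real))"
    "integrable lborel (\<lambda>x::plane. indicator {a..b} ((norm x)\<^sup>2) * F ((norm x)\<^sup>2))"
proof -
  note [measurable] = locally_integrableD(1)[OF u] log_Holder_measurable(2)[OF F]
  have "(\<lambda>x. indicator {a..b} ((norm x)\<^sup>2) *\<^sub>R u x) = (\<lambda>x. indicator {a..b} ((norm x)\<^sup>2) * u x)" by simp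
  moreover have "integrable lborel (\<lambda>x. indicator {a..b} ((norm x)\<^sup>2) *\<^sub>R u x)"
  proof (rule locally_integrable_mult_bounded[OF u, where C=1 and R="sqrt b"])
    show "\<bar>indicator {a..b} ((norm x)\<^sup>2) :: real\<bar> \<le> 1 * indicator (cball 0 (sqrt b)) x" for x :: plane
      using real_le_rsqrt[of "norm x" b] by (auto simp: indicator_def)
  qed measurable
  ultimately show "integrable lborel (\<lambda>x. indicator {a..b} ((norm x)\<^sup>2) * (u x :: real))" by simp
  obtain C where C: "C \<ge> 0" "\<And>q. q \<in> {a..b} \<Longrightarrow> \<bar>F q\<bar> \<le> C" using log_Holder_bounded_annulus[OF F ab] by blast
  show "integrable lborel (\<lambda>x::plane. indicator {a..b} ((norm x)\<^sup>2) * F ((norm x)\<^sup>2))"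
  proof (rule integrable_dominated)
    show "integrable lborel (\<lambda>x::plane. C * indicator {a..b} ((norm x)\<^sup>2))"
      using annulus_area(1)[OF ab] by simp
    show "norm (indicator {a..b} ((norm x)\<^sup>2) * F ((norm x)\<^sup>2)) \<le> C * indicator {a..b} ((norm x)\<^sup>2)" for x :: plane
      using C(2)[of "(norm x)\<^sup>2"] by (auto simp: indicator_def)
  qed measurable
qed

lemma mean_zero_bump_props:
  assumes ab: "0 < a" "a < b"
  shows "smooth1 k (mean_zero_bump a b n)" "\<bar>mean_zero_bump a b n q\<bar> \<le> 1 + (b - a)"
    "q < min a 1 \<Longrightarrow> mean_zero_bump a b n q = 0" "q > max b 2 \<Longrightarrow> mean_zero_bump a b n q = 0"
    "integrable lborel (mean_zero_bump a b n)" "(LINT q|lborel. mean_zero_bump a b n q) = 0"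
    "(\<lambda>n. mean_zero_bump a b n q) \<longlonglongrightarrow> indicator {a<..<b} q - (b - a) * indicator {1<..<2} q"
proof -
  let ?J = "LINT s|lborel. bump 1 2 n s" and ?K = "LINT s|lborel. bump a b n s"
  have J: "0 \<le> ?J" "?J \<le> 1" "0 \<le> ?K" "?K \<le> b - a" using bump_integral_bounds(1,2)[of 1 2 n] bump_integral_bounds(1,2)[of a b n] ab by auto
  have e: "mean_zero_bump a b n = (\<lambda>q. ?J * bump a b n q + (- ?K) * bump 1 2 n q)" by (auto simp: mean_zero_bump_def)
  show "smooth1 k (mean_zero_bump a b n)" unfolding e
    by (intro smooth1_add smooth1_mult smooth1_const smooth1_bump)
  have "\<bar>?J * bump a b n q\<bar> \<le> 1 * 1" "\<bar>?K * bump 1 2 n q\<bar> \<le> (b - a) * 1"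
    unfolding abs_mult using J ab bump_bounds by (intro mult_mono; auto)+
  then show "\<bar>mean_zero_bump a b n q\<bar> \<le> 1 + (b - a)" 
    unfolding mean_zero_bump_def using abs_triangle_ineq4[of "?J * bump a b n q" "?K * bump 1 2 n q"] by argo
  show "q < min a 1 \<Longrightarrow> mean_zero_bump a b n q = 0" "q > max b 2 \<Longrightarrow> mean_zero_bump a b n q = 0"
    by (auto simp: mean_zero_bump_def bump_eq_0)
  show "integrable lborel (mean_zero_bump a b n)" unfolding e using bump_integrable(1) by auto
  show "(LINT q|lborel. mean_zero_bump a b n q) = 0" unfolding e using bump_integrable(1) by simp
  have "(\<lambda>n. mean_zero_bump a b n q) \<longlonglongrightarrow> (2 - 1) * indicator {a<..<b} q - (b - a) * indicator {1<..<2} q"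
    unfolding mean_zero_bump_def using ab by (intro tendsto_intros bump_integral_bounds(3) bump_tendsto) auto
  then show "(\<lambda>n. mean_zero_bump a b n q) \<longlonglongrightarrow> indicator {a<..<b} q - (b - a) * indicator {1<..<2} q" by simp
qed

text \<open>Tested with mean-zero functions of \<open>|x|\<^sup>2\<close>, both \<open>u\<close>
  and the profile of its gradient give the same pairing with the radial derivative. Their
  difference \<open>v\<close> is radial, and its integral over an annulus is proportional to the
  area of the annulus; hence \<open>v\<close> is constant.\<close>

lemma radial_profile:
  assumes ug: "has_weak_gradient u g" and g: "g \<in> Lq_space 2" and rad: "radial u"
  obtains F where "log_Holder (pint 2 g / (4 * pi)) F" "AE x in lborel. u x = F ((norm x)\<^sup>2)"
proof -
  have u: "locally_integrable u" using ug by (simp add: has_weak_gradient_def)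
  note LH = profile_log_Holder[OF g]
  note [measurable] = locally_integrableD(1)[OF u] log_Holder_measurable(2)[OF LH]
  define v where "v x = u x - profile g ((norm x)\<^sup>2)" for x
  have [measurable]: "v \<in> borel_measurable borel" unfolding v_def[abs_def] by measurable
  have vi: "integrable lborel (\<lambda>x. indicator {a..b} ((norm x)\<^sup>2) * v x)" if "0 < a" "a \<le> b" for a b
    using annulus_integrable[OF u LH that] by (simp add: v_def right_diff_distrib)
  have vo: "integrable lborel (\<lambda>x. indicator {a<..<b} ((norm x)\<^sup>2) * v x)" if "0 < a" "a \<le> b" for a b
    by (rule integrable_dominated[OF integrable_norm[OF vi[OF that]]]) (auto simp: indicator_def)
  have ann: "(LINT x|lborel. indicator {a<..<b} ((norm x)\<^sup>2) * v x) = (b - a) * (LINT x|lborel. indicator {1<..<2} ((norm x)\<^sup>2) * v x)"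
    if ab: "0 < a" "a < b" for a b
  proof -
    define a' b' where "a' = min a 1" and "b' = max b 2"
    have ab': "0 < a'" "a' \<le> 1" "1 \<le> b'" "a' \<le> b'" using ab by (auto simp: a'_def b'_def)
    define C where "C = 1 + (b - a)"
    let ?\<theta> = "mean_zero_bump a b"
    have th: "\<bar>?\<theta> n q\<bar> \<le> C * indicator {a'..b'} q" for n q
      using mean_zero_bump_props(2,3,4)[OF ab, where n=n and q=q] by (auto simp: C_def a'_def b'_def indicator_def not_le not_less)
    have [measurable]: "?\<theta> n \<in> borel_measurable borel" for n using mean_zero_bump_props(5)[OF ab] by auto
    have zero: "(LINT x|lborel. v x * ?\<theta> n ((norm x)\<^sup>2)) = 0" for n
    proof -
      define Z where "Z = (\<lambda>q. LINT s|lborel. indicator {..q} s * ?\<theta> n s)"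
      have c: "continuous_on UNIV (?\<theta> n)" using mean_zero_bump_props(1)[OF ab, of 0] by simp
      have s3: "q < a' \<Longrightarrow> ?\<theta> n q = 0" "q > b' \<Longrightarrow> ?\<theta> n q = 0" for q
        using mean_zero_bump_props(3,4)[OF ab] by (auto simp: a'_def b'_def)
      note P' = smooth_bounded_primitive[where a=a' and b=b', OF c mean_zero_bump_props(5)[OF ab] s3 mean_zero_bump_props(6)[OF ab]]
      have P: "(Z has_real_derivative ?\<theta> n q) (at q)" "q \<le> a' \<Longrightarrow> Z q = 0" "q \<ge> b' \<Longrightarrow> Z q = 0" for q
        unfolding Z_def using P' by blast+
      have "smooth1 (Suc k) Z" for k
        using P(1) mean_zero_bump_props(1)[OF ab, of k n] unfolding smooth1.simps by blast
      then have Zs: "smooth1 k Z" for k using smooth1_SucD by blast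
      have "2 * (LINT x|lborel. u x * ?\<theta> n ((norm x)\<^sup>2)) = - (LINT x|lborel. Z ((norm x)\<^sup>2) * radial_deriv g x)"
        by (rule weak_gradient_radial_test[OF ug Zs P(1) ab'(1) P(2) P(3)])
      moreover have "2 * (LINT x|lborel. profile g ((norm (x::plane))\<^sup>2) * ?\<theta> n ((norm x)\<^sup>2)) = - (LINT x|lborel. Z ((norm x)\<^sup>2) * radial_deriv g x)"
        unfolding Z_def by (rule profile_pairing[OF g c mean_zero_bump_props(2)[OF ab] ab'(1-3) s3 mean_zero_bump_props(6)[OF ab]])
      moreover have "integrable lborel (\<lambda>x. w x * ?\<theta> n ((norm x)\<^sup>2))"
        if w: "integrable lborel (\<lambda>x. indicator {a'..b'} ((norm x)\<^sup>2) * w x)" and [measurable]: "w \<in> borel_measurable borel" for w :: "plane \<Rightarrow> real"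
      proof (rule integrable_dominated)
        show "integrable lborel (\<lambda>x. C * norm (indicator {a'..b'} ((norm x)\<^sup>2) * w x))"
          by (intro integrable_mult_right integrable_norm w)
        show "norm (w x * ?\<theta> n ((norm x)\<^sup>2)) \<le> C * norm (indicator {a'..b'} ((norm x)\<^sup>2) * w x)" for x
          using mult_right_mono[OF th[of n "(norm x)\<^sup>2"], of "\<bar>w x\<bar>"] by (simp add: abs_mult mult_ac)
      qed measurable
      from this[OF annulus_integrable(1)[OF u LH ab'(1,4)]] this[OF annulus_integrable(2)[OF u LH ab'(1,4)]]
      have "integrable lborel (\<lambda>x. u x * ?\<theta> n ((norm x)\<^sup>2))" "integrable lborel (\<lambda>x::plane. profile g ((norm x)\<^sup>2) * ?\<theta> n ((norm x)\<^sup>2))"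
        by simp_all
      ultimately show ?thesis by (simp add: v_def left_diff_distrib)
    qed
    have "(\<lambda>n. LINT x|lborel. v x * ?\<theta> n ((norm x)\<^sup>2)) \<longlonglongrightarrow> (LINT x|lborel. v x * (indicator {a<..<b} ((norm x)\<^sup>2) - (b - a) * indicator {1<..<2} ((norm x)\<^sup>2)))"
    proof (rule integral_dominated_convergence)
      show "integrable lborel (\<lambda>x. C * norm (indicator {a'..b'} ((norm x)\<^sup>2) * v x))"
        by (intro integrable_mult_right integrable_norm vi ab')
      show "AE x in lborel. norm (v x * ?\<theta> n ((norm x)\<^sup>2)) \<le> C * norm (indicator {a'..b'} ((norm x)\<^sup>2) * v x)" for n
        using mult_right_mono[OF th[of n "(norm _)\<^sup>2"], of "\<bar>v _\<bar>"] by (intro AE_I2) (simp add: abs_mult mult_ac)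
      show "AE x in lborel. (\<lambda>n. v x * ?\<theta> n ((norm x)\<^sup>2)) \<longlonglongrightarrow> v x * (indicator {a<..<b} ((norm x)\<^sup>2) - (b - a) * indicator {1<..<2} ((norm x)\<^sup>2))"
        by (intro AE_I2 tendsto_mult tendsto_const mean_zero_bump_props(7)[OF ab])
    qed measurable
    then have "(LINT x|lborel. v x * (indicator {a<..<b} ((norm x)\<^sup>2) - (b - a) * indicator {1<..<2} ((norm x)\<^sup>2))) = 0"
      using zero by (simp add: LIMSEQ_const_iff)
    moreover have "v x * (indicator {a<..<b} ((norm x)\<^sup>2) - (b - a) * indicator {1<..<2} ((norm x)\<^sup>2))
      = indicator {a<..<b} ((norm x)\<^sup>2) * v x - (b - a) * (indicator {1<..<2} ((norm x)\<^sup>2) * v x)" for x by (simp add: algebra_simps)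
    ultimately show ?thesis using vo[of a b] vo[of 1 2] ab by simp
  qed
  \<comment> \<open>The constant is the mean of \<open>v\<close> over the annulus \<open>1 <
    |x|\<^sup>2 < 2\<close>, whose area is \<open>\<pi>\<close>.\<close>
  define c0 where "c0 = (LINT x|lborel. indicator {1<..<2} ((norm x)\<^sup>2) * v x) / pi"
  define w where "w x = v x - c0" for x
  have [measurable]: "w \<in> borel_measurable borel" unfolding w_def[abs_def] by measurable
  have wi: "integrable lborel (\<lambda>x. indicator {a<..<b} ((norm x)\<^sup>2) * w x)" if "0 < a" "a \<le> b" for a b
    using vo[OF that] annulus_area(3)[OF that] by (simp add: w_def right_diff_distrib)
  have w0: "(LINT x|lborel. indicator {a<..<b} ((norm x)\<^sup>2) * w x) = 0" if ab: "0 < a" "a < b" for a b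
  proof -
    have "(LINT x|lborel. indicator {a<..<b} ((norm x)\<^sup>2) * w x)
        = (LINT x|lborel. indicator {a<..<b} ((norm x)\<^sup>2) * v x - indicator {a<..<b} ((norm x)\<^sup>2) * c0)"
      by (simp add: w_def right_diff_distrib)
    also have "\<dots> = (b - a) * (c0 * pi) - (pi * (b - a)) * c0"
      using vo[of a b] annulus_area(3,4)[of a b] ab ann[OF ab] by (subst Bochner_Integration.integral_diff) (simp_all add: c0_def)
    finally show ?thesis by simp
  qed
  have wrad: "radial w"
  proof -
    obtain f where "AE x in lborel. u x = f (norm x)" using rad by (auto simp: radial_def)
    then have "AE x in lborel. w x = f (norm x) - profile g ((norm x)\<^sup>2) - c0" by eventually_elim (simp add: w_def v_def)
    then show ?thesis unfolding radial_def by (intro exI[of _ "\<lambda>r. f r - profile g (r\<^sup>2) - c0"])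
  qed
  have "AE x in lborel. indicator {1 / real (Suc n)<..<real (Suc (Suc n))} ((norm x)\<^sup>2) * w x = 0" for n
  proof (rule radial_eq_zero)
    define a b where "a = 1 / real (Suc n)" and "b = real (Suc (Suc n))"
    have ab: "0 < a" "a < b"
    proof -
      have "a \<le> 1" "1 < b" "0 < a" by (auto simp: a_def b_def)
      then show "0 < a" "a < b" by linarith+
    qed
    show i: "integrable lborel (\<lambda>x. indicator {1 / real (Suc n)<..<real (Suc (Suc n))} ((norm x)\<^sup>2) * w x)"
      using wi[of a b] ab by (simp add: a_def b_def)
    obtain f where "AE x in lborel. w x = f (norm x)" using wrad by (auto simp: radial_def)
    then have "AE x in lborel. indicator {a<..<b} ((norm x)\<^sup>2) * w x = indicator {a<..<b} ((norm x)\<^sup>2) * f (norm x)" by eventually_elim simp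
    then show "radial (\<lambda>x. indicator {1 / real (Suc n)<..<real (Suc (Suc n))} ((norm x)\<^sup>2) * w x)"
      unfolding radial_def a_def b_def by (intro exI[of _ "\<lambda>r. indicator {1 / real (Suc n)<..<real (Suc (Suc n))} (r\<^sup>2) * f r"])
    show "indicator {1 / real (Suc n)<..<real (Suc (Suc n))} ((norm x)\<^sup>2) * w x = 0" if "norm x > sqrt b" for x
    proof -
      have "(norm x)\<^sup>2 > b" using that real_less_rsqrt ab by (smt (verit) real_le_rsqrt)
      then show ?thesis by (simp add: b_def)
    qed
    show "(LINT x|lborel. indicator X ((norm x)\<^sup>2) * (indicator {1 / real (Suc n)<..<real (Suc (Suc n))} ((norm x)\<^sup>2) * w x)) = 0"
      if "X \<in> sets borel" for X
    proof (rule preimage_integrals_zero_induct[OF i, where N=borel and E="range (\<lambda>(a, b). {a<..<b::real})"])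
      show "Int_stable (range (\<lambda>(a, b). {a<..<b::real}))"
      proof (rule Int_stableI)
        fix X Y :: "real set" assume "X \<in> range (\<lambda>(a, b). {a<..<b})" "Y \<in> range (\<lambda>(a, b). {a<..<b})"
        then obtain y z where yz: "X = (\<lambda>(a, b). {a<..<b}) y" "Y = (\<lambda>(a, b). {a<..<b}) z" by blast
        define a b c d where "a = fst y" and "b = snd y" and "c = fst z" and "d = snd z"
        have "X = {a<..<b}" "Y = {c<..<d}" using yz by (simp_all add: a_def b_def c_def d_def case_prod_beta)
        then have "X \<inter> Y = {max a c<..<min b d}" by auto
        then show "X \<inter> Y \<in> range (\<lambda>(a, b). {a<..<b})" by (auto intro!: range_eqI[of _ _ "(max a c, min b d)"])
      qed
      show "sets borel = sigma_sets (space borel) (range (\<lambda>(a, b). {a<..<b::real}))"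
        using arg_cong[OF borel_eq_box[where 'a=real], of sets] by (simp add: box_real)
      show "(LINT x|lborel. indicator {1 / real (Suc n)<..<real (Suc (Suc n))} ((norm x)\<^sup>2) * w x) = 0"
        using w0[OF ab] by (simp add: a_def b_def)
      show "(LINT x|lborel. indicator X ((norm x)\<^sup>2) * (indicator {1 / real (Suc n)<..<real (Suc (Suc n))} ((norm x)\<^sup>2) * w x)) = 0"
        if XE: "X \<in> range (\<lambda>(a, b). {a<..<b::real})" for X
      proof -
        obtain z where z: "X = (\<lambda>(a, b). {a<..<b}) z" using XE by blast
        define c d where "c = fst z" and "d = snd z"
        have X: "X = {c<..<d}" using z by (simp add: c_def d_def case_prod_beta)
        have "indicator X ((norm x)\<^sup>2) * (indicator {a<..<b} ((norm x)\<^sup>2) * w x) = indicator {max c a<..<min d b} ((norm x)\<^sup>2) * w x" for x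
          by (auto simp: X indicator_def)
        moreover have "(LINT x|lborel. indicator {max c a<..<min d b} ((norm x)\<^sup>2) * w x) = 0"
          using w0[of "max c a" "min d b"] ab by (cases "max c a < min d b") auto
        ultimately show ?thesis unfolding a_def[symmetric] b_def[symmetric] by (simp only:)
      qed
    qed (use that in auto)
  qed
  then have "AE x in lborel. \<forall>n. indicator {1 / real (Suc n)<..<real (Suc (Suc n))} ((norm x)\<^sup>2) * w x = 0"
    by (subst AE_all_countable) blast
  then have "AE x in lborel. u x = profile g ((norm x)\<^sup>2) + c0"
    using AE_lborel_singleton[of 0]
  proof eventually_elim
    case (elim x)
    then have q: "(norm x)\<^sup>2 > 0" by simp
    obtain n1 where n1: "1 / real (Suc n1) < (norm x)\<^sup>2" using q nat_approx_posE by blast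
    obtain n2 where n2: "(norm x)\<^sup>2 < real n2" using reals_Archimedean2 by blast
    define n where "n = max n1 n2"
    have "1 / real (Suc n) \<le> 1 / real (Suc n1)" "real n2 \<le> real (Suc (Suc n))" by (auto simp: n_def frac_le)
    then have "(norm x)\<^sup>2 \<in> {1 / real (Suc n)<..<real (Suc (Suc n))}" using n1 n2 by auto
    then have "w x = 0" using elim(1)[rule_format, of n] by simp
    then show ?case by (simp add: w_def v_def)
  qed
  moreover have "log_Holder (pint 2 g / (4 * pi)) (\<lambda>q. profile g q + c0)"
    using LH by (simp add: log_Holder_def)
  ultimately show thesis using that by blast
qed

section \<open>Decay and integrability of radial functions of finite energy\<close>

text \<open>Uniform information about a radial function of finite energy: the constant
  \<open>a\<close> stands for a bound on the Dirichlet integral and \<open>b\<close> bounds the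
  \<open>L\<^sup>\<beta>\<close> part. Stated through the profile, the bound on the gradient
  survives pointwise limits.\<close>

definition bounded_profile :: "real \<Rightarrow> real \<Rightarrow> real \<Rightarrow> (plane \<Rightarrow> real) \<Rightarrow> (real \<Rightarrow> real) \<Rightarrow> bool" where
  "bounded_profile \<beta> a b u F \<longleftrightarrow> 1 < \<beta> \<and> \<beta> < 2 \<and> 0 < a \<and> 0 \<le> b \<and> log_Holder a F \<and> u \<in> Lq_space \<beta> \<and>
     (AE x in lborel. u x = F ((norm x)\<^sup>2)) \<and> pint \<beta> u \<le> b"

lemma bounded_profileD:
  assumes "bounded_profile \<beta> a b u F"
  shows "1 < \<beta>" "\<beta> < 2" "0 < a" "0 \<le> b" "log_Holder a F" "u \<in> Lq_space \<beta>"
    "AE x in lborel. u x = F ((norm x)\<^sup>2)" "pint \<beta> u \<le> b" "u \<in> borel_measurable borel"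
  using assms by (auto simp: bounded_profile_def Lq_space_def)

definition decay_const :: "real \<Rightarrow> real \<Rightarrow> real \<Rightarrow> real" where
  "decay_const \<beta> a b = 2 * (a * b / pi) powr (1 / (\<beta> + 2))"

lemma decay_const_nonneg: "0 \<le> decay_const \<beta> a b" by (simp add: decay_const_def)

text \<open>If \<open>|F(q)| = m\<close>, then \<open>|F| \<ge> m/2\<close> on the interval from \<open>q\<close> to \<open>q exp(m\<^sup>2/4a)\<close>; the \<open>L\<^sup>\<beta>\<close> mass of the
  corresponding annulus is at most \<open>b\<close>.\<close>

lemma radial_decay:
  assumes bp: "bounded_profile \<beta> a b u F" and q: "q > 0"
  shows "\<bar>F q\<bar> \<le> decay_const \<beta> a b * q powr (- (1 / (\<beta> + 2)))"
proof (cases "F q = 0")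
  case True
  then show ?thesis by (simp add: decay_const_nonneg)
next
  case False
  note D = bounded_profileD[OF bp]
  define m where "m = \<bar>F q\<bar>"
  have m: "m > 0" using False by (simp add: m_def)
  define d where "d = m\<^sup>2 / (4 * a)"
  have d: "d > 0" using m D(3) by (simp add: d_def)
  define Q where "Q = q * exp d"
  have qQ: "q \<le> Q" using q d by (simp add: Q_def)
  have Fs: "m / 2 \<le> \<bar>F s\<bar>" if s: "s \<in> {q..Q}" for s
  proof -
    have "ln (s / q) \<le> ln (exp d)" using s q by (intro ln_mono) (auto simp: Q_def field_simps)
    then have "(F s - F q)\<^sup>2 \<le> a * d"
      using D(5) s q D(3) unfolding log_Holder_def by (smt (verit) atLeastAtMost_iff ln_exp mult_left_mono)
    also have "a * d = (m / 2)\<^sup>2" using D(3) by (simp add: d_def power2_eq_square)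
    finally have "\<bar>F s - F q\<bar> \<le> m / 2" using m by (simp add: abs_le_square_iff[of _ "m/2", symmetric])
    then show ?thesis unfolding m_def by linarith
  qed
  have "(m / 2) powr \<beta> * (pi * (Q - q)) = (LINT x|lborel. (m / 2) powr \<beta> * indicator {q..Q} ((norm (x::plane))\<^sup>2))"
    using annulus_area(2)[OF q qQ] by simp
  also have "\<dots> \<le> pint \<beta> u" unfolding pint_def
  proof (rule integral_mono_AE)
    show "integrable lborel (\<lambda>x::plane. (m / 2) powr \<beta> * indicator {q..Q} ((norm x)\<^sup>2))" using annulus_area(1)[OF q qQ] by simp
    show "AE x in lborel. (m / 2) powr \<beta> * indicator {q..Q} ((norm x)\<^sup>2) \<le> norm (u x) powr \<beta>"
      using D(7)
    proof eventually_elim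
      case (elim x)
      show ?case using Fs[of "(norm x)\<^sup>2"] m D(1) elim by (auto simp: indicator_def intro!: powr_mono2)
    qed
  qed (use Lq_spaceD(2)[OF D(6)] in auto)
  also have "\<dots> \<le> b" by (rule D(8))
  finally have 1: "(m / 2) powr \<beta> * (pi * (Q - q)) \<le> b" .
  have "q * d \<le> Q - q" using mult_left_mono[OF exp_ge_add_one_self[of d], of q] q by (simp add: Q_def algebra_simps)
  then have "(m / 2) powr \<beta> * (pi * (q * d)) \<le> b" using 1 by (smt (verit) mult_left_mono pi_gt_zero powr_ge_zero)
  moreover have "d = (m / 2)\<^sup>2 / a" by (simp add: d_def power2_eq_square)
  moreover have "(m / 2) powr (\<beta> + 2) = (m / 2) powr \<beta> * (m / 2)\<^sup>2" using m by (simp add: powr_add powr_numeral)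
  ultimately have "(m / 2) powr (\<beta> + 2) * (pi * q / a) \<le> b" by (simp add: mult_ac)
  then have "(m / 2) powr (\<beta> + 2) \<le> a * b / pi * (1 / q)" using q D(3) by (simp add: field_simps)
  then have "((m / 2) powr (\<beta> + 2)) powr (1 / (\<beta> + 2)) \<le> (a * b / pi * (1 / q)) powr (1 / (\<beta> + 2))"
    using D(1) by (intro powr_mono2) auto
  then have "m / 2 \<le> (a * b / pi * (1 / q)) powr (1 / (\<beta> + 2))" using m D(1) by (simp add: powr_powr)
  also have "\<dots> = (a * b / pi) powr (1 / (\<beta> + 2)) * (1 / q) powr (1 / (\<beta> + 2))"
    by (rule powr_mult)
  also have "(1 / q) powr (1 / (\<beta> + 2)) = q powr (- (1 / (\<beta> + 2)))" using q by (simp add: powr_divide powr_minus_divide)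
  finally show ?thesis by (simp add: m_def decay_const_def)
qed

text \<open>Here \<open>|F(q)| \<le> |F(1)| + sqrt(a ln(1/q))\<close>, and the logarithm is
  absorbed by the power \<open>q powr (-1/(2 r))\<close>, chosen so that the \<open>r\<close>-th
  power is integrable at the origin.\<close>

lemma radial_growth_at_zero:
  assumes bp: "bounded_profile \<beta> a b u F" and q: "0 < q" "q \<le> 1" and r: "r > 0"
  shows "\<bar>F q\<bar> powr r \<le> (decay_const \<beta> a b + sqrt (a * r)) powr r * q powr (- (1 / 2))"
proof -
  note D = bounded_profileD[OF bp]
  have "\<bar>F 1\<bar> \<le> decay_const \<beta> a b" using radial_decay[OF bp, of 1] by simp
  moreover have "(F 1 - F q)\<^sup>2 \<le> a * ln (1 / q)" using D(5) q unfolding log_Holder_def by auto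
  then have "\<bar>F 1 - F q\<bar> \<le> sqrt (a * ln (1 / q))" by (intro real_le_rsqrt) simp
  moreover have "sqrt (a * ln (1 / q)) \<le> sqrt (a * r) * q powr (- (1 / (2 * r)))"
  proof -
    have "ln (1 / q) \<le> (1 / q) powr (1 / r) / (1 / r)" using q r by (intro ln_powr_bound) auto
    also have "\<dots> = r * (q powr (- (1 / (2 * r))))\<^sup>2"
    proof -
      have "(q powr (- (1 / (2 * r))))\<^sup>2 = q powr (- (1 / r))" using r by (simp add: power2_eq_square flip: powr_add)
      moreover have "(1 / q) powr (1 / r) = q powr (- (1 / r))" using q by (simp add: powr_divide powr_minus_divide)
      ultimately show ?thesis by simp
    qed
    finally have "a * ln (1 / q) \<le> a * (r * (q powr (- (1 / (2 * r))))\<^sup>2)" using D(3) by (intro mult_left_mono) auto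
    then have "sqrt (a * ln (1 / q)) \<le> sqrt (a * (r * (q powr (- (1 / (2 * r))))\<^sup>2))" by (rule real_sqrt_le_mono)
    then show ?thesis by (simp add: real_sqrt_mult)
  qed
  ultimately have "\<bar>F q\<bar> \<le> decay_const \<beta> a b + sqrt (a * r) * q powr (- (1 / (2 * r)))" by linarith
  moreover have "decay_const \<beta> a b * 1 \<le> decay_const \<beta> a b * q powr (- (1 / (2 * r)))"
    using q r by (intro mult_left_mono decay_const_nonneg) (simp add: powr_minus one_le_inverse_iff powr_le1)
  ultimately have "\<bar>F q\<bar> \<le> (decay_const \<beta> a b + sqrt (a * r)) * q powr (- (1 / (2 * r)))" by (simp add: algebra_simps)
  then have "\<bar>F q\<bar> powr r \<le> ((decay_const \<beta> a b + sqrt (a * r)) * q powr (- (1 / (2 * r)))) powr r"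
    using r by (intro powr_mono2) auto
  also have "\<dots> = (decay_const \<beta> a b + sqrt (a * r)) powr r * (q powr (- (1 / (2 * r)))) powr r"
    by (rule powr_mult)
  also have "(q powr (- (1 / (2 * r)))) powr r = q powr (- (1 / 2))" using r by (simp add: powr_powr)
  finally show ?thesis .
qed

lemma disc_power_integrable:
  assumes s: "s < 1"
  shows "integrable lborel (\<lambda>x::plane. indicator {0<..1} ((norm x)\<^sup>2) * ((norm x)\<^sup>2) powr (- s))"
    "(LINT x|lborel. indicator {0<..1} ((norm (x::plane))\<^sup>2) * ((norm x)\<^sup>2) powr (- s)) = pi / (1 - s)"
proof -
  have "((\<lambda>q. q powr (- s)) has_integral (1 powr (- s + 1) / (- s + 1))) {0..1::real}"
    by (rule has_integral_powr_from_0) (use s in auto)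
  then have "((\<lambda>q. if q \<in> {0..1} then q powr (- s) else 0) has_integral (1 / (1 - s))) UNIV"
    by (subst has_integral_restrict_UNIV) simp
  moreover have "(\<lambda>q. if q \<in> {0..1} then q powr (- s) else 0) = (\<lambda>q. indicator {0<..1} q * q powr (- s))"
    by (auto simp: fun_eq_iff indicator_def order_le_less)
  ultimately have hi: "((\<lambda>q. indicator {0<..1} q * q powr (- s)) has_integral (1 / (1 - s))) UNIV" by simp
  have nn: "(\<integral>\<^sup>+q. ennreal (indicator {0<..1} q * q powr (- s)) \<partial>lborel) = ennreal (1 / (1 - s))"
    by (rule nn_integral_has_integral_lborel[OF _ _ hi]) auto
  have hb: "has_bochner_integral lborel (\<lambda>q. indicator {0<..1} q * q powr (- s)) (1 / (1 - s))"
    by (rule has_bochner_integral_nn_integral[OF _ _ _ nn]) (use s in auto)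
  have e: "(\<lambda>q::real. indicator {0<..} q * (indicator {0<..1} q * q powr (- s))) = (\<lambda>q. indicator {0<..1} q * q powr (- s))"
    by (auto simp: indicator_def)
  show "integrable lborel (\<lambda>x::plane. indicator {0<..1} ((norm x)\<^sup>2) * ((norm x)\<^sup>2) powr (- s))"
    "(LINT x|lborel. indicator {0<..1} ((norm (x::plane))\<^sup>2) * ((norm x)\<^sup>2) powr (- s)) = pi / (1 - s)"
    using radial_integral[of "\<lambda>q. indicator {0<..1} q * q powr (- s)"] hb unfolding e
    by (auto simp: has_bochner_integral_iff)
qed

definition Lq_const :: "real \<Rightarrow> real \<Rightarrow> real \<Rightarrow> real \<Rightarrow> real" where
  "Lq_const \<beta> r a b = (decay_const \<beta> a b + sqrt (a * r)) powr r * (2 * pi) + decay_const \<beta> a b powr (r - \<beta>) * b"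

text \<open>A pointwise bound by a fixed integrable function near the origin and by a multiple of
  \<open>|u|\<^sup>\<beta>\<close> elsewhere.\<close>

lemma radial_power_le:
  assumes bp: "bounded_profile \<beta> a b u F" and r: "r \<ge> \<beta>"
  shows "AE x in lborel. \<bar>u x\<bar> powr r \<le>
      (decay_const \<beta> a b + sqrt (a * r)) powr r * (indicator {0<..1} ((norm x)\<^sup>2) * ((norm x)\<^sup>2) powr (- (1/2)))
      + decay_const \<beta> a b powr (r - \<beta>) * \<bar>u x\<bar> powr \<beta>"
  using bounded_profileD(7)[OF bp] AE_lborel_singleton[of 0]
proof eventually_elim
  case (elim x)
  note D = bounded_profileD[OF bp]
  let ?q = "(norm x)\<^sup>2"
  have q: "?q > 0" using elim by simp
  show ?case
  proof (cases "?q \<le> 1")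
    case True
    have "\<bar>u x\<bar> powr r \<le> (decay_const \<beta> a b + sqrt (a * r)) powr r * ?q powr (- (1/2))"
      unfolding elim by (rule radial_growth_at_zero[OF bp q True]) (use r D(1) in auto)
    also have "\<dots> = (decay_const \<beta> a b + sqrt (a * r)) powr r * (indicator {0<..1} ?q * ?q powr (- (1/2)))"
      using q True by simp
    finally show ?thesis by (smt (verit) mult_nonneg_nonneg powr_ge_zero)
  next
    case False
    have "\<bar>F ?q\<bar> \<le> decay_const \<beta> a b * ?q powr (- (1 / (\<beta> + 2)))" by (rule radial_decay[OF bp q])
    also have "\<dots> \<le> decay_const \<beta> a b * 1"
      using False D(1) by (intro mult_left_mono decay_const_nonneg) (simp add: powr_minus inverse_le_1_iff ge_one_powr_ge_zero)
    finally have "\<bar>u x\<bar> \<le> decay_const \<beta> a b" using elim by simp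
    then have "\<bar>u x\<bar> powr (r - \<beta>) * \<bar>u x\<bar> powr \<beta> \<le> decay_const \<beta> a b powr (r - \<beta>) * \<bar>u x\<bar> powr \<beta>"
      using r by (intro mult_right_mono powr_mono2) auto
    moreover have "\<bar>u x\<bar> powr (r - \<beta>) * \<bar>u x\<bar> powr \<beta> = \<bar>u x\<bar> powr r"
      by (cases "u x = 0") (auto simp: powr_add[symmetric])
    ultimately show ?thesis using False by simp
  qed
qed

lemma radial_Lq_bound:
  assumes bp: "bounded_profile \<beta> a b u F" and r: "r \<ge> \<beta>"
  shows "u \<in> Lq_space r" "pint r u \<le> Lq_const \<beta> r a b"
proof -
  note D = bounded_profileD[OF bp]
  note [measurable] = D(9)
  have i: "integrable lborel (\<lambda>x. (decay_const \<beta> a b + sqrt (a * r)) powr r * (indicator {0<..1} ((norm x)\<^sup>2) * ((norm x)\<^sup>2) powr (- (1/2)))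
      + decay_const \<beta> a b powr (r - \<beta>) * \<bar>u x\<bar> powr \<beta>)"
    using disc_power_integrable(1)[of "1/2"] Lq_spaceD(2)[OF D(6)] by auto
  have j: "integrable lborel (\<lambda>x. norm (u x) powr r)"
    by (rule Bochner_Integration.integrable_bound[OF i])
      (use radial_power_le[OF bp r] in \<open>auto elim!: eventually_mono intro: order_trans[OF _ abs_ge_self]\<close>)
  then show "u \<in> Lq_space r" by (simp add: Lq_space_def)
  have "pint r u \<le> (LINT x|lborel. (decay_const \<beta> a b + sqrt (a * r)) powr r * (indicator {0<..1} ((norm x)\<^sup>2) * ((norm x)\<^sup>2) powr (- (1/2)))
      + decay_const \<beta> a b powr (r - \<beta>) * \<bar>u x\<bar> powr \<beta>)"
    unfolding pint_def by (rule integral_mono_AE[OF j i]) (use radial_power_le[OF bp r] in auto)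
  also have "\<dots> = (decay_const \<beta> a b + sqrt (a * r)) powr r * (2 * pi) + decay_const \<beta> a b powr (r - \<beta>) * pint \<beta> u"
    using disc_power_integrable[of "1/2"] Lq_spaceD(2)[OF D(6)] by (simp add: pint_def)
  also have "\<dots> \<le> Lq_const \<beta> r a b" unfolding Lq_const_def using D(8) by (intro add_left_mono mult_left_mono) auto
  finally show "pint r u \<le> Lq_const \<beta> r a b" .
qed

definition log_weight :: "plane \<Rightarrow> real" where "log_weight x = 1 + ln (1 + norm x)"

lemma log_weight_ge_1: "1 \<le> log_weight x" by (simp add: log_weight_def)

lemma log_weight_measurable [measurable]: "log_weight \<in> borel_measurable borel"
  unfolding log_weight_def[abs_def] by measurable

lemma log_weight_le_power:
  assumes "(norm x)\<^sup>2 \<ge> 1" "\<delta> > 0"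
  shows "log_weight x \<le> (2 + 1 / (2 * \<delta>)) * ((norm x)\<^sup>2) powr \<delta>"
proof -
  have n: "norm x \<ge> 1" using assms(1) power2_le_imp_le[of 1 "norm x"] by simp
  have "ln (1 + norm x) \<le> ln (2 * norm x)" using n by (intro ln_mono) auto
  also have "\<dots> = ln 2 + ln (norm x)" using n by (subst ln_mult) auto
  also have "ln (norm x) = ln ((norm x)\<^sup>2) / 2" using n by (simp add: ln_realpow)
  also have "ln ((norm x)\<^sup>2) \<le> ((norm x)\<^sup>2) powr \<delta> / \<delta>" using assms by (intro ln_powr_bound) auto
  finally have "log_weight x \<le> 2 + 1 / (2 * \<delta>) * ((norm x)\<^sup>2) powr \<delta>"
    using ln2_le_25_over_36 by (simp add: log_weight_def divide_right_mono)
  moreover have "2 \<le> 2 * ((norm x)\<^sup>2) powr \<delta>" using assms ge_one_powr_ge_zero[of "(norm x)\<^sup>2" \<delta>] by simp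
  ultimately show ?thesis unfolding distrib_right by linarith
qed

text \<open>Half the decay exponent of \<open>|u|\<^sup>2\<^sup>-\<^sup>\<beta>\<close> in the
  variable \<open>|x|\<^sup>2\<close>. The other half absorbs the logarithmic weight.\<close>

definition tail_exp :: "real \<Rightarrow> real" where "tail_exp \<beta> = (2 - \<beta>) / (2 * (\<beta> + 2))"

definition tail_const :: "real \<Rightarrow> real \<Rightarrow> real \<Rightarrow> real" where
  "tail_const \<beta> a b = (2 + 1 / (2 * tail_exp \<beta>)) * decay_const \<beta> a b powr (2 - \<beta>)"

text \<open>Away from the origin, \<open>u\<^sup>2\<close> is \<open>|u|\<^sup>\<beta>\<close>
  times \<open>|u|\<^sup>2\<^sup>-\<^sup>\<beta>\<close>, and the second factor decays like a
  power because \<open>\<beta> < 2\<close>. The decay beats the weight, which makes the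
  logarithmic energy finite and its tails uniformly small.\<close>

lemma weighted_square_le:
  assumes bp: "bounded_profile \<beta> a b u F"
  shows "AE x in lborel. (u x)\<^sup>2 * log_weight x \<le>
      2 * (decay_const \<beta> a b)\<^sup>2 * (indicator {0<..1} ((norm x)\<^sup>2) * ((norm x)\<^sup>2) powr (- (2 / (\<beta> + 2))))
      + tail_const \<beta> a b * (indicator {1<..} ((norm x)\<^sup>2) * ((norm x)\<^sup>2) powr (- tail_exp \<beta>) * \<bar>u x\<bar> powr \<beta>)"
  using bounded_profileD(7)[OF bp] AE_lborel_singleton[of 0]
proof eventually_elim
  case (elim x)
  note D = bounded_profileD[OF bp]
  let ?q = "(norm x)\<^sup>2" and ?d = "decay_const \<beta> a b"
  have q: "?q > 0" using elim by simp
  have u: "\<bar>u x\<bar> \<le> ?d * ?q powr (- (1 / (\<beta> + 2)))" unfolding elim(1) by (rule radial_decay[OF bp q])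
  have te: "tail_exp \<beta> > 0" using D(1,2) by (simp add: tail_exp_def)
  show ?case
  proof (cases "?q \<le> 1")
    case True
    then have "norm x \<le> 1" by (simp add: power_le_one_iff)
    then have "ln (1 + norm x) \<le> 1" using ln_add_one_self_le_self[of "norm x"] by simp
    then have l: "log_weight x \<le> 2" by (simp add: log_weight_def)
    have "(u x)\<^sup>2 = \<bar>u x\<bar>\<^sup>2" by simp
    also have "\<dots> \<le> (?d * ?q powr (- (1 / (\<beta> + 2))))\<^sup>2" using u by (intro power_mono) auto
    also have "\<dots> = ?d\<^sup>2 * ?q powr (- (2 / (\<beta> + 2)))"
      using q by (simp add: power_mult_distrib powr_power)
    finally have "(u x)\<^sup>2 * log_weight x \<le> (?d\<^sup>2 * ?q powr (- (2 / (\<beta> + 2)))) * 2"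
      using l log_weight_ge_1[of x] by (intro mult_mono) auto
    then show ?thesis using True q by simp
  next
    case False
    have "\<bar>u x\<bar> powr (2 - \<beta>) \<le> (?d * ?q powr (- (1 / (\<beta> + 2)))) powr (2 - \<beta>)"
      using u D(2) by (intro powr_mono2) auto
    also have "\<dots> = ?d powr (2 - \<beta>) * ?q powr (- (2 * tail_exp \<beta>))"
    proof -
      have "- (1 / (\<beta> + 2)) * (2 - \<beta>) = - (2 * tail_exp \<beta>)"
        unfolding tail_exp_def using D(1) by (simp add: frac_eq_eq algebra_simps)
      then show ?thesis using decay_const_nonneg by (subst powr_mult) (auto simp: powr_powr)
    qed
    finally have 1: "\<bar>u x\<bar> powr (2 - \<beta>) \<le> ?d powr (2 - \<beta>) * ?q powr (- (2 * tail_exp \<beta>))" .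
    have "(u x)\<^sup>2 = \<bar>u x\<bar> powr \<beta> * \<bar>u x\<bar> powr (2 - \<beta>)"
      by (cases "u x = 0") (auto simp: powr_add[symmetric] powr_numeral)
    then have "(u x)\<^sup>2 * log_weight x \<le> (\<bar>u x\<bar> powr \<beta> * (?d powr (2 - \<beta>) * ?q powr (- (2 * tail_exp \<beta>)))) * ((2 + 1 / (2 * tail_exp \<beta>)) * ?q powr tail_exp \<beta>)"
      using 1 log_weight_ge_1[of x] log_weight_le_power[OF _ te, of x] False by (auto intro!: mult_mono mult_left_mono)
    also have "\<dots> = tail_const \<beta> a b * ((?q powr (- (2 * tail_exp \<beta>)) * ?q powr tail_exp \<beta>) * \<bar>u x\<bar> powr \<beta>)"
      by (simp add: tail_const_def)
    also have "?q powr (- (2 * tail_exp \<beta>)) * ?q powr tail_exp \<beta> = ?q powr (- tail_exp \<beta>)"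
      using q by (simp add: powr_add[symmetric])
    finally show ?thesis using False by simp
  qed
qed

definition weight_const :: "real \<Rightarrow> real \<Rightarrow> real \<Rightarrow> real" where
  "weight_const \<beta> a b = 2 * (decay_const \<beta> a b)\<^sup>2 * (pi / (1 - 2 / (\<beta> + 2))) + tail_const \<beta> a b * b"

lemma tail_const_nonneg: "1 < \<beta> \<Longrightarrow> \<beta> < 2 \<Longrightarrow> 0 \<le> tail_const \<beta> a b"
  by (auto simp: tail_const_def tail_exp_def intro!: mult_nonneg_nonneg add_nonneg_nonneg)

lemma weighted_square_bound:
  assumes bp: "bounded_profile \<beta> a b u F"
  shows "integrable lborel (\<lambda>x. (u x)\<^sup>2 * log_weight x)" "(LINT x|lborel. (u x)\<^sup>2 * log_weight x) \<le> weight_const \<beta> a b"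
    "R \<ge> 1 \<Longrightarrow> (LINT x|lborel. indicator {R<..} ((norm x)\<^sup>2) * ((u x)\<^sup>2 * log_weight x)) \<le> tail_const \<beta> a b * b * R powr (- tail_exp \<beta>)"
proof -
  note D = bounded_profileD[OF bp]
  note [measurable] = D(9)
  let ?A = "\<lambda>x::plane. indicator {0<..1} ((norm x)\<^sup>2) * ((norm x)\<^sup>2) powr (- (2 / (\<beta> + 2)))"
  let ?B = "\<lambda>x. indicator {1<..} ((norm x)\<^sup>2) * ((norm x)\<^sup>2) powr (- tail_exp \<beta>) * \<bar>u x\<bar> powr \<beta>"
  have te: "tail_exp \<beta> > 0" using D(1,2) by (simp add: tail_exp_def)
  have s: "2 / (\<beta> + 2) < 1" using D(1) by simp
  have iu: "integrable lborel (\<lambda>x. \<bar>u x\<bar> powr \<beta>)" using Lq_spaceD(2)[OF D(6)] by simp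
  have p1: "q powr (- tail_exp \<beta>) \<le> S powr (- tail_exp \<beta>)" if "S \<ge> 1" "q > S" for q S :: real
    using that te by (intro powr_mono2') auto
  have Ble: "?B x \<le> \<bar>u x\<bar> powr \<beta>" for x
    using p1[of 1 "(norm x)\<^sup>2"] by (auto simp: indicator_def intro!: mult_left_le_one_le)
  have iB: "integrable lborel ?B"
    by (rule integrable_dominated[OF iu]) (use Ble in \<open>auto simp: abs_mult\<close>)
  note iA = disc_power_integrable[OF s]
  have i: "integrable lborel (\<lambda>x. 2 * (decay_const \<beta> a b)\<^sup>2 * ?A x + tail_const \<beta> a b * ?B x)" using iA(1) iB by auto
  show j: "integrable lborel (\<lambda>x. (u x)\<^sup>2 * log_weight x)"
  proof (rule Bochner_Integration.integrable_bound[OF i])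
    show "AE x in lborel. norm ((u x)\<^sup>2 * log_weight x) \<le> norm (2 * (decay_const \<beta> a b)\<^sup>2 * ?A x + tail_const \<beta> a b * ?B x)"
      using weighted_square_le[OF bp]
    proof eventually_elim
      case (elim x)
      have "0 \<le> (u x)\<^sup>2 * log_weight x" using log_weight_ge_1[of x] by simp
      then show ?case using elim by (simp only: real_norm_def abs_of_nonneg)
    qed
  qed measurable
  have "(LINT x|lborel. (u x)\<^sup>2 * log_weight x) \<le> (LINT x|lborel. 2 * (decay_const \<beta> a b)\<^sup>2 * ?A x + tail_const \<beta> a b * ?B x)"
    by (rule integral_mono_AE[OF j i weighted_square_le[OF bp]])
  also have "\<dots> = 2 * (decay_const \<beta> a b)\<^sup>2 * (pi / (1 - 2 / (\<beta> + 2))) + tail_const \<beta> a b * (LINT x|lborel. ?B x)"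
    using iA iB by simp
  also have "(LINT x|lborel. ?B x) \<le> (LINT x|lborel. \<bar>u x\<bar> powr \<beta>)" by (rule integral_mono[OF iB iu Ble])
  also have "\<dots> \<le> b" using D(8) by (simp add: pint_def)
  finally show "(LINT x|lborel. (u x)\<^sup>2 * log_weight x) \<le> weight_const \<beta> a b"
    using tail_const_nonneg[OF D(1,2)] by (simp add: weight_const_def mult_left_mono)
  assume R: "R \<ge> 1"
  have jR: "integrable lborel (\<lambda>x. indicator {R<..} ((norm x)\<^sup>2) * ((u x)\<^sup>2 * log_weight x))"
    by (rule Bochner_Integration.integrable_bound[OF j]) (auto simp: indicator_def)
  have "(LINT x|lborel. indicator {R<..} ((norm x)\<^sup>2) * ((u x)\<^sup>2 * log_weight x)) \<le> (LINT x|lborel. (tail_const \<beta> a b * R powr (- tail_exp \<beta>)) * \<bar>u x\<bar> powr \<beta>)"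
  proof (rule integral_mono_AE[OF jR])
    show "AE x in lborel. indicator {R<..} ((norm x)\<^sup>2) * ((u x)\<^sup>2 * log_weight x) \<le> (tail_const \<beta> a b * R powr (- tail_exp \<beta>)) * \<bar>u x\<bar> powr \<beta>"
      using weighted_square_le[OF bp]
    proof eventually_elim
      case (elim x)
      show ?case
      proof (cases "(norm x)\<^sup>2 > R")
        case True
        have "(u x)\<^sup>2 * log_weight x \<le> tail_const \<beta> a b * (((norm x)\<^sup>2) powr (- tail_exp \<beta>) * \<bar>u x\<bar> powr \<beta>)" using elim True R by simp
        also have "\<dots> \<le> tail_const \<beta> a b * (R powr (- tail_exp \<beta>) * \<bar>u x\<bar> powr \<beta>)"
          using p1[OF R True] tail_const_nonneg[OF D(1,2)] by (intro mult_left_mono mult_right_mono) auto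
        finally show ?thesis using True by (simp add: mult.assoc)
      next
        case False
        then show ?thesis using tail_const_nonneg[OF D(1,2)] by (auto intro!: mult_nonneg_nonneg)
      qed
    qed
  qed (use iu in auto)
  also have "\<dots> = tail_const \<beta> a b * R powr (- tail_exp \<beta>) * pint \<beta> u" by (simp add: pint_def)
  also have "\<dots> \<le> tail_const \<beta> a b * R powr (- tail_exp \<beta>) * b"
    using D(8) tail_const_nonneg[OF D(1,2)] by (intro mult_left_mono mult_nonneg_nonneg) auto
  finally show "(LINT x|lborel. indicator {R<..} ((norm x)\<^sup>2) * ((u x)\<^sup>2 * log_weight x)) \<le> tail_const \<beta> a b * b * R powr (- tail_exp \<beta>)"
    by (simp add: mult_ac)
qed

lemma R_pair_bounded_profile:
  assumes R: "R_pair \<beta> u g" and \<beta>: "1 < \<beta>" "\<beta> < 2" and a: "a > 0" "pint 2 g \<le> a" and b: "pint \<beta> u \<le> b"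
  obtains F where "bounded_profile \<beta> a b u F"
proof -
  note D = R_pairD[OF R]
  have "has_weak_gradient u g" using R \<beta> by (auto simp: R_pair_def H_pair_weak_gradient)
  from radial_profile[OF this D(2,3)] obtain F where F: "log_Holder (pint 2 g / (4 * pi)) F" "AE x in lborel. u x = F ((norm x)\<^sup>2)" .
  have "pint 2 g / (4 * pi) \<le> a / 1" using pi_ge_two a pint_nonneg[of 2 g] by (intro frac_le) auto
  then have "log_Holder a F" using F(1) unfolding log_Holder_def
    by (smt (verit, best) div_by_1 divide_le_eq_1 divide_right_mono le_divide_eq_1_pos ln_ge_zero mult_right_mono)
  moreover have "0 \<le> b" using pint_nonneg[of \<beta> u] b by linarith
  ultimately show thesis using that F(2) D(1) \<beta> a(1) b by (auto simp: bounded_profile_def)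
qed

section \<open>The logarithmic energy\<close>

text \<open>The singular part of the kernel is integrable; the remaining part is at most the
  product of the weights at \<open>x\<close> and \<open>y\<close>.\<close>

definition ln_neg :: "plane \<Rightarrow> real" where "ln_neg z = max 0 (- ln (norm z))"

lemma ln_neg_measurable [measurable]: "ln_neg \<in> borel_measurable borel"
  unfolding ln_neg_def[abs_def] by measurable

lemma ln_neg_nonneg: "0 \<le> ln_neg z" by (simp add: ln_neg_def)

lemma ln_neg_minus: "ln_neg (x - y) = ln_neg (y - x)"
  by (simp add: ln_neg_def norm_minus_commute)

lemma ln_neg_integrable: "integrable lborel ln_neg"
proof (rule integrable_dominated[OF disc_power_integrable(1)[of "1/2"]])
  show "norm (ln_neg x) \<le> indicator {0<..1} ((norm x)\<^sup>2) * ((norm x)\<^sup>2) powr (- (1/2))" for x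
  proof (cases "x = 0 \<or> norm x > 1")
    case True
    then have "ln_neg x = 0" by (auto simp: ln_neg_def)
    then show ?thesis by simp
  next
    case False
    then have n: "0 < norm x" "norm x \<le> 1" by auto
    have "- ln (norm x) = ln (1 / norm x)" using n by (simp add: ln_div)
    also have "\<dots> \<le> 1 / norm x" using n ln_bound[of "1 / norm x"] by simp
    finally have "\<bar>ln_neg x\<bar> \<le> 1 / norm x" using n by (simp add: ln_neg_def)
    moreover have "((norm x)\<^sup>2) powr (- (1/2)) = 1 / norm x"
      using n by (simp add: powr_minus_divide powr_half_sqrt)
    moreover have "(norm x)\<^sup>2 \<le> 1" using n by (simp add: power_le_one)
    ultimately show ?thesis using n by simp
  qed
qed simp_all

definition ln_neg_mass :: real where "ln_neg_mass = (LINT z|lborel. ln_neg z)"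

lemma ln_neg_mass_nonneg: "0 \<le> ln_neg_mass"
  unfolding ln_neg_mass_def by (rule integral_nonneg_AE) (simp add: ln_neg_nonneg)

lemma ln_neg_shift: "integrable lborel (\<lambda>y. ln_neg (x - y))" "(LINT y|lborel. ln_neg (x - y)) = ln_neg_mass"
  using lborel_translate[of ln_neg "- x"] ln_neg_integrable
  by (simp_all add: ln_neg_minus[of x] ln_neg_mass_def)

lemma ln_le_weights: "ln (norm (x - y)) \<le> log_weight x * log_weight y"
proof (cases "x = y")
  case True
  then show ?thesis using log_weight_ge_1[of y] by simp
next
  case False
  have "norm (x - y) \<le> (1 + norm x) * (1 + norm y)"
  proof -
    have "0 \<le> norm x * norm y" by simp
    moreover have "(1 + norm x) * (1 + norm y) = 1 + norm x + norm y + norm x * norm y" by (simp add: algebra_simps)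
    ultimately show ?thesis using norm_triangle_ineq4[of x y] by linarith
  qed
  then have "ln (norm (x - y)) \<le> ln ((1 + norm x) * (1 + norm y))" using False by (intro ln_mono) auto
  also have "\<dots> = ln (1 + norm x) + ln (1 + norm y)" 
  proof (rule ln_mult_pos)
    show "0 < 1 + norm x" "0 < 1 + norm y" by (auto intro: add_pos_nonneg)
  qed
  also have "\<dots> \<le> log_weight x * log_weight y" by (simp add: log_weight_def algebra_simps)
  finally show ?thesis .
qed

lemma abs_ln_le: "\<bar>ln (norm (x - y))\<bar> \<le> log_weight x * log_weight y + ln_neg (x - y)"
proof -
  have "0 \<le> log_weight x * log_weight y" using log_weight_ge_1[of x] log_weight_ge_1[of y] by simp
  then show ?thesis using ln_le_weights[of x y] by (auto simp: ln_neg_def)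
qed

text \<open>The two integrability conditions answer to the two parts of the kernel: the weighted
  mass controls long distances, the square integral controls the convolution with the singular
  part.\<close>

definition log_density :: "(plane \<Rightarrow> real) \<Rightarrow> bool" where
  "log_density a \<longleftrightarrow> a \<in> borel_measurable borel \<and> integrable lborel (\<lambda>x. \<bar>a x\<bar> * log_weight x) \<and> integrable lborel (\<lambda>x. (a x)\<^sup>2)"

definition wmass :: "(plane \<Rightarrow> real) \<Rightarrow> real" where "wmass a = (LINT x|lborel. \<bar>a x\<bar> * log_weight x)"
definition sqmass :: "(plane \<Rightarrow> real) \<Rightarrow> real" where "sqmass a = (LINT x|lborel. (a x)\<^sup>2)"

lemma wmass_nonneg: "0 \<le> wmass h"
proof -
  have "0 \<le> \<bar>h x\<bar> * log_weight x" for x using log_weight_ge_1[of x] by simp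
  then show ?thesis unfolding wmass_def by (intro integral_nonneg_AE AE_I2)
qed

definition log_kernel :: "(plane \<Rightarrow> real) \<Rightarrow> (plane \<Rightarrow> real) \<Rightarrow> plane \<times> plane \<Rightarrow> real" where
  "log_kernel a b z = ln (norm (fst z - snd z)) * a (fst z) * b (snd z)"

definition log_energy :: "(plane \<Rightarrow> real) \<Rightarrow> (plane \<Rightarrow> real) \<Rightarrow> real" where
  "log_energy a b = (LINT z|(lborel \<Otimes>\<^sub>M lborel). log_kernel a b z)"

lemma ln_neg_product:
  assumes a: "integrable lborel (\<lambda>x. (a x)\<^sup>2)" and [measurable]: "a \<in> borel_measurable borel"
  shows "integrable (lborel \<Otimes>\<^sub>M lborel) (\<lambda>z. ln_neg (fst z - snd z) * (a (fst z))\<^sup>2)"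
    "(LINT z|(lborel \<Otimes>\<^sub>M lborel). ln_neg (fst z - snd z) * (a (fst z))\<^sup>2) = ln_neg_mass * sqmass a"
    "integrable (lborel \<Otimes>\<^sub>M lborel) (\<lambda>z. ln_neg (fst z - snd z) * (a (snd z))\<^sup>2)"
    "(LINT z|(lborel \<Otimes>\<^sub>M lborel). ln_neg (fst z - snd z) * (a (snd z))\<^sup>2) = ln_neg_mass * sqmass a"
proof -
  have inner: "(LINT y|lborel. ln_neg (x - y) * (a x)\<^sup>2) = ln_neg_mass * (a x)\<^sup>2" for x
    using ln_neg_shift(2)[of x] by simp
  show i: "integrable (lborel \<Otimes>\<^sub>M lborel) (\<lambda>z. ln_neg (fst z - snd z) * (a (fst z))\<^sup>2)"
  proof (rule lborel_pair.Fubini_integrable)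
    show "integrable lborel (\<lambda>x. LINT y|lborel. norm (ln_neg (fst (x, y) - snd (x, y)) * (a (fst (x, y)))\<^sup>2))"
      using a by (simp add: abs_mult ln_neg_nonneg ln_neg_shift(2))
    show "AE x in lborel. integrable lborel (\<lambda>y. ln_neg (fst (x, y) - snd (x, y)) * (a (fst (x, y)))\<^sup>2)"
      using ln_neg_shift(1) by simp
  qed measurable
  show e: "(LINT z|(lborel \<Otimes>\<^sub>M lborel). ln_neg (fst z - snd z) * (a (fst z))\<^sup>2) = ln_neg_mass * sqmass a"
    using lborel_pair.integral_fst'[OF i] by (simp add: ln_neg_shift(2) sqmass_def)
  have sw: "(\<lambda>(x, y). ln_neg (fst (y, x) - snd (y, x)) * (a (fst (y, x)))\<^sup>2) = (\<lambda>z. ln_neg (fst z - snd z) * (a (snd z))\<^sup>2)"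
    by (auto simp: ln_neg_minus)
  show "integrable (lborel \<Otimes>\<^sub>M lborel) (\<lambda>z. ln_neg (fst z - snd z) * (a (snd z))\<^sup>2)"
    using lborel_pair.integrable_product_swap[OF i] unfolding sw .
  show "(LINT z|(lborel \<Otimes>\<^sub>M lborel). ln_neg (fst z - snd z) * (a (snd z))\<^sup>2) = ln_neg_mass * sqmass a"
    using lborel_pair.integral_product_swap[OF borel_measurable_integrable[OF i]] e unfolding sw by simp
qed

text \<open>At short distances, \<open>|a(x) b(y)| \<le> a(x)\<^sup>2 + b(y)\<^sup>2\<close> and
  the singular part of the kernel is integrated out in one variable.\<close>

lemma log_energy_bound:
  assumes a: "log_density a" and b: "log_density b"
  shows "integrable (lborel \<Otimes>\<^sub>M lborel) (log_kernel a b)"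
    "\<bar>log_energy a b\<bar> \<le> wmass a * wmass b + ln_neg_mass * (sqmass a + sqmass b)"
proof -
  have [measurable]: "a \<in> borel_measurable borel" "b \<in> borel_measurable borel"
    using a b by (auto simp: log_density_def)
  have ia: "integrable lborel (\<lambda>x. \<bar>a x\<bar> * log_weight x)" "integrable lborel (\<lambda>x. (a x)\<^sup>2)"
    and ib: "integrable lborel (\<lambda>x. \<bar>b x\<bar> * log_weight x)" "integrable lborel (\<lambda>x. (b x)\<^sup>2)"
    using a b by (auto simp: log_density_def)
  let ?G = "\<lambda>z. (\<bar>a (fst z)\<bar> * log_weight (fst z)) * (\<bar>b (snd z)\<bar> * log_weight (snd z))
     + (ln_neg (fst z - snd z) * (a (fst z))\<^sup>2 + ln_neg (fst z - snd z) * (b (snd z))\<^sup>2)"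
  note P = integrable_product[OF ia(1) ib(1)] and A = ln_neg_product[OF ia(2)] and B = ln_neg_product[OF ib(2)]
  have iG: "integrable (lborel \<Otimes>\<^sub>M lborel) ?G"
    by (intro Bochner_Integration.integrable_add P(1) A(1) B(3)) auto
  have le: "norm (log_kernel a b z) \<le> ?G z" for z
  proof -
    obtain x y where z: "z = (x, y)" by (cases z)
    have xy: "\<bar>a x\<bar> * \<bar>b y\<bar> \<le> (a x)\<^sup>2 + (b y)\<^sup>2"
    proof -
      have "0 \<le> \<bar>a x\<bar> * \<bar>b y\<bar>" by simp
      then show ?thesis using sum_squares_bound[of "\<bar>a x\<bar>" "\<bar>b y\<bar>"] unfolding power2_abs mult.assoc by linarith
    qed
    have "norm (log_kernel a b z) = \<bar>ln (norm (x - y))\<bar> * (\<bar>a x\<bar> * \<bar>b y\<bar>)" by (simp add: log_kernel_def z abs_mult)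
    also have "\<dots> \<le> (log_weight x * log_weight y + ln_neg (x - y)) * (\<bar>a x\<bar> * \<bar>b y\<bar>)" by (intro mult_right_mono abs_ln_le) auto
    also have "\<dots> = (\<bar>a x\<bar> * log_weight x) * (\<bar>b y\<bar> * log_weight y) + ln_neg (x - y) * (\<bar>a x\<bar> * \<bar>b y\<bar>)" by (simp add: algebra_simps)
    also have "ln_neg (x - y) * (\<bar>a x\<bar> * \<bar>b y\<bar>) \<le> ln_neg (x - y) * ((a x)\<^sup>2 + (b y)\<^sup>2)"
      by (intro mult_left_mono xy ln_neg_nonneg)
    finally show ?thesis by (simp add: z algebra_simps)
  qed
  show ik: "integrable (lborel \<Otimes>\<^sub>M lborel) (log_kernel a b)"
    by (rule integrable_dominated[OF iG _ le]) (unfold log_kernel_def[abs_def], measurable)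
  have "\<bar>log_energy a b\<bar> \<le> (LINT z|(lborel \<Otimes>\<^sub>M lborel). ?G z)"
    unfolding log_energy_def using Bochner_Integration.integral_norm_bound_integral[OF ik iG] le by simp
  also have "\<dots> = wmass a * wmass b + (ln_neg_mass * sqmass a + ln_neg_mass * sqmass b)"
    using P A B by (simp add: wmass_def)
  finally show "\<bar>log_energy a b\<bar> \<le> wmass a * wmass b + ln_neg_mass * (sqmass a + sqmass b)"
    by (simp add: distrib_left)
qed

text \<open>For nonnegative densities the singular part of the kernel only lowers the
  energy.\<close>

lemma log_energy_le:
  assumes a: "log_density a" and b: "log_density b" and pos: "\<And>x. 0 \<le> a x" "\<And>x. 0 \<le> b x"
  shows "log_energy a b \<le> wmass a * wmass b"
proof -
  have ia: "integrable lborel (\<lambda>x. \<bar>a x\<bar> * log_weight x)" and ib: "integrable lborel (\<lambda>x. \<bar>b x\<bar> * log_weight x)"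
    using a b by (auto simp: log_density_def)
  note P = integrable_product[OF ia ib]
  have "log_energy a b \<le> (LINT z|(lborel \<Otimes>\<^sub>M lborel). (\<bar>a (fst z)\<bar> * log_weight (fst z)) * (\<bar>b (snd z)\<bar> * log_weight (snd z)))"
    unfolding log_energy_def
  proof (rule integral_mono[OF log_energy_bound(1)[OF a b] P(1)])
    fix z :: "plane \<times> plane"
    obtain x y where z: "z = (x, y)" by (cases z)
    have "ln (norm (x - y)) * (a x * b y) \<le> (log_weight x * log_weight y) * (a x * b y)"
      by (intro mult_right_mono ln_le_weights mult_nonneg_nonneg pos)
    then show "log_kernel a b z \<le> (\<bar>a (fst z)\<bar> * log_weight (fst z)) * (\<bar>b (snd z)\<bar> * log_weight (snd z))"
      using pos by (simp add: log_kernel_def z mult_ac)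
  qed
  then show ?thesis using P(2) by (simp add: wmass_def)
qed

lemma log_density_add:
  assumes a: "log_density a" and b: "log_density b"
  shows "log_density (\<lambda>x. a x + b x)" "wmass (\<lambda>x. a x + b x) \<le> wmass a + wmass b"
    "sqmass (\<lambda>x. a x + b x) \<le> 2 * sqmass a + 2 * sqmass b"
proof -
  have [measurable]: "a \<in> borel_measurable borel" "b \<in> borel_measurable borel"
    using a b by (auto simp: log_density_def)
  have ia: "integrable lborel (\<lambda>x. \<bar>a x\<bar> * log_weight x)" "integrable lborel (\<lambda>x. (a x)\<^sup>2)"
    and ib: "integrable lborel (\<lambda>x. \<bar>b x\<bar> * log_weight x)" "integrable lborel (\<lambda>x. (b x)\<^sup>2)"
    using a b by (auto simp: log_density_def)
  have i1: "integrable lborel (\<lambda>x. \<bar>a x\<bar> * log_weight x + \<bar>b x\<bar> * log_weight x)" and i2: "integrable lborel (\<lambda>x. 2 * (a x)\<^sup>2 + 2 * (b x)\<^sup>2)"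
    using ia ib by auto
  have le1: "\<bar>a x + b x\<bar> * log_weight x \<le> \<bar>a x\<bar> * log_weight x + \<bar>b x\<bar> * log_weight x" for x
    using mult_right_mono[OF abs_triangle_ineq[of "a x" "b x"], of "log_weight x"] log_weight_ge_1[of x] by (simp add: algebra_simps)
  have le2: "(a x + b x)\<^sup>2 \<le> 2 * (a x)\<^sup>2 + 2 * (b x)\<^sup>2" for x
    using sum_squares_bound[of "a x" "b x"] by (simp add: power2_sum)
  have j1: "integrable lborel (\<lambda>x. \<bar>a x + b x\<bar> * log_weight x)"
  proof (rule integrable_dominated[OF i1])
    show "norm (\<bar>a x + b x\<bar> * log_weight x) \<le> \<bar>a x\<bar> * log_weight x + \<bar>b x\<bar> * log_weight x" for x
      using le1[of x] log_weight_ge_1[of x] by (simp add: abs_mult)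
  qed measurable
  have j2: "integrable lborel (\<lambda>x. (a x + b x)\<^sup>2)" by (rule integrable_dominated[OF i2]) (use le2 in auto)
  show "log_density (\<lambda>x. a x + b x)" using j1 j2 by (simp add: log_density_def)
  show "wmass (\<lambda>x. a x + b x) \<le> wmass a + wmass b"
    using integral_mono[OF j1 i1 le1] ia ib by (simp add: wmass_def)
  show "sqmass (\<lambda>x. a x + b x) \<le> 2 * sqmass a + 2 * sqmass b"
    using integral_mono[OF j2 i2 le2] ia ib by (simp add: sqmass_def)
qed

lemma log_density_cmult:
  assumes a: "log_density a"
  shows "log_density (\<lambda>x. c * a x)" "wmass (\<lambda>x. c * a x) = \<bar>c\<bar> * wmass a" "sqmass (\<lambda>x. c * a x) = c\<^sup>2 * sqmass a"
  using a by (auto simp: log_density_def wmass_def sqmass_def abs_mult mult.assoc power_mult_distrib)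

lemma log_energy_add:
  assumes "log_density a" "log_density b" "log_density c"
  shows "log_energy (\<lambda>x. a x + b x) c = log_energy a c + log_energy b c"
proof -
  have "log_kernel (\<lambda>x. a x + b x) c = (\<lambda>z. log_kernel a c z + log_kernel b c z)"
    by (auto simp: log_kernel_def algebra_simps)
  then show ?thesis using log_energy_bound(1) assms by (simp add: log_energy_def)
qed

lemma log_energy_cmult: "log_energy (\<lambda>x. k * a x) c = k * log_energy a c"
proof -
  have "log_kernel (\<lambda>x. k * a x) c = (\<lambda>z. k * log_kernel a c z)"
    by (auto simp: log_kernel_def)
  then show ?thesis by (simp add: log_energy_def)
qed

lemma log_energy_commute:
  assumes a: "log_density a" and b: "log_density b"
  shows "log_energy a b = log_energy b a"
proof -
  have "(\<lambda>(x, y). log_kernel a b (y, x)) = log_kernel b a"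
    by (auto simp: log_kernel_def norm_minus_commute)
  then show ?thesis
    using lborel_pair.integral_product_swap[OF borel_measurable_integrable[OF log_energy_bound(1)[OF a b]]]
    by (simp add: log_energy_def)
qed

lemma log_energy_diff_squares:
  assumes a: "log_density a" and b: "log_density b"
  shows "log_energy a a - log_energy b b = log_energy (\<lambda>x. a x + (- 1) * b x) (\<lambda>x. a x + b x)"
proof -
  have m: "log_density (\<lambda>x. (- 1) * b x)" by (rule log_density_cmult(1)[OF b])
  have p: "log_density (\<lambda>x. a x + b x)" by (rule log_density_add(1)[OF a b])
  have "log_energy (\<lambda>x. a x + (- 1) * b x) (\<lambda>x. a x + b x) = log_energy a (\<lambda>x. a x + b x) + (- 1) * log_energy b (\<lambda>x. a x + b x)"
    by (simp only: log_energy_add[OF a m p] log_energy_cmult)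
  also have "log_energy a (\<lambda>x. a x + b x) = log_energy a a + log_energy b a"
    by (simp only: log_energy_commute[OF a p] log_energy_add[OF a b a])
  also have "log_energy b (\<lambda>x. a x + b x) = log_energy a b + log_energy b b"
    by (simp only: log_energy_commute[OF b p] log_energy_add[OF a b b])
  finally show ?thesis using log_energy_commute[OF a b] by simp
qed

text \<open>The difference is the bilinear form at \<open>a - b\<close> and \<open>a +
  b\<close>. Rescaling the arguments by \<open>1/e\<close> and \<open>e\<close> leaves the form
  unchanged and weights the square integrals so that a small \<open>a - b\<close> yields a small
  bound.\<close>

lemma log_energy_diff_bound:
  assumes a: "log_density a" and b: "log_density b" and e: "e > 0"
  shows "\<bar>log_energy a a - log_energy b b\<bar> \<le> wmass (\<lambda>x. a x - b x) * (wmass a + wmass b)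
     + ln_neg_mass * (sqmass (\<lambda>x. a x - b x) / e\<^sup>2 + e\<^sup>2 * (2 * sqmass a + 2 * sqmass b))"
proof -
  define d where "d x = a x + (- 1) * b x" for x
  have d: "log_density d" unfolding d_def[abs_def] by (intro log_density_add(1) log_density_cmult(1) a b)
  note s = log_density_add[OF a b]
  note de = log_density_cmult[OF d, of "1/e"] and se = log_density_cmult[OF s(1), of e]
  have w0: "0 \<le> wmass h" for h by (rule wmass_nonneg)
  have "log_energy d (\<lambda>x. a x + b x) = log_energy (\<lambda>x. 1/e * d x) (\<lambda>x. e * (a x + b x))"
  proof -
    have "log_energy (\<lambda>x. 1/e * d x) (\<lambda>x. e * (a x + b x)) = 1/e * log_energy d (\<lambda>x. e * (a x + b x))"
      by (rule log_energy_cmult)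
    also have "log_energy d (\<lambda>x. e * (a x + b x)) = e * log_energy (\<lambda>x. a x + b x) d"
      by (simp only: log_energy_commute[OF d se(1)] log_energy_cmult)
    also have "log_energy (\<lambda>x. a x + b x) d = log_energy d (\<lambda>x. a x + b x)" by (rule log_energy_commute[OF s(1) d])
    finally show ?thesis using e by simp
  qed
  then have "\<bar>log_energy d (\<lambda>x. a x + b x)\<bar> \<le> (1/e * wmass d) * (e * wmass (\<lambda>x. a x + b x)) + ln_neg_mass * ((1/e)\<^sup>2 * sqmass d + e\<^sup>2 * sqmass (\<lambda>x. a x + b x))"
    using log_energy_bound(2)[OF de(1) se(1)] e unfolding de(2,3) se(2,3) by simp
  also have "\<dots> \<le> wmass d * (wmass a + wmass b) + ln_neg_mass * (sqmass d / e\<^sup>2 + e\<^sup>2 * (2 * sqmass a + 2 * sqmass b))"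
    using e s(2,3) w0[of d] ln_neg_mass_nonneg
    by (intro add_mono mult_left_mono) (auto simp: power_divide intro!: mult_left_mono)
  finally show ?thesis using log_energy_diff_squares[OF a b] by (simp add: d_def[abs_def])
qed

lemma V0_log_energy:
  assumes "log_density (\<lambda>x. (u x)\<^sup>2)"
  shows "V0 u = 1 / (2 * pi) * log_energy (\<lambda>x. (u x)\<^sup>2) (\<lambda>x. (u x)\<^sup>2)"
  using lborel_pair.integral_fst'[OF log_energy_bound(1)[OF assms assms]]
  unfolding V0_def log_energy_def by (simp add: log_kernel_def[abs_def])

text \<open>Since \<open>ln |x/c - y/c| = ln |x - y| - ln c\<close>, a dilation adds a multiple
  of the squared mass to the logarithmic energy.\<close>

lemma V0_scale:
  assumes ld: "log_density (\<lambda>x. (u x)\<^sup>2)" and c: "c > 0" and [measurable]: "u \<in> borel_measurable borel"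
  shows "V0 (\<lambda>x. u (c *\<^sub>R x)) = 1 / c ^ 4 * (V0 u - 1 / (2 * pi) * ln c * (LINT x|lborel. (u x)\<^sup>2)\<^sup>2)"
proof -
  define M where "M = (LINT x|lborel. (u x)\<^sup>2)"
  have iM: "integrable lborel (\<lambda>x. (u x)\<^sup>2)"
  proof (rule integrable_dominated)
    show "integrable lborel (\<lambda>x. \<bar>(u x)\<^sup>2\<bar> * log_weight x)" using ld by (simp add: log_density_def)
    show "norm ((u x)\<^sup>2) \<le> \<bar>(u x)\<^sup>2\<bar> * log_weight x" for x
      using mult_left_mono[OF log_weight_ge_1[of x], of "(u x)\<^sup>2"] by simp
  qed simp
  let ?k = "\<lambda>x y. ln (norm (x - y)) * (u x)\<^sup>2 * (u y)\<^sup>2"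
  have ik: "integrable (lborel \<Otimes>\<^sub>M lborel) (\<lambda>z. ?k (fst z) (snd z))"
    using log_energy_bound(1)[OF ld ld] by (simp add: log_kernel_def[abs_def])
  define J where "J x = (LINT y|lborel. ?k x y)" for x
  have iJ: "integrable lborel J" using lborel_pair.integrable_fst'[OF ik] by (simp add: J_def[abs_def])
  have [measurable]: "J \<in> borel_measurable borel" using iJ by auto
  have inner: "AE x in lborel. (LINT y|lborel. ln (norm (x - y) / c) * (u x)\<^sup>2 * (u y)\<^sup>2) = J x - ln c * M * (u x)\<^sup>2"
    using lborel_pair.AE_integrable_fst'[OF ik]
  proof eventually_elim
    case (elim x)
    have "(LINT y|lborel. ln (norm (x - y) / c) * (u x)\<^sup>2 * (u y)\<^sup>2) = (LINT y|lborel. ?k x y - ln c * (u x)\<^sup>2 * (u y)\<^sup>2)"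
    proof (rule integral_cong_AE)
      show "AE y in lborel. ln (norm (x - y) / c) * (u x)\<^sup>2 * (u y)\<^sup>2 = ?k x y - ln c * (u x)\<^sup>2 * (u y)\<^sup>2"
        using AE_lborel_singleton[of x] by eventually_elim (use c in \<open>simp add: ln_div algebra_simps\<close>)
    qed measurable
    also have "\<dots> = J x - ln c * (u x)\<^sup>2 * M"
      using elim iM by (subst Bochner_Integration.integral_diff) (auto simp: J_def M_def)
    finally show ?case by (simp add: mult_ac)
  qed
  have in_scale: "(LINT y|lborel. ln (norm (x - y)) * (u (c *\<^sub>R x))\<^sup>2 * (u (c *\<^sub>R y))\<^sup>2)
     = 1 / c\<^sup>2 * (LINT y|lborel. ln (norm (c *\<^sub>R x - y) / c) * (u (c *\<^sub>R x))\<^sup>2 * (u y)\<^sup>2)" for x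
  proof -
    have "norm (x - y) = norm (c *\<^sub>R x - c *\<^sub>R y) / c" for y
      using c by (simp flip: scaleR_diff_right)
    then show ?thesis
      using lborel_scale(2)[of c "\<lambda>y. ln (norm (c *\<^sub>R x - y) / c) * (u (c *\<^sub>R x))\<^sup>2 * (u y)\<^sup>2"] c by simp
  qed
  define G where "G x = (LINT y|lborel. ln (norm (x - y) / c) * (u x)\<^sup>2 * (u y)\<^sup>2)" for x
  have [measurable]: "G \<in> borel_measurable borel" unfolding G_def[abs_def] by measurable
  have "2 * pi * V0 (\<lambda>x. u (c *\<^sub>R x)) = (LINT x|lborel. 1 / c\<^sup>2 * G (c *\<^sub>R x))"
    unfolding V0_def in_scale G_def by simp
  also have "\<dots> = 1 / c\<^sup>2 * (1 / c\<^sup>2 * (LINT x|lborel. G x))" using lborel_scale(2)[of c G] c by simp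
  also have "(LINT x|lborel. G x) = (LINT x|lborel. J x - ln c * M * (u x)\<^sup>2)"
    by (rule integral_cong_AE) (use inner in \<open>auto simp: G_def\<close>)
  also have "\<dots> = 2 * pi * V0 u - ln c * M * M"
    using iJ iM by (subst Bochner_Integration.integral_diff) (auto simp: M_def V0_def J_def[abs_def])
  finally have "2 * pi * V0 (\<lambda>x. u (c *\<^sub>R x)) = 1 / c ^ 4 * (2 * pi * V0 u - ln c * M * M)"
    by (simp add: power4_eq_xxxx power2_eq_square)
  then show ?thesis unfolding M_def[symmetric] using c by (simp add: field_simps power2_eq_square)
qed

lemma profile_log_density:
  assumes bp: "bounded_profile \<beta> a b u F"
  shows "log_density (\<lambda>x. (u x)\<^sup>2)" "wmass (\<lambda>x. (u x)\<^sup>2) \<le> weight_const \<beta> a b" "sqmass (\<lambda>x. (u x)\<^sup>2) \<le> Lq_const \<beta> 4 a b"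
    "integrable lborel (\<lambda>x. (u x)\<^sup>2)" "(LINT x|lborel. (u x)\<^sup>2) \<le> wmass (\<lambda>x. (u x)\<^sup>2)"
proof -
  note D = bounded_profileD[OF bp]
  note [measurable] = D(9)
  have e: "((u x)\<^sup>2)\<^sup>2 = norm (u x) powr 4" for x
    by (cases "u x = 0") (auto simp: powr_numeral)
  have r: "\<beta> \<le> 4" using D by simp
  have i4: "integrable lborel (\<lambda>x. ((u x)\<^sup>2)\<^sup>2)" unfolding e by (rule Lq_spaceD(2)[OF radial_Lq_bound(1)[OF bp r]])
  show "log_density (\<lambda>x. (u x)\<^sup>2)" unfolding log_density_def using weighted_square_bound(1)[OF bp] i4 by simp
  show "wmass (\<lambda>x. (u x)\<^sup>2) \<le> weight_const \<beta> a b" unfolding wmass_def using weighted_square_bound(2)[OF bp] by simp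
  show "sqmass (\<lambda>x. (u x)\<^sup>2) \<le> Lq_const \<beta> 4 a b" unfolding sqmass_def e
    using radial_Lq_bound(2)[OF bp r] by (simp add: pint_def)
  have le: "(u x)\<^sup>2 \<le> (u x)\<^sup>2 * log_weight x" for x using mult_left_mono[OF log_weight_ge_1[of x], of "(u x)\<^sup>2"] by simp
  show i2: "integrable lborel (\<lambda>x. (u x)\<^sup>2)"
    by (rule integrable_dominated[OF weighted_square_bound(1)[OF bp]]) (use le in auto)
  show "(LINT x|lborel. (u x)\<^sup>2) \<le> wmass (\<lambda>x. (u x)\<^sup>2)"
    unfolding wmass_def using integral_mono[OF i2 weighted_square_bound(1)[OF bp] le] by simp
qed

section \<open>Compactness\<close>

lemma log_Holder_abs:
  assumes F: "log_Holder K F" and q: "0 < q" "0 < s"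
  shows "(F q - F s)\<^sup>2 \<le> K * \<bar>ln (q / s)\<bar>"
proof (cases "s \<le> q")
  case True
  then have "ln (q / s) \<ge> 0" using q by simp
  then show ?thesis using F True q by (auto simp: log_Holder_def)
next
  case False
  then have "(F s - F q)\<^sup>2 \<le> K * ln (s / q)" using F q by (auto simp: log_Holder_def)
  moreover have "ln (s / q) = \<bar>ln (q / s)\<bar>" using False q by (simp add: ln_div)
  ultimately show ?thesis by (simp add: power2_commute)
qed

text \<open>Profiles with common bounds are equicontinuous and locally bounded on \<open>(0,\<infinity>)\<close>: a diagonal
  sequence converges at the rationals, hence everywhere.\<close>

lemma profile_subsequence:
  fixes v :: "nat \<Rightarrow> plane \<Rightarrow> real"
  assumes bp: "\<And>n. bounded_profile \<beta> a b (v n) (F n)"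
  obtains k G where "strict_mono k" "log_Holder a G" "\<And>q. q > 0 \<Longrightarrow> (\<lambda>n. F (k n) q) \<longlonglongrightarrow> G q"
proof -
  have a: "a > 0" and \<beta>: "\<beta> > 1" and LH: "log_Holder a (F n)" for n using bounded_profileD[OF bp] by auto
  define f where "f n q = F n q * q powr (1 / (\<beta> + 2))" for n q
  have "countable ({0<..} \<inter> \<rat> :: real set)" by (intro countable_Int2 countable_rat)
  moreover have "norm (f n q) \<le> decay_const \<beta> a b" if "q \<in> {0<..} \<inter> \<rat>" for n q
  proof -
    have q: "q > 0" using that by simp
    have "\<bar>f n q\<bar> = \<bar>F n q\<bar> * q powr (1 / (\<beta> + 2))" by (simp add: f_def abs_mult)
    also have "\<dots> \<le> (decay_const \<beta> a b * q powr (- (1 / (\<beta> + 2)))) * q powr (1 / (\<beta> + 2))"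
      by (intro mult_right_mono radial_decay[OF bp q]) auto
    also have "\<dots> = decay_const \<beta> a b" using q by (simp add: powr_minus)
    finally show ?thesis by simp
  qed
  ultimately obtain k where k: "strict_mono (k::nat\<Rightarrow>nat)" "\<And>q. q \<in> {0<..} \<inter> \<rat> \<Longrightarrow> \<exists>l. (\<lambda>n. f (k n) q) \<longlonglongrightarrow> l"
    using function_convergent_subsequence[of "{0<..} \<inter> \<rat>" f "decay_const \<beta> a b"] by blast
  have rat: "convergent (\<lambda>n. F (k n) q)" if q: "q > 0" "q \<in> \<rat>" for q
  proof -
    obtain l where "(\<lambda>n. f (k n) q) \<longlonglongrightarrow> l" using k(2)[of q] q by auto
    then have "(\<lambda>n. f (k n) q / q powr (1 / (\<beta> + 2))) \<longlonglongrightarrow> l / q powr (1 / (\<beta> + 2))" by (intro tendsto_divide) (use q in auto)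
    then show ?thesis using q by (auto simp: f_def convergent_def)
  qed
  have all: "convergent (\<lambda>n. F (k n) q)" if q: "q > 0" for q
  proof (rule Cauchy_convergent, rule metric_CauchyI)
    fix e :: real assume e: "e > 0"
    define d where "d = (e / 4)\<^sup>2 / a"
    have d: "d > 0" using e a by (simp add: d_def)
    have "q < q * exp d" using q d by simp
    then obtain s where s: "s \<in> \<rat>" "q < s" "s < q * exp d" using Rats_dense_in_real by blast
    have s0: "s > 0" using s q by linarith
    have "ln (s / q) \<le> ln (exp d)" using s q s0 by (intro ln_mono) (auto simp: field_simps)
    then have lns: "\<bar>ln (s / q)\<bar> \<le> d" using s q s0 by simp
    have near: "\<bar>F n s - F n q\<bar> \<le> e / 4" for n
    proof -
      have "(F n s - F n q)\<^sup>2 \<le> a * \<bar>ln (s / q)\<bar>" by (rule log_Holder_abs[OF LH s0 q])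
      also have "\<dots> \<le> a * d" using lns a by (intro mult_left_mono) auto
      also have "\<dots> = (e / 4)\<^sup>2" using a by (simp add: d_def)
      finally show ?thesis using e by (simp add: abs_le_square_iff[of _ "e/4", symmetric])
    qed
    have "Cauchy (\<lambda>n. F (k n) s)" using rat[OF s0 s(1)] by (rule convergent_Cauchy)
    then obtain M where M: "\<forall>m\<ge>M. \<forall>n\<ge>M. dist (F (k m) s) (F (k n) s) < e / 4" using metric_CauchyD[of _ "e/4"] e by (metis zero_less_divide_iff zero_less_numeral)
    have "dist (F (k m) q) (F (k n) q) < e" if "m \<ge> M" "n \<ge> M" for m n
      using M[rule_format, OF that] near[of "k m"] near[of "k n"] e unfolding dist_real_def by linarith
    then show "\<exists>M. \<forall>m\<ge>M. \<forall>n\<ge>M. dist (F (k m) q) (F (k n) q) < e" by blast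
  qed
  define G where "G q = lim (\<lambda>n. F (k n) q)" for q
  have lim: "(\<lambda>n. F (k n) q) \<longlonglongrightarrow> G q" if "q > 0" for q
    using all[OF that] by (simp add: G_def convergent_LIMSEQ_iff)
  have "log_Holder a G" unfolding log_Holder_def
  proof (intro allI impI)
    fix c d :: real assume cd: "0 < c" "c \<le> d"
    have "(\<lambda>n. (F (k n) d - F (k n) c)\<^sup>2) \<longlonglongrightarrow> (G d - G c)\<^sup>2" by (intro tendsto_intros lim) (use cd in auto)
    then show "(G d - G c)\<^sup>2 \<le> a * ln (d / c)"
      by (rule LIMSEQ_le_const2) (use LH cd in \<open>auto simp: log_Holder_def\<close>)
  qed
  then show thesis using that k(1) lim by blast
qed

lemma powr_strict_midpoint:
  fixes x z \<beta> :: real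
  assumes \<beta>: "\<beta> > 1" and xz: "0 \<le> z" "z < x"
  shows "((x + z) / 2) powr \<beta> < (x powr \<beta> + z powr \<beta>) / 2"
proof -
  define y where "y = (x + z) / 2"
  have y: "z < y" "y < x" "x - y = y - z" using xz by (auto simp: y_def field_simps)
  have d: "((\<lambda>t. t powr \<beta>) has_real_derivative \<beta> * t powr (\<beta> - 1)) (at t)" if "t > 0" for t
    using that by (auto intro!: derivative_eq_intros simp: powr_diff)
  have c: "continuous_on S (\<lambda>t. t powr \<beta>)" if "S \<subseteq> {0..}" for S
    using that \<beta> by (intro continuous_on_powr' continuous_intros) auto
  have mv: "\<exists>\<xi>. r < \<xi> \<and> \<xi> < s \<and> s powr \<beta> - r powr \<beta> = (s - r) * (\<beta> * \<xi> powr (\<beta> - 1))" if rs: "0 \<le> r" "r < s" for r s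
  proof -
    have "continuous_on {r..s} (\<lambda>t. t powr \<beta>)" by (rule c) (use rs in auto)
    moreover have "((\<lambda>t. t powr \<beta>) has_derivative (\<lambda>h. \<beta> * t powr (\<beta> - 1) * h)) (at t)" if "r < t" for t
      using d[of t] that rs by (simp add: has_field_derivative_def)
    ultimately show ?thesis
      using mvt[OF rs(2), of "\<lambda>t. t powr \<beta>" "\<lambda>t h. \<beta> * t powr (\<beta> - 1) * h"] by (metis mult.commute)
  qed
  obtain s1 where 1: "z < s1" "s1 < y" "y powr \<beta> - z powr \<beta> = (y - z) * (\<beta> * s1 powr (\<beta> - 1))"
    using mv[of z y] xz y by auto
  obtain s2 where 2: "y < s2" "s2 < x" "x powr \<beta> - y powr \<beta> = (x - y) * (\<beta> * s2 powr (\<beta> - 1))"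
    using mv[of y x] xz y by auto
  have s: "0 < s1" "s1 < s2" using 1 2 xz by auto
  then have "s1 powr (\<beta> - 1) < s2 powr (\<beta> - 1)" using \<beta> by (intro powr_less_mono2) auto
  then have "(y - z) * (\<beta> * s1 powr (\<beta> - 1)) < (x - y) * (\<beta> * s2 powr (\<beta> - 1))" using y \<beta> by simp
  then have "y powr \<beta> - z powr \<beta> < x powr \<beta> - y powr \<beta>" by (simp only: 1(3) 2(3))
  then show ?thesis unfolding y_def[symmetric] by argo
qed

definition midpoint_defect :: "real \<Rightarrow> real \<Rightarrow> real \<Rightarrow> real" where
  "midpoint_defect \<beta> s t = (\<bar>s\<bar> powr \<beta> + \<bar>t\<bar> powr \<beta>) / 2 - \<bar>(s + t) / 2\<bar> powr \<beta>"

lemma midpoint_defect_pos: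
  assumes \<beta>: "\<beta> > 1" and s: "-1 \<le> s" "s < 1"
  shows "midpoint_defect \<beta> 1 s > 0"
proof (cases "s \<ge> 0")
  case True
  then show ?thesis using powr_strict_midpoint[OF \<beta>, of s 1] s by (simp add: midpoint_defect_def)
next
  case False
  have "\<bar>(1 + s) / 2\<bar> powr \<beta> < ((1 + \<bar>s\<bar>) / 2) powr \<beta>" using False s \<beta> by (intro powr_less_mono2) auto
  also have "\<dots> \<le> (1 powr \<beta> + \<bar>s\<bar> powr \<beta>) / 2"
    using powr_strict_midpoint[OF \<beta>, of "\<bar>s\<bar>" 1] s False by (cases "\<bar>s\<bar> = 1") auto
  finally show ?thesis by (simp add: midpoint_defect_def)
qed

text \<open>By homogeneity the larger of the two numbers may be taken to be 1. For
  \<open>s\<close> in \<open>[-1,1]\<close> at a distance from 1 the defect of strict convexity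
  has a positive minimum by compactness.\<close>

lemma uniform_convexity:
  assumes \<beta>: "\<beta> > 1" and e: "e > 0"
  obtains C where "C \<ge> 0" "\<And>s t. \<bar>s - t\<bar> powr \<beta> \<le> e * (\<bar>s\<bar> powr \<beta> + \<bar>t\<bar> powr \<beta>) + C * midpoint_defect \<beta> s t"
proof -
  have cont: "continuous_on UNIV (midpoint_defect \<beta> 1)" "continuous_on UNIV (\<lambda>s. \<bar>1 - s\<bar> powr \<beta>)"
    unfolding midpoint_defect_def[abs_def] using \<beta> by (auto intro!: continuous_intros continuous_on_powr')
  define S where "S = {-1..1} \<inter> {s. e \<le> \<bar>1 - s\<bar> powr \<beta>}"
  have "closed {s. e \<le> \<bar>1 - s\<bar> powr \<beta>}" by (intro closed_Collect_le cont(2) continuous_on_const)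
  then have S: "compact S" unfolding S_def by (intro compact_Int_closed) auto
  have Sne: "s < 1" if "s \<in> S" for s using that e \<beta> by (cases "s = 1") (auto simp: S_def)
  have "\<exists>m>0. \<forall>s\<in>S. m \<le> midpoint_defect \<beta> 1 s"
  proof (cases "S = {}")
    case False
    then obtain s0 where s0: "s0 \<in> S" "\<forall>s\<in>S. midpoint_defect \<beta> 1 s0 \<le> midpoint_defect \<beta> 1 s"
      using continuous_attains_inf[OF S False continuous_on_subset[OF cont(1)]] by auto
    then show ?thesis using midpoint_defect_pos[OF \<beta>, of s0] Sne[of s0] by (auto simp: S_def)
  qed (auto intro: exI[of _ 1])
  then obtain m where m: "m > 0" "\<And>s. s \<in> S \<Longrightarrow> m \<le> midpoint_defect \<beta> 1 s" by auto
  define C where "C = 2 powr \<beta> / m"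
  have C: "C \<ge> 0" using m by (simp add: C_def)
  have d0: "0 \<le> midpoint_defect \<beta> 1 s" if "s \<in> {-1..1}" for s
    using midpoint_defect_pos[OF \<beta>, of s] that by (cases "s = 1") (auto simp: midpoint_defect_def)
  have 1: "\<bar>1 - s\<bar> powr \<beta> \<le> e + C * midpoint_defect \<beta> 1 s" if s: "s \<in> {-1..1}" for s
  proof (cases "s \<in> S")
    case True
    have "\<bar>1 - s\<bar> powr \<beta> \<le> 2 powr \<beta>" using s \<beta> by (intro powr_mono2) auto
    also have "\<dots> = C * m" using m by (simp add: C_def)
    also have "\<dots> \<le> C * midpoint_defect \<beta> 1 s" using C m(2)[OF True] by (intro mult_left_mono)
    finally show ?thesis using e by simp
  next
    case False
    then have "\<bar>1 - s\<bar> powr \<beta> < e" using s by (auto simp: S_def)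
    then show ?thesis using d0[OF s] C by (smt (verit) mult_nonneg_nonneg)
  qed
  have 2: "\<bar>s - t\<bar> powr \<beta> \<le> e * (\<bar>s\<bar> powr \<beta> + \<bar>t\<bar> powr \<beta>) + C * midpoint_defect \<beta> s t" if le: "\<bar>t\<bar> \<le> \<bar>s\<bar>" for s t
  proof (cases "s = 0")
    case True
    then show ?thesis using le by (simp add: midpoint_defect_def)
  next
    case False
    define r where "r = t / s"
    have t: "t = s * r" and r: "r \<in> {-1..1}" using False le by (auto simp: r_def abs_le_iff field_simps abs_if split: if_splits)
    have h: "\<bar>s * y\<bar> powr \<beta> = \<bar>s\<bar> powr \<beta> * \<bar>y\<bar> powr \<beta>" for y by (simp add: abs_mult powr_mult)
    have "s - t = s * (1 - r)" "(s + t) / 2 = s * ((1 + r) / 2)" by (simp_all add: t algebra_simps add_divide_distrib)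
    then have *: "\<bar>s - t\<bar> powr \<beta> = \<bar>s\<bar> powr \<beta> * \<bar>1 - r\<bar> powr \<beta>" "midpoint_defect \<beta> s t = \<bar>s\<bar> powr \<beta> * midpoint_defect \<beta> 1 r"
      unfolding midpoint_defect_def by (simp_all only: h t) (simp_all add: algebra_simps add_divide_distrib)
    have "\<bar>s - t\<bar> powr \<beta> \<le> \<bar>s\<bar> powr \<beta> * (e + C * midpoint_defect \<beta> 1 r)"
      unfolding * by (intro mult_left_mono 1 r) auto
    also have "\<dots> = e * \<bar>s\<bar> powr \<beta> + C * midpoint_defect \<beta> s t" by (simp add: * algebra_simps)
    finally show ?thesis using e by (smt (verit) distrib_left mult_nonneg_nonneg powr_ge_zero)
  qed
  have sym: "midpoint_defect \<beta> s t = midpoint_defect \<beta> t s" for s t by (simp add: midpoint_defect_def add.commute)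
  have "\<bar>s - t\<bar> powr \<beta> \<le> e * (\<bar>s\<bar> powr \<beta> + \<bar>t\<bar> powr \<beta>) + C * midpoint_defect \<beta> s t" for s t
    using 2[of t s] 2[of s t] by (cases "\<bar>t\<bar> \<le> \<bar>s\<bar>") (auto simp: sym[of t s] abs_minus_commute add.commute)
  then show thesis using that[OF C] by blast
qed

lemma midpoint_defect_nonneg:
  assumes \<beta>: "\<beta> > 1" shows "0 \<le> midpoint_defect \<beta> s t"
proof -
  have "\<bar>(s + t) / 2\<bar> powr \<beta> \<le> ((\<bar>s\<bar> + \<bar>t\<bar>) / 2) powr \<beta>" using \<beta> by (intro powr_mono2) auto
  also have "\<dots> \<le> (\<bar>s\<bar> powr \<beta> + \<bar>t\<bar> powr \<beta>) / 2"
    using powr_strict_midpoint[OF \<beta>, of "\<bar>s\<bar>" "\<bar>t\<bar>"] powr_strict_midpoint[OF \<beta>, of "\<bar>t\<bar>" "\<bar>s\<bar>"]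
    by (cases "\<bar>s\<bar>" "\<bar>t\<bar>" rule: linorder_cases) (auto simp: add.commute)
  finally show ?thesis by (simp add: midpoint_defect_def)
qed

text \<open>Iterated midpoints of the tail of a sequence of functions, carried along with the corresponding
  combinations of their gradients.\<close>

inductive tail_mid :: "(nat \<Rightarrow> plane \<Rightarrow> real) \<Rightarrow> (nat \<Rightarrow> plane \<Rightarrow> plane) \<Rightarrow> nat \<Rightarrow> (plane \<Rightarrow> real) \<Rightarrow> (plane \<Rightarrow> plane) \<Rightarrow> bool"
  for v g N where
  base: "n \<ge> N \<Longrightarrow> tail_mid v g N (v n) (g n)"
| mid: "tail_mid v g N c h \<Longrightarrow> tail_mid v g N c' h' \<Longrightarrow>
    tail_mid v g N (\<lambda>x. (1/2) * (c x + c' x)) (\<lambda>x. (1/2) *\<^sub>R (h x + h' x))"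

lemma tail_mid_antimono:
  assumes "tail_mid v g M c h" "N \<le> M"
  shows "tail_mid v g N c h"
  using assms(1)
proof induction
  case (base n)
  then show ?case using assms(2) by (intro tail_mid.base) simp
next
  case (mid c h c' h')
  show ?case by (rule tail_mid.mid[OF mid.IH])
qed

lemma tail_mid_R_pair:
  assumes R: "\<And>n. R_pair \<beta> (v n) (g n)" and \<beta>: "\<beta> > 1" and t: "tail_mid v g N c h"
  shows "R_pair \<beta> c h"
  using t
proof induction
  case (base n)
  show ?case by (rule R)
next
  case (mid c h c' h')
  show ?case by (rule R_pair_cmult[OF R_pair_add[OF mid.IH \<beta>] \<beta>])
qed

lemma tail_mid_pointwise:
  assumes "tail_mid v g N c h" "\<And>n. n \<ge> N \<Longrightarrow> \<bar>v n x - l\<bar> \<le> e"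
  shows "\<bar>c x - l\<bar> \<le> e"
  using assms(1)
proof induction
  case (mid c h c' h')
  then show ?case unfolding abs_le_iff by (auto simp: field_simps)
qed (use assms(2) in auto)

lemma L2_parallelogram:
  fixes h h' :: "plane \<Rightarrow> plane"
  assumes h: "h \<in> Lq_space 2" and h': "h' \<in> Lq_space 2"
  shows "pint 2 (\<lambda>x. (1/2) *\<^sub>R (h x + h' x)) = (pint 2 h + pint 2 h') / 2 - pint 2 (\<lambda>x. h x - h' x) / 4"
proof -
  have i: "integrable lborel (\<lambda>x. (norm (h x))\<^sup>2)" "integrable lborel (\<lambda>x. (norm (h' x))\<^sup>2)" "integrable lborel (\<lambda>x. (norm (h x - h' x))\<^sup>2)"
    using Lq_spaceD(2)[OF h] Lq_spaceD(2)[OF h'] Lq_spaceD(2)[OF Lq_space_diff(1)[OF h h']] by (simp_all add: powr_2_norm)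
  have "(norm ((1/2) *\<^sub>R (h x + h' x)))\<^sup>2 = ((norm (h x))\<^sup>2 + (norm (h' x))\<^sup>2) / 2 - (norm (h x - h' x))\<^sup>2 / 4" for x
    unfolding power2_norm_eq_inner
    by (simp add: inner_add_left inner_add_right inner_diff_left inner_diff_right inner_commute field_simps)
  then show ?thesis using i unfolding pint_def powr_2_norm by simp
qed

lemma pint_midpoint:
  assumes c: "c \<in> Lq_space \<beta>" and c': "c' \<in> Lq_space \<beta>" and \<beta>: "\<beta> > 1"
  shows "integrable lborel (\<lambda>x. midpoint_defect \<beta> (c x) (c' x))"
    "pint \<beta> (\<lambda>x. (1/2) * (c x + c' x)) = (pint \<beta> c + pint \<beta> c') / 2 - (LINT x|lborel. midpoint_defect \<beta> (c x) (c' x))"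
proof -
  have L: "(\<lambda>x. (1/2) *\<^sub>R (c x + c' x)) \<in> Lq_space \<beta>"
    by (rule Lq_space_cmult(1)[OF Lq_space_add(1)[OF c c']]) (use \<beta> in simp)
  have i: "integrable lborel (\<lambda>x. \<bar>c x\<bar> powr \<beta>)" "integrable lborel (\<lambda>x. \<bar>c' x\<bar> powr \<beta>)" "integrable lborel (\<lambda>x. \<bar>(c x + c' x) / 2\<bar> powr \<beta>)"
    using Lq_spaceD(2)[OF c] Lq_spaceD(2)[OF c'] Lq_spaceD(2)[OF L] by simp_all
  show "integrable lborel (\<lambda>x. midpoint_defect \<beta> (c x) (c' x))" unfolding midpoint_defect_def using i by auto
  show "pint \<beta> (\<lambda>x. (1/2) * (c x + c' x)) = (pint \<beta> c + pint \<beta> c') / 2 - (LINT x|lborel. midpoint_defect \<beta> (c x) (c' x))"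
    unfolding midpoint_defect_def using i by (simp add: pint_def)
qed

lemma tail_mid_bounds:
  assumes R: "\<And>n. R_pair \<beta> (v n) (g n)" and \<beta>: "\<beta> > 1" and t: "tail_mid v g N c h"
    and b: "\<And>n. n \<ge> N \<Longrightarrow> pint 2 (g n) \<le> a" "\<And>n. n \<ge> N \<Longrightarrow> pint \<beta> (v n) \<le> b"
  shows "pint 2 h \<le> a" "pint \<beta> c \<le> b"
proof -
  have "pint 2 h \<le> a \<and> pint \<beta> c \<le> b" using t
  proof induction
    case (mid c h c' h')
    note r = tail_mid_R_pair[OF R \<beta> mid(1)] tail_mid_R_pair[OF R \<beta> mid(2)]
    note L = R_pairD[OF r(1)] R_pairD[OF r(2)]
    have "0 \<le> (LINT x|lborel. midpoint_defect \<beta> (c x) (c' x))" by (rule integral_nonneg_AE) (simp add: midpoint_defect_nonneg[OF \<beta>])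
    then show ?case unfolding L2_parallelogram[OF L(2) L(6)] pint_midpoint(2)[OF L(1) L(5) \<beta>]
      using mid.IH pint_nonneg[of 2 "\<lambda>x. h x - h' x"] by argo
  qed (use b in auto)
  then show "pint 2 h \<le> a" "pint \<beta> c \<le> b" by auto
qed

text \<open>Mazur's lemma in a concrete form: almost minimisers of the strictly convex functional
  \<open>\<parallel>\<nabla>c\<parallel>\<^sup>2 + \<parallel>c\<parallel>\<^sup>\<beta>\<close> among the iterated midpoints of the tails form a Cauchy sequence. Hence an almost
  everywhere limit of a bounded sequence of finite energy functions is again of finite energy, and
  the Dirichlet integral does not jump up.\<close>

lemma weak_limit_R_pair:
  assumes R: "\<And>n. R_pair \<beta> (v n) (g n)" and \<beta>: "\<beta> > 1"
    and b: "\<And>n. pint 2 (g n) \<le> a" "\<And>n. pint \<beta> (v n) \<le> b"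
    and A: "(\<lambda>n. pint 2 (g n)) \<longlonglongrightarrow> A"
    and u [measurable]: "u \<in> borel_measurable borel" and rad: "radial u" and lim: "AE x in lborel. (\<lambda>n. v n x) \<longlonglongrightarrow> u x"
  shows "\<exists>G. R_pair \<beta> u G \<and> pint 2 G \<le> A"
proof -
  \<comment> \<open>\<open>d N\<close> is the infimum over combinations of the members from
    \<open>N\<close> on; it increases to a finite limit \<open>D\<close>.\<close>
  define \<Psi> where "\<Psi> c h = pint 2 h + pint \<beta> c" for c :: "plane \<Rightarrow> real" and h :: "plane \<Rightarrow> plane"
  define S where "S N = {\<Psi> c h |c h. tail_mid v g N c h}" for N
  define d where "d N = Inf (S N)" for N
  have \<Psi>0: "0 \<le> \<Psi> c h" for c h unfolding \<Psi>_def by (intro add_nonneg_nonneg pint_nonneg)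
  have Sbb: "bdd_below (S N)" for N using \<Psi>0 by (auto simp: S_def intro!: bdd_belowI[of _ 0])
  have Sin: "\<Psi> (v n) (g n) \<in> S N" if "n \<ge> N" for n N using tail_mid.base[OF that] by (auto simp: S_def)
  have Sne: "S N \<noteq> {}" for N using Sin[of N N] by auto
  have dle: "d N \<le> \<Psi> c h" if "tail_mid v g N c h" for N c h
    unfolding d_def by (rule cInf_lower[OF _ Sbb]) (use that in \<open>auto simp: S_def\<close>)
  have dmono: "d N \<le> d M" if "N \<le> M" for N M
    unfolding d_def by (rule cInf_superset_mono[OF Sne Sbb]) (use tail_mid_antimono[OF _ that] in \<open>force simp: S_def\<close>)
  have dbd: "d N \<le> a + b" for N using dle[OF tail_mid.base[of N N]] b[of N] by (simp add: \<Psi>_def)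
  have d0: "0 \<le> d N" for N
    unfolding d_def by (rule cInf_greatest[OF Sne]) (use \<Psi>0 in \<open>auto simp: S_def\<close>)
  have "Bseq d" by (rule BseqI'[of _ "a + b"]) (use d0 dbd in auto)
  then have "convergent d" by (rule Bseq_mono_convergent) (use dmono in auto)
  then obtain D where D: "d \<longlonglongrightarrow> D" by (auto simp: convergent_def)
  have dD: "d N \<le> D" for N by (rule LIMSEQ_le_const[OF D]) (use dmono in blast)
  have "\<exists>c h. tail_mid v g N c h \<and> \<Psi> c h < d N + 1 / real (Suc N)" for N
  proof -
    have "Inf (S N) < d N + 1 / real (Suc N)" by (simp add: d_def)
    from cInf_lessD[OF Sne this] obtain s where s: "s \<in> S N" "s < d N + 1 / real (Suc N)" by blast
    then obtain c h where "s = \<Psi> c h" "tail_mid v g N c h" unfolding S_def by blast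
    then show ?thesis using s(2) by blast
  qed
  then obtain c h where ch: "\<And>N. tail_mid v g N (c N) (h N)" "\<And>N. \<Psi> (c N) (h N) < d N + 1 / real (Suc N)" by metis
  note cR = tail_mid_R_pair[OF R \<beta> ch(1)]
  note L = R_pairD[OF cR]
  note [measurable] = L(4)
  define \<eta> where "\<eta> N = D - d N + 1 / real (Suc N)" for N
  have "(\<lambda>N. D - d N + 1 / real (Suc N)) \<longlonglongrightarrow> D - D + 0" by (intro tendsto_intros D lim_1_over_n[THEN LIMSEQ_Suc])
  then have \<eta>: "\<eta> \<longlonglongrightarrow> 0" by (simp add: \<eta>_def[abs_def])
  \<comment> \<open>The midpoint of two almost minimisers competes for \<open>d N\<close>, so
    there is no room for a large defect of convexity.\<close>
  have defect: "pint 2 (\<lambda>x. h m x - h n x) / 4 + (LINT x|lborel. midpoint_defect \<beta> (c m x) (c n x)) \<le> \<eta> N"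
    if mn: "m \<ge> N" "n \<ge> N" for m n N
  proof -
    have "tail_mid v g N (\<lambda>x. (1/2) * (c m x + c n x)) (\<lambda>x. (1/2) *\<^sub>R (h m x + h n x))"
      by (intro tail_mid.mid tail_mid_antimono[OF ch(1)] mn)
    from dle[OF this] have "d N \<le> (pint 2 (h m) + pint 2 (h n)) / 2 - pint 2 (\<lambda>x. h m x - h n x) / 4
       + ((pint \<beta> (c m) + pint \<beta> (c n)) / 2 - (LINT x|lborel. midpoint_defect \<beta> (c m x) (c n x)))"
      unfolding \<Psi>_def L2_parallelogram[OF L(2) L(2)] pint_midpoint(2)[OF L(1) L(1) \<beta>] .
    moreover have "1 / real (Suc m) \<le> 1 / real (Suc N)" "1 / real (Suc n) \<le> 1 / real (Suc N)" using mn by (auto intro!: divide_left_mono)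
    ultimately show ?thesis using ch(2)[of m] ch(2)[of n] dD[of m] dD[of n] unfolding \<Psi>_def \<eta>_def by argo
  qed
  have defect0: "0 \<le> (LINT x|lborel. midpoint_defect \<beta> (c m x) (c n x))" for m n
    by (rule integral_nonneg_AE) (simp add: midpoint_defect_nonneg[OF \<beta>])
  have "\<exists>G\<in>Lq_space 2. (\<lambda>n. pint 2 (\<lambda>x. h n x - G x)) \<longlonglongrightarrow> 0"
  proof (rule L2_complete[OF L(2)])
    fix e :: real assume e: "e > 0"
    have "eventually (\<lambda>N. \<eta> N < e / 4) sequentially" by (rule order_tendstoD(2)[OF \<eta>]) (use e in simp)
    then obtain N where N: "\<eta> N < e / 4" by (auto simp: eventually_sequentially)
    have "pint 2 (\<lambda>x. h m x - h n x) < e" if "m \<ge> N" "n \<ge> N" for m n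
      using defect[OF that] defect0[of m n] N by argo
    then show "\<exists>N. \<forall>m\<ge>N. \<forall>n\<ge>N. pint 2 (\<lambda>x. h m x - h n x) < e" by blast
  qed
  then obtain G where G: "G \<in> Lq_space 2" "(\<lambda>n. pint 2 (\<lambda>x. h n x - G x)) \<longlonglongrightarrow> 0" by blast
  \<comment> \<open>Averages of values close to \<open>u x\<close> are close to \<open>u
    x\<close>.\<close>
  have clim: "AE x in lborel. (\<lambda>n. c n x) \<longlonglongrightarrow> u x"
    using lim
  proof eventually_elim
    case (elim x)
    show ?case
    proof (rule LIMSEQ_I)
      fix e :: real assume e: "e > 0"
      then obtain N where "\<forall>n\<ge>N. norm (v n x - u x) < e / 2" using LIMSEQ_D[OF elim, of "e/2"] by auto
      then have N: "\<And>n. n \<ge> N \<Longrightarrow> \<bar>v n x - u x\<bar> \<le> e / 2" by (auto intro: less_imp_le)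
      have "norm (c n x - u x) < e" if "n \<ge> N" for n
        using tail_mid_pointwise[OF tail_mid_antimono[OF ch(1) that] N] e by simp
      then show "\<exists>no. \<forall>n\<ge>no. norm (c n x - u x) < e" by blast
    qed
  qed
  have cb: "pint \<beta> (c n) \<le> b" for n by (rule tail_mid_bounds(2)[OF R \<beta> ch(1) b])
  \<comment> \<open>The \<open>L\<^sup>\<beta>\<close> Cauchy property follows from the small
    defects by uniform convexity; the limit must be \<open>u\<close>.\<close>
  have near: "\<exists>N. \<forall>n\<ge>N. integrable lborel (\<lambda>x. norm (c n x - u x) powr \<beta>) \<and> pint \<beta> (\<lambda>x. c n x - u x) < e" if e: "e > 0" for e
  proof -
    define e' where "e' = e / (4 * (\<bar>b\<bar> + 1))"
    have e': "e' > 0" "e' * (2 * \<bar>b\<bar>) \<le> e / 2" using e by (auto simp: e'_def field_simps)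
    obtain C where C: "C \<ge> 0" "\<And>s t. \<bar>s - t\<bar> powr \<beta> \<le> e' * (\<bar>s\<bar> powr \<beta> + \<bar>t\<bar> powr \<beta>) + C * midpoint_defect \<beta> s t"
      using uniform_convexity[OF \<beta> e'(1)] by blast
    have "(\<lambda>N. C * \<eta> N) \<longlonglongrightarrow> C * 0" by (intro tendsto_intros \<eta>)
    then have "eventually (\<lambda>N. C * \<eta> N < e / 4) sequentially" by (rule order_tendstoD(2)) (use e in simp)
    then obtain N where N: "C * \<eta> N < e / 4" by (auto simp: eventually_sequentially)
    have bd: "(LINT x|lborel. norm (c n x - c m x) powr \<beta>) \<le> e / 2 + e / 4" if mn: "n \<ge> N" "m \<ge> N" for m n
    proof -
      have i: "integrable lborel (\<lambda>x. e' * (norm (c n x) powr \<beta> + norm (c m x) powr \<beta>) + C * midpoint_defect \<beta> (c n x) (c m x))"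
        using Lq_spaceD(2)[OF L(1)] pint_midpoint(1)[OF L(1) L(1) \<beta>] by auto
      have "(LINT x|lborel. norm (c n x - c m x) powr \<beta>) \<le> (LINT x|lborel. e' * (norm (c n x) powr \<beta> + norm (c m x) powr \<beta>) + C * midpoint_defect \<beta> (c n x) (c m x))"
        by (rule integral_mono[OF _ i]) (use Lq_spaceD(2)[OF Lq_space_diff(1)[OF L(1) L(1)]] \<beta> C(2) in auto)
      also have "\<dots> = e' * (pint \<beta> (c n) + pint \<beta> (c m)) + C * (LINT x|lborel. midpoint_defect \<beta> (c n x) (c m x))"
        using Lq_spaceD(2)[OF L(1)] pint_midpoint(1)[OF L(1) L(1) \<beta>] by (simp add: pint_def)
      also have "\<dots> \<le> e' * (2 * \<bar>b\<bar>) + C * \<eta> N"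
        using cb[of n] cb[of m] e'(1) C(1) defect[OF mn] pint_nonneg[of 2 "\<lambda>x. h n x - h m x"]
        by (intro add_mono mult_left_mono) auto
      finally show ?thesis using e'(2) N by argo
    qed
    have "integrable lborel (\<lambda>x. norm (c n x - u x) powr \<beta>) \<and> pint \<beta> (\<lambda>x. c n x - u x) < e" if n: "n \<ge> N" for n
    proof -
      have l: "AE x in lborel. (\<lambda>m. norm (c n x - c m x) powr \<beta>) \<longlonglongrightarrow> norm (c n x - u x) powr \<beta>"
        using clim by eventually_elim (use \<beta> in \<open>auto intro!: tendsto_powr' tendsto_intros\<close>)
      note F = fatou_bound[OF Lq_spaceD(2)[OF Lq_space_diff(1)[OF L(1) L(1)]] _ _ l bd[OF n], of N]
      have "integrable lborel (\<lambda>x. norm (c n x - u x) powr \<beta>)" by (rule F(1)) (use \<beta> in auto)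
      moreover have "(LINT x|lborel. norm (c n x - u x) powr \<beta>) \<le> e / 2 + e / 4" by (rule F(2)) (use \<beta> in auto)
      ultimately show ?thesis using e by (simp add: pint_def)
    qed
    then show ?thesis by blast
  qed
  have uL: "u \<in> Lq_space \<beta>"
  proof -
    obtain N where "integrable lborel (\<lambda>x. norm (c N x - u x) powr \<beta>)" using near[of 1] by auto
    then have "(\<lambda>x. c N x - u x) \<in> Lq_space \<beta>" by (simp add: Lq_space_def)
    from Lq_space_diff(1)[OF L(1)[of N] this] \<beta> show ?thesis by simp
  qed
  have "H_pair \<beta> u G"
  proof (rule H_pair_limit[OF uL G(1) \<beta>])
    fix e :: real assume e: "e > 0"
    obtain N1 where N1: "\<forall>n\<ge>N1. pint \<beta> (\<lambda>x. c n x - u x) < e" using near[OF e] by blast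
    have "eventually (\<lambda>n. pint 2 (\<lambda>x. h n x - G x) < e) sequentially" using order_tendstoD(2)[OF G(2) e] .
    then obtain N2 where N2: "\<forall>n\<ge>N2. pint 2 (\<lambda>x. h n x - G x) < e" by (auto simp: eventually_sequentially)
    have "H_pair \<beta> (c (max N1 N2)) (h (max N1 N2))" using cR by (simp add: R_pair_def)
    then show "\<exists>v h. H_pair \<beta> v h \<and> pint 2 (\<lambda>x. h x - G x) < e \<and> pint \<beta> (\<lambda>x. v x - u x) < e"
      using N1 N2 by (intro exI[of _ "c (max N1 N2)"] exI[of _ "h (max N1 N2)"]) auto
  qed
  then have RG: "R_pair \<beta> u G" using rad by (simp add: R_pair_def)
  \<comment> \<open>From a late index on all Dirichlet integrals are below \<open>A + e\<close>,
    and so are those of the averages by convexity.\<close>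
  have "pint 2 G \<le> A"
  proof (rule field_le_epsilon)
    fix e :: real assume e: "e > 0"
    have "eventually (\<lambda>n. pint 2 (g n) < A + e) sequentially" by (rule order_tendstoD(2)[OF A]) (use e in simp)
    then obtain N where N: "\<And>n. n \<ge> N \<Longrightarrow> pint 2 (g n) < A + e" by (auto simp: eventually_sequentially)
    have hb: "pint 2 (h n) \<le> A + e" if "n \<ge> N" for n
      by (rule tail_mid_bounds(1)[OF R \<beta> tail_mid_antimono[OF ch(1) that] _ b(2)]) (use N in \<open>auto intro: less_imp_le\<close>)
    have i2: "integrable lborel (\<lambda>x. norm (h n x - G x) powr 2)" for n
      by (rule Lq_spaceD(2)[OF Lq_space_diff(1)[OF L(2) G(1)]]) simp
    have "(\<lambda>n. LINT x|lborel. norm (norm (h n x - G x) powr 2)) \<longlonglongrightarrow> 0" using G(2) by (simp add: pint_def)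
    from tendsto_L1_AE_subseq[OF i2 this] obtain r where r: "strict_mono r" "AE x in lborel. (\<lambda>n. norm (h (r n) x - G x) powr 2) \<longlonglongrightarrow> 0"
      by blast
    have l: "AE x in lborel. (\<lambda>n. norm (h (r n) x) powr 2) \<longlonglongrightarrow> norm (G x) powr 2"
      using r(2)
    proof eventually_elim
      case (elim x)
      then have "(\<lambda>n. sqrt ((norm (h (r n) x - G x))\<^sup>2)) \<longlonglongrightarrow> sqrt 0" unfolding powr_2_norm by (rule tendsto_real_sqrt)
      then have "(\<lambda>n. h (r n) x - G x) \<longlonglongrightarrow> 0" by (simp add: tendsto_norm_zero_iff)
      then have "(\<lambda>n. h (r n) x) \<longlonglongrightarrow> G x" by (simp add: LIM_zero_iff)
      then show ?case unfolding powr_2_norm by (intro tendsto_intros)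
    qed
    have "(LINT x|lborel. norm (G x) powr 2) \<le> A + e"
    proof (rule fatou_bound(2)[OF Lq_spaceD(2)[OF L(2)] _ _ l])
      show "(LINT x|lborel. norm (h (r n) x) powr 2) \<le> A + e" if "n \<ge> N" for n
        using hb[of "r n"] that seq_suble[OF r(1), of n] by (simp add: pint_def)
    qed (use Lq_spaceD(1)[OF G(1)] in auto)
    then show "pint 2 G \<le> A + e" by (simp add: pint_def)
  qed
  then show ?thesis using RG by blast
qed

text \<open>The integrands of the weighted mass and of the square integral of \<open>v\<^sup>2 -
  u\<^sup>2\<close>.\<close>

definition square_gap :: "(plane \<Rightarrow> real) \<Rightarrow> (plane \<Rightarrow> real) \<Rightarrow> plane \<Rightarrow> real" where
  "square_gap v u x = \<bar>(v x)\<^sup>2 - (u x)\<^sup>2\<bar> * log_weight x + ((v x)\<^sup>2 - (u x)\<^sup>2)\<^sup>2"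

lemma square_gap_le:
  "square_gap v u x \<le> 2 * (((v x)\<^sup>2 * log_weight x + ((v x)\<^sup>2)\<^sup>2) + ((u x)\<^sup>2 * log_weight x + ((u x)\<^sup>2)\<^sup>2))" "0 \<le> square_gap v u x"
proof -
  have l: "0 \<le> log_weight x" using log_weight_ge_1[of x] by simp
  have "\<bar>(v x)\<^sup>2 - (u x)\<^sup>2\<bar> \<le> (v x)\<^sup>2 + (u x)\<^sup>2" by (simp add: abs_le_iff)
  then have 1: "\<bar>(v x)\<^sup>2 - (u x)\<^sup>2\<bar> * log_weight x \<le> ((v x)\<^sup>2 + (u x)\<^sup>2) * log_weight x" using l by (rule mult_right_mono)
  have 0: "0 \<le> (v x)\<^sup>2 * (u x)\<^sup>2" "0 \<le> (v x)\<^sup>2 * log_weight x" "0 \<le> (u x)\<^sup>2 * log_weight x" using l by simp_all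
  have "((v x)\<^sup>2 - (u x)\<^sup>2)\<^sup>2 = ((v x)\<^sup>2)\<^sup>2 + ((u x)\<^sup>2)\<^sup>2 - 2 * ((v x)\<^sup>2 * (u x)\<^sup>2)" by (simp add: power2_diff)
  then show "square_gap v u x \<le> 2 * (((v x)\<^sup>2 * log_weight x + ((v x)\<^sup>2)\<^sup>2) + ((u x)\<^sup>2 * log_weight x + ((u x)\<^sup>2)\<^sup>2))"
    using 1 0 zero_le_power2[of "(v x)\<^sup>2"] zero_le_power2[of "(u x)\<^sup>2"] unfolding square_gap_def distrib_right by argo
  show "0 \<le> square_gap v u x" using l by (simp add: square_gap_def)
qed

text \<open>An integrable bound on \<open>|x|\<^sup>2 \<le> R\<close> common to all functions
  with the bounds \<open>a\<close> and \<open>b\<close>: a power singularity in the unit disc, a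
  constant in the annulus.\<close>

definition local_majorant :: "real \<Rightarrow> real \<Rightarrow> real \<Rightarrow> real \<Rightarrow> plane \<Rightarrow> real" where
  "local_majorant \<beta> a b R x =
    (2 * (decay_const \<beta> a b + sqrt (a * 2)) powr 2 + (decay_const \<beta> a b + sqrt (a * 4)) powr 4)
       * (indicator {0<..1} ((norm x)\<^sup>2) * ((norm x)\<^sup>2) powr (- (1/2)))
    + ((decay_const \<beta> a b)\<^sup>2 * (1 + ln (1 + sqrt R)) + ((decay_const \<beta> a b)\<^sup>2)\<^sup>2) * indicator {1..R} ((norm x)\<^sup>2)"

lemma local_majorant_integrable:
  assumes "R \<ge> 1" shows "integrable lborel (local_majorant \<beta> a b R)"
  unfolding local_majorant_def[abs_def]
  using disc_power_integrable(1)[of "1/2"] annulus_area(1)[of 1 R] assms by auto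

lemma profile_local_bound:
  assumes bp: "bounded_profile \<beta> a b u F" and R: "R \<ge> 1"
  shows "AE x in lborel. (norm x)\<^sup>2 \<le> R \<longrightarrow> (u x)\<^sup>2 * log_weight x + ((u x)\<^sup>2)\<^sup>2 \<le> local_majorant \<beta> a b R x"
    and "AE x in lborel. (norm x)\<^sup>2 > 1 \<longrightarrow> \<bar>u x\<bar> \<le> decay_const \<beta> a b"
proof -
  note D = bounded_profileD[OF bp]
  let ?d = "decay_const \<beta> a b"
  have out: "\<bar>F q\<bar> \<le> ?d" if "q > 1" for q
  proof -
    have "\<bar>F q\<bar> \<le> ?d * q powr (- (1 / (\<beta> + 2)))" by (rule radial_decay[OF bp]) (use that in simp)
    also have "\<dots> \<le> ?d * 1"
      using that D(1) by (intro mult_left_mono decay_const_nonneg) (simp add: powr_minus inverse_le_1_iff ge_one_powr_ge_zero)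
    finally show ?thesis by simp
  qed
  show "AE x in lborel. (norm x)\<^sup>2 > 1 \<longrightarrow> \<bar>u x\<bar> \<le> ?d"
    using D(7) by eventually_elim (use out in auto)
  show "AE x in lborel. (norm x)\<^sup>2 \<le> R \<longrightarrow> (u x)\<^sup>2 * log_weight x + ((u x)\<^sup>2)\<^sup>2 \<le> local_majorant \<beta> a b R x"
    using D(7) AE_lborel_singleton[of 0]
  proof eventually_elim
    case (elim x)
    let ?q = "(norm x)\<^sup>2"
    have q: "?q > 0" using elim by simp
    have p: "(u x)\<^sup>2 = \<bar>u x\<bar> powr 2" "((u x)\<^sup>2)\<^sup>2 = \<bar>u x\<bar> powr 4"
      by (cases "u x = 0"; auto simp: powr_numeral)+
    have gr: "\<bar>u x\<bar> powr r \<le> (?d + sqrt (a * r)) powr r * ?q powr (- (1/2))" if "?q \<le> 1" "r > 0" for r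
      using radial_growth_at_zero[OF bp q that] elim(1) by simp
    have l0: "0 \<le> log_weight x" using log_weight_ge_1[of x] by simp
    show ?case
    proof (rule impI, cases "?q \<le> 1")
      case True
      then have "norm x \<le> 1" by (simp add: power_le_one_iff)
      then have l: "log_weight x \<le> 2" using ln_add_one_self_le_self[of "norm x"] by (simp add: log_weight_def)
      have "(u x)\<^sup>2 * log_weight x \<le> ((?d + sqrt (a * 2)) powr 2 * ?q powr (- (1/2))) * 2"
        unfolding p(1) by (rule mult_mono[OF gr[OF True] l _ l0]) auto
      moreover have "((u x)\<^sup>2)\<^sup>2 \<le> (?d + sqrt (a * 4)) powr 4 * ?q powr (- (1/2))"
        unfolding p(2) by (rule gr[OF True]) auto
      moreover have "0 \<le> (?d\<^sup>2 * (1 + ln (1 + sqrt R)) + (?d\<^sup>2)\<^sup>2) * indicator {1..R} ?q"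
        using R by (intro mult_nonneg_nonneg add_nonneg_nonneg) auto
      ultimately show "(u x)\<^sup>2 * log_weight x + ((u x)\<^sup>2)\<^sup>2 \<le> local_majorant \<beta> a b R x"
        using True q unfolding local_majorant_def distrib_right by simp
    next
      assume le: "?q \<le> R"
      case False
      have "\<bar>u x\<bar> \<le> ?d" using out[of ?q] False elim(1) by simp
      then have "\<bar>u x\<bar>\<^sup>2 \<le> ?d\<^sup>2" by (intro power_mono) auto
      then have u2: "(u x)\<^sup>2 \<le> ?d\<^sup>2" by simp
      have "norm x \<le> sqrt R" using le by (intro real_le_rsqrt)
      then have "log_weight x \<le> 1 + ln (1 + sqrt R)" unfolding log_weight_def by (intro add_left_mono ln_mono) (auto simp: add_pos_nonneg)
      then have "(u x)\<^sup>2 * log_weight x \<le> ?d\<^sup>2 * (1 + ln (1 + sqrt R))" using u2 l0 by (intro mult_mono) auto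
      moreover have "((u x)\<^sup>2)\<^sup>2 \<le> (?d\<^sup>2)\<^sup>2" by (rule power_mono[OF u2]) simp
      ultimately show "(u x)\<^sup>2 * log_weight x + ((u x)\<^sup>2)\<^sup>2 \<le> local_majorant \<beta> a b R x"
        using False le unfolding local_majorant_def by simp
    qed
  qed
qed

text \<open>Dominated convergence on bounded sets, uniformly small tails outside. This is
  convergence of the squares in the two norms that control the logarithmic energy.\<close>

lemma square_gap_tendsto_0:
  assumes bp: "\<And>n. bounded_profile \<beta> a b (v n) (F n)" and bu: "bounded_profile \<beta> a b u G"
    and lim: "AE x in lborel. (\<lambda>n. v n x) \<longlonglongrightarrow> u x"
  shows "integrable lborel (square_gap (v n) u)" "(\<lambda>n. LINT x|lborel. square_gap (v n) u x) \<longlonglongrightarrow> 0"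
proof -
  note D = bounded_profileD[OF bu]
  note [measurable] = bounded_profileD(9)[OF bp] D(9)
  have gm [measurable]: "square_gap (v n) u \<in> borel_measurable borel" for n unfolding square_gap_def[abs_def] by measurable
  have i: "integrable lborel (\<lambda>x. (w x)\<^sup>2 * log_weight x)" "integrable lborel (\<lambda>x. ((w x)\<^sup>2)\<^sup>2)"
    if "bounded_profile \<beta> a b w H" for w H
    using profile_log_density(1)[OF that] by (auto simp: log_density_def)
  show ig: "integrable lborel (square_gap (v n) u)" for n
  proof (rule integrable_dominated)
    show "integrable lborel (\<lambda>x. 2 * (((v n x)\<^sup>2 * log_weight x + ((v n x)\<^sup>2)\<^sup>2) + ((u x)\<^sup>2 * log_weight x + ((u x)\<^sup>2)\<^sup>2)))"
      using i[OF bp] i[OF bu] by auto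
    show "norm (square_gap (v n) u x) \<le> 2 * (((v n x)\<^sup>2 * log_weight x + ((v n x)\<^sup>2)\<^sup>2) + ((u x)\<^sup>2 * log_weight x + ((u x)\<^sup>2)\<^sup>2))" for x
      using square_gap_le[of "v n" u x] by simp
  qed simp
  define K where "K = 4 * (1 + (decay_const \<beta> a b)\<^sup>2) * (tail_const \<beta> a b * b)"
  show "(\<lambda>n. LINT x|lborel. square_gap (v n) u x) \<longlonglongrightarrow> 0"
  proof (rule LIMSEQ_I)
    fix e :: real assume e: "e > 0"
    have te: "tail_exp \<beta> > 0" using D(1,2) by (simp add: tail_exp_def)
    have "((\<lambda>R. K * R powr (- tail_exp \<beta>)) \<longlongrightarrow> K * 0) at_top"
      by (intro tendsto_mult tendsto_const tendsto_neg_powr filterlim_ident) (use te in auto)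
    then have "eventually (\<lambda>R. K * R powr (- tail_exp \<beta>) < e / 2) at_top" by (rule order_tendstoD(2)) (use e in simp)
    moreover have "eventually (\<lambda>R::real. R \<ge> 1) at_top" by (rule eventually_ge_at_top)
    ultimately have "eventually (\<lambda>R. K * R powr (- tail_exp \<beta>) < e / 2 \<and> R \<ge> 1) at_top" by (rule eventually_conj)
    then obtain R where R: "K * R powr (- tail_exp \<beta>) < e / 2" "R \<ge> 1" by (auto simp: eventually_at_top_linorder)
    have "(\<lambda>n. LINT x|lborel. indicator {..R} ((norm x)\<^sup>2) * square_gap (v n) u x) \<longlonglongrightarrow> (LINT x|(lborel::plane measure). 0)"
    proof (rule integral_dominated_convergence)
      show "integrable lborel (\<lambda>x. 4 * local_majorant \<beta> a b R x)" using local_majorant_integrable[OF R(2)] by simp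
      show "AE x in lborel. (\<lambda>n. indicator {..R} ((norm x)\<^sup>2) * square_gap (v n) u x) \<longlonglongrightarrow> 0"
        using lim
      proof eventually_elim
        case (elim x)
        have "(\<lambda>n. indicator {..R} ((norm x)\<^sup>2) * square_gap (v n) u x) \<longlonglongrightarrow> indicator {..R} ((norm x)\<^sup>2) * (\<bar>(u x)\<^sup>2 - (u x)\<^sup>2\<bar> * log_weight x + ((u x)\<^sup>2 - (u x)\<^sup>2)\<^sup>2)"
          unfolding square_gap_def by (intro tendsto_intros elim)
        then show ?case by simp
      qed
      show "AE x in lborel. norm (indicator {..R} ((norm x)\<^sup>2) * square_gap (v n) u x) \<le> 4 * local_majorant \<beta> a b R x" for n
        using profile_local_bound(1)[OF bp[of n] R(2)] profile_local_bound(1)[OF bu R(2)]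
      proof eventually_elim
        case (elim x)
        have lm: "0 \<le> local_majorant \<beta> a b R x" unfolding local_majorant_def using R(2)
          by (intro add_nonneg_nonneg mult_nonneg_nonneg) auto
        show ?case
        proof (cases "(norm x)\<^sup>2 \<le> R")
          case True
          then have "square_gap (v n) u x \<le> 4 * local_majorant \<beta> a b R x" using elim square_gap_le(1)[of "v n" u x] by argo
          then show ?thesis using True square_gap_le(2)[of "v n" u x] by simp
        qed (use lm in auto)
      qed
    qed measurable
    then have "eventually (\<lambda>n. (LINT x|lborel. indicator {..R} ((norm x)\<^sup>2) * square_gap (v n) u x) < e / 2) sequentially"
      by (intro order_tendstoD(2)) (use e in auto)
    then obtain N where N: "\<And>n. n \<ge> N \<Longrightarrow> (LINT x|lborel. indicator {..R} ((norm x)\<^sup>2) * square_gap (v n) u x) < e / 2"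
      by (auto simp: eventually_sequentially)
    have tail: "(LINT x|lborel. indicator {R<..} ((norm x)\<^sup>2) * square_gap (v n) u x) \<le> K * R powr (- tail_exp \<beta>)" for n
    proof -
      let ?d = "(decay_const \<beta> a b)\<^sup>2"
      have j: "integrable lborel (\<lambda>x. indicator {R<..} ((norm x)\<^sup>2) * f x)" if "integrable lborel f" for f :: "plane \<Rightarrow> real"
      proof -
        have [measurable]: "f \<in> borel_measurable borel" using that by auto
        show ?thesis by (rule Bochner_Integration.integrable_bound[OF that]) (auto simp: indicator_def)
      qed
      have "(LINT x|lborel. indicator {R<..} ((norm x)\<^sup>2) * square_gap (v n) u x)
         \<le> (LINT x|lborel. 2 * (1 + ?d) * (indicator {R<..} ((norm x)\<^sup>2) * ((v n x)\<^sup>2 * log_weight x)) + 2 * (1 + ?d) * (indicator {R<..} ((norm x)\<^sup>2) * ((u x)\<^sup>2 * log_weight x)))"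
      proof (rule integral_mono_AE)
        show "integrable lborel (\<lambda>x. indicator {R<..} ((norm x)\<^sup>2) * square_gap (v n) u x)" by (rule j[OF ig])
        show "integrable lborel (\<lambda>x. 2 * (1 + ?d) * (indicator {R<..} ((norm x)\<^sup>2) * ((v n x)\<^sup>2 * log_weight x)) + 2 * (1 + ?d) * (indicator {R<..} ((norm x)\<^sup>2) * ((u x)\<^sup>2 * log_weight x)))"
          by (intro Bochner_Integration.integrable_add integrable_mult_right j i(1)[OF bp] i(1)[OF bu])
        show "AE x in lborel. indicator {R<..} ((norm x)\<^sup>2) * square_gap (v n) u x \<le> 2 * (1 + ?d) * (indicator {R<..} ((norm x)\<^sup>2) * ((v n x)\<^sup>2 * log_weight x)) + 2 * (1 + ?d) * (indicator {R<..} ((norm x)\<^sup>2) * ((u x)\<^sup>2 * log_weight x))"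
          using profile_local_bound(2)[OF bp[of n] R(2)] profile_local_bound(2)[OF bu R(2)]
        proof eventually_elim
          case (elim x)
          have *: "(w x)\<^sup>2 * log_weight x + ((w x)\<^sup>2)\<^sup>2 \<le> (1 + ?d) * ((w x)\<^sup>2 * log_weight x)" if "\<bar>w x\<bar> \<le> decay_const \<beta> a b" for w :: "plane \<Rightarrow> real"
          proof -
            have "\<bar>w x\<bar>\<^sup>2 \<le> ?d" using that by (intro power_mono) auto
            then have "((w x)\<^sup>2)\<^sup>2 \<le> ?d * ((w x)\<^sup>2 * log_weight x)" using log_weight_ge_1[of x]
              unfolding power2_eq_square[of "(w x)\<^sup>2"] by (intro mult_mono) (auto simp: mult_le_cancel_left1)
            then show ?thesis by (simp add: distrib_right)
          qed
          show ?case
          proof (cases "(norm x)\<^sup>2 > R")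
            case True
            then have "\<bar>v n x\<bar> \<le> decay_const \<beta> a b" "\<bar>u x\<bar> \<le> decay_const \<beta> a b" using elim R(2) by auto
            note vu = *[of "v n", OF this(1)] *[of u, OF this(2)]
            have "square_gap (v n) u x \<le> 2 * ((1 + ?d) * ((v n x)\<^sup>2 * log_weight x) + (1 + ?d) * ((u x)\<^sup>2 * log_weight x))"
              by (rule order_trans[OF square_gap_le(1)], intro mult_left_mono add_mono vu) simp
            then show ?thesis using True by (simp only: distrib_left mult.assoc) (simp add: algebra_simps)
          qed simp
        qed
      qed
      also have "\<dots> = 2 * (1 + ?d) * (LINT x|lborel. indicator {R<..} ((norm x)\<^sup>2) * ((v n x)\<^sup>2 * log_weight x)) + 2 * (1 + ?d) * (LINT x|lborel. indicator {R<..} ((norm x)\<^sup>2) * ((u x)\<^sup>2 * log_weight x))"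
        using j[OF i(1)[OF bp]] j[OF i(1)[OF bu]] by simp
      also have "\<dots> \<le> 2 * (1 + ?d) * (tail_const \<beta> a b * b * R powr (- tail_exp \<beta>)) + 2 * (1 + ?d) * (tail_const \<beta> a b * b * R powr (- tail_exp \<beta>))"
        by (intro add_mono mult_left_mono weighted_square_bound(3)[OF bp R(2)] weighted_square_bound(3)[OF bu R(2)]) auto
      also have "\<dots> = K * R powr (- tail_exp \<beta>)" by (simp add: K_def algebra_simps)
      finally show ?thesis .
    qed
    have "norm ((LINT x|lborel. square_gap (v n) u x) - 0) < e" if n: "n \<ge> N" for n
    proof -
      have j: "integrable lborel (\<lambda>x. indicator X ((norm x)\<^sup>2) * square_gap (v n) u x)" if [measurable]: "X \<in> sets borel" for X
        by (rule Bochner_Integration.integrable_bound[OF ig[of n]]) (auto simp: indicator_def)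
      have "(LINT x|lborel. square_gap (v n) u x) = (LINT x|lborel. indicator {..R} ((norm x)\<^sup>2) * square_gap (v n) u x + indicator {R<..} ((norm x)\<^sup>2) * square_gap (v n) u x)"
        by (intro Bochner_Integration.integral_cong) (auto simp: indicator_def)
      also have "\<dots> = (LINT x|lborel. indicator {..R} ((norm x)\<^sup>2) * square_gap (v n) u x) + (LINT x|lborel. indicator {R<..} ((norm x)\<^sup>2) * square_gap (v n) u x)"
        by (intro Bochner_Integration.integral_add j) auto
      finally have "(LINT x|lborel. square_gap (v n) u x) < e" using N[OF n] tail[of n] R(1) by argo
      moreover have "0 \<le> (LINT x|lborel. square_gap (v n) u x)" by (rule integral_nonneg_AE) (simp add: square_gap_le(2))
      ultimately show ?thesis by simp
    qed
    then show "\<exists>n0. \<forall>n\<ge>n0. norm ((LINT x|lborel. square_gap (v n) u x) - 0) < e" by blast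
  qed
qed

text \<open>The difference of the energies is estimated with a free parameter \<open>e\<close>:
  first \<open>n\<close> tends to infinity for fixed \<open>e\<close>, then \<open>e\<close> to
  zero.\<close>

lemma V0_mass_tendsto:
  assumes bp: "\<And>n. bounded_profile \<beta> a b (v n) (F n)" and bu: "bounded_profile \<beta> a b u G"
    and lim: "AE x in lborel. (\<lambda>n. v n x) \<longlonglongrightarrow> u x"
  shows "(\<lambda>n. V0 (v n)) \<longlonglongrightarrow> V0 u" "(\<lambda>n. LINT x|lborel. (v n x)\<^sup>2) \<longlonglongrightarrow> (LINT x|lborel. (u x)\<^sup>2)"
proof -
  define \<gamma> where "\<gamma> n = (LINT x|lborel. square_gap (v n) u x)" for n
  have \<gamma>: "\<gamma> \<longlonglongrightarrow> 0" unfolding \<gamma>_def[abs_def] by (rule square_gap_tendsto_0(2)[OF bp bu lim])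
  note Pv = profile_log_density[OF bp] and Pu = profile_log_density[OF bu]
  have ld: "log_density (\<lambda>x. (v n x)\<^sup>2 - (u x)\<^sup>2)" for n
    using log_density_add(1)[OF Pv(1) log_density_cmult(1)[OF Pu(1), of "-1"]] by simp
  have i: "integrable lborel (\<lambda>x. \<bar>(v n x)\<^sup>2 - (u x)\<^sup>2\<bar> * log_weight x)" "integrable lborel (\<lambda>x. ((v n x)\<^sup>2 - (u x)\<^sup>2)\<^sup>2)" for n
    using ld[of n] by (auto simp: log_density_def)
  have sp: "\<gamma> n = wmass (\<lambda>x. (v n x)\<^sup>2 - (u x)\<^sup>2) + sqmass (\<lambda>x. (v n x)\<^sup>2 - (u x)\<^sup>2)" for n
    unfolding \<gamma>_def square_gap_def wmass_def sqmass_def using i by simp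
  have sq0: "0 \<le> sqmass f" for f unfolding sqmass_def by (rule integral_nonneg_AE) simp
  have w: "wmass (\<lambda>x. (v n x)\<^sup>2 - (u x)\<^sup>2) \<le> \<gamma> n" "sqmass (\<lambda>x. (v n x)\<^sup>2 - (u x)\<^sup>2) \<le> \<gamma> n" "0 \<le> \<gamma> n" for n
    using sp[of n] sq0[of "\<lambda>x. (v n x)\<^sup>2 - (u x)\<^sup>2"] wmass_nonneg[of "\<lambda>x. (v n x)\<^sup>2 - (u x)\<^sup>2"] by argo+
  show "(\<lambda>n. LINT x|lborel. (v n x)\<^sup>2) \<longlonglongrightarrow> (LINT x|lborel. (u x)\<^sup>2)"
  proof (rule LIM_zero_cancel, rule tendsto_rabs_zero_cancel, rule tendsto_sandwich[OF _ _ tendsto_const \<gamma>])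
    have "\<bar>(LINT x|lborel. (v n x)\<^sup>2) - (LINT x|lborel. (u x)\<^sup>2)\<bar> \<le> \<gamma> n" for n
    proof -
      have "(LINT x|lborel. (v n x)\<^sup>2) - (LINT x|lborel. (u x)\<^sup>2) = (LINT x|lborel. (v n x)\<^sup>2 - (u x)\<^sup>2)"
        using Pv(4) Pu(4) by simp
      also have "\<bar>\<dots>\<bar> \<le> wmass (\<lambda>x. (v n x)\<^sup>2 - (u x)\<^sup>2)" unfolding wmass_def real_norm_def[symmetric]
      proof (rule Bochner_Integration.integral_norm_bound_integral)
        show "integrable lborel (\<lambda>x. norm ((v n x)\<^sup>2 - (u x)\<^sup>2) * log_weight x)" using i(1)[of n] by simp
        show "norm ((v n x)\<^sup>2 - (u x)\<^sup>2) \<le> norm ((v n x)\<^sup>2 - (u x)\<^sup>2) * log_weight x" for x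
          using mult_left_mono[OF log_weight_ge_1[of x], of "norm ((v n x)\<^sup>2 - (u x)\<^sup>2)"] by simp
      qed (use Pv(4) Pu(4) in auto)
      finally show ?thesis using w(1)[of n] by linarith
    qed
    then show "\<forall>\<^sub>F n in sequentially. \<bar>(LINT x|lborel. (v n x)\<^sup>2) - (LINT x|lborel. (u x)\<^sup>2)\<bar> \<le> \<gamma> n" by simp
  qed simp
  define L where "L n = log_energy (\<lambda>x. (v n x)\<^sup>2) (\<lambda>x. (v n x)\<^sup>2)" for n
  define L' where "L' = log_energy (\<lambda>x. (u x)\<^sup>2) (\<lambda>x. (u x)\<^sup>2)"
  define W S where "W = \<bar>weight_const \<beta> a b\<bar>" and "S = \<bar>Lq_const \<beta> 4 a b\<bar>"
  have bnd: "\<bar>L n - L'\<bar> \<le> \<gamma> n * (W + W) + ln_neg_mass * (\<gamma> n / e\<^sup>2 + e\<^sup>2 * (2 * S + 2 * S))" if e: "e > 0" for n e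
  proof -
    have ww: "wmass (\<lambda>x. (v n x)\<^sup>2) \<le> W" "wmass (\<lambda>x. (u x)\<^sup>2) \<le> W" "sqmass (\<lambda>x. (v n x)\<^sup>2) \<le> S" "sqmass (\<lambda>x. (u x)\<^sup>2) \<le> S"
      using Pv(2,3)[of n] Pu(2,3) by (auto simp: W_def S_def)
    have "\<bar>L n - L'\<bar> \<le> wmass (\<lambda>x. (v n x)\<^sup>2 - (u x)\<^sup>2) * (wmass (\<lambda>x. (v n x)\<^sup>2) + wmass (\<lambda>x. (u x)\<^sup>2))
     + ln_neg_mass * (sqmass (\<lambda>x. (v n x)\<^sup>2 - (u x)\<^sup>2) / e\<^sup>2 + e\<^sup>2 * (2 * sqmass (\<lambda>x. (v n x)\<^sup>2) + 2 * sqmass (\<lambda>x. (u x)\<^sup>2)))"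
      unfolding L_def L'_def by (rule log_energy_diff_bound[OF Pv(1) Pu(1) e])
    also have "\<dots> \<le> \<gamma> n * (W + W) + ln_neg_mass * (\<gamma> n / e\<^sup>2 + e\<^sup>2 * (2 * S + 2 * S))"
      using w[of n] ww ln_neg_mass_nonneg wmass_nonneg
      by (intro add_mono mult_mono mult_left_mono divide_right_mono add_nonneg_nonneg) auto
    finally show ?thesis .
  qed
  have "L \<longlonglongrightarrow> L'"
  proof (rule LIMSEQ_I)
    fix r :: real assume r: "r > 0"
    define Q where "Q = ln_neg_mass * (4 * S) + 1"
    have Q: "Q > 0" using ln_neg_mass_nonneg by (simp add: Q_def S_def add_nonneg_pos)
    define e where "e = sqrt (r / (2 * Q))"
    have e: "e > 0" "e\<^sup>2 = r / (2 * Q)" using r Q by (auto simp: e_def)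
    have "(\<lambda>n. \<gamma> n * (W + W) + ln_neg_mass * (\<gamma> n / e\<^sup>2)) \<longlonglongrightarrow> 0 * (W + W) + ln_neg_mass * (0 / e\<^sup>2)"
      by (intro tendsto_intros \<gamma>) (use e in auto)
    then have "eventually (\<lambda>n. \<gamma> n * (W + W) + ln_neg_mass * (\<gamma> n / e\<^sup>2) < r / 2) sequentially"
      by (rule order_tendstoD(2)) (use r in simp)
    then obtain N where N: "\<And>n. n \<ge> N \<Longrightarrow> \<gamma> n * (W + W) + ln_neg_mass * (\<gamma> n / e\<^sup>2) < r / 2"
      by (auto simp: eventually_sequentially)
    have "ln_neg_mass * (e\<^sup>2 * (2 * S + 2 * S)) \<le> Q * e\<^sup>2" unfolding Q_def by (simp add: algebra_simps)
    also have "\<dots> = r / 2" using Q e by simp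
    finally have tl: "ln_neg_mass * (e\<^sup>2 * (2 * S + 2 * S)) \<le> r / 2" .
    have "norm (L n - L') < r" if "n \<ge> N" for n
    proof -
      have "norm (L n - L') \<le> (\<gamma> n * (W + W) + ln_neg_mass * (\<gamma> n / e\<^sup>2)) + ln_neg_mass * (e\<^sup>2 * (2 * S + 2 * S))"
        using bnd[OF e(1), of n] by (simp only: distrib_left[of ln_neg_mass] real_norm_def add.assoc)
      also have "\<dots> < r / 2 + r / 2" using N[OF that] tl by (rule add_less_le_mono)
      finally show ?thesis by simp
    qed
    then show "\<exists>N. \<forall>n\<ge>N. norm (L n - L') < r" by blast
  qed
  then have "(\<lambda>n. 1 / (2 * pi) * L n) \<longlonglongrightarrow> 1 / (2 * pi) * L'" by (intro tendsto_intros)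
  then show "(\<lambda>n. V0 (v n)) \<longlonglongrightarrow> V0 u"
    unfolding L_def L'_def V0_log_energy[OF Pv(1)] V0_log_energy[OF Pu(1)] .
qed

section \<open>First and second differences of the energy\<close>

lemma DERIV_abs_powr:
  fixes q t :: real
  assumes q: "q > 1"
  shows "((\<lambda>t. \<bar>t\<bar> powr q) has_real_derivative q * (sgn t * \<bar>t\<bar> powr (q - 1))) (at t)"
    and "((\<lambda>t. sgn t * \<bar>t\<bar> powr q) has_real_derivative q * \<bar>t\<bar> powr (q - 1)) (at t)"
proof -
  have pos: "((\<lambda>t. t powr q) has_real_derivative q * s powr (q - 1)) (at s)" if "s > 0" for s
    using that by (auto intro!: derivative_eq_intros simp: powr_diff)
  have neg: "((\<lambda>t. (- t) powr q) has_real_derivative - (q * (- s) powr (q - 1))) (at s)" if "s < 0" for s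
    using DERIV_chain2[OF pos[of "- s"] DERIV_minus[OF DERIV_ident]] that by simp
  have lim0: "((\<lambda>h. \<bar>h\<bar> powr (q - 1)) \<longlongrightarrow> 0) (at (0::real))"
  proof -
    have "((\<lambda>h. \<bar>h\<bar> powr (q - 1)) \<longlongrightarrow> \<bar>0\<bar> powr (q - 1)) (at (0::real))"
      using q by (intro tendsto_powr' tendsto_intros) auto
    then show ?thesis by simp
  qed
  have e: "\<bar>h\<bar> powr q = \<bar>h\<bar> powr (q - 1) * \<bar>h\<bar>" for h :: real
    by (cases "h = 0") (auto simp: powr_diff)
  consider "t > 0" | "t < 0" | "t = 0" by linarith
  then show "((\<lambda>t. \<bar>t\<bar> powr q) has_real_derivative q * (sgn t * \<bar>t\<bar> powr (q - 1))) (at t)"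
  proof cases
    case 1
    have "((\<lambda>t. \<bar>t\<bar> powr q) has_real_derivative q * t powr (q - 1)) (at t)"
      by (rule has_field_derivative_transform_within_open[OF pos[OF 1], of "{0<..}"]) (use 1 in auto)
    then show ?thesis using 1 by simp
  next
    case 2
    have "((\<lambda>t. \<bar>t\<bar> powr q) has_real_derivative - (q * (- t) powr (q - 1))) (at t)"
      by (rule has_field_derivative_transform_within_open[OF neg[OF 2], of "{..<0}"]) (use 2 in auto)
    then show ?thesis using 2 by simp
  next
    case 3
    have "((\<lambda>h. (\<bar>h\<bar> powr q) / h) \<longlongrightarrow> 0) (at 0)"
    proof (rule Lim_null_comparison[OF _ lim0])
      show "\<forall>\<^sub>F h in at 0. norm (\<bar>h\<bar> powr q / h) \<le> \<bar>h\<bar> powr (q - 1)"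
        by (auto simp: e abs_mult eventually_at_filter)
    qed
    then show ?thesis using 3 by (simp add: DERIV_def)
  qed
  consider "t > 0" | "t < 0" | "t = 0" by linarith
  then show "((\<lambda>t. sgn t * \<bar>t\<bar> powr q) has_real_derivative q * \<bar>t\<bar> powr (q - 1)) (at t)"
  proof cases
    case 1
    have "((\<lambda>t. sgn t * \<bar>t\<bar> powr q) has_real_derivative q * t powr (q - 1)) (at t)"
      by (rule has_field_derivative_transform_within_open[OF pos[OF 1], of "{0<..}"]) (use 1 in auto)
    then show ?thesis using 1 by simp
  next
    case 2
    have "((\<lambda>t. sgn t * \<bar>t\<bar> powr q) has_real_derivative - (- (q * (- t) powr (q - 1)))) (at t)"
      by (rule has_field_derivative_transform_within_open[OF DERIV_minus[OF neg[OF 2]], of "{..<0}"]) (use 2 in auto)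
    then show ?thesis using 2 by simp
  next
    case 3
    have "((\<lambda>h. (sgn h * \<bar>h\<bar> powr q) / h) \<longlongrightarrow> 0) (at 0)"
    proof (rule Lim_null_comparison[OF _ lim0])
      show "\<forall>\<^sub>F h in at 0. norm (sgn h * \<bar>h\<bar> powr q / h) \<le> \<bar>h\<bar> powr (q - 1)"
        by (auto simp: e abs_mult abs_sgn_eq eventually_at_filter)
    qed
    then show ?thesis using 3 q by (simp add: DERIV_def)
  qed
qed

lemma MVT_abs:
  fixes f f' :: "real \<Rightarrow> real"
  assumes d: "\<And>t. (f has_real_derivative f' t) (at t)"
  obtains \<xi> where "\<bar>\<xi>\<bar> \<le> max \<bar>s\<bar> \<bar>t\<bar>" "f t - f s = (t - s) * f' \<xi>"
proof -
  consider "s < t" | "t < s" | "s = t" by linarith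
  then show thesis
  proof cases
    case 1
    then obtain z where "s < z" "z < t" "f t - f s = (t - s) * f' z" using MVT2[of s t f f'] d by auto
    then show ?thesis by (intro that[of z]) auto
  next
    case 2
    then obtain z where z: "t < z" "z < s" "f s - f t = (s - t) * f' z" using MVT2[of t s f f'] d by auto
    have "f t - f s = - ((s - t) * f' z)" using z(3) by linarith
    then show ?thesis using z by (intro that[of z]) (auto simp: algebra_simps)
  next
    case 3
    then show ?thesis by (intro that[of s]) auto
  qed
qed

lemma add_abs_powr_le:
  fixes x y q :: real
  assumes "q \<ge> 0"
  shows "(\<bar>x\<bar> + \<bar>y\<bar>) powr q \<le> 2 powr q * (\<bar>x\<bar> powr q + \<bar>y\<bar> powr q)"
  using norm_add_powr_le[OF assms, of "\<bar>x\<bar>" "\<bar>y\<bar>"] by simp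

lemma abs_powr_lipschitz:
  fixes x y q s :: real
  assumes q: "q > 1" and s: "\<bar>s\<bar> \<le> 1"
  shows "\<bar>\<bar>x + s * y\<bar> powr q - \<bar>x\<bar> powr q\<bar> \<le> \<bar>s\<bar> * (q * 2 powr q * (\<bar>x\<bar> powr q + \<bar>y\<bar> powr q))"
proof -
  define M where "M = \<bar>x\<bar> + \<bar>y\<bar>"
  have sy: "\<bar>s * y\<bar> \<le> \<bar>y\<bar>" using s by (simp add: abs_mult mult_left_le_one_le)
  obtain z where z: "\<bar>z\<bar> \<le> max \<bar>x\<bar> \<bar>x + s * y\<bar>" "\<bar>x + s * y\<bar> powr q - \<bar>x\<bar> powr q = (x + s * y - x) * (q * (sgn z * \<bar>z\<bar> powr (q - 1)))"
    using MVT_abs[OF DERIV_abs_powr(1)[OF q], of x "x + s * y"] by blast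
  have zM: "\<bar>z\<bar> \<le> M" using z(1) sy unfolding M_def by linarith
  have "\<bar>\<bar>x + s * y\<bar> powr q - \<bar>x\<bar> powr q\<bar> = \<bar>s\<bar> * (q * (\<bar>y\<bar> * (\<bar>sgn z\<bar> * \<bar>z\<bar> powr (q - 1))))"
    using q unfolding z(2) by (simp add: abs_mult)
  also have "\<dots> \<le> \<bar>s\<bar> * (q * (2 powr q * (\<bar>x\<bar> powr q + \<bar>y\<bar> powr q)))"
  proof (intro mult_left_mono)
    have "\<bar>y\<bar> * (\<bar>sgn z\<bar> * \<bar>z\<bar> powr (q - 1)) \<le> M * (1 * M powr (q - 1))"
      using zM q by (intro mult_mono powr_mono2) (auto simp: M_def abs_sgn_eq)
    also have "M * (1 * M powr (q - 1)) = M powr q"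
      by (cases "M = 0") (auto simp: M_def powr_diff)
    also have "M powr q \<le> 2 powr q * (\<bar>x\<bar> powr q + \<bar>y\<bar> powr q)" unfolding M_def using q by (intro add_abs_powr_le) auto
    finally show "\<bar>y\<bar> * (\<bar>sgn z\<bar> * \<bar>z\<bar> powr (q - 1)) \<le> 2 powr q * (\<bar>x\<bar> powr q + \<bar>y\<bar> powr q)" .
  qed (use q in auto)
  finally show ?thesis by (simp add: mult.assoc)
qed

text \<open>The mean value theorem, applied to the function of the step length and then to the
  derivative of \<open>|t|\<^sup>p\<close>, which is differentiable for \<open>p >
  2\<close>.\<close>

lemma abs_powr_second_difference:
  fixes x y p s :: real
  assumes p: "p > 2" and s: "\<bar>s\<bar> \<le> 1"
  shows "\<bar>x + s * y\<bar> powr p + \<bar>x - s * y\<bar> powr p - 2 * \<bar>x\<bar> powr p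
     \<le> s\<^sup>2 * (2 * p * (p - 1) * 2 powr p * (\<bar>x\<bar> powr p + \<bar>y\<bar> powr p))"
proof -
  define M where "M = \<bar>x\<bar> + \<bar>y\<bar>"
  define z where "z = s * y"
  have sy: "\<bar>z\<bar> \<le> \<bar>y\<bar>" using s by (simp add: z_def abs_mult mult_left_le_one_le)
  define f' where "f' t = p * (sgn t * \<bar>t\<bar> powr (p - 1))" for t
  have d1: "((\<lambda>t. \<bar>t\<bar> powr p) has_real_derivative f' t) (at t)" for t
    unfolding f'_def using DERIV_abs_powr(1)[of p] p by simp
  have d2: "(f' has_real_derivative p * ((p - 1) * \<bar>t\<bar> powr (p - 2))) (at t)" for t
    unfolding f'_def[abs_def] using DERIV_cmult[OF DERIV_abs_powr(2)[of "p - 1" t], of p] p by simp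
  have dh: "((\<lambda>\<theta>. \<bar>x + \<theta> * z\<bar> powr p + \<bar>x - \<theta> * z\<bar> powr p) has_real_derivative z * (f' (x + \<theta> * z) - f' (x - \<theta> * z))) (at \<theta>)" for \<theta>
  proof -
    have "((\<lambda>\<theta>. \<bar>x + \<theta> * z\<bar> powr p) has_real_derivative f' (x + \<theta> * z) * z) (at \<theta>)"
      by (rule DERIV_chain2[OF d1]) (auto intro!: derivative_eq_intros)
    moreover have "((\<lambda>\<theta>. \<bar>x - \<theta> * z\<bar> powr p) has_real_derivative f' (x - \<theta> * z) * (- z)) (at \<theta>)"
      by (rule DERIV_chain2[OF d1]) (auto intro!: derivative_eq_intros)
    ultimately show ?thesis using DERIV_add by (fastforce simp: algebra_simps)
  qed
  obtain \<theta> where th: "0 < \<theta>" "\<theta> < 1" "(\<bar>x + 1 * z\<bar> powr p + \<bar>x - 1 * z\<bar> powr p) - (\<bar>x + 0 * z\<bar> powr p + \<bar>x - 0 * z\<bar> powr p)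
      = (1 - 0) * (z * (f' (x + \<theta> * z) - f' (x - \<theta> * z)))"
    using MVT2[of 0 1 "\<lambda>\<theta>. \<bar>x + \<theta> * z\<bar> powr p + \<bar>x - \<theta> * z\<bar> powr p", OF _ dh] by auto
  have tz: "\<bar>\<theta> * z\<bar> \<le> \<bar>y\<bar>" using sy th by (simp add: abs_mult) (meson abs_ge_zero less_imp_le mult_left_le_one_le order_trans)
  obtain \<xi> where xi: "\<bar>\<xi>\<bar> \<le> max \<bar>x - \<theta> * z\<bar> \<bar>x + \<theta> * z\<bar>" "f' (x + \<theta> * z) - f' (x - \<theta> * z) = ((x + \<theta> * z) - (x - \<theta> * z)) * (p * ((p - 1) * \<bar>\<xi>\<bar> powr (p - 2)))"
    using MVT_abs[OF d2] by blast
  have xiM: "\<bar>\<xi>\<bar> \<le> M" using xi(1) tz unfolding M_def by linarith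
  have "\<bar>x + s * y\<bar> powr p + \<bar>x - s * y\<bar> powr p - 2 * \<bar>x\<bar> powr p = z * (2 * \<theta> * z * (p * ((p - 1) * \<bar>\<xi>\<bar> powr (p - 2))))"
    using th(3) unfolding xi(2) by (simp add: z_def)
  also have "\<dots> = s\<^sup>2 * (2 * p * (p - 1) * (\<theta> * (y\<^sup>2 * \<bar>\<xi>\<bar> powr (p - 2))))" by (simp add: z_def power2_eq_square)
  also have "\<dots> \<le> s\<^sup>2 * (2 * p * (p - 1) * (1 * (M\<^sup>2 * M powr (p - 2))))"
  proof (intro mult_left_mono mult_mono powr_mono2)
    show "y\<^sup>2 \<le> M\<^sup>2" by (simp add: abs_le_square_iff[symmetric] M_def)
  qed (use th p xiM in \<open>auto simp: M_def\<close>)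
  also have "1 * (M\<^sup>2 * M powr (p - 2)) = M powr p"
    by (cases "M = 0") (auto simp: M_def powr_diff powr_numeral)
  also have "s\<^sup>2 * (2 * p * (p - 1) * M powr p) \<le> s\<^sup>2 * (2 * p * (p - 1) * (2 powr p * (\<bar>x\<bar> powr p + \<bar>y\<bar> powr p)))"
    unfolding M_def using p by (intro mult_left_mono add_abs_powr_le) auto
  finally show ?thesis by (simp add: mult.assoc)
qed

text \<open>For exponents below \<open>2\<close> the second difference is bounded by a multiple of \<open>|z|\<^sup>\<beta>\<close>: write
  \<open>|x \<plusminus> z|\<^sup>\<beta> = ((x \<plusminus> z)\<^sup>2) powr (\<beta>/2)\<close> and use that \<open>t powr (\<beta>/2)\<close> is concave and subadditive.\<close>

lemma abs_powr_second_difference_concave: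
  fixes x z \<beta> :: real
  assumes \<beta>: "1 < \<beta>" "\<beta> < 2"
  shows "\<bar>x + z\<bar> powr \<beta> + \<bar>x - z\<bar> powr \<beta> - 2 * \<bar>x\<bar> powr \<beta> \<le> 2 * \<bar>z\<bar> powr \<beta>"
proof -
  define r where "r = \<beta> / 2"
  have r: "0 < r" "r < 1" using \<beta> by (auto simp: r_def)
  have sq: "\<bar>t\<bar> powr \<beta> = (t\<^sup>2) powr r" for t :: real
  proof (cases "t = 0")
    case False
    then have "(\<bar>t\<bar> powr 2) powr r = (t\<^sup>2) powr r" by (simp add: powr_numeral)
    moreover have "(\<bar>t\<bar> powr 2) powr r = \<bar>t\<bar> powr \<beta>" by (simp only: powr_powr) (simp add: r_def)
    ultimately show ?thesis by simp
  qed simp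
  have conc: "(S powr r + T powr r) / 2 \<le> ((S + T) / 2) powr r" if "0 \<le> S" "0 \<le> T" for S T :: real
  proof -
    let ?X = "S powr r" and ?Y = "T powr r"
    have inv: "(S powr r) powr (1 / r) = S" "(T powr r) powr (1 / r) = T" using that r by (auto simp: powr_powr)
    have g: "1 / r > 1" using r by simp
    have "((?X + ?Y) / 2) powr (1 / r) \<le> (?X powr (1 / r) + ?Y powr (1 / r)) / 2"
      using midpoint_defect_nonneg[OF g, of ?X ?Y] by (simp add: midpoint_defect_def)
    then have "((?X + ?Y) / 2) powr (1 / r) \<le> (S + T) / 2" by (simp add: inv)
    then have "(((?X + ?Y) / 2) powr (1 / r)) powr r \<le> ((S + T) / 2) powr r" using r by (intro powr_mono2) auto
    then show ?thesis using r by (simp add: powr_powr)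
  qed
  have sub: "(S + T) powr r \<le> S powr r + T powr r" if "0 \<le> S" "0 \<le> T" for S T :: real
  proof (cases "S + T = 0")
    case True
    then show ?thesis by simp
  next
    case False
    then have ST: "S + T > 0" using that by linarith
    have *: "X / (S + T) \<le> (X / (S + T)) powr r" if "0 \<le> X" "X \<le> S + T" for X
    proof (cases "X = 0")
      case False
      then have "(X / (S + T)) powr 1 \<le> (X / (S + T)) powr r" using that ST r by (intro powr_mono') auto
      then show ?thesis using that ST False by simp
    qed simp
    have "1 = S / (S + T) + T / (S + T)" using ST by (simp add: add_divide_distrib[symmetric])
    also have "\<dots> \<le> (S / (S + T)) powr r + (T / (S + T)) powr r" using that by (intro add_mono *) auto
    also have "\<dots> = (S powr r + T powr r) / (S + T) powr r" by (simp add: powr_divide add_divide_distrib)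
    finally show ?thesis using ST by (simp add: pos_le_divide_eq)
  qed
  have av: "((x + z)\<^sup>2 + (x - z)\<^sup>2) / 2 = x\<^sup>2 + z\<^sup>2" by (simp add: power2_sum power2_diff)
  have "(((x + z)\<^sup>2) powr r + ((x - z)\<^sup>2) powr r) / 2 \<le> (x\<^sup>2 + z\<^sup>2) powr r"
    using conc[of "(x + z)\<^sup>2" "(x - z)\<^sup>2"] unfolding av by simp
  also have "\<dots> \<le> (x\<^sup>2) powr r + (z\<^sup>2) powr r" by (rule sub) auto
  finally show ?thesis unfolding sq by argo
qed

definition potential :: "real \<Rightarrow> real \<Rightarrow> (plane \<Rightarrow> real) \<Rightarrow> real" where
  "potential \<beta> p u = (LINT x|lborel. 1 / \<beta> * \<bar>u x\<bar> powr \<beta> + 1 / p * \<bar>u x\<bar> powr p)"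

definition total_mass :: "(plane \<Rightarrow> real) \<Rightarrow> real" where "total_mass u = (LINT x|lborel. (u x)\<^sup>2)"

lemma potential_eq:
  assumes "u \<in> Lq_space \<beta>" "u \<in> Lq_space p"
  shows "potential \<beta> p u = pint \<beta> u / \<beta> + pint p u / p"
    "integrable lborel (\<lambda>x. 1 / \<beta> * \<bar>u x\<bar> powr \<beta> + 1 / p * \<bar>u x\<bar> powr p)"
  using Lq_spaceD(2)[OF assms(1)] Lq_spaceD(2)[OF assms(2)] by (auto simp: potential_def pint_def)

lemma energy_eq: "energy \<beta> p u = pint 2 (weak_grad u) / 2 - V0 u / 4 + potential \<beta> p u"
  by (simp add: energy_def potential_def pint_def powr_2_norm)

lemma pint_perturb:
  fixes w k :: "plane \<Rightarrow> real"
  assumes w: "w \<in> Lq_space q" and k: "k \<in> Lq_space q" and q: "q > 1" and s: "\<bar>s\<bar> \<le> 1"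
  shows "(\<lambda>x. w x + s * k x) \<in> Lq_space q"
    "\<bar>pint q (\<lambda>x. w x + s * k x) - pint q w\<bar> \<le> \<bar>s\<bar> * (q * 2 powr q * (pint q w + pint q k))"
proof -
  show L: "(\<lambda>x. w x + s * k x) \<in> Lq_space q"
    using Lq_space_add(1)[OF w Lq_space_cmult(1)[OF k, of s]] q by simp
  have i: "integrable lborel (\<lambda>x. \<bar>w x + s * k x\<bar> powr q)" "integrable lborel (\<lambda>x. \<bar>w x\<bar> powr q)" "integrable lborel (\<lambda>x. \<bar>k x\<bar> powr q)"
    using Lq_spaceD(2)[OF L] Lq_spaceD(2)[OF w] Lq_spaceD(2)[OF k] by simp_all
  have "\<bar>pint q (\<lambda>x. w x + s * k x) - pint q w\<bar> = norm (LINT x|lborel. \<bar>w x + s * k x\<bar> powr q - \<bar>w x\<bar> powr q)"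
    using i by (simp add: pint_def)
  also have "\<dots> \<le> (LINT x|lborel. \<bar>s\<bar> * (q * 2 powr q * (\<bar>w x\<bar> powr q + \<bar>k x\<bar> powr q)))"
    by (rule Bochner_Integration.integral_norm_bound_integral) (use i abs_powr_lipschitz[OF q s] in auto)
  also have "\<dots> = \<bar>s\<bar> * (q * 2 powr q * (pint q w + pint q k))" using i by (simp add: pint_def)
  finally show "\<bar>pint q (\<lambda>x. w x + s * k x) - pint q w\<bar> \<le> \<bar>s\<bar> * (q * 2 powr q * (pint q w + pint q k))" .
qed

lemma pint_second_difference:
  fixes w k :: "plane \<Rightarrow> real"
  assumes w: "w \<in> Lq_space p" and k: "k \<in> Lq_space p" and p: "p > 2" and s: "\<bar>s\<bar> \<le> 1"
  shows "pint p (\<lambda>x. w x + s * k x) + pint p (\<lambda>x. w x - s * k x) - 2 * pint p w \<le> s\<^sup>2 * (2 * p * (p - 1) * 2 powr p * (pint p w + pint p k))"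
proof -
  have p1: "p > 1" using p by simp
  have s': "\<bar>- s\<bar> \<le> 1" using s by simp
  have i: "integrable lborel (\<lambda>x. \<bar>w x + s * k x\<bar> powr p)" "integrable lborel (\<lambda>x. \<bar>w x - s * k x\<bar> powr p)" "integrable lborel (\<lambda>x. \<bar>w x\<bar> powr p)" "integrable lborel (\<lambda>x. \<bar>k x\<bar> powr p)"
    using Lq_spaceD(2)[OF pint_perturb(1)[OF w k p1 s]] Lq_spaceD(2)[OF pint_perturb(1)[OF w k p1 s']] Lq_spaceD(2)[OF w] Lq_spaceD(2)[OF k] by simp_all
  have "pint p (\<lambda>x. w x + s * k x) + pint p (\<lambda>x. w x - s * k x) - 2 * pint p w = (LINT x|lborel. \<bar>w x + s * k x\<bar> powr p + \<bar>w x - s * k x\<bar> powr p - 2 * \<bar>w x\<bar> powr p)"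
    using i by (simp add: pint_def)
  also have "\<dots> \<le> (LINT x|lborel. s\<^sup>2 * (2 * p * (p - 1) * 2 powr p * (\<bar>w x\<bar> powr p + \<bar>k x\<bar> powr p)))"
    by (rule integral_mono) (use i abs_powr_second_difference[OF p s] in auto)
  also have "\<dots> = s\<^sup>2 * (2 * p * (p - 1) * 2 powr p * (pint p w + pint p k))" using i by (simp add: pint_def)
  finally show ?thesis .
qed

lemma pint_second_difference_concave:
  fixes w k :: "plane \<Rightarrow> real"
  assumes w: "w \<in> Lq_space \<beta>" and k: "k \<in> Lq_space \<beta>" and \<beta>: "1 < \<beta>" "\<beta> < 2" and s: "0 \<le> s" "s \<le> 1"
  shows "pint \<beta> (\<lambda>x. w x + s * k x) + pint \<beta> (\<lambda>x. w x - s * k x) - 2 * pint \<beta> w \<le> 2 * s powr \<beta> * pint \<beta> k"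
proof -
  have s': "\<bar>s\<bar> \<le> 1" "\<bar>- s\<bar> \<le> 1" using s by auto
  have i: "integrable lborel (\<lambda>x. \<bar>w x + s * k x\<bar> powr \<beta>)" "integrable lborel (\<lambda>x. \<bar>w x - s * k x\<bar> powr \<beta>)" "integrable lborel (\<lambda>x. \<bar>w x\<bar> powr \<beta>)" "integrable lborel (\<lambda>x. \<bar>k x\<bar> powr \<beta>)"
    using Lq_spaceD(2)[OF pint_perturb(1)[OF w k \<beta>(1) s'(1)]] Lq_spaceD(2)[OF pint_perturb(1)[OF w k \<beta>(1) s'(2)]] Lq_spaceD(2)[OF w] Lq_spaceD(2)[OF k] by simp_all
  have "pint \<beta> (\<lambda>x. w x + s * k x) + pint \<beta> (\<lambda>x. w x - s * k x) - 2 * pint \<beta> w = (LINT x|lborel. \<bar>w x + s * k x\<bar> powr \<beta> + \<bar>w x - s * k x\<bar> powr \<beta> - 2 * \<bar>w x\<bar> powr \<beta>)"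
    using i by (simp add: pint_def)
  also have "\<dots> \<le> (LINT x|lborel. 2 * s powr \<beta> * \<bar>k x\<bar> powr \<beta>)"
  proof (rule integral_mono)
    show "\<bar>w x + s * k x\<bar> powr \<beta> + \<bar>w x - s * k x\<bar> powr \<beta> - 2 * \<bar>w x\<bar> powr \<beta> \<le> 2 * s powr \<beta> * \<bar>k x\<bar> powr \<beta>" for x
      using abs_powr_second_difference_concave[OF \<beta>, of "w x" "s * k x"] s by (simp add: abs_mult powr_mult)
  qed (use i in auto)
  also have "\<dots> = 2 * s powr \<beta> * pint \<beta> k" by (simp add: pint_def)
  finally show ?thesis .
qed

text \<open>Expanding the square shows the logarithmic energy to be a quartic polynomial in
  \<open>s\<close>, whose coefficients bound its first and second differences.\<close>

lemma log_energy_line: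
  assumes a: "log_density (\<lambda>x. (w x)\<^sup>2)" and c: "log_density (\<lambda>x. w x * k x)" and e: "log_density (\<lambda>x. (k x)\<^sup>2)"
  defines "L \<equiv> log_energy"
  shows "L (\<lambda>x. (w x + s * k x)\<^sup>2) (\<lambda>x. (w x + s * k x)\<^sup>2) =
     L (\<lambda>x. (w x)\<^sup>2) (\<lambda>x. (w x)\<^sup>2) + 4 * s * L (\<lambda>x. (w x)\<^sup>2) (\<lambda>x. w x * k x)
     + s\<^sup>2 * (4 * L (\<lambda>x. w x * k x) (\<lambda>x. w x * k x) + 2 * L (\<lambda>x. (w x)\<^sup>2) (\<lambda>x. (k x)\<^sup>2))
     + 4 * s ^ 3 * L (\<lambda>x. w x * k x) (\<lambda>x. (k x)\<^sup>2) + s ^ 4 * L (\<lambda>x. (k x)\<^sup>2) (\<lambda>x. (k x)\<^sup>2)"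
    "log_density (\<lambda>x. (w x + s * k x)\<^sup>2)"
proof -
  let ?a = "\<lambda>x. (w x)\<^sup>2" and ?c = "\<lambda>x. w x * k x" and ?e = "\<lambda>x. (k x)\<^sup>2"
  have c': "log_density (\<lambda>x. (2 * s) * ?c x)" and e': "log_density (\<lambda>x. s\<^sup>2 * ?e x)" by (intro log_density_cmult(1) c e)+
  have ac: "log_density (\<lambda>x. ?a x + (2 * s) * ?c x)" by (rule log_density_add(1)[OF a c'])
  have v: "log_density (\<lambda>x. (?a x + (2 * s) * ?c x) + s\<^sup>2 * ?e x)" by (rule log_density_add(1)[OF ac e'])
  have eq: "(\<lambda>x. (w x + s * k x)\<^sup>2) = (\<lambda>x. (?a x + (2 * s) * ?c x) + s\<^sup>2 * ?e x)"
    by (auto simp: power2_eq_square algebra_simps)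
  show "log_density (\<lambda>x. (w x + s * k x)\<^sup>2)" unfolding eq by (rule v)
  have exp: "log_energy (\<lambda>x. (?a x + (2 * s) * ?c x) + s\<^sup>2 * ?e x) f = log_energy ?a f + 2 * s * log_energy ?c f + s\<^sup>2 * log_energy ?e f"
    if f: "log_density f" for f
    by (simp only: log_energy_add[OF ac e' f] log_energy_add[OF a c' f] log_energy_cmult)
  have exp': "log_energy f (\<lambda>x. (?a x + (2 * s) * ?c x) + s\<^sup>2 * ?e x) = log_energy ?a f + 2 * s * log_energy ?c f + s\<^sup>2 * log_energy ?e f"
    if f: "log_density f" for f
    by (simp only: log_energy_commute[OF f v] exp[OF f])
  show "L (\<lambda>x. (w x + s * k x)\<^sup>2) (\<lambda>x. (w x + s * k x)\<^sup>2) =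
     L ?a ?a + 4 * s * L ?a ?c + s\<^sup>2 * (4 * L ?c ?c + 2 * L ?a ?e) + 4 * s ^ 3 * L ?c ?e + s ^ 4 * L ?e ?e"
    unfolding L_def eq exp[OF v] exp'[OF a] exp'[OF c] exp'[OF e]
      log_energy_commute[OF c a] log_energy_commute[OF e a] log_energy_commute[OF e c]
    by (simp add: algebra_simps power2_eq_square power3_eq_cube power4_eq_xxxx)
qed

lemma log_density_product:
  assumes a: "log_density (\<lambda>x. (w x)\<^sup>2)" and e: "log_density (\<lambda>x. (k x)\<^sup>2)"
    and [measurable]: "w \<in> borel_measurable borel" "k \<in> borel_measurable borel"
  shows "log_density (\<lambda>x. w x * k x)" "wmass (\<lambda>x. w x * k x) \<le> wmass (\<lambda>x. (w x)\<^sup>2) + wmass (\<lambda>x. (k x)\<^sup>2)"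
    "sqmass (\<lambda>x. w x * k x) \<le> sqmass (\<lambda>x. (w x)\<^sup>2) + sqmass (\<lambda>x. (k x)\<^sup>2)"
proof -
  have i: "integrable lborel (\<lambda>x. \<bar>(w x)\<^sup>2\<bar> * log_weight x + \<bar>(k x)\<^sup>2\<bar> * log_weight x)" "integrable lborel (\<lambda>x. ((w x)\<^sup>2)\<^sup>2 + ((k x)\<^sup>2)\<^sup>2)"
    using a e by (auto simp: log_density_def)
  have ab: "\<bar>s\<bar> * \<bar>t\<bar> \<le> s\<^sup>2 + t\<^sup>2" for s t :: real
  proof -
    have "0 \<le> \<bar>s\<bar> * \<bar>t\<bar>" by simp
    then show ?thesis using sum_squares_bound[of "\<bar>s\<bar>" "\<bar>t\<bar>"] unfolding power2_abs mult.assoc by linarith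
  qed
  have le1: "\<bar>w x * k x\<bar> * log_weight x \<le> \<bar>(w x)\<^sup>2\<bar> * log_weight x + \<bar>(k x)\<^sup>2\<bar> * log_weight x" for x
    unfolding distrib_right[symmetric] using log_weight_ge_1[of x] ab[of "w x" "k x"] by (intro mult_right_mono) (auto simp: abs_mult)
  have le2: "(w x * k x)\<^sup>2 \<le> ((w x)\<^sup>2)\<^sup>2 + ((k x)\<^sup>2)\<^sup>2" for x
    using ab[of "(w x)\<^sup>2" "(k x)\<^sup>2"] by (simp add: power_mult_distrib)
  have j1: "integrable lborel (\<lambda>x. \<bar>w x * k x\<bar> * log_weight x)"
  proof (rule integrable_dominated[OF i(1)])
    show "norm (\<bar>w x * k x\<bar> * log_weight x) \<le> \<bar>(w x)\<^sup>2\<bar> * log_weight x + \<bar>(k x)\<^sup>2\<bar> * log_weight x" for x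
    proof -
      have "0 \<le> \<bar>w x * k x\<bar> * log_weight x" using log_weight_ge_1[of x] by simp
      then show ?thesis using le1[of x] by (simp only: real_norm_def abs_of_nonneg)
    qed
  qed measurable
  have j2: "integrable lborel (\<lambda>x. (w x * k x)\<^sup>2)" by (rule integrable_dominated[OF i(2)]) (use le2 in auto)
  show "log_density (\<lambda>x. w x * k x)" using j1 j2 by (simp add: log_density_def)
  show "wmass (\<lambda>x. w x * k x) \<le> wmass (\<lambda>x. (w x)\<^sup>2) + wmass (\<lambda>x. (k x)\<^sup>2)"
    using integral_mono[OF j1 i(1) le1] a e by (simp add: wmass_def log_density_def)
  show "sqmass (\<lambda>x. w x * k x) \<le> sqmass (\<lambda>x. (w x)\<^sup>2) + sqmass (\<lambda>x. (k x)\<^sup>2)"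
    using integral_mono[OF j2 i(2) le2] a e by (simp add: sqmass_def log_density_def)
qed

lemma V0_perturb:
  assumes a: "log_density (\<lambda>x. (w x)\<^sup>2)" and e: "log_density (\<lambda>x. (k x)\<^sup>2)"
    and m [measurable]: "w \<in> borel_measurable borel" "k \<in> borel_measurable borel"
    and W: "wmass (\<lambda>x. (w x)\<^sup>2) + wmass (\<lambda>x. (k x)\<^sup>2) \<le> W" and S: "sqmass (\<lambda>x. (w x)\<^sup>2) + sqmass (\<lambda>x. (k x)\<^sup>2) \<le> S"
    and s: "0 \<le> s" "s \<le> 1"
  defines "B \<equiv> W * W + ln_neg_mass * (S + S)"
  shows "\<bar>V0 (\<lambda>x. w x + s * k x) - V0 w\<bar> \<le> s * (15 * B)"
    "\<bar>V0 (\<lambda>x. w x + s * k x) + V0 (\<lambda>x. w x - s * k x) - 2 * V0 w\<bar> \<le> s\<^sup>2 * (14 * B)"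
proof -
  note c = log_density_product[OF a e m]
  let ?a = "\<lambda>x. (w x)\<^sup>2" and ?c = "\<lambda>x. w x * k x" and ?e = "\<lambda>x. (k x)\<^sup>2"
  have sq0: "0 \<le> sqmass f" for f unfolding sqmass_def by (rule integral_nonneg_AE) simp
  have bd: "\<bar>log_energy f g\<bar> \<le> B" if "log_density f" "log_density g" "wmass f \<le> W" "wmass g \<le> W" "sqmass f \<le> S" "sqmass g \<le> S" for f g
  proof -
    have "wmass f * wmass g \<le> W * W" using that(3,4) wmass_nonneg[of f] wmass_nonneg[of g] by (intro mult_mono) linarith+
    moreover have "ln_neg_mass * (sqmass f + sqmass g) \<le> ln_neg_mass * (S + S)" using that by (intro mult_left_mono add_mono ln_neg_mass_nonneg)
    ultimately show ?thesis using log_energy_bound(2)[OF that(1,2)] unfolding B_def by linarith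
  qed
  have w: "wmass ?a \<le> W" "wmass ?c \<le> W" "wmass ?e \<le> W" "sqmass ?a \<le> S" "sqmass ?c \<le> S" "sqmass ?e \<le> S"
    using W S c(2,3) wmass_nonneg[of ?a] wmass_nonneg[of ?e] sq0[of ?a] sq0[of ?e] by linarith+
  define l0 l1 l2 l3 l4 where "l0 = log_energy ?a ?a" and "l1 = 4 * log_energy ?a ?c"
    and "l2 = 4 * log_energy ?c ?c + 2 * log_energy ?a ?e" and "l3 = 4 * log_energy ?c ?e" and "l4 = log_energy ?e ?e"
  have l: "\<bar>l1\<bar> \<le> 4 * B" "\<bar>l2\<bar> \<le> 6 * B" "\<bar>l3\<bar> \<le> 4 * B" "\<bar>l4\<bar> \<le> B"
    using bd[OF a c(1) w(1,2,4,5)] bd[OF c(1) c(1) w(2,2,5,5)] bd[OF a e w(1,3,4,6)] bd[OF c(1) e w(2,3,5,6)] bd[OF e e w(3,3,6,6)]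
    unfolding l1_def l2_def l3_def l4_def by linarith+
  have V: "V0 (\<lambda>x. w x + t * k x) = 1 / (2 * pi) * (l0 + t * l1 + t\<^sup>2 * l2 + t ^ 3 * l3 + t ^ 4 * l4)" for t
    using V0_log_energy[OF log_energy_line(2)[OF a c(1) e, of t]] log_energy_line(1)[OF a c(1) e, of t]
    by (simp add: l0_def l1_def l2_def l3_def l4_def algebra_simps)
  have V0w: "V0 w = 1 / (2 * pi) * l0" using V0_log_energy[OF a] by (simp add: l0_def)
  have pi1: "1 / (2 * pi) \<le> 1" "0 \<le> 1 / (2 * pi)" using pi_ge_two by (auto simp: divide_le_eq)
  have red: "\<bar>1 / (2 * pi) * y\<bar> \<le> Y" if "\<bar>y\<bar> \<le> Y" for y Y
    using that pi1 mult_left_le_one_le[of "\<bar>y\<bar>" "1 / (2 * pi)"] unfolding abs_mult by simp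
  have p: "s ^ 2 \<le> s" "s ^ 3 \<le> s" "s ^ 4 \<le> s" "s ^ 4 \<le> s\<^sup>2"
    using s power_decreasing[of 1 2 s] power_decreasing[of 1 3 s] power_decreasing[of 1 4 s] power_decreasing[of 2 4 s] by auto
  have B: "B \<ge> 0" using l(4) abs_ge_zero[of l4] by linarith
  have tm: "\<bar>x * l\<bar> \<le> y * C" if "0 \<le> x" "x \<le> y" "\<bar>l\<bar> \<le> C" for x y l C :: real
    using that by (simp add: abs_mult mult_mono)
  have "V0 (\<lambda>x. w x + s * k x) - V0 w = 1 / (2 * pi) * (s * l1 + s\<^sup>2 * l2 + s ^ 3 * l3 + s ^ 4 * l4)"
    unfolding V V0w by (simp add: algebra_simps)
  moreover have "\<bar>s * l1 + s\<^sup>2 * l2 + s ^ 3 * l3 + s ^ 4 * l4\<bar> \<le> s * (15 * B)"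
    using tm[OF _ _ l(1), of s s] tm[OF _ p(1) l(2)] tm[OF _ p(2) l(3)] tm[OF _ p(3) l(4)] s by simp
  ultimately show "\<bar>V0 (\<lambda>x. w x + s * k x) - V0 w\<bar> \<le> s * (15 * B)" using red by simp
  have "V0 (\<lambda>x. w x + s * k x) + V0 (\<lambda>x. w x - s * k x) - 2 * V0 w = 1 / (2 * pi) * (2 * (s\<^sup>2 * l2) + 2 * (s ^ 4 * l4))"
  proof -
    define c where "c = 1 / (2 * pi)"
    have V': "V0 (\<lambda>x. w x - s * k x) = c * (l0 - s * l1 + s\<^sup>2 * l2 - s ^ 3 * l3 + s ^ 4 * l4)"
      using V[of "- s"] by (simp add: c_def)
    show ?thesis unfolding V' V[of s] V0w c_def[symmetric] by (simp add: algebra_simps)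
  qed
  moreover have "\<bar>2 * (s\<^sup>2 * l2) + 2 * (s ^ 4 * l4)\<bar> \<le> s\<^sup>2 * (14 * B)"
    using tm[OF _ order_refl l(2), of "s\<^sup>2"] tm[OF _ p(4) l(4)] s by simp
  ultimately show "\<bar>V0 (\<lambda>x. w x + s * k x) + V0 (\<lambda>x. w x - s * k x) - 2 * V0 w\<bar> \<le> s\<^sup>2 * (14 * B)" using red by simp
qed

lemma total_mass_perturb:
  assumes iw: "integrable lborel (\<lambda>x. (w x)\<^sup>2)" and ik: "integrable lborel (\<lambda>x. (k x)\<^sup>2)"
    and [measurable]: "w \<in> borel_measurable borel" "k \<in> borel_measurable borel" and s: "0 \<le> s" "s \<le> 1"
  shows "\<bar>total_mass (\<lambda>x. w x + s * k x) - total_mass w\<bar> \<le> s * (2 * (total_mass w + total_mass k))"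
proof -
  have ab: "\<bar>s * t\<bar> * 2 \<le> s\<^sup>2 + t\<^sup>2" for s t :: real
    using sum_squares_bound[of "\<bar>s\<bar>" "\<bar>t\<bar>"] by (simp add: abs_mult)
  have iwk: "integrable lborel (\<lambda>x. w x * k x)"
  proof (rule integrable_dominated[OF Bochner_Integration.integrable_add[OF iw ik]])
    show "norm (w x * k x) \<le> (w x)\<^sup>2 + (k x)\<^sup>2" for x using ab[of "w x" "k x"] by simp
  qed measurable
  have e: "(w x + s * k x)\<^sup>2 - (w x)\<^sup>2 = 2 * s * (w x * k x) + s\<^sup>2 * (k x)\<^sup>2" for x
    by (simp add: power2_eq_square algebra_simps)
  have iv: "integrable lborel (\<lambda>x. (w x + s * k x)\<^sup>2)"
  proof -
    have "(\<lambda>x. (w x + s * k x)\<^sup>2) = (\<lambda>x. (w x)\<^sup>2 + (2 * s * (w x * k x) + s\<^sup>2 * (k x)\<^sup>2))" using e by (auto simp: algebra_simps)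
    then show ?thesis using iw ik iwk by simp
  qed
  have "total_mass (\<lambda>x. w x + s * k x) - total_mass w = (LINT x|lborel. (w x + s * k x)\<^sup>2 - (w x)\<^sup>2)"
    using iv iw by (simp add: total_mass_def)
  also have "\<bar>\<dots>\<bar> \<le> (LINT x|lborel. s * (2 * ((w x)\<^sup>2 + (k x)\<^sup>2)))"
    unfolding real_norm_def[symmetric]
  proof (rule Bochner_Integration.integral_norm_bound_integral)
    show "norm ((w x + s * k x)\<^sup>2 - (w x)\<^sup>2) \<le> s * (2 * ((w x)\<^sup>2 + (k x)\<^sup>2))" for x
    proof -
      have "\<bar>(w x + s * k x)\<^sup>2 - (w x)\<^sup>2\<bar> \<le> \<bar>2 * s * (w x * k x)\<bar> + \<bar>s\<^sup>2 * (k x)\<^sup>2\<bar>" unfolding e by (rule abs_triangle_ineq)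
      also have "\<bar>2 * s * (w x * k x)\<bar> = s * (\<bar>w x * k x\<bar> * 2)" using s by (simp add: abs_mult)
      also have "\<bar>s\<^sup>2 * (k x)\<^sup>2\<bar> = s\<^sup>2 * (k x)\<^sup>2" by simp
      also have "s * (\<bar>w x * k x\<bar> * 2) + s\<^sup>2 * (k x)\<^sup>2 \<le> s * ((w x)\<^sup>2 + (k x)\<^sup>2) + s * (k x)\<^sup>2"
        using s ab[of "w x" "k x"] power_decreasing[of 1 2 s] by (intro add_mono mult_left_mono mult_right_mono) auto
      also have "\<dots> \<le> s * (2 * ((w x)\<^sup>2 + (k x)\<^sup>2))" using s by (simp add: algebra_simps)
      finally show ?thesis by simp
    qed
  qed (use iv iw ik in auto)
  also have "\<dots> = s * (2 * (total_mass w + total_mass k))" using iw ik by (simp add: total_mass_def)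
  finally show ?thesis .
qed

section \<open>The Pohozaev fibre\<close>

text \<open>The energy of the dilation of a function by the factor \<open>sqrt \<tau>\<close>,
  in terms of the Dirichlet integral \<open>A\<close>, the local potential term
  \<open>P\<close>, the logarithmic energy \<open>V\<close> and the coefficient \<open>K\<close>
  of \<open>- \<tau>\<^sup>2 ln \<tau>\<close>. Its \<open>\<tau>\<close>-derivative is \<open>P
  - \<tau> (V/2 + K + 2 K ln \<tau>)\<close>.\<close>

definition fibre :: "real \<Rightarrow> real \<Rightarrow> real \<Rightarrow> real \<Rightarrow> real \<Rightarrow> real" where
  "fibre A P V K \<tau> = A / 2 + \<tau> * P - \<tau>\<^sup>2 * V / 4 - \<tau>\<^sup>2 * ln \<tau> * K"

text \<open>The hypothesis \<open>P = V/2 + K\<close> says that 1 is a stationary point of the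
  fibre. With \<open>s = \<tau>\<^sup>2\<close>, the difference of the two values is \<open>-P
  (\<tau> - 1)\<^sup>2 / 2 + K (s - 1 - s ln s) / 2\<close>, a sum of two nonpositive
  terms.\<close>

lemma fibre_le_1:
  assumes P: "P = V / 2 + K" and pos: "K \<ge> 0" "P \<ge> 0" "\<tau> > 0"
  shows "fibre A P V K \<tau> \<le> fibre A P V K 1"
proof -
  define s where "s = \<tau>\<^sup>2"
  have s: "s > 0" using pos by (simp add: s_def)
  have "ln (1 / s) \<le> 1 / s - 1" using s by (intro ln_le_minus_one) simp
  then have "s * (- ln s) \<le> s * (1 / s - 1)" using s by (intro mult_left_mono) (auto simp: ln_div)
  then have "s - 1 - s * ln s \<le> 0" using s by (simp add: algebra_simps)
  then have K: "K * (s - 1 - s * ln s) \<le> 0" using pos by (simp add: mult_nonneg_nonpos)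
  have ls: "ln s = 2 * ln \<tau>" using pos by (simp add: s_def ln_realpow)
  have V: "V = 2 * P - 2 * K" using P by simp
  have "fibre A P V K \<tau> - fibre A P V K 1 = - (P * (\<tau> - 1)\<^sup>2) / 2 + K * (s - 1 - s * ln s) / 2"
    by (unfold fibre_def V ls, unfold s_def) (simp add: power2_eq_square field_simps)
  moreover have "0 \<le> P * (\<tau> - 1)\<^sup>2" using pos by simp
  ultimately show ?thesis using K by argo
qed

lemma fibre_IVT:
  fixes t1 t2 V K P :: real
  assumes t: "0 < t1" "t1 \<le> t2"
    and lo: "t1 * (V / 2 + K + 2 * K * ln t1) \<le> P" and hi: "P \<le> t2 * (V / 2 + K + 2 * K * ln t2)"
  obtains \<tau> where "t1 \<le> \<tau>" "\<tau> \<le> t2" "P = \<tau> * (V / 2 + K + 2 * K * ln \<tau>)"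
proof -
  have "\<exists>\<tau>\<ge>t1. \<tau> \<le> t2 \<and> \<tau> * (V / 2 + K + 2 * K * ln \<tau>) = P"
    by (rule IVT'[OF lo hi t(2)]) (use t in \<open>auto intro!: continuous_intros\<close>)
  then show thesis using that by blast
qed

text \<open>Each fibre has a stationary point: the logarithm dominates for very small and for
  very large \<open>\<tau>\<close>.\<close>

lemma fibre_root:
  assumes K: "K > 0" and P: "P > 0"
  obtains \<tau> :: real where "\<tau> > 0" "P = \<tau> * (V / 2 + K + 2 * K * ln \<tau>)"
proof -
  define l1 l2 where "l1 = - (\<bar>V\<bar> / 2 + K) / (2 * K)" and "l2 = (\<bar>V\<bar> / 2 + P) / (2 * K)"
  have k1: "2 * K * l1 = - (\<bar>V\<bar> / 2 + K)" and k2: "2 * K * l2 = \<bar>V\<bar> / 2 + P" using K by (simp_all add: l1_def l2_def)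
  have l: "l1 \<le> 0" "0 \<le> l2" using K P by (auto simp: l1_def l2_def divide_nonpos_pos)
  have "exp l1 * (V / 2 + K + 2 * K * ln (exp l1)) \<le> 0"
    using k1 by (intro mult_nonneg_nonpos) auto
  then have lo: "exp l1 * (V / 2 + K + 2 * K * ln (exp l1)) \<le> P" using P by linarith
  have "P \<le> V / 2 + K + 2 * K * ln (exp l2)" using k2 K by (simp add: abs_if split: if_splits)
  moreover have "1 \<le> exp l2" using l by simp
  ultimately have hi: "P \<le> exp l2 * (V / 2 + K + 2 * K * ln (exp l2))"
    using P mult_mono[of 1 "exp l2" P "V / 2 + K + 2 * K * ln (exp l2)"] by simp
  have "exp l1 \<le> exp l2" using l by simp
  from fibre_IVT[OF exp_gt_zero this lo hi] obtain \<tau> where "exp l1 \<le> \<tau>" "P = \<tau> * (V / 2 + K + 2 * K * ln \<tau>)" by metis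
  then show thesis using that[of \<tau>] exp_gt_zero[of l1] by linarith
qed

text \<open>The stationary point depends continuously on the coefficients: at \<open>1 -
  \<epsilon>\<close> and \<open>1 + \<epsilon>\<close> the derivative of the unperturbed fibre
  has opposite signs, and this is stable.\<close>

lemma fibre_root_near_1:
  assumes P0: "P0 = W0 / 2 + K0" "P0 > 0" and K0: "K0 > 0" and \<epsilon>: "0 < \<epsilon>" "\<epsilon> < 1"
  obtains \<eta> :: real where "\<eta> > 0"
    "\<And>P V K. \<bar>P - P0\<bar> \<le> \<eta> \<Longrightarrow> \<bar>V - W0\<bar> \<le> \<eta> \<Longrightarrow> \<bar>K - K0\<bar> \<le> \<eta> \<Longrightarrow>
      \<exists>\<tau>. 1 - \<epsilon> \<le> \<tau> \<and> \<tau> \<le> 1 + \<epsilon> \<and> P = \<tau> * (V / 2 + K + 2 * K * ln \<tau>)"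
proof -
  define f where "f \<tau> P V K = \<tau> * (V / 2 + K + 2 * K * ln \<tau>) - P" for \<tau> P V K :: real
  define C where "C \<tau> = \<tau> * (2 + 2 * \<bar>ln \<tau>\<bar>) + 1" for \<tau> :: real
  have gen: "\<bar>v / 2 + k + 2 * y\<bar> \<le> e + e + 2 * Y" if "\<bar>v\<bar> \<le> e" "\<bar>k\<bar> \<le> e" "\<bar>y\<bar> \<le> Y" for v k y e Y :: real
    using that by linarith
  have pert: "\<bar>f \<tau> P V K - f \<tau> P0 W0 K0\<bar> \<le> C \<tau> * \<eta>"
    if "\<tau> > 0" "\<bar>P - P0\<bar> \<le> \<eta>" "\<bar>V - W0\<bar> \<le> \<eta>" "\<bar>K - K0\<bar> \<le> \<eta>" for \<tau> P V K \<eta>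
  proof -
    have "f \<tau> P V K - f \<tau> P0 W0 K0 = \<tau> * ((V - W0) / 2 + (K - K0) + 2 * ((K - K0) * ln \<tau>)) - (P - P0)"
      by (simp add: f_def algebra_simps diff_divide_distrib)
    also have "\<bar>\<dots>\<bar> \<le> \<bar>\<tau> * ((V - W0) / 2 + (K - K0) + 2 * ((K - K0) * ln \<tau>))\<bar> + \<bar>P - P0\<bar>" by (rule abs_triangle_ineq4)
    also have "\<bar>\<tau> * ((V - W0) / 2 + (K - K0) + 2 * ((K - K0) * ln \<tau>))\<bar> \<le> \<tau> * (\<eta> + \<eta> + 2 * (\<eta> * \<bar>ln \<tau>\<bar>))"
    proof -
      have "\<bar>(K - K0) * ln \<tau>\<bar> \<le> \<eta> * \<bar>ln \<tau>\<bar>" using that(4) by (simp add: abs_mult mult_right_mono)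
      then have "\<bar>(V - W0) / 2 + (K - K0) + 2 * ((K - K0) * ln \<tau>)\<bar> \<le> \<eta> + \<eta> + 2 * (\<eta> * \<bar>ln \<tau>\<bar>)"
        by (rule gen[OF that(3,4)])
      then show ?thesis using that(1) by (simp add: abs_mult)
    qed
    also have "\<bar>P - P0\<bar> \<le> \<eta>" by (rule that(2))
    finally show ?thesis by (simp add: C_def algebra_simps)
  qed
  define t1 t2 where "t1 = 1 - \<epsilon>" and "t2 = 1 + \<epsilon>"
  have t: "0 < t1" "t1 < 1" "1 < t2" using \<epsilon> by (auto simp: t1_def t2_def)
  have base: "f \<tau> P0 W0 K0 = P0 * (\<tau> - 1) + 2 * (K0 * (\<tau> * ln \<tau>))" for \<tau>
  proof -
    have "f \<tau> P0 W0 K0 = \<tau> * (P0 + 2 * K0 * ln \<tau>) - P0" by (simp only: f_def P0(1)[symmetric])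
    then show ?thesis by (simp add: algebra_simps)
  qed
  have "P0 * (t1 - 1) < 0" "K0 * (t1 * ln t1) < 0" using t P0 K0 by (auto simp: mult_pos_neg)
  then have f1: "f t1 P0 W0 K0 < 0" unfolding base by linarith
  have "P0 * (t2 - 1) > 0" "K0 * (t2 * ln t2) > 0" using t P0 K0 by auto
  then have f2: "f t2 P0 W0 K0 > 0" unfolding base by linarith
  have C0: "C \<tau> > 0" if "\<tau> > 0" for \<tau>
  proof -
    have "0 \<le> \<tau> * (2 + 2 * \<bar>ln \<tau>\<bar>)" using that by (intro mult_nonneg_nonneg) auto
    then show ?thesis by (simp add: C_def)
  qed
  have C: "C t1 > 0" "C t2 > 0" using C0 t by auto
  define \<eta> where "\<eta> = min (- f t1 P0 W0 K0 / C t1) (f t2 P0 W0 K0 / C t2)"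
  have \<eta>: "\<eta> > 0" using f1 f2 C by (simp add: \<eta>_def divide_neg_pos)
  have Ce: "C t1 * \<eta> \<le> - f t1 P0 W0 K0" "C t2 * \<eta> \<le> f t2 P0 W0 K0"
  proof -
    have "\<eta> \<le> - f t1 P0 W0 K0 / C t1" "\<eta> \<le> f t2 P0 W0 K0 / C t2" by (simp_all add: \<eta>_def)
    then show "C t1 * \<eta> \<le> - f t1 P0 W0 K0" "C t2 * \<eta> \<le> f t2 P0 W0 K0"
      unfolding pos_le_divide_eq[OF C(1)] pos_le_divide_eq[OF C(2)] by (simp_all add: mult.commute)
  qed
  show thesis
  proof (rule that[OF \<eta>])
    fix P V K assume d: "\<bar>P - P0\<bar> \<le> \<eta>" "\<bar>V - W0\<bar> \<le> \<eta>" "\<bar>K - K0\<bar> \<le> \<eta>"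
    have "f t1 P V K \<le> 0" "0 \<le> f t2 P V K"
      using pert[OF _ d, of t1] pert[OF _ d, of t2] Ce t by linarith+
    then have lo: "t1 * (V / 2 + K + 2 * K * ln t1) \<le> P" and hi: "P \<le> t2 * (V / 2 + K + 2 * K * ln t2)"
      by (simp_all add: f_def)
    have "t1 \<le> t2" using t by simp
    from fibre_IVT[OF t(1) this lo hi] show "\<exists>\<tau>. 1 - \<epsilon> \<le> \<tau> \<and> \<tau> \<le> 1 + \<epsilon> \<and> P = \<tau> * (V / 2 + K + 2 * K * ln \<tau>)"
      unfolding t1_def t2_def by metis
  qed
qed

text \<open>The coefficient of \<open>- \<tau>\<^sup>2 ln \<tau>\<close> in the energy of a
  dilation.\<close>

definition mass_coeff :: "(plane \<Rightarrow> real) \<Rightarrow> real" where "mass_coeff u = (total_mass u)\<^sup>2 / (16 * pi)"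

abbreviation dirichlet :: "(plane \<Rightarrow> real) \<Rightarrow> real" where "dirichlet u \<equiv> pint 2 (weak_grad u)"

lemma Hr_profile:
  assumes u: "u \<in> Hr_space \<beta>" and \<beta>: "1 < \<beta>" "\<beta> < 2" and b: "a > 0" "dirichlet u \<le> a" "pint \<beta> u \<le> b"
  obtains F where "bounded_profile \<beta> a b u F"
  using R_pair_bounded_profile[OF Hr_space_R_pair(1)[OF \<beta>(1) u] \<beta> b] by blast

lemma Hr_regularity:
  assumes u: "u \<in> Hr_space \<beta>" and \<beta>: "1 < \<beta>" "\<beta> < 2"
  shows "u \<in> borel_measurable borel" "r \<ge> \<beta> \<Longrightarrow> u \<in> Lq_space r" "log_density (\<lambda>x. (u x)\<^sup>2)" "integrable lborel (\<lambda>x. (u x)\<^sup>2)"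
proof -
  have "dirichlet u + 1 > 0" using pint_nonneg[of 2 "weak_grad u"] by linarith
  from Hr_profile[OF u \<beta> this, of "pint \<beta> u"] obtain F where bp: "bounded_profile \<beta> (dirichlet u + 1) (pint \<beta> u) u F" by auto
  show "u \<in> borel_measurable borel" "r \<ge> \<beta> \<Longrightarrow> u \<in> Lq_space r" "log_density (\<lambda>x. (u x)\<^sup>2)" "integrable lborel (\<lambda>x. (u x)\<^sup>2)"
    using bounded_profileD(9)[OF bp] radial_Lq_bound(1)[OF bp] profile_log_density[OF bp] by auto
qed

lemma total_mass_nonneg: "0 \<le> total_mass u"
  unfolding total_mass_def by (rule integral_nonneg_AE) simp

lemma total_mass_zero:
  assumes "integrable lborel (\<lambda>x. (u x)\<^sup>2)"
  shows "total_mass u = 0 \<longleftrightarrow> (AE x in lborel. u x = 0)"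
  unfolding total_mass_def using integral_nonneg_eq_0_iff_AE[OF assms] by simp

lemma potential_pos:
  assumes u: "u \<in> Hr_space \<beta>" and \<beta>: "1 < \<beta>" "\<beta> < 2" "2 < p" and m: "total_mass u > 0"
  shows "potential \<beta> p u > 0" "pint \<beta> u \<le> \<beta> * potential \<beta> p u"
proof -
  note R = Hr_regularity[OF u \<beta>(1,2)]
  have L: "u \<in> Lq_space \<beta>" "u \<in> Lq_space p" using R(2) \<beta> by auto
  have pe: "potential \<beta> p u = pint \<beta> u / \<beta> + pint p u / p" by (rule potential_eq(1)[OF L])
  have "pint p u / p \<ge> 0" using pint_nonneg[of p u] \<beta> by simp
  then have le: "pint \<beta> u / \<beta> \<le> potential \<beta> p u" unfolding pe by simp
  then show "pint \<beta> u \<le> \<beta> * potential \<beta> p u" using \<beta> by (simp add: pos_divide_le_eq mult.commute)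
  have "pint \<beta> u \<noteq> 0"
  proof
    assume "pint \<beta> u = 0"
    then have "AE x in lborel. norm (u x) powr \<beta> = 0"
      unfolding pint_def using integral_nonneg_eq_0_iff_AE[OF Lq_spaceD(2)[OF L(1)]] by simp
    then have "AE x in lborel. u x = 0" by eventually_elim simp
    then show False using total_mass_zero[OF R(4)] m by simp
  qed
  then have "0 < pint \<beta> u / \<beta>" using pint_nonneg[of \<beta> u] \<beta> by simp
  then show "potential \<beta> p u > 0" using le by linarith
qed

text \<open>The functions that are stationary with respect to dilations.\<close>

definition pohozaev :: "real \<Rightarrow> real \<Rightarrow> (plane \<Rightarrow> real) set" where
  "pohozaev \<beta> p = {u \<in> Hr_space \<beta>. total_mass u > 0 \<and> potential \<beta> p u = V0 u / 2 + mass_coeff u}"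

lemma mass_coeff_pos: "total_mass u > 0 \<Longrightarrow> mass_coeff u > 0" by (simp add: mass_coeff_def)

lemma energy_fibre: "energy \<beta> p u = fibre (dirichlet u) (potential \<beta> p u) (V0 u) (mass_coeff u) 1"
  by (simp add: energy_eq fibre_def)

text \<open>Eliminating the logarithmic energy shows the energy to be coercive on the Pohozaev
  manifold.\<close>

lemma energy_pohozaev:
  assumes "u \<in> pohozaev \<beta> p"
  shows "energy \<beta> p u = dirichlet u / 2 + potential \<beta> p u / 2 + mass_coeff u / 2"
proof -
  have "potential \<beta> p u = V0 u / 2 + mass_coeff u" using assms by (simp add: pohozaev_def)
  then show ?thesis unfolding energy_eq by argo
qed

text \<open>Dilating by \<open>sqrt \<tau>\<close> leaves the Dirichlet integral fixed and moves the other terms along the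
  fibre.\<close>

lemma dilation:
  assumes u: "u \<in> Hr_space \<beta>" and \<beta>: "1 < \<beta>" "\<beta> < 2" "2 < p" and \<tau>: "\<tau> > 0"
  defines "v \<equiv> \<lambda>x. u ((1 / sqrt \<tau>) *\<^sub>R x)"
  shows "v \<in> Hr_space \<beta>" "dirichlet v = dirichlet u" "potential \<beta> p v = \<tau> * potential \<beta> p u"
    "total_mass v = \<tau> * total_mass u" "V0 v = \<tau>\<^sup>2 * (V0 u + 4 * mass_coeff u * ln \<tau>)"
    "energy \<beta> p v = fibre (dirichlet u) (potential \<beta> p u) (V0 u) (mass_coeff u) \<tau>"
proof -
  note R = Hr_regularity[OF u \<beta>(1,2)]
  note [measurable] = R(1)
  define c where "c = 1 / sqrt \<tau>"
  have c: "c > 0" "1 / c\<^sup>2 = \<tau>" using \<tau> by (simp_all add: c_def power_divide)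
  have Rp: "R_pair \<beta> u (weak_grad u)" by (rule Hr_space_R_pair(1)[OF \<beta>(1) u])
  have Rv: "R_pair \<beta> v (\<lambda>x. c *\<^sub>R weak_grad u (c *\<^sub>R x))" unfolding v_def c_def[symmetric] by (rule R_pair_scale[OF Rp \<beta>(1) c(1)])
  show v: "v \<in> Hr_space \<beta>" by (rule Hr_space_R_pair(2)[OF \<beta>(1) Rv])
  have "dirichlet v = pint 2 (\<lambda>x. c *\<^sub>R weak_grad u (c *\<^sub>R x))"
    using Rv by (intro H_pair_weak_grad(3)[OF _ \<beta>(1)]) (simp add: R_pair_def)
  also have "\<dots> = dirichlet u" by (rule pint_grad_scale[OF R_pairD(2)[OF Rp] c(1)])
  finally show d: "dirichlet v = dirichlet u" .
  have L: "u \<in> Lq_space \<beta>" "u \<in> Lq_space p" "v \<in> Lq_space \<beta>" "v \<in> Lq_space p"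
    using R(2) Hr_regularity(2)[OF v \<beta>(1,2)] \<beta> by auto
  have "pint r v = \<tau> * pint r u" if "u \<in> Lq_space r" for r
    unfolding v_def c_def[symmetric] using Lq_space_scale(2)[OF that c(1)] c(2) by (simp add: divide_inverse)
  then show P: "potential \<beta> p v = \<tau> * potential \<beta> p u"
    unfolding potential_eq(1)[OF L(1,2)] potential_eq(1)[OF L(3,4)] using L by (simp add: distrib_left)
  have "total_mass v = (1 / c\<^sup>2) * total_mass u"
    unfolding v_def c_def[symmetric] total_mass_def using lborel_scale(2)[of c "\<lambda>x. (u x)\<^sup>2"] c(1) by simp
  then show M: "total_mass v = \<tau> * total_mass u" using c(2) by simp
  have "V0 v = 1 / c ^ 4 * (V0 u - 1 / (2 * pi) * ln c * (total_mass u)\<^sup>2)"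
    unfolding v_def c_def[symmetric] total_mass_def by (rule V0_scale[OF R(3) c(1) R(1)])
  moreover have "1 / c ^ 4 = \<tau>\<^sup>2"
  proof -
    have "1 / c ^ 4 = (1 / c\<^sup>2)\<^sup>2" by (simp add: power_divide)
    then show ?thesis using c(2) by simp
  qed
  moreover have "ln c = - ln \<tau> / 2" using \<tau> by (simp add: c_def ln_div ln_sqrt)
  ultimately show V: "V0 v = \<tau>\<^sup>2 * (V0 u + 4 * mass_coeff u * ln \<tau>)" by (simp add: mass_coeff_def algebra_simps)
  show "energy \<beta> p v = fibre (dirichlet u) (potential \<beta> p u) (V0 u) (mass_coeff u) \<tau>"
    unfolding energy_eq d P V fibre_def by (simp add: algebra_simps)
qed

lemma dilation_pohozaev:
  assumes u: "u \<in> Hr_space \<beta>" and \<beta>: "1 < \<beta>" "\<beta> < 2" "2 < p" and \<tau>: "\<tau> > 0" and m: "total_mass u > 0"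
    and root: "potential \<beta> p u = \<tau> * (V0 u / 2 + mass_coeff u + 2 * mass_coeff u * ln \<tau>)"
  shows "(\<lambda>x. u ((1 / sqrt \<tau>) *\<^sub>R x)) \<in> pohozaev \<beta> p"
proof -
  note D = dilation[OF u \<beta> \<tau>]
  have "mass_coeff (\<lambda>x. u ((1 / sqrt \<tau>) *\<^sub>R x)) = \<tau>\<^sup>2 * mass_coeff u" by (simp add: mass_coeff_def D(4) power_mult_distrib)
  then show ?thesis unfolding pohozaev_def using D(1,3,4,5) m \<tau> root
    by (simp add: power2_eq_square algebra_simps)
qed

section \<open>Existence of a minimiser on the Pohozaev manifold\<close>

lemma nonzero_radial_function:
  assumes \<beta>: "1 < \<beta>" "\<beta> < 2"
  shows "\<exists>u\<in>Hr_space \<beta>. total_mass u > 0"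
proof -
  define u :: "plane \<Rightarrow> real" where "u x = bump (-1) 1 0 ((norm x)\<^sup>2)" for x
  have t: "u \<in> test_functions"
  proof (rule test_functionsI[where R=1])
    show "C_k k u" for k unfolding u_def[abs_def] by (rule C_k_compose[OF smooth1_bump C_k_norm2])
    show "norm x \<le> 1" if "u x \<noteq> 0" for x
    proof -
      have "(norm x)\<^sup>2 < 1" using that bump_eq_0[of "(norm x)\<^sup>2" "-1" 1 0] by (auto simp: u_def)
      then show ?thesis by (simp add: abs_square_less_1)
    qed
  qed
  have "R_pair \<beta> u (grad u)" unfolding R_pair_def radial_def
    using H_pair_test[OF t \<beta>(1)] by (auto simp: u_def intro!: exI[of _ "\<lambda>r. bump (-1) 1 0 (r\<^sup>2)"])
  then have u: "u \<in> Hr_space \<beta>" by (rule Hr_space_R_pair(2)[OF \<beta>(1)])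
  have "total_mass u \<noteq> 0"
  proof
    assume "total_mass u = 0"
    then have "AE x in lborel. u x = 0" using total_mass_zero[OF Hr_regularity(4)[OF u \<beta>]] by simp
    then have "AE x in lborel. x \<notin> ball (0::plane) 1"
    proof eventually_elim
      case (elim x)
      show ?case
      proof
        assume "x \<in> ball 0 1"
        then have "(norm x)\<^sup>2 < 1" by (simp add: abs_square_less_1)
        moreover have "- 1 < (norm x)\<^sup>2" using zero_le_power2[of "norm x"] by linarith
        ultimately have "(norm x)\<^sup>2 \<in> {-1<..<1}" by simp
        then show False using bump_pos[of "(norm x)\<^sup>2" "-1" 1 0] elim by (simp add: u_def)
      qed
    qed
    then have "ball (0::plane) 1 \<in> null_sets lborel" by (subst (asm) AE_iff_null_sets[symmetric]) auto
    then have "measure lborel (ball (0::plane) 1) = 0" by (auto simp: measure_def)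
    then show False using content_ball_gt_0_iff[of "0::plane" 1] by simp
  qed
  then show ?thesis using u total_mass_nonneg[of u] by (intro bexI[of _ u]) linarith+
qed

text \<open>Members of the Pohozaev manifold cannot vanish. Their potential term is at most the
  squared weighted mass, which by the decay estimate is of the order of the potential term to
  the power \<open>4 / (\<beta> + 2) > 1\<close>, up to terms of higher order.\<close>

lemma pohozaev_lower_bound:
  assumes \<beta>: "1 < \<beta>" "\<beta> < 2" "2 < p" and a: "a > 0"
  obtains \<delta> where "\<delta> > 0" "\<And>u. u \<in> pohozaev \<beta> p \<Longrightarrow> dirichlet u \<le> a \<Longrightarrow> \<delta> \<le> potential \<beta> p u"
proof -
  \<comment> \<open>The factor \<open>sqrt b\<close> is split off from the weighted mass; what
    remains tends to zero with \<open>b\<close> since \<open>2 \<gamma> > 1/2\<close>.\<close>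
  define \<gamma> where "\<gamma> = 1 / (\<beta> + 2)"
  have \<gamma>: "\<gamma> > 1/4" "\<gamma> > 0" using \<beta> by (auto simp: \<gamma>_def field_simps)
  define k1 k2 where "k1 = 2 * (2 * (a / pi) powr \<gamma>)\<^sup>2 * (pi / (1 - 2 / (\<beta> + 2)))"
    and "k2 = (2 + 1 / (2 * tail_exp \<beta>)) * (2 * (a / pi) powr \<gamma>) powr (2 - \<beta>)"
  have wc: "weight_const \<beta> a b = sqrt b * (k1 * b powr (2 * \<gamma> - 1/2) + k2 * b powr (\<gamma> * (2 - \<beta>) + 1/2))" if b: "b > 0" for b
  proof -
    have d: "decay_const \<beta> a b = (2 * (a / pi) powr \<gamma>) * b powr \<gamma>"
      unfolding decay_const_def \<gamma>_def[symmetric] by (simp add: powr_mult[symmetric])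
    have 1: "(decay_const \<beta> a b)\<^sup>2 = (2 * (a / pi) powr \<gamma>)\<^sup>2 * (sqrt b * b powr (2 * \<gamma> - 1/2))"
    proof -
      have "(b powr \<gamma>)\<^sup>2 = b powr (2 * \<gamma>)" using b by (simp add: powr_power mult.commute)
      also have "\<dots> = b powr (1/2) * b powr (2 * \<gamma> - 1/2)" by (simp add: powr_add[symmetric])
      finally show ?thesis using b by (simp add: d power_mult_distrib powr_half_sqrt)
    qed
    have 2: "decay_const \<beta> a b powr (2 - \<beta>) * b = (2 * (a / pi) powr \<gamma>) powr (2 - \<beta>) * (sqrt b * b powr (\<gamma> * (2 - \<beta>) + 1/2))"
    proof -
      have "(b powr \<gamma>) powr (2 - \<beta>) * b = b powr (\<gamma> * (2 - \<beta>)) * b powr 1" using b by (simp add: powr_powr)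
      also have "\<dots> = b powr (1/2 + (\<gamma> * (2 - \<beta>) + 1/2))" by (simp only: powr_add[symmetric]) (simp add: add.commute)
      also have "\<dots> = b powr (1/2) * b powr (\<gamma> * (2 - \<beta>) + 1/2)" by (rule powr_add)
      finally show ?thesis unfolding d powr_mult using b by (simp add: powr_half_sqrt mult_ac)
    qed
    have "weight_const \<beta> a b = 2 * (decay_const \<beta> a b)\<^sup>2 * (pi / (1 - 2 / (\<beta> + 2))) + (2 + 1 / (2 * tail_exp \<beta>)) * (decay_const \<beta> a b powr (2 - \<beta>) * b)"
      by (simp add: weight_const_def tail_const_def mult.assoc)
    then show ?thesis unfolding 1 2 k1_def k2_def by (simp add: algebra_simps)
  qed
  have "((\<lambda>b. k1 * b powr (2 * \<gamma> - 1/2) + k2 * b powr (\<gamma> * (2 - \<beta>) + 1/2)) \<longlongrightarrow> k1 * 0 + k2 * 0) (at_right 0)"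
  proof (intro tendsto_intros)
    have z: "((\<lambda>b::real. b powr e) \<longlongrightarrow> 0) (at_right 0)" if "e > 0" for e
    proof -
      have "((\<lambda>b::real. b powr e) \<longlongrightarrow> 0 powr e) (at_right 0)"
        by (intro tendsto_powr') (use that in \<open>auto simp: eventually_at_right intro!: exI[of _ 1]\<close>)
      then show ?thesis by simp
    qed
    show "((\<lambda>b. b powr (2 * \<gamma> - 1/2)) \<longlongrightarrow> 0) (at_right 0)" by (rule z) (use \<gamma> in simp)
    show "((\<lambda>b. b powr (\<gamma> * (2 - \<beta>) + 1/2)) \<longlongrightarrow> 0) (at_right 0)" by (rule z) (use \<gamma> \<beta> in \<open>auto intro!: add_nonneg_pos\<close>)
  qed
  then have "((\<lambda>b. (k1 * b powr (2 * \<gamma> - 1/2) + k2 * b powr (\<gamma> * (2 - \<beta>) + 1/2))\<^sup>2) \<longlongrightarrow> 0\<^sup>2) (at_right 0)"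
    by (intro tendsto_power) simp
  then have "eventually (\<lambda>b. (k1 * b powr (2 * \<gamma> - 1/2) + k2 * b powr (\<gamma> * (2 - \<beta>) + 1/2))\<^sup>2 < 1 / \<beta>) (at_right 0)"
    by (rule order_tendstoD(2)) (use \<beta> in simp)
  then obtain r where r: "r > 0" "\<And>b. 0 < b \<Longrightarrow> b < r \<Longrightarrow> (k1 * b powr (2 * \<gamma> - 1/2) + k2 * b powr (\<gamma> * (2 - \<beta>) + 1/2))\<^sup>2 < 1 / \<beta>"
    unfolding eventually_at_right_field by blast
  show thesis
  proof (rule that[of "r / \<beta>"])
    show "r / \<beta> > 0" using r \<beta> by simp
    fix u assume u: "u \<in> pohozaev \<beta> p" and da: "dirichlet u \<le> a"
    have H: "u \<in> Hr_space \<beta>" "total_mass u > 0" "potential \<beta> p u = V0 u / 2 + mass_coeff u" using u by (auto simp: pohozaev_def)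
    note pp = potential_pos[OF H(1) \<beta> H(2)]
    define b where "b = \<beta> * potential \<beta> p u"
    have b: "b > 0" using pp(1) \<beta> by (simp add: b_def)
    obtain F where bp: "bounded_profile \<beta> a b u F"
      using Hr_profile[OF H(1) \<beta>(1,2) a da] pp(2) unfolding b_def by blast
    note L = profile_log_density[OF bp]
    define W where "W = wmass (\<lambda>x. (u x)\<^sup>2)"
    have W0: "0 \<le> W" unfolding W_def by (rule wmass_nonneg)
    have "log_energy (\<lambda>x. (u x)\<^sup>2) (\<lambda>x. (u x)\<^sup>2) \<le> W * W" unfolding W_def by (rule log_energy_le[OF L(1) L(1)]) auto
    then have "V0 u \<le> 1 / (2 * pi) * (W * W)" unfolding V0_log_energy[OF L(1)] by (intro mult_left_mono) auto
    also have "\<dots> \<le> 1 * (W * W)" using pi_ge_two by (intro mult_right_mono) (auto simp: divide_le_eq)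
    finally have V: "V0 u \<le> W * W" by simp
    have "(total_mass u)\<^sup>2 \<le> W\<^sup>2" using L(5) total_mass_nonneg[of u] unfolding W_def total_mass_def by (intro power_mono) auto
    then have "mass_coeff u \<le> W\<^sup>2 / (16 * pi)" unfolding mass_coeff_def by (intro divide_right_mono) auto
    also have "\<dots> \<le> W\<^sup>2 / 2" using pi_ge_two by (intro divide_left_mono) auto
    finally have "potential \<beta> p u \<le> W\<^sup>2" using H(3) V by (simp add: power2_eq_square)
    also have "\<dots> \<le> (weight_const \<beta> a b)\<^sup>2" using L(2) W0 unfolding W_def by (intro power_mono) auto
    also have "\<dots> = b * (k1 * b powr (2 * \<gamma> - 1/2) + k2 * b powr (\<gamma> * (2 - \<beta>) + 1/2))\<^sup>2"
      using b by (simp add: wc power_mult_distrib)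
    finally have le: "potential \<beta> p u \<le> b * (k1 * b powr (2 * \<gamma> - 1/2) + k2 * b powr (\<gamma> * (2 - \<beta>) + 1/2))\<^sup>2" .
    have "\<not> b < r"
    proof
      assume "b < r"
      then have "b * (k1 * b powr (2 * \<gamma> - 1/2) + k2 * b powr (\<gamma> * (2 - \<beta>) + 1/2))\<^sup>2 < b * (1 / \<beta>)"
        using r(2)[OF b] b by (intro mult_strict_left_mono) auto
      also have "\<dots> = potential \<beta> p u" using \<beta> by (simp add: b_def)
      finally show False using le by simp
    qed
    then show "r / \<beta> \<le> potential \<beta> p u" using \<beta> by (simp add: b_def pos_divide_le_eq mult.commute)
  qed
qed

text \<open>Minimising sequences are bounded, hence their profiles converge along a subsequence.
  In the limit the nonlocal terms converge, while the Dirichlet integral and the potential can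
  only drop. The limit is not zero because the potentials stay away from zero. If it has left
  the manifold, it is dilated back, and the drop works in its favour: every member of the
  sequence maximises the energy on its own fibre.\<close>

lemma pohozaev_minimiser:
  assumes \<beta>: "1 < \<beta>" "\<beta> < 2" "2 < p"
  shows "\<exists>w\<in>pohozaev \<beta> p. \<forall>u\<in>pohozaev \<beta> p. energy \<beta> p w \<le> energy \<beta> p u"
proof -
  have toS: "\<exists>\<tau>>0. (\<lambda>x. u ((1 / sqrt \<tau>) *\<^sub>R x)) \<in> pohozaev \<beta> p" if u: "u \<in> Hr_space \<beta>" "total_mass u > 0" for u
  proof -
    obtain \<tau> where "\<tau> > 0" "potential \<beta> p u = \<tau> * (V0 u / 2 + mass_coeff u + 2 * mass_coeff u * ln \<tau>)"
      using fibre_root[OF mass_coeff_pos[OF u(2)] potential_pos(1)[OF u(1) \<beta> u(2)]] by metis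
    then show ?thesis using dilation_pohozaev[OF u(1) \<beta> _ u(2)] by blast
  qed
  define E where "E = energy \<beta> p ` pohozaev \<beta> p"
  define m where "m = Inf E"
  have Ene: "E \<noteq> {}" using nonzero_radial_function[OF \<beta>(1,2)] toS by (auto simp: E_def)
  have parts: "0 \<le> dirichlet u" "0 \<le> potential \<beta> p u" "0 \<le> mass_coeff u" if "u \<in> pohozaev \<beta> p" for u
  proof -
    have u: "u \<in> Hr_space \<beta>" "total_mass u > 0" using that by (auto simp: pohozaev_def)
    show "0 \<le> dirichlet u" by (rule pint_nonneg)
    show "0 \<le> potential \<beta> p u" using potential_pos(1)[OF u(1) \<beta> u(2)] by simp
    show "0 \<le> mass_coeff u" using mass_coeff_pos[OF u(2)] by simp
  qed
  have e0: "0 \<le> energy \<beta> p u" if "u \<in> pohozaev \<beta> p" for u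
    using parts[OF that] energy_pohozaev[OF that] by simp
  have Ebb: "bdd_below E" using e0 by (auto simp: E_def intro!: bdd_belowI[of _ 0])
  have mle: "m \<le> energy \<beta> p u" if "u \<in> pohozaev \<beta> p" for u
    unfolding m_def by (rule cInf_lower[OF _ Ebb]) (use that in \<open>auto simp: E_def\<close>)
  have "\<exists>u. u \<in> pohozaev \<beta> p \<and> energy \<beta> p u < m + 1 / real (Suc n)" for n
  proof -
    have "Inf E < m + 1 / real (Suc n)" by (simp add: m_def)
    from cInf_lessD[OF Ene this] show ?thesis by (auto simp: E_def)
  qed
  then obtain u0 where u0: "\<And>n. u0 n \<in> pohozaev \<beta> p" "\<And>n. energy \<beta> p (u0 n) < m + 1 / real (Suc n)" by metis
  define a where "a = 2 * (m + 1) + 1"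
  have m0: "0 \<le> m" unfolding m_def by (rule cInf_greatest[OF Ene]) (use e0 in \<open>auto simp: E_def\<close>)
  have bd: "dirichlet (u0 n) \<le> a" "potential \<beta> p (u0 n) \<le> a" for n
  proof -
    have "1 / real (Suc n) \<le> 1" by simp
    then show "dirichlet (u0 n) \<le> a" "potential \<beta> p (u0 n) \<le> a"
      using u0(2)[of n] energy_pohozaev[OF u0(1)[of n]] parts[OF u0(1)[of n]] unfolding a_def by argo+
  qed
  have a0: "a > 0" using m0 by (simp add: a_def)
  \<comment> \<open>Subsequence along which the Dirichlet integrals and the potentials converge.\<close>
  have "bounded (range (\<lambda>n. (dirichlet (u0 n), potential \<beta> p (u0 n))))"
  proof (rule bounded_subset)
    show "bounded (cbox (0::real, 0::real) (a, a))" by (rule bounded_cbox)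
    show "range (\<lambda>n. (dirichlet (u0 n), potential \<beta> p (u0 n))) \<subseteq> cbox (0, 0) (a, a)"
      using parts[OF u0(1)] bd by (auto simp: cbox_Pair_eq)
  qed
  from bounded_imp_convergent_subsequence[OF this] obtain l r0 where r0: "strict_mono (r0 :: nat \<Rightarrow> nat)" "((\<lambda>n. (dirichlet (u0 n), potential \<beta> p (u0 n))) \<circ> r0) \<longlonglongrightarrow> l" by blast
  define A P where "A = fst l" and "P = snd l"
  have lim0: "(\<lambda>n. dirichlet (u0 (r0 n))) \<longlonglongrightarrow> A" "(\<lambda>n. potential \<beta> p (u0 (r0 n))) \<longlonglongrightarrow> P"
    using tendsto_fst[OF r0(2)] tendsto_snd[OF r0(2)] by (simp_all add: o_def A_def P_def)
  have S0: "u0 (r0 n) \<in> Hr_space \<beta>" "total_mass (u0 (r0 n)) > 0" for n using u0(1) by (auto simp: pohozaev_def)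
  define b where "b = \<beta> * a"
  have pb: "pint \<beta> (u0 (r0 n)) \<le> b" for n
  proof -
    have "pint \<beta> (u0 (r0 n)) \<le> \<beta> * potential \<beta> p (u0 (r0 n))" by (rule potential_pos(2)[OF S0(1) \<beta> S0(2)])
    also have "\<dots> \<le> b" unfolding b_def using bd(2)[of "r0 n"] \<beta> by (intro mult_left_mono) auto
    finally show ?thesis .
  qed
  have "\<forall>n. \<exists>F. bounded_profile \<beta> a b (u0 (r0 n)) F"
  proof
    fix n
    obtain F where "bounded_profile \<beta> a b (u0 (r0 n)) F" by (rule Hr_profile[OF S0(1) \<beta>(1,2) a0 bd(1) pb])
    then show "\<exists>F. bounded_profile \<beta> a b (u0 (r0 n)) F" by (intro exI[of _ F])
  qed
  from choice[OF this] obtain F where bp0': "\<forall>n. bounded_profile \<beta> a b (u0 (r0 n)) (F n)" by (rule exE)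
  then have bp0: "bounded_profile \<beta> a b (u0 (r0 n)) (F n)" for n by (rule spec)
  obtain k G where k: "strict_mono k" "log_Holder a G" "\<And>q. q > 0 \<Longrightarrow> (\<lambda>n. F (k n) q) \<longlonglongrightarrow> G q"
    by (rule profile_subsequence[where F=F and v="\<lambda>n. u0 (r0 n)", OF bp0]) (rule that)
  define v where "v n = u0 (r0 (k n))" for n
  have vS: "v n \<in> pohozaev \<beta> p" and vH: "v n \<in> Hr_space \<beta>" for n using u0(1) by (auto simp: v_def pohozaev_def)
  have bp: "bounded_profile \<beta> a b (v n) (F (k n))" for n unfolding v_def by (rule bp0)
  have vA: "(\<lambda>n. dirichlet (v n)) \<longlonglongrightarrow> A" and vP: "(\<lambda>n. potential \<beta> p (v n)) \<longlonglongrightarrow> P"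
    using LIMSEQ_subseq_LIMSEQ[OF lim0(1) k(1)] LIMSEQ_subseq_LIMSEQ[OF lim0(2) k(1)] by (simp_all add: v_def o_def)
  define u where "u x = G ((norm x)\<^sup>2)" for x :: plane
  have um [measurable]: "u \<in> borel_measurable borel" unfolding u_def[abs_def] by (rule log_Holder_measurable(2)[OF k(2)])
  have urad: "radial u" unfolding radial_def by (intro exI[of _ "\<lambda>r. G (r\<^sup>2)"]) (simp add: u_def)
  have lim: "AE x in lborel. (\<lambda>n. v n x) \<longlonglongrightarrow> u x"
  proof -
    have "AE x in lborel. \<forall>n. v n x = F (k n) ((norm x)\<^sup>2)"
      unfolding AE_all_countable using bounded_profileD(7)[OF bp] by blast
    then show ?thesis using AE_lborel_singleton[of 0]
      by eventually_elim (use k(3) in \<open>auto simp: u_def\<close>)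
  qed
  have dl: "pint 2 (weak_grad (v n)) \<le> a" "pint \<beta> (v n) \<le> b" for n
    using bd(1) bounded_profileD(8)[OF bp] by (auto simp: v_def)
  obtain g where g: "R_pair \<beta> u g" "pint 2 g \<le> A"
    using weak_limit_R_pair[OF Hr_space_R_pair(1)[OF \<beta>(1) vH] \<beta>(1) dl vA um urad lim] by blast
  have uH: "u \<in> Hr_space \<beta>" by (rule Hr_space_R_pair(2)[OF \<beta>(1) g(1)])
  have uA: "dirichlet u \<le> A"
    using H_pair_weak_grad(3)[OF _ \<beta>(1), of u g] g by (simp add: R_pair_def)
  note vL = Hr_regularity[OF vH \<beta>(1,2)] and uL = Hr_regularity[OF uH \<beta>(1,2)]
  have powl: "AE x in lborel. (\<lambda>n. \<bar>v n x\<bar> powr q) \<longlonglongrightarrow> \<bar>u x\<bar> powr q" if "q > 0" for q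
    using lim by eventually_elim (use that in \<open>auto intro!: tendsto_powr' tendsto_intros\<close>)
  have "pint \<beta> u \<le> b"
    unfolding pint_def
    by (rule fatou_bound(2)[where f="\<lambda>n x. norm (v n x) powr \<beta>" and N=0])
      (use powl[of \<beta>] \<beta> Lq_spaceD(2)[OF vL(2)] dl(2) in \<open>auto simp: pint_def\<close>)
  then have bu: "bounded_profile \<beta> a b u G"
    using bounded_profileD[OF bp[of 0]] k(2) R_pairD(1)[OF g(1)] by (auto simp: bounded_profile_def u_def)
  note VM = V0_mass_tendsto[OF bp bu lim]
  have Ml: "(\<lambda>n. total_mass (v n)) \<longlonglongrightarrow> total_mass u" unfolding total_mass_def by (rule VM(2))
  then have Kl: "(\<lambda>n. mass_coeff (v n)) \<longlonglongrightarrow> mass_coeff u" unfolding mass_coeff_def by (intro tendsto_intros) auto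
  have uP: "potential \<beta> p u \<le> P"
  proof (rule field_le_epsilon)
    fix e :: real assume e: "e > 0"
    have "eventually (\<lambda>n. potential \<beta> p (v n) < P + e) sequentially" by (rule order_tendstoD(2)[OF vP]) (use e in simp)
    then obtain N where N: "\<And>n. n \<ge> N \<Longrightarrow> potential \<beta> p (v n) < P + e" by (auto simp: eventually_sequentially)
    show "potential \<beta> p u \<le> P + e" unfolding potential_def
    proof (rule fatou_bound(2)[where f="\<lambda>n x. 1 / \<beta> * \<bar>v n x\<bar> powr \<beta> + 1 / p * \<bar>v n x\<bar> powr p" and N=N])
      show "integrable lborel (\<lambda>x. 1 / \<beta> * \<bar>v n x\<bar> powr \<beta> + 1 / p * \<bar>v n x\<bar> powr p)" for n
        by (rule potential_eq(2)) (use vL(2) \<beta> in auto)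
      show "AE x in lborel. (\<lambda>n. 1 / \<beta> * \<bar>v n x\<bar> powr \<beta> + 1 / p * \<bar>v n x\<bar> powr p) \<longlonglongrightarrow> 1 / \<beta> * \<bar>u x\<bar> powr \<beta> + 1 / p * \<bar>u x\<bar> powr p"
        using powl[of \<beta>] powl[of p] \<beta> by (auto elim!: eventually_elim2 intro!: tendsto_intros)
      show "(LINT x|lborel. 1 / \<beta> * \<bar>v n x\<bar> powr \<beta> + 1 / p * \<bar>v n x\<bar> powr p) \<le> P + e" if "n \<ge> N" for n
        using N[OF that] by (simp add: potential_def)
    qed (use \<beta> in auto)
  qed
  have "(\<lambda>n. V0 (v n) / 2 + mass_coeff (v n)) \<longlonglongrightarrow> V0 u / 2 + mass_coeff u" by (intro tendsto_intros VM(1) Kl) auto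
  moreover have "(\<lambda>n. V0 (v n) / 2 + mass_coeff (v n)) = (\<lambda>n. potential \<beta> p (v n))" using vS by (auto simp: pohozaev_def)
  ultimately have PV: "P = V0 u / 2 + mass_coeff u" using LIMSEQ_unique[OF vP] by simp
  obtain \<delta> where \<delta>: "\<delta> > 0" "\<And>n. \<delta> \<le> potential \<beta> p (v n)"
    using pohozaev_lower_bound[OF \<beta> a0] vS dl(1) by metis
  \<comment> \<open>The limit \<open>P\<close> of the potentials is the value \<open>V0 u / 2 +
    mass_coeff u\<close> of the limit function, and it is positive.\<close>
  have "\<delta> \<le> P" by (rule LIMSEQ_le_const[OF vP]) (use \<delta> in blast)
  have mass: "total_mass u > 0"
  proof (rule ccontr)
    assume "\<not> total_mass u > 0"
    then have z: "total_mass u = 0" using total_mass_nonneg[of u] by linarith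
    then have "AE x in lborel. u x = 0" using total_mass_zero[OF uL(4)] by simp
    then have "(LINT y|lborel. ln (norm (x - y)) * (u x)\<^sup>2 * (u y)\<^sup>2) = 0" for x
      by (intro integral_eq_zero_AE) (auto elim!: eventually_mono)
    then have "V0 u = 0" by (simp add: V0_def)
    then show False using PV z \<open>\<delta> \<le> P\<close> \<delta>(1) by (simp add: mass_coeff_def)
  qed
  \<comment> \<open>Return to the manifold by a dilation, and compare with the same dilation of
    the sequence.\<close>
  obtain \<tau> where \<tau>: "\<tau> > 0" "potential \<beta> p u = \<tau> * (V0 u / 2 + mass_coeff u + 2 * mass_coeff u * ln \<tau>)"
    using fibre_root[OF mass_coeff_pos[OF mass] potential_pos(1)[OF uH \<beta> mass]] by metis
  define w where "w = (\<lambda>x. u ((1 / sqrt \<tau>) *\<^sub>R x))"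
  have wS: "w \<in> pohozaev \<beta> p" unfolding w_def by (rule dilation_pohozaev[OF uH \<beta> \<tau>(1) mass \<tau>(2)])
  have "energy \<beta> p w = fibre (dirichlet u) (potential \<beta> p u) (V0 u) (mass_coeff u) \<tau>" unfolding w_def by (rule dilation(6)[OF uH \<beta> \<tau>(1)])
  also have "\<dots> \<le> fibre A P (V0 u) (mass_coeff u) \<tau>"
    unfolding fibre_def using uA mult_left_mono[OF uP, of \<tau>] \<tau>(1) by argo
  also have "\<dots> \<le> m"
  proof -
    have "(\<lambda>n. fibre (dirichlet (v n)) (potential \<beta> p (v n)) (V0 (v n)) (mass_coeff (v n)) \<tau>) \<longlonglongrightarrow> fibre A P (V0 u) (mass_coeff u) \<tau>"
      unfolding fibre_def by (intro tendsto_intros vA vP VM(1) Kl) auto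
    moreover have "(\<lambda>n. m + 1 / real (Suc n)) \<longlonglongrightarrow> m + 0" by (intro tendsto_intros lim_1_over_n[THEN LIMSEQ_Suc])
    moreover have "fibre (dirichlet (v n)) (potential \<beta> p (v n)) (V0 (v n)) (mass_coeff (v n)) \<tau> \<le> m + 1 / real (Suc n)" for n
    proof -
      have "fibre (dirichlet (v n)) (potential \<beta> p (v n)) (V0 (v n)) (mass_coeff (v n)) \<tau> \<le> energy \<beta> p (v n)"
        unfolding energy_fibre by (rule fibre_le_1) (use vS[of n] parts[OF vS[of n]] \<tau> in \<open>auto simp: pohozaev_def\<close>)
      also have "\<dots> \<le> m + 1 / real (Suc (r0 (k n)))" using u0(2)[of "r0 (k n)"] by (simp add: v_def)
      also have "n \<le> r0 (k n)" using seq_suble[OF r0(1), of "k n"] seq_suble[OF k(1), of n] by linarith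
      then have "1 / real (Suc (r0 (k n))) \<le> 1 / real (Suc n)" by (intro divide_left_mono) auto
      finally show ?thesis by simp
    qed
    ultimately show ?thesis using LIMSEQ_le[of _ _ "\<lambda>n. m + 1 / real (Suc n)" "m + 0"] by auto
  qed
  finally have "energy \<beta> p w \<le> m" .
  then show ?thesis using wS mle by (intro bexI[of _ w]) (auto intro: order_trans)
qed

section \<open>The minimiser is a critical point\<close>

lemma dirichlet_second_difference:
  assumes w: "w \<in> Hr_space \<beta>" and k: "k \<in> Hr_space \<beta>" and \<beta>: "1 < \<beta>"
  shows "(\<lambda>x. w x + s * k x) \<in> Hr_space \<beta>" "(\<lambda>x. w x - s * k x) \<in> Hr_space \<beta>"
    "dirichlet (\<lambda>x. w x + s * k x) + dirichlet (\<lambda>x. w x - s * k x) - 2 * dirichlet w = 2 * s\<^sup>2 * dirichlet k"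
proof -
  define gw gk where "gw = weak_grad w" and "gk = weak_grad k"
  have Rw: "R_pair \<beta> w gw" and Rk: "R_pair \<beta> k gk" unfolding gw_def gk_def by (rule Hr_space_R_pair(1)[OF \<beta>], fact)+
  have R: "R_pair \<beta> (\<lambda>x. w x + c * k x) (\<lambda>x. gw x + c *\<^sub>R gk x)" for c
    by (rule R_pair_add[OF Rw R_pair_cmult[OF Rk \<beta>] \<beta>])
  have Rp: "R_pair \<beta> (\<lambda>x. w x + s * k x) (\<lambda>x. gw x + s *\<^sub>R gk x)" by (rule R)
  have Rm: "R_pair \<beta> (\<lambda>x. w x - s * k x) (\<lambda>x. gw x - s *\<^sub>R gk x)" using R[of "- s"] by simp
  show "(\<lambda>x. w x + s * k x) \<in> Hr_space \<beta>" "(\<lambda>x. w x - s * k x) \<in> Hr_space \<beta>"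
    by (rule Hr_space_R_pair(2)[OF \<beta>], fact)+
  have d: "dirichlet (\<lambda>x. w x + s * k x) = pint 2 (\<lambda>x. gw x + s *\<^sub>R gk x)"
    "dirichlet (\<lambda>x. w x - s * k x) = pint 2 (\<lambda>x. gw x - s *\<^sub>R gk x)"
    using Rp Rm by (auto intro!: H_pair_weak_grad(3)[OF _ \<beta>] simp: R_pair_def)
  have "pint 2 (\<lambda>x. (1/2) *\<^sub>R ((gw x + s *\<^sub>R gk x) + (gw x - s *\<^sub>R gk x)))
      = (pint 2 (\<lambda>x. gw x + s *\<^sub>R gk x) + pint 2 (\<lambda>x. gw x - s *\<^sub>R gk x)) / 2
        - pint 2 (\<lambda>x. (gw x + s *\<^sub>R gk x) - (gw x - s *\<^sub>R gk x)) / 4"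
    by (rule L2_parallelogram[OF R_pairD(2)[OF Rp] R_pairD(2)[OF Rm]])
  moreover have "(\<lambda>x. (1/2) *\<^sub>R ((gw x + s *\<^sub>R gk x) + (gw x - s *\<^sub>R gk x))) = gw"
    by (simp add: fun_eq_iff scaleR_2[symmetric])
  moreover have "(\<lambda>x. (gw x + s *\<^sub>R gk x) - (gw x - s *\<^sub>R gk x)) = (\<lambda>x. (2 * s) *\<^sub>R gk x)"
    by (simp add: fun_eq_iff scaleR_2[symmetric])
  moreover have "pint 2 (\<lambda>x. (2 * s) *\<^sub>R gk x) = 4 * s\<^sup>2 * pint 2 gk"
    by (simp add: pint_def powr_2_norm power_mult_distrib)
  ultimately have "pint 2 gw = (pint 2 (\<lambda>x. gw x + s *\<^sub>R gk x) + pint 2 (\<lambda>x. gw x - s *\<^sub>R gk x)) / 2 - (4 * s\<^sup>2 * pint 2 gk) / 4"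
    by (simp only:)
  then show "dirichlet (\<lambda>x. w x + s * k x) + dirichlet (\<lambda>x. w x - s * k x) - 2 * dirichlet w = 2 * s\<^sup>2 * dirichlet k"
    unfolding d gw_def[symmetric] gk_def[symmetric] by argo
qed

lemma mass_coeff_perturb:
  assumes "\<bar>total_mass v - total_mass w\<bar> \<le> s * c" "0 \<le> s" "s \<le> 1" "0 \<le> c"
  shows "\<bar>mass_coeff v - mass_coeff w\<bar> \<le> s * (c * (2 * total_mass w + c))"
proof -
  have sc: "s * c \<le> c" using mult_right_mono[of s 1 c] assms by simp
  have M: "0 \<le> total_mass v" "0 \<le> total_mass w" by (rule total_mass_nonneg)+
  have "mass_coeff v - mass_coeff w = (total_mass v - total_mass w) * (total_mass v + total_mass w) / (16 * pi)"
    by (simp add: mass_coeff_def power2_eq_square algebra_simps diff_divide_distrib)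
  then have "\<bar>mass_coeff v - mass_coeff w\<bar> = \<bar>total_mass v - total_mass w\<bar> * (total_mass v + total_mass w) / (16 * pi)"
    using M by (simp add: abs_mult)
  also have "\<dots> \<le> \<bar>total_mass v - total_mass w\<bar> * (total_mass v + total_mass w) / 1"
    using M pi_ge_two by (intro divide_left_mono) auto
  also have "\<dots> \<le> (s * c) * (2 * total_mass w + c)"
    unfolding div_by_1 by (rule mult_mono) (use assms sc M in auto)
  finally show ?thesis by (simp add: mult_ac)
qed

text \<open>A function with \<open>H_norm \<beta> h \<le> s\<close> is \<open>s\<close> times
  such a direction. Bounds on the two integrals replace the norm because the estimates for
  profiles take these integrals as input.\<close>

definition unit_direction :: "real \<Rightarrow> (plane \<Rightarrow> real) \<Rightarrow> bool" where
  "unit_direction \<beta> k \<longleftrightarrow> k \<in> Hr_space \<beta> \<and> dirichlet k \<le> 1 \<and> pint \<beta> k \<le> 1"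

lemma unit_direction_minus:
  assumes k: "unit_direction \<beta> k" and \<beta>: "1 < \<beta>"
  shows "unit_direction \<beta> (\<lambda>x. - k x)"
proof -
  have R: "R_pair \<beta> (\<lambda>x. (-1) * k x) (\<lambda>x. (-1) *\<^sub>R weak_grad k x)"
    using k by (intro R_pair_cmult[OF Hr_space_R_pair(1)[OF \<beta>] \<beta>]) (simp add: unit_direction_def)
  have "dirichlet (\<lambda>x. (-1) * k x) = pint 2 (\<lambda>x. (-1) *\<^sub>R weak_grad k x)"
    using R by (intro H_pair_weak_grad(3)[OF _ \<beta>]) (simp add: R_pair_def)
  then show ?thesis using Hr_space_R_pair(2)[OF \<beta> R] k by (simp add: unit_direction_def pint_def)
qed

text \<open>The constants are uniform in the direction because the bounds on radial functions
  depend on the two integrals only. The exponent \<open>\<beta>\<close> of \<open>s\<close> in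
  the second difference comes from \<open>|u|\<^sup>\<beta>\<close>, all other terms contribute
  \<open>s\<^sup>2\<close>.\<close>

lemma energy_perturb:
  assumes w: "w \<in> Hr_space \<beta>" and \<beta>: "1 < \<beta>" "\<beta> < 2" "2 < p"
  obtains C where "0 \<le> C"
    "\<And>k s. unit_direction \<beta> k \<Longrightarrow> 0 \<le> s \<Longrightarrow> s \<le> 1 \<Longrightarrow> \<bar>potential \<beta> p (\<lambda>x. w x + s * k x) - potential \<beta> p w\<bar> \<le> s * C"
    "\<And>k s. unit_direction \<beta> k \<Longrightarrow> 0 \<le> s \<Longrightarrow> s \<le> 1 \<Longrightarrow> \<bar>V0 (\<lambda>x. w x + s * k x) - V0 w\<bar> \<le> s * C"
    "\<And>k s. unit_direction \<beta> k \<Longrightarrow> 0 \<le> s \<Longrightarrow> s \<le> 1 \<Longrightarrow> \<bar>total_mass (\<lambda>x. w x + s * k x) - total_mass w\<bar> \<le> s * C"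
    "\<And>k s. unit_direction \<beta> k \<Longrightarrow> 0 \<le> s \<Longrightarrow> s \<le> 1 \<Longrightarrow> \<bar>mass_coeff (\<lambda>x. w x + s * k x) - mass_coeff w\<bar> \<le> s * C"
    "\<And>k s. unit_direction \<beta> k \<Longrightarrow> 0 \<le> s \<Longrightarrow> s \<le> 1 \<Longrightarrow>
       energy \<beta> p (\<lambda>x. w x + s * k x) + energy \<beta> p (\<lambda>x. w x - s * k x) - 2 * energy \<beta> p w \<le> (s\<^sup>2 + s powr \<beta>) * C"
proof -
  note Rw = Hr_regularity[OF w \<beta>(1,2)]
  have wL: "w \<in> Lq_space \<beta>" "w \<in> Lq_space p" using Rw(2) \<beta> by auto
  define L where "L = pint p w + Lq_const \<beta> p 1 1"
  define W where "W = wmass (\<lambda>x. (w x)\<^sup>2) + weight_const \<beta> 1 1"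
  define S where "S = sqmass (\<lambda>x. (w x)\<^sup>2) + Lq_const \<beta> 4 1 1"
  define B where "B = W * W + ln_neg_mass * (S + S)"
  define CP where "CP = 2 powr \<beta> * (pint \<beta> w + 1) + 2 powr p * L"
  define CM where "CM = 2 * (total_mass w + weight_const \<beta> 1 1)"
  define CK where "CK = CM * (2 * total_mass w + CM)"
  define CE where "CE = 3 + 4 * B + 2 * (p - 1) * 2 powr p * L"
  have main: "k \<in> borel_measurable borel" "k \<in> Lq_space \<beta>" "k \<in> Lq_space p" "pint p k \<le> Lq_const \<beta> p 1 1"
      "log_density (\<lambda>x. (k x)\<^sup>2)" "wmass (\<lambda>x. (k x)\<^sup>2) \<le> weight_const \<beta> 1 1" "sqmass (\<lambda>x. (k x)\<^sup>2) \<le> Lq_const \<beta> 4 1 1"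
      "integrable lborel (\<lambda>x. (k x)\<^sup>2)" "total_mass k \<le> weight_const \<beta> 1 1"
    if "unit_direction \<beta> k" for k
  proof -
    have k: "k \<in> Hr_space \<beta>" "dirichlet k \<le> 1" "pint \<beta> k \<le> 1" using that by (auto simp: unit_direction_def)
    obtain F where bp: "bounded_profile \<beta> 1 1 k F" by (rule Hr_profile[OF k(1) \<beta>(1,2) _ k(2,3)]) auto
    show "k \<in> borel_measurable borel" "k \<in> Lq_space \<beta>" using bounded_profileD[OF bp] by auto
    show "k \<in> Lq_space p" "pint p k \<le> Lq_const \<beta> p 1 1" using radial_Lq_bound[OF bp, of p] \<beta> by auto
    show "log_density (\<lambda>x. (k x)\<^sup>2)" "wmass (\<lambda>x. (k x)\<^sup>2) \<le> weight_const \<beta> 1 1" "sqmass (\<lambda>x. (k x)\<^sup>2) \<le> Lq_const \<beta> 4 1 1"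
      "integrable lborel (\<lambda>x. (k x)\<^sup>2)" by (rule profile_log_density[OF bp])+
    show "total_mass k \<le> weight_const \<beta> 1 1" unfolding total_mass_def
      using profile_log_density(2,5)[OF bp] by linarith
  qed
  \<comment> \<open>The constants are nonnegative because the zero function is an admissible direction.\<close>
  have z: "unit_direction \<beta> (\<lambda>x. 0)"
  proof -
    have R: "R_pair \<beta> (\<lambda>x. 0 * w x) (\<lambda>x. 0 *\<^sub>R weak_grad w x)" by (rule R_pair_cmult[OF Hr_space_R_pair(1)[OF \<beta>(1) w] \<beta>(1)])
    have "dirichlet (\<lambda>x. 0 * w x) = pint 2 (\<lambda>x. 0 *\<^sub>R weak_grad w x)"
      using R by (intro H_pair_weak_grad(3)[OF _ \<beta>(1)]) (simp add: R_pair_def)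
    then show ?thesis using Hr_space_R_pair(2)[OF \<beta>(1) R] by (simp add: unit_direction_def pint_def)
  qed
  have sq0: "0 \<le> sqmass h" for h :: "plane \<Rightarrow> real" unfolding sqmass_def by (rule integral_nonneg_AE) simp
  have c0: "0 \<le> Lq_const \<beta> p 1 1" "0 \<le> weight_const \<beta> 1 1" "0 \<le> Lq_const \<beta> 4 1 1"
    using main(4,6,7)[OF z] pint_nonneg[of p "\<lambda>x::plane. 0::real"] wmass_nonneg[of "\<lambda>x. 0\<^sup>2"] sq0[of "\<lambda>x. 0\<^sup>2"] by linarith+
  have L0: "0 \<le> L" using c0 pint_nonneg[of p w] by (simp add: L_def)
  have W0: "0 \<le> W" "0 \<le> S" using c0 wmass_nonneg[of "\<lambda>x. (w x)\<^sup>2"] sq0[of "\<lambda>x. (w x)\<^sup>2"] by (simp_all add: W_def S_def)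
  have B0: "0 \<le> B" using W0 ln_neg_mass_nonneg by (simp add: B_def)
  have CP0: "0 \<le> CP" using L0 pint_nonneg[of \<beta> w] by (simp add: CP_def)
  have CM0: "0 \<le> CM" using c0 total_mass_nonneg[of w] by (simp add: CM_def)
  have CK0: "0 \<le> CK" using CM0 total_mass_nonneg[of w] by (simp add: CK_def)
  have CE0: "0 \<le> CE" using B0 L0 \<beta> by (simp add: CE_def)
  define C where "C = CP + 15 * B + CM + CK + CE"
  have C: "0 \<le> C" "CP \<le> C" "15 * B \<le> C" "CM \<le> C" "CK \<le> C" "CE \<le> C"
    using B0 CP0 CM0 CK0 CE0 by (simp_all add: C_def)
  show thesis
  proof (rule that[OF C(1)])
    fix k s assume k: "unit_direction \<beta> k" and s: "0 \<le> (s::real)" "s \<le> 1"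
    note m = main[OF k]
    have kH: "k \<in> Hr_space \<beta>" "dirichlet k \<le> 1" "pint \<beta> k \<le> 1" using k by (auto simp: unit_direction_def)
    have s': "\<bar>s\<bar> \<le> 1" "\<bar>- s\<bar> \<le> 1" using s by auto
    note D = dirichlet_second_difference[OF w kH(1) \<beta>(1), of s]
    have weak: "s * c \<le> s * C" if "c \<le> C" for c using that s by (intro mult_left_mono)
    have Lv: "(\<lambda>x. w x + s * k x) \<in> Lq_space \<beta>" "(\<lambda>x. w x + s * k x) \<in> Lq_space p"
      and Lm: "(\<lambda>x. w x - s * k x) \<in> Lq_space \<beta>" "(\<lambda>x. w x - s * k x) \<in> Lq_space p"
      using Hr_regularity(2)[OF D(1) \<beta>(1,2)] Hr_regularity(2)[OF D(2) \<beta>(1,2)] \<beta> by auto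
    let ?v = "\<lambda>x. w x + s * k x" and ?v' = "\<lambda>x. w x - s * k x"
    have pk: "pint p w + pint p k \<le> L" using m(4) by (simp add: L_def)
    show "\<bar>potential \<beta> p ?v - potential \<beta> p w\<bar> \<le> s * C"
    proof (rule order_trans[OF _ weak[OF C(2)]])
      have 1: "\<bar>pint \<beta> ?v - pint \<beta> w\<bar> / \<beta> \<le> s * (2 powr \<beta> * (pint \<beta> w + 1))"
      proof -
        have "\<bar>pint \<beta> ?v - pint \<beta> w\<bar> \<le> s * (\<beta> * 2 powr \<beta> * (pint \<beta> w + pint \<beta> k))"
          using pint_perturb(2)[OF wL(1) m(2) \<beta>(1) s'(1)] s by simp
        also have "\<dots> \<le> s * (\<beta> * 2 powr \<beta> * (pint \<beta> w + 1))"
          using s \<beta> kH(3) by (intro mult_left_mono add_left_mono) auto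
        finally show ?thesis using \<beta> by (simp add: pos_divide_le_eq mult_ac)
      qed
      have 2: "\<bar>pint p ?v - pint p w\<bar> / p \<le> s * (2 powr p * L)"
      proof -
        have "\<bar>pint p ?v - pint p w\<bar> \<le> s * (p * 2 powr p * (pint p w + pint p k))"
          using pint_perturb(2)[OF wL(2) m(3) _ s'(1)] s \<beta> by simp
        also have "\<dots> \<le> s * (p * 2 powr p * L)"
          using s \<beta> pk by (intro mult_left_mono) auto
        finally show ?thesis using \<beta> by (simp add: pos_divide_le_eq mult_ac)
      qed
      have "potential \<beta> p ?v - potential \<beta> p w = (pint \<beta> ?v - pint \<beta> w) / \<beta> + (pint p ?v - pint p w) / p"
        unfolding potential_eq(1)[OF wL] potential_eq(1)[OF Lv] by (simp add: diff_divide_distrib)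
      also have "\<bar>\<dots>\<bar> \<le> \<bar>pint \<beta> ?v - pint \<beta> w\<bar> / \<beta> + \<bar>pint p ?v - pint p w\<bar> / p"
        using abs_triangle_ineq[of "(pint \<beta> ?v - pint \<beta> w) / \<beta>" "(pint p ?v - pint p w) / p"] \<beta> by simp
      finally show "\<bar>potential \<beta> p ?v - potential \<beta> p w\<bar> \<le> s * CP"
        using 1 2 by (simp add: CP_def distrib_left)
    qed
    have WS: "wmass (\<lambda>x. (w x)\<^sup>2) + wmass (\<lambda>x. (k x)\<^sup>2) \<le> W" "sqmass (\<lambda>x. (w x)\<^sup>2) + sqmass (\<lambda>x. (k x)\<^sup>2) \<le> S"
      using m(6,7) by (simp_all add: W_def S_def)
    note V = V0_perturb[OF Rw(3) m(5) Rw(1) m(1) WS s, folded B_def]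
    show "\<bar>V0 ?v - V0 w\<bar> \<le> s * C" by (rule order_trans[OF V(1) weak[OF C(3)]])
    have M: "\<bar>total_mass ?v - total_mass w\<bar> \<le> s * CM"
    proof (rule order_trans[OF total_mass_perturb[OF Rw(4) m(8) Rw(1) m(1) s]])
      show "s * (2 * (total_mass w + total_mass k)) \<le> s * CM"
        unfolding CM_def using m(9) s by (intro mult_left_mono) auto
    qed
    show "\<bar>total_mass ?v - total_mass w\<bar> \<le> s * C" by (rule order_trans[OF M weak[OF C(4)]])
    show "\<bar>mass_coeff ?v - mass_coeff w\<bar> \<le> s * C"
      by (rule order_trans[OF mass_coeff_perturb[OF M s CM0, folded CK_def] weak[OF C(5)]])
    show "energy \<beta> p ?v + energy \<beta> p ?v' - 2 * energy \<beta> p w \<le> (s\<^sup>2 + s powr \<beta>) * C"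
    proof -
      have d: "dirichlet ?v + dirichlet ?v' - 2 * dirichlet w \<le> 2 * s\<^sup>2"
        unfolding D(3) using mult_left_mono[OF kH(2), of "2 * s\<^sup>2"] by simp
      have 1: "(pint \<beta> ?v + pint \<beta> ?v' - 2 * pint \<beta> w) / \<beta> \<le> 2 * s powr \<beta>"
      proof -
        have "pint \<beta> ?v + pint \<beta> ?v' - 2 * pint \<beta> w \<le> 2 * s powr \<beta> * pint \<beta> k"
          by (rule pint_second_difference_concave[OF wL(1) m(2) \<beta>(1,2) s])
        also have "\<dots> \<le> 2 * s powr \<beta> * \<beta>" using kH(3) \<beta> by (intro mult_left_mono) auto
        finally show ?thesis using \<beta> by (simp add: pos_divide_le_eq)
      qed
      have 2: "(pint p ?v + pint p ?v' - 2 * pint p w) / p \<le> s\<^sup>2 * (2 * (p - 1) * 2 powr p * L)"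
      proof -
        have "pint p ?v + pint p ?v' - 2 * pint p w \<le> s\<^sup>2 * (2 * p * (p - 1) * 2 powr p * (pint p w + pint p k))"
          by (rule pint_second_difference[OF wL(2) m(3) \<beta>(3) s'(1)])
        also have "\<dots> \<le> s\<^sup>2 * (2 * p * (p - 1) * 2 powr p * L)"
          using \<beta> pk by (intro mult_left_mono) auto
        finally show ?thesis using \<beta> by (simp add: pos_divide_le_eq mult_ac)
      qed
      have P: "potential \<beta> p ?v + potential \<beta> p ?v' - 2 * potential \<beta> p w
          = (pint \<beta> ?v + pint \<beta> ?v' - 2 * pint \<beta> w) / \<beta> + (pint p ?v + pint p ?v' - 2 * pint p w) / p"
        unfolding potential_eq(1)[OF wL] potential_eq(1)[OF Lv] potential_eq(1)[OF Lm]
        by (simp add: diff_divide_distrib add_divide_distrib)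
      have V2: "- (V0 ?v + V0 ?v' - 2 * V0 w) \<le> s\<^sup>2 * (14 * B)" using V(2) by (simp add: abs_le_iff)
      define d2 v2 p2 where "d2 = dirichlet ?v + dirichlet ?v' - 2 * dirichlet w"
        and "v2 = V0 ?v + V0 ?v' - 2 * V0 w" and "p2 = potential \<beta> p ?v + potential \<beta> p ?v' - 2 * potential \<beta> p w"
      have E: "energy \<beta> p ?v + energy \<beta> p ?v' - 2 * energy \<beta> p w = d2 / 2 - v2 / 4 + p2"
        unfolding energy_eq d2_def v2_def p2_def by argo
      have a1: "d2 \<le> 2 * s\<^sup>2" using d by (simp add: d2_def)
      have a2: "- v2 \<le> s\<^sup>2 * (14 * B)" using V2 by (simp add: v2_def)
      have a3: "p2 \<le> 2 * s powr \<beta> + s\<^sup>2 * (2 * (p - 1) * 2 powr p * L)" unfolding p2_def P using 1 2 by (rule add_mono)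
      have "d2 / 2 - v2 / 4 + p2 \<le> s\<^sup>2 + s\<^sup>2 * (14 * B) / 4 + (2 * s powr \<beta> + s\<^sup>2 * (2 * (p - 1) * 2 powr p * L))"
        using a1 a2 a3 by argo
      also have "\<dots> = s\<^sup>2 * (1 + 14 / 4 * B + 2 * (p - 1) * 2 powr p * L) + s powr \<beta> * 2" by (simp add: algebra_simps)
      also have "\<dots> \<le> s\<^sup>2 * CE + s powr \<beta> * CE"
      proof (intro add_mono mult_left_mono)
        show "1 + 14 / 4 * B + 2 * (p - 1) * 2 powr p * L \<le> CE" unfolding CE_def using B0 by argo
        show "2 \<le> CE" unfolding CE_def using B0 L0 \<beta> by (simp add: add_increasing2)
      qed auto
      also have "\<dots> = (s\<^sup>2 + s powr \<beta>) * CE" by (simp add: algebra_simps)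
      also have "\<dots> \<le> (s\<^sup>2 + s powr \<beta>) * C" using C(6) by (intro mult_left_mono) auto
      finally show ?thesis unfolding E .
    qed
  qed
qed

text \<open>The passage from \<open>\<tau>\<close> to 1 changes both fibres by almost the same
  amount: the coefficients differ by at most \<open>D\<close> and are multiplied by quantities
  of order \<open>\<epsilon>\<close>.\<close>

lemma fibre_difference_bound:
  fixes \<tau> \<epsilon> D :: real
  assumes \<tau>: "1 - \<epsilon> \<le> \<tau>" "\<tau> \<le> 1 + \<epsilon>" and \<epsilon>: "0 < \<epsilon>" "\<epsilon> \<le> 1/2"
    and D: "\<bar>P' - P\<bar> \<le> D" "\<bar>V' - V\<bar> \<le> D" "\<bar>K' - K\<bar> \<le> D"
    and le: "fibre A P V K \<tau> \<le> fibre A' P' V' K' \<tau>"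
  shows "fibre A P V K 1 - 8 * \<epsilon> * D \<le> fibre A' P' V' K' 1"
proof -
  have D0: "0 \<le> D" using D(1) by linarith
  have t: "\<tau> > 0" using \<tau> \<epsilon> by linarith
  have l: "\<bar>ln \<tau>\<bar> \<le> 2 * \<epsilon>"
  proof -
    have "ln \<tau> \<le> \<epsilon>" using ln_le_minus_one[OF t] \<tau> by linarith
    moreover have "- ln \<tau> \<le> 1 / \<tau> - 1" using ln_le_minus_one[of "1 / \<tau>"] t by (simp add: ln_div)
    moreover have "1 / \<tau> - 1 \<le> 2 * \<epsilon>"
    proof -
      have "1 \<le> (1 + 2 * \<epsilon>) * (1 - \<epsilon>)" using mult_left_mono[of \<epsilon> "1/2" "2 * \<epsilon>"] \<epsilon> by (simp add: algebra_simps)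
      also have "\<dots> \<le> (1 + 2 * \<epsilon>) * \<tau>" using \<tau> \<epsilon> by (intro mult_left_mono) auto
      finally show ?thesis using t by (simp add: pos_divide_le_eq algebra_simps)
    qed
    ultimately show ?thesis using \<epsilon> by linarith
  qed
  have a: "\<bar>1 - \<tau>\<bar> \<le> \<epsilon>" using \<tau> by linarith
  have b: "\<bar>1 - \<tau>\<^sup>2\<bar> \<le> 4 * \<epsilon>"
  proof -
    have "\<bar>1 - \<tau>\<^sup>2\<bar> = \<bar>1 - \<tau>\<bar> * \<bar>1 + \<tau>\<bar>" by (simp add: abs_mult[symmetric] power2_eq_square algebra_simps)
    also have "\<dots> \<le> \<epsilon> * 4" using a \<tau> \<epsilon> by (intro mult_mono) auto
    finally show ?thesis by simp
  qed
  have c: "\<bar>\<tau>\<^sup>2 * ln \<tau>\<bar> \<le> 6 * \<epsilon>"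
  proof -
    have "\<tau>\<^sup>2 \<le> (3/2)\<^sup>2" using \<tau> \<epsilon> t by (intro power_mono) auto
    then have "\<tau>\<^sup>2 \<le> 3" by (simp add: power2_eq_square)
    then have "\<tau>\<^sup>2 * \<bar>ln \<tau>\<bar> \<le> 3 * (2 * \<epsilon>)" using l by (intro mult_mono) auto
    then show ?thesis by (simp add: abs_mult)
  qed
  have 1: "\<bar>(1 - \<tau>) * (P' - P)\<bar> \<le> \<epsilon> * D" unfolding abs_mult using a D(1) \<epsilon> by (intro mult_mono) auto
  have 2: "\<bar>(1 - \<tau>\<^sup>2) * (V' - V)\<bar> \<le> 4 * \<epsilon> * D" unfolding abs_mult using b D(2) \<epsilon> by (intro mult_mono) auto
  have 3: "\<bar>(\<tau>\<^sup>2 * ln \<tau>) * (K' - K)\<bar> \<le> 6 * \<epsilon> * D" unfolding abs_mult[of "\<tau>\<^sup>2 * ln \<tau>"] using c D(3) \<epsilon> by (intro mult_mono) auto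
  have "fibre A' P' V' K' 1 - fibre A P V K 1 = (fibre A' P' V' K' \<tau> - fibre A P V K \<tau>)
      + (1 - \<tau>) * (P' - P) - (1 - \<tau>\<^sup>2) * (V' - V) / 4 + (\<tau>\<^sup>2 * ln \<tau>) * (K' - K)"
    by (simp add: fibre_def algebra_simps diff_divide_distrib add_divide_distrib)
  moreover have "- (\<epsilon> * D) \<le> (1 - \<tau>) * (P' - P)" "(1 - \<tau>\<^sup>2) * (V' - V) \<le> 4 * \<epsilon> * D" "- (6 * \<epsilon> * D) \<le> (\<tau>\<^sup>2 * ln \<tau>) * (K' - K)"
    using 1 2 3 by (simp_all add: abs_le_iff)
  ultimately show ?thesis using le by argo
qed

text \<open>Every small perturbation of a minimiser returns to the Pohozaev manifold by a dilation whose
  parameter is close to 1. Since the minimiser itself maximises the energy on its dilation orbit, the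
  dilation costs only a small multiple of the size of the perturbation.\<close>

lemma minimiser_lower_bound:
  assumes w: "w \<in> pohozaev \<beta> p" and min: "\<And>u. u \<in> pohozaev \<beta> p \<Longrightarrow> energy \<beta> p w \<le> energy \<beta> p u"
    and \<beta>: "1 < \<beta>" "\<beta> < 2" "2 < p" and \<epsilon>: "\<epsilon> > 0"
  obtains \<delta> where "\<delta> > 0"
    "\<And>k s. unit_direction \<beta> k \<Longrightarrow> 0 \<le> s \<Longrightarrow> s < \<delta> \<Longrightarrow> energy \<beta> p w - \<epsilon> * s \<le> energy \<beta> p (\<lambda>x. w x + s * k x)"
proof -
  have H: "w \<in> Hr_space \<beta>" "total_mass w > 0" "potential \<beta> p w = V0 w / 2 + mass_coeff w" using w by (auto simp: pohozaev_def)
  obtain C where C: "0 \<le> C"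
    and pert: "\<And>k s. unit_direction \<beta> k \<Longrightarrow> 0 \<le> s \<Longrightarrow> s \<le> 1 \<Longrightarrow> \<bar>potential \<beta> p (\<lambda>x. w x + s * k x) - potential \<beta> p w\<bar> \<le> s * C"
    "\<And>k s. unit_direction \<beta> k \<Longrightarrow> 0 \<le> s \<Longrightarrow> s \<le> 1 \<Longrightarrow> \<bar>V0 (\<lambda>x. w x + s * k x) - V0 w\<bar> \<le> s * C"
    "\<And>k s. unit_direction \<beta> k \<Longrightarrow> 0 \<le> s \<Longrightarrow> s \<le> 1 \<Longrightarrow> \<bar>total_mass (\<lambda>x. w x + s * k x) - total_mass w\<bar> \<le> s * C"
    "\<And>k s. unit_direction \<beta> k \<Longrightarrow> 0 \<le> s \<Longrightarrow> s \<le> 1 \<Longrightarrow> \<bar>mass_coeff (\<lambda>x. w x + s * k x) - mass_coeff w\<bar> \<le> s * C"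
    by (rule energy_perturb[OF H(1) \<beta>]) (rule that)
  define e where "e = min (1/2) (\<epsilon> / (8 * (C + 1)))"
  have e: "0 < e" "e \<le> 1/2" "e < 1" "8 * e * C \<le> \<epsilon>"
  proof -
    show "0 < e" using \<epsilon> C by (simp add: e_def)
    show "e \<le> 1/2" unfolding e_def by (rule min.cobounded1)
    then show "e < 1" by simp
    have "8 * e * C \<le> 8 * e * (C + 1)" using \<open>0 < e\<close> by simp
    also have "\<dots> = e * (8 * (C + 1))" by simp
    also have "\<dots> \<le> \<epsilon> / (8 * (C + 1)) * (8 * (C + 1))" using C by (intro mult_right_mono) (auto simp: e_def)
    also have "\<dots> = \<epsilon>" using C by simp
    finally show "8 * e * C \<le> \<epsilon>" .
  qed
  obtain \<eta> where \<eta>: "\<eta> > 0" and root: "\<And>P V K. \<bar>P - potential \<beta> p w\<bar> \<le> \<eta> \<Longrightarrow> \<bar>V - V0 w\<bar> \<le> \<eta> \<Longrightarrow> \<bar>K - mass_coeff w\<bar> \<le> \<eta> \<Longrightarrow>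
      \<exists>\<tau>. 1 - e \<le> \<tau> \<and> \<tau> \<le> 1 + e \<and> P = \<tau> * (V / 2 + K + 2 * K * ln \<tau>)"
    by (rule fibre_root_near_1[OF H(3) potential_pos(1)[OF H(1) \<beta> H(2)] mass_coeff_pos[OF H(2)] e(1,3)]) (rule that)
  \<comment> \<open>The last bound keeps the perturbed function from having zero mass.\<close>
  define \<delta> where "\<delta> = min 1 (min \<eta> (total_mass w) / (C + 1))"
  have \<delta>: "\<delta> > 0" using \<eta> H(2) C by (simp add: \<delta>_def)
  show thesis
  proof (rule that[OF \<delta>])
    fix k s assume k: "unit_direction \<beta> k" and s: "0 \<le> s" "s < \<delta>"
    define v where "v = (\<lambda>x. w x + s * k x)"
    have s1: "s \<le> 1" using s by (simp add: \<delta>_def)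
    have "s < min \<eta> (total_mass w) / (C + 1)" using s by (simp add: \<delta>_def)
    then have "s * (C + 1) < min \<eta> (total_mass w)" using C by (simp add: pos_less_divide_eq)
    then have sC: "s * C < \<eta>" "s * C < total_mass w" using s by (simp_all add: distrib_left)
    note pt = pert[OF k s(1) s1, folded v_def]
    have vH: "v \<in> Hr_space \<beta>"
      unfolding v_def by (rule dirichlet_second_difference(1)[OF H(1) _ \<beta>(1)]) (use k in \<open>simp add: unit_direction_def\<close>)
    have vM: "total_mass v > 0" using pt(3) sC(2) by linarith
    have "\<bar>potential \<beta> p v - potential \<beta> p w\<bar> \<le> \<eta>" "\<bar>V0 v - V0 w\<bar> \<le> \<eta>" "\<bar>mass_coeff v - mass_coeff w\<bar> \<le> \<eta>"
      using pt sC(1) by linarith+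
    from root[OF this] obtain \<tau> where \<tau>: "1 - e \<le> \<tau>" "\<tau> \<le> 1 + e"
      and r: "potential \<beta> p v = \<tau> * (V0 v / 2 + mass_coeff v + 2 * mass_coeff v * ln \<tau>)" by blast
    have t0: "\<tau> > 0" using \<tau>(1) e(3) by linarith
    have "fibre (dirichlet w) (potential \<beta> p w) (V0 w) (mass_coeff w) \<tau> \<le> fibre (dirichlet w) (potential \<beta> p w) (V0 w) (mass_coeff w) 1"
      by (rule fibre_le_1[OF H(3) _ _ t0]) (use mass_coeff_pos[OF H(2)] potential_pos(1)[OF H(1) \<beta> H(2)] in auto)
    also have "\<dots> = energy \<beta> p w" by (rule energy_fibre[symmetric])
    also have "\<dots> \<le> energy \<beta> p (\<lambda>x. v ((1 / sqrt \<tau>) *\<^sub>R x))"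
      by (rule min[OF dilation_pohozaev[OF vH \<beta> t0 vM r]])
    also have "\<dots> = fibre (dirichlet v) (potential \<beta> p v) (V0 v) (mass_coeff v) \<tau>" by (rule dilation(6)[OF vH \<beta> t0])
    finally have "fibre (dirichlet w) (potential \<beta> p w) (V0 w) (mass_coeff w) 1 - 8 * e * (s * C) \<le> fibre (dirichlet v) (potential \<beta> p v) (V0 v) (mass_coeff v) 1"
      by (rule fibre_difference_bound[OF \<tau> e(1,2) pt(1,2,4)])
    moreover have "8 * e * (s * C) \<le> \<epsilon> * s" using mult_right_mono[OF e(4) s(1)] by (simp add: mult_ac)
    ultimately show "energy \<beta> p w - \<epsilon> * s \<le> energy \<beta> p (\<lambda>x. w x + s * k x)"
      unfolding energy_fibre v_def[symmetric] by linarith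
  qed
qed

text \<open>The lower bound in the direction \<open>- k\<close> becomes an upper bound in the direction \<open>k\<close>, because
  the second difference of the energy is at most of order \<open>s\<^sup>\<beta>\<close> with \<open>\<beta> > 1\<close>.\<close>

lemma minimiser_two_sided_bound:
  assumes w: "w \<in> pohozaev \<beta> p" and min: "\<And>u. u \<in> pohozaev \<beta> p \<Longrightarrow> energy \<beta> p w \<le> energy \<beta> p u"
    and \<beta>: "1 < \<beta>" "\<beta> < 2" "2 < p" and \<epsilon>: "\<epsilon> > 0"
  obtains \<delta> where "\<delta> > 0"
    "\<And>k s. unit_direction \<beta> k \<Longrightarrow> 0 < s \<Longrightarrow> s < \<delta> \<Longrightarrow> \<bar>energy \<beta> p (\<lambda>x. w x + s * k x) - energy \<beta> p w\<bar> \<le> \<epsilon> * s"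
proof -
  have H: "w \<in> Hr_space \<beta>" using w by (auto simp: pohozaev_def)
  obtain C where C: "0 \<le> C" and sec: "\<And>k s. unit_direction \<beta> k \<Longrightarrow> 0 \<le> s \<Longrightarrow> s \<le> 1 \<Longrightarrow>
       energy \<beta> p (\<lambda>x. w x + s * k x) + energy \<beta> p (\<lambda>x. w x - s * k x) - 2 * energy \<beta> p w \<le> (s\<^sup>2 + s powr \<beta>) * C"
    by (rule energy_perturb[OF H \<beta>]) (rule that)
  obtain \<delta>1 where \<delta>1: "\<delta>1 > 0" and lower: "\<And>k s. unit_direction \<beta> k \<Longrightarrow> 0 \<le> s \<Longrightarrow> s < \<delta>1 \<Longrightarrow>
      energy \<beta> p w - \<epsilon> / 2 * s \<le> energy \<beta> p (\<lambda>x. w x + s * k x)"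
    by (rule minimiser_lower_bound[OF w min \<beta>, of "\<epsilon> / 2"]) (use \<epsilon> that in auto)
  have "((\<lambda>s::real. (s + s powr (\<beta> - 1)) * C) \<longlongrightarrow> (0 + 0 powr (\<beta> - 1)) * C) (at_right 0)"
    by (intro tendsto_intros tendsto_powr') (use \<beta> in \<open>auto intro: eventually_mono[OF eventually_at_right_less]\<close>)
  then have "eventually (\<lambda>s::real. (s + s powr (\<beta> - 1)) * C < \<epsilon> / 2) (at_right 0)"
    by (rule order_tendstoD(2)) (use \<epsilon> in simp)
  then obtain \<delta>2 where \<delta>2: "\<delta>2 > 0" "\<And>s. 0 < s \<Longrightarrow> s < \<delta>2 \<Longrightarrow> (s + s powr (\<beta> - 1)) * C < \<epsilon> / 2"
    unfolding eventually_at_right_field by blast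
  define \<delta> where "\<delta> = min 1 (min \<delta>1 \<delta>2)"
  have \<delta>: "\<delta> > 0" using \<delta>1 \<delta>2 by (simp add: \<delta>_def)
  show thesis
  proof (rule that[OF \<delta>])
    fix k s assume k: "unit_direction \<beta> k" and s: "0 < s" "s < \<delta>"
    have s': "0 \<le> s" "s \<le> 1" "s < \<delta>1" "s < \<delta>2" using s by (auto simp: \<delta>_def)
    have l: "energy \<beta> p w - \<epsilon> / 2 * s \<le> energy \<beta> p (\<lambda>x. w x + s * k x)" by (rule lower[OF k s'(1,3)])
    have l': "energy \<beta> p w - \<epsilon> / 2 * s \<le> energy \<beta> p (\<lambda>x. w x - s * k x)"
      using lower[OF unit_direction_minus[OF k \<beta>(1)] s'(1,3)] by simp
    have "(s\<^sup>2 + s powr \<beta>) * C = s * ((s + s powr (\<beta> - 1)) * C)"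
      using s(1) powr_add[of s 1 "\<beta> - 1"] by (simp add: power2_eq_square algebra_simps)
    also have "\<dots> \<le> s * (\<epsilon> / 2)" using \<delta>2(2)[OF s(1) s'(4)] s(1) by (intro mult_left_mono) auto
    finally have u: "energy \<beta> p (\<lambda>x. w x + s * k x) + energy \<beta> p (\<lambda>x. w x - s * k x) - 2 * energy \<beta> p w \<le> s * (\<epsilon> / 2)"
      using sec[OF k s'(1,2)] by linarith
    have "0 \<le> \<epsilon> * s" using \<epsilon> s by simp
    then show "\<bar>energy \<beta> p (\<lambda>x. w x + s * k x) - energy \<beta> p w\<bar> \<le> \<epsilon> * s"
      using l l' u unfolding abs_le_iff by argo
  qed
qed

lemma unit_direction_rescale:
  assumes h: "h \<in> Hr_space \<beta>" and \<beta>: "1 < \<beta>" and s: "0 < s" "H_norm \<beta> h \<le> s"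
  shows "unit_direction \<beta> (\<lambda>x. (1 / s) * h x)"
proof -
  have R: "R_pair \<beta> (\<lambda>x. (1 / s) * h x) (\<lambda>x. (1 / s) *\<^sub>R weak_grad h x)"
    by (rule R_pair_cmult[OF Hr_space_R_pair(1)[OF \<beta> h] \<beta>])
  have "dirichlet (\<lambda>x. (1 / s) * h x) = pint 2 (\<lambda>x. (1 / s) *\<^sub>R weak_grad h x)"
    using R by (intro H_pair_weak_grad(3)[OF _ \<beta>]) (simp add: R_pair_def)
  also have "\<dots> = dirichlet h / s\<^sup>2"
    by (simp add: pint_def powr_2_norm power_divide)
  also have "\<dots> \<le> 1" using H_norm_bounds(1)[OF \<beta> s(2)] s(1) by (simp add: pos_divide_le_eq)
  finally have 1: "dirichlet (\<lambda>x. (1 / s) * h x) \<le> 1" .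
  have "pint \<beta> (\<lambda>x. (1 / s) * h x) = pint \<beta> h / s powr \<beta>"
    using s(1) by (simp add: pint_def abs_mult powr_divide)
  also have "\<dots> \<le> 1" using H_norm_bounds(2)[OF \<beta> s(2)] s(1) by (simp add: pos_divide_le_eq)
  finally show ?thesis using 1 Hr_space_R_pair(2)[OF \<beta> R] by (simp add: unit_direction_def)
qed

lemma minimiser_critical_point:
  assumes w: "w \<in> pohozaev \<beta> p" and min: "\<And>u. u \<in> pohozaev \<beta> p \<Longrightarrow> energy \<beta> p w \<le> energy \<beta> p u"
    and \<beta>: "1 < \<beta>" "\<beta> < 2" "2 < p"
  shows "critical_point \<beta> p w"
  unfolding critical_point_def
proof (intro conjI allI impI)
  show "w \<in> Hr_space \<beta>" using w by (simp add: pohozaev_def)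
  fix \<epsilon> :: real assume \<epsilon>: "0 < \<epsilon>"
  obtain \<delta> where \<delta>: "\<delta> > 0" and two: "\<And>k s. unit_direction \<beta> k \<Longrightarrow> 0 < s \<Longrightarrow> s < \<delta> \<Longrightarrow>
      \<bar>energy \<beta> p (\<lambda>x. w x + s * k x) - energy \<beta> p w\<bar> \<le> \<epsilon> * s"
    by (rule minimiser_two_sided_bound[OF w min \<beta> \<epsilon>]) (use that in auto)
  have "\<bar>energy \<beta> p (\<lambda>x. w x + h x) - energy \<beta> p w\<bar> \<le> \<epsilon> * H_norm \<beta> h"
    if h: "h \<in> Hr_space \<beta>" and n: "H_norm \<beta> h < \<delta>" for h
  proof -
    \<comment> \<open>Dividing by any \<open>s\<close> above the norm, rather than by the norm, covers functions of norm zero.\<close>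
    have s: "\<bar>energy \<beta> p (\<lambda>x. w x + h x) - energy \<beta> p w\<bar> \<le> \<epsilon> * s" if "H_norm \<beta> h < s" "s < \<delta>" for s
    proof -
      have "0 \<le> H_norm \<beta> h" by (simp add: H_norm_def Lq_norm_def)
      then have s: "0 < s" using that(1) by linarith
      have "unit_direction \<beta> (\<lambda>x. (1 / s) * h x)" by (rule unit_direction_rescale[OF h \<beta>(1) s]) (use that in simp)
      from two[OF this s that(2)] show ?thesis using s by simp
    qed
    have "\<bar>energy \<beta> p (\<lambda>x. w x + h x) - energy \<beta> p w\<bar> / \<epsilon> \<le> s" if "H_norm \<beta> h < s" "s < \<delta>" for s
      using s[OF that] \<epsilon> by (simp add: pos_divide_le_eq mult.commute)
    then have "\<bar>energy \<beta> p (\<lambda>x. w x + h x) - energy \<beta> p w\<bar> / \<epsilon> \<le> H_norm \<beta> h" by (rule dense_ge_bounded[OF n])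
    then show ?thesis using \<epsilon> by (simp add: pos_divide_le_eq mult.commute)
  qed
  then show "\<exists>\<delta>>0. \<forall>h\<in>Hr_space \<beta>. H_norm \<beta> h < \<delta> \<longrightarrow>
      \<bar>energy \<beta> p (\<lambda>x. w x + h x) - energy \<beta> p w\<bar> \<le> \<epsilon> * H_norm \<beta> h"
    using \<delta> by blast
qed

theorem theorem1p4:
  fixes \<beta> p :: real
  assumes "1 < \<beta>" and "\<beta> < 2" and "2 < p"
  shows "\<exists>u \<phi>. radial_solution \<beta> p u \<phi> \<and> \<not> (AE x in lborel. u x = 0)"
proof -
  obtain w where w: "w \<in> pohozaev \<beta> p" and min: "\<And>u. u \<in> pohozaev \<beta> p \<Longrightarrow> energy \<beta> p w \<le> energy \<beta> p u"
    using pohozaev_minimiser[OF assms] by blast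
  have H: "w \<in> Hr_space \<beta>" "total_mass w > 0" using w by (auto simp: pohozaev_def)
  have "radial_solution \<beta> p w (log_potential w)"
    unfolding radial_solution_def using H(1) minimiser_critical_point[OF w min assms] by blast
  moreover have "\<not> (AE x in lborel. w x = 0)"
    using total_mass_zero[OF Hr_regularity(4)[OF H(1) assms(1,2)]] H(2) by simp
  ultimately show ?thesis by blast
qed

end
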